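(* Assume that $a_0,a_1$ are bounded on $V\times V$, that $a_0(v,v)\ge 0$ for all $v\in V$ (no positive lower bound is assumed), that $a_1(v,v)\ge\beta|v|_V^2$ for all $v\in V$ with some $\beta>0$, that $f\in L^2(0,T;H)$, $u_0\in H$, and that $0<M_0<\infty$ and $M_1<\infty$. Let $X=(u,\zeta)\in C([0,T];\mathcal W)$ be the mild solution of $X'=\mathcal AX+(f,0)$, $X(0)=(u_0,0)$, and let $\xi(t)=\int_{[0,\infty)}\zeta(\lambda,t)\,d\nu(\lambda)$, $\eta(t)=\int_{[0,\infty)}\lambda\zeta(\lambda,t)\,d\nu(\lambda)$. Put $D_0=\|u_0\|_H^2+\|f\|_{L^2(0,T;H)}^2$ and $C_T=(2+T)e^T$. Then $$\sup_{t\in[0,T]}\left[\|u(t)\|_H^2+\int_{[0,\infty)}a_1(\zeta(\lambda,t),\zeta(\lambda,t))\,d\nu(\lambda)\right]+2\int_0^T\int_{[0,\infty)}\lambda\,a_1(\zeta(\lambda,t),\zeta(\lambda,t))\,d\nu(\lambda)\,dt\le C_TD_0.$$ Moreover $$\sup_{t\in[0,T]}|\xi(t)|_V^2\le\frac{M_0}{\beta}e^TD_0,\qquad \int_0^T|\eta(t)|_V^2\,dt\le\frac{M_1}{2\beta}\left(1+Te^T\right)D_0,$$ and the last two bounds also hold with $|\cdot|_V^2$ replaced by the full norm $\|\cdot\|_V^2$ after multiplying the right-hand sides by $1+C_P^2$. If, in addition, $u\in L^2(0,T;V)$, then $$\sup_{t\in[0,T]}\left[\|u(t)\|_H^2+\int_{[0,\infty)}a_1(\zeta(\lambda,t),\zeta(\lambda,t))\,d\nu(\lambda)\right]+2\int_0^Ta_0(u(t),u(t))\,dt+2\int_0^T\int_{[0,\infty)}\lambda\,a_1(\zeta(\lambda,t),\zeta(\lambda,t))\,d\nu(\lambda)\,dt\le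 C_TD_0.$$
   Context: Setting. $\Omega\subset\mathbb R^d$, $d\in\{1,2,3\}$, is a bounded Lipschitz domain; $H=L^2(\Omega)$, $V=H^1_0(\Omega)$ (real spaces), $|v|_V=\|\nabla v\|_{L^2(\Omega)}$, $\|v\|_V^2=\|v\|_H^2+|v|_V^2$; $C_P$ is the Poincaré constant, $\|v\|_H\le C_P|v|_V$ for all $v\in V$; $H$ is identified with a subspace of $V'$; $T>0$ is fixed. $A_0,A_1\in L^\infty(\Omega)^{d\times d}$ are symmetric matrix fields, $A_1$ pointwise positive semidefinite a.e., $a_i(w,v)=\int_\Omega A_i\nabla w\cdot\nabla v\,dx$, and $\mathsf A_i:V\to V'$ is given by $\langle\mathsf A_iw,v\rangle=a_i(w,v)$, $i=0,1$. The kernel $k(t)=\int_{[0,\infty)}e^{-\lambda t}\,d\nu(\lambda)$ is completely monotone and non-zero, with non-negative Borel representing measure $\nu$ on $[0,\infty)$; $M_0=\nu([0,\infty))$ and $M_1=\int_{[0,\infty)}\lambda\,d\nu(\lambda)$. Spaces and operators. $\mathcal K$ is the Hilbert space of strongly $\nu$-measurable $\zeta:[0,\infty)\to V$ with $\|\zeta\|_{\mathcal K}^2=\int_{[0,\infty)}a_1(\zeta(\lambda),\zeta(\lambda))\,d\nu(\lambda)<\infty$; $\mathcal W=H\times\mathcal K$ with $\|(u,\zeta)\|_{\mathcal W}^2=\|u\|_H^2+\|\zeta\|_{\mathcal K}^2$. $J:\mathcal K\to V$, $J\zeta=\int\zeta\,d\nu$; $E:V\to\mathcal K$, $(Eu)(\lambda)=u$;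 $(\Lambda\zeta)(\lambda)=\lambda\zeta(\lambda)$. $\mathcal A(u,\zeta)=(-\mathsf A_0u-\mathsf A_1J\zeta,\;Eu-\Lambda\zeta)$ with domain $D(\mathcal A)=\{(u,\zeta)\in V\times\mathcal K:\ \mathsf A_0u+\mathsf A_1J\zeta\in H,\ Eu-\Lambda\zeta\in\mathcal K\}$; under the stated assumptions $\mathcal A$ generates a contraction $C_0$-semigroup $S(t)$ on $\mathcal W$, and the mild solution is $X(t)=S(t)(u_0,0)+\int_0^tS(t-s)(f(s),0)\,ds$. We write $\zeta(\lambda,t)$ for $\zeta(t)(\lambda)$. *)

theory Defs
  imports "HOL-Analysis.Analysis" "HOL-Library.Function_Algebras"
begin

text \<open>
  Elements of \<open>L\<^sup>2(\<Omega>)\<close>, \<open>H\<^sup>1\<^sub>0(\<Omega>)\<close> and of the history space are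
  handled through representatives.  A ``normed space'' is therefore a set \<open>V\<close> of representatives,
  closed under the vector space operations, with a seminorm \<open>p\<close>; two representatives denote the
  same element iff \<open>p (x - y) = 0\<close>.  Functions carry the pointwise vector space structure.
\<close>

instantiation "fun" :: (type, real_vector) real_vector
begin

definition scaleR_fun_def: "c *\<^sub>R f = (\<lambda>x. c *\<^sub>R f x)"

instance
  by standard (simp_all add: scaleR_fun_def fun_eq_iff scaleR_add_right scaleR_add_left)

end

subsection \<open>Bochner integration and semigroups in a seminormed space of representatives\<close>

definition strongly_measurable ::
    "'s measure \<Rightarrow> 'a::real_vector set \<Rightarrow> ('a \<Rightarrow> real) \<Rightarrow> ('s \<Rightarrow> 'a) \<Rightarrow> bool" where
  "strongly_measurable M V p f \<longleftrightarrow>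
     (AE x in M. f x \<in> V) \<and>
     (\<exists>s :: nat \<Rightarrow> 's \<Rightarrow> 'a.
        (\<forall>i. simple_function M (s i) \<and> s i ` space M \<subseteq> V) \<and>
        (AE x in M. (\<lambda>i. p (f x - s i x)) \<longlonglongrightarrow> 0))"

text \<open>
  The library's \<^const>\<open>has_bochner_integral\<close> with the norm replaced by the seminorm \<open>p\<close>;
  the value \<open>I\<close> is determined up to \<open>p\<close>-null elements.
\<close>

definition has_bochner_integral_in ::
    "'s measure \<Rightarrow> 'a::real_vector set \<Rightarrow> ('a \<Rightarrow> real) \<Rightarrow> ('s \<Rightarrow> 'a) \<Rightarrow> 'a \<Rightarrow> bool" where
  "has_bochner_integral_in M V p f I \<longleftrightarrow>
     strongly_measurable M V p f \<and> I \<in> V \<and>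
     (\<exists>s :: nat \<Rightarrow> 's \<Rightarrow> 'a.
        (\<forall>i. Bochner_Integration.simple_bochner_integrable M (s i) \<and> s i ` space M \<subseteq> V) \<and>
        (\<lambda>i. \<integral>\<^sup>+x. ennreal (p (f x - s i x)) \<partial>M) \<longlonglongrightarrow> 0 \<and>
        (\<lambda>i. p (Bochner_Integration.simple_bochner_integral M (s i) - I)) \<longlonglongrightarrow> 0)"

definition bochner_integrable_in ::
    "'s measure \<Rightarrow> 'a::real_vector set \<Rightarrow> ('a \<Rightarrow> real) \<Rightarrow> ('s \<Rightarrow> 'a) \<Rightarrow> bool" where
  "bochner_integrable_in M V p f \<longleftrightarrow> (\<exists>I. has_bochner_integral_in M V p f I)"

definition bochner_integral_in ::
    "'s measure \<Rightarrow> 'a::real_vector set \<Rightarrow> ('a \<Rightarrow> real) \<Rightarrow> ('s \<Rightarrow> 'a) \<Rightarrow> 'a" where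
  "bochner_integral_in M V p f =
     (if bochner_integrable_in M V p f then SOME I. has_bochner_integral_in M V p f I else 0)"

definition bochner_L2 ::
    "'s measure \<Rightarrow> 'a::real_vector set \<Rightarrow> ('a \<Rightarrow> real) \<Rightarrow> ('s \<Rightarrow> 'a) \<Rightarrow> bool" where
  "bochner_L2 M V p f \<longleftrightarrow>
     strongly_measurable M V p f \<and> (\<integral>\<^sup>+x. ennreal ((p (f x))\<^sup>2) \<partial>M) < \<infinity>"

definition continuous_path ::
    "real \<Rightarrow> 'a::real_vector set \<Rightarrow> ('a \<Rightarrow> real) \<Rightarrow> (real \<Rightarrow> 'a) \<Rightarrow> bool" where
  "continuous_path T W p X \<longleftrightarrow>
     (\<forall>t\<in>{0..T}. X t \<in> W \<and> ((\<lambda>s. p (X s - X t)) \<longlongrightarrow> 0) (at t within {0..T}))"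

text \<open>On representatives the algebraic laws can only be required up to \<open>p\<close>-null elements.\<close>

definition contraction_C0_semigroup ::
    "'a::real_vector set \<Rightarrow> ('a \<Rightarrow> real) \<Rightarrow> (real \<Rightarrow> 'a \<Rightarrow> 'a) \<Rightarrow> bool" where
  "contraction_C0_semigroup W p S \<longleftrightarrow>
     (\<forall>t\<ge>0. \<forall>x\<in>W. S t x \<in> W \<and> p (S t x) \<le> p x) \<and>
     (\<forall>t\<ge>0. \<forall>x\<in>W. \<forall>y\<in>W. \<forall>a b.
        p (S t (a *\<^sub>R x + b *\<^sub>R y) - (a *\<^sub>R S t x + b *\<^sub>R S t y)) = 0) \<and>
     (\<forall>x\<in>W. p (S 0 x - x) = 0) \<and>
     (\<forall>s\<ge>0. \<forall>t\<ge>0. \<forall>x\<in>W. p (S (s + t) x - S s (S t x)) = 0) \<and>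
     (\<forall>x\<in>W. ((\<lambda>t. p (S t x - x)) \<longlongrightarrow> 0) (at_right 0))"

definition is_generator ::
    "'a::real_vector set \<Rightarrow> ('a \<Rightarrow> real) \<Rightarrow> (real \<Rightarrow> 'a \<Rightarrow> 'a) \<Rightarrow> 'a set \<Rightarrow> ('a \<Rightarrow> 'a) \<Rightarrow> bool" where
  "is_generator W p S D A \<longleftrightarrow>
     D \<subseteq> W \<and> (\<forall>x\<in>D. A x \<in> W) \<and>
     (\<forall>x\<in>W. \<forall>y\<in>W.
        ((\<lambda>h. p ((1 / h) *\<^sub>R (S h x - x) - y)) \<longlongrightarrow> 0) (at_right 0) \<longleftrightarrow>
        x \<in> D \<and> p (A x - y) = 0)"

text \<open>\<open>X(t) = S(t) x\<^sub>0 + \<integral>\<^sub>0\<^sup>t S(t - s) F(s) ds\<close> for all \<open>t \<in> [0,T]\<close>, with \<open>X \<in> C([0,T]; W)\<close>.\<close>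

definition mild_solution ::
    "'a::real_vector set \<Rightarrow> ('a \<Rightarrow> real) \<Rightarrow> (real \<Rightarrow> 'a \<Rightarrow> 'a) \<Rightarrow> real \<Rightarrow> 'a \<Rightarrow>
     (real \<Rightarrow> 'a) \<Rightarrow> (real \<Rightarrow> 'a) \<Rightarrow> bool" where
  "mild_solution W p S T x0 F X \<longleftrightarrow>
     continuous_path T W p X \<and>
     (\<forall>t\<in>{0..T}. \<exists>I. has_bochner_integral_in (lebesgue_on {0..t}) W p (\<lambda>s. S (t - s) (F s)) I \<and>
                     p (X t - (S t x0 + I)) = 0)"

subsection \<open>Domains, Lebesgue and Sobolev spaces\<close>

text \<open>
  Near each boundary point, \<open>\<Omega>\<close> is the strict epigraph, in some direction \<open>e\<close>, of a Lipschitz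
  function of the component orthogonal to \<open>e\<close>.
\<close>

definition bounded_Lipschitz_domain :: "(real ^ 'n::finite) set \<Rightarrow> bool" where
  "bounded_Lipschitz_domain \<Omega> \<longleftrightarrow>
     \<Omega> \<noteq> {} \<and> open \<Omega> \<and> connected \<Omega> \<and> bounded \<Omega> \<and>
     (\<forall>x\<in>frontier \<Omega>. \<exists>r>0. \<exists>e L. \<exists>\<gamma> :: real ^ 'n \<Rightarrow> real.
        norm e = 1 \<and> L-lipschitz_on {z. z \<bullet> e = 0} \<gamma> \<and>
        (\<forall>y\<in>ball x r. y \<in> \<Omega> \<longleftrightarrow> \<gamma> (y - (y \<bullet> e) *\<^sub>R e) < y \<bullet> e))"

definition L2_space :: "'s measure \<Rightarrow> ('s \<Rightarrow> 'b::euclidean_space) set" where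
  "L2_space M = {f \<in> borel_measurable M. integrable M (\<lambda>x. (norm (f x))\<^sup>2)}"

definition L2_nrm :: "'s measure \<Rightarrow> ('s \<Rightarrow> 'b::euclidean_space) \<Rightarrow> real" where
  "L2_nrm M f = sqrt (LINT x|M. (norm (f x))\<^sup>2)"

definition Hsp :: "(real ^ 'n::finite) set \<Rightarrow> (real ^ 'n \<Rightarrow> real) set" where
  "Hsp \<Omega> = L2_space (lebesgue_on \<Omega>)"

definition H_nrm :: "(real ^ 'n::finite) set \<Rightarrow> (real ^ 'n \<Rightarrow> real) \<Rightarrow> real" where
  "H_nrm \<Omega> = L2_nrm (lebesgue_on \<Omega>)"

definition H_inner :: "(real ^ 'n::finite) set \<Rightarrow> (real ^ 'n \<Rightarrow> real) \<Rightarrow> (real ^ 'n \<Rightarrow> real) \<Rightarrow> real" where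
  "H_inner \<Omega> u v = (LINT x|lebesgue_on \<Omega>. u x * v x)"

definition partial :: "'n \<Rightarrow> (real ^ 'n::finite \<Rightarrow> real) \<Rightarrow> real ^ 'n \<Rightarrow> real" where
  "partial i \<phi> x = frechet_derivative \<phi> (at x) (axis i 1)"

fun Ck :: "nat \<Rightarrow> (real ^ 'n::finite \<Rightarrow> real) \<Rightarrow> bool" where
  "Ck 0 \<phi> \<longleftrightarrow> continuous_on UNIV \<phi>"
| "Ck (Suc k) \<phi> \<longleftrightarrow> \<phi> differentiable_on UNIV \<and> (\<forall>i. Ck k (partial i \<phi>))"

definition test_functions :: "(real ^ 'n::finite) set \<Rightarrow> (real ^ 'n \<Rightarrow> real) set" where
  "test_functions \<Omega> =
     {\<phi>. (\<forall>k. Ck k \<phi>) \<and> compact (closure {x. \<phi> x \<noteq> 0}) \<and> closure {x. \<phi> x \<noteq> 0} \<subseteq> \<Omega>}"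

definition is_weak_gradient ::
    "(real ^ 'n::finite) set \<Rightarrow> (real ^ 'n \<Rightarrow> real) \<Rightarrow> (real ^ 'n \<Rightarrow> real ^ 'n) \<Rightarrow> bool" where
  "is_weak_gradient \<Omega> v g \<longleftrightarrow>
     g \<in> L2_space (lebesgue_on \<Omega>) \<and>
     (\<forall>\<phi>\<in>test_functions \<Omega>. \<forall>i.
        (LINT x|lebesgue_on \<Omega>. v x * partial i \<phi> x) = - (LINT x|lebesgue_on \<Omega>. g x $ i * \<phi> x))"

text \<open>The weak gradient is unique almost everywhere on \<open>\<Omega>\<close>; \<open>wgrad\<close> picks a representative.\<close>

definition wgrad :: "(real ^ 'n::finite) set \<Rightarrow> (real ^ 'n \<Rightarrow> real) \<Rightarrow> real ^ 'n \<Rightarrow> real ^ 'n" where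
  "wgrad \<Omega> v = (SOME g. is_weak_gradient \<Omega> v g)"

definition H1sp :: "(real ^ 'n::finite) set \<Rightarrow> (real ^ 'n \<Rightarrow> real) set" where
  "H1sp \<Omega> = {v \<in> Hsp \<Omega>. \<exists>g. is_weak_gradient \<Omega> v g}"

definition V_seminrm :: "(real ^ 'n::finite) set \<Rightarrow> (real ^ 'n \<Rightarrow> real) \<Rightarrow> real" where
  "V_seminrm \<Omega> v = L2_nrm (lebesgue_on \<Omega>) (wgrad \<Omega> v)"

definition V_nrm :: "(real ^ 'n::finite) set \<Rightarrow> (real ^ 'n \<Rightarrow> real) \<Rightarrow> real" where
  "V_nrm \<Omega> v = sqrt ((H_nrm \<Omega> v)\<^sup>2 + (V_seminrm \<Omega> v)\<^sup>2)"

text \<open>\<open>H\<^sup>1\<^sub>0(\<Omega>)\<close>: the closure of the test functions in \<open>H\<^sup>1(\<Omega>)\<close>.\<close>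

definition Vsp :: "(real ^ 'n::finite) set \<Rightarrow> (real ^ 'n \<Rightarrow> real) set" where
  "Vsp \<Omega> = {v \<in> H1sp \<Omega>. \<exists>\<phi> :: nat \<Rightarrow> real ^ 'n \<Rightarrow> real.
     (\<forall>m. \<phi> m \<in> test_functions \<Omega>) \<and> (\<lambda>m. V_nrm \<Omega> (v - \<phi> m)) \<longlonglongrightarrow> 0}"

subsection \<open>Coefficients, forms and kernel\<close>

definition symmetric_Linfty_field ::
    "(real ^ 'n::finite) set \<Rightarrow> (real ^ 'n \<Rightarrow> real ^ 'n ^ 'n) \<Rightarrow> bool" where
  "symmetric_Linfty_field \<Omega> A \<longleftrightarrow>
     A \<in> borel_measurable (lebesgue_on \<Omega>) \<and>
     (\<exists>C. AE x in lebesgue_on \<Omega>. norm (A x) \<le> C) \<and>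
     (AE x in lebesgue_on \<Omega>. transpose (A x) = A x)"

definition form ::
    "(real ^ 'n::finite) set \<Rightarrow> (real ^ 'n \<Rightarrow> real ^ 'n ^ 'n) \<Rightarrow>
     (real ^ 'n \<Rightarrow> real) \<Rightarrow> (real ^ 'n \<Rightarrow> real) \<Rightarrow> real" where
  "form \<Omega> A w v = (LINT x|lebesgue_on \<Omega>. (A x *v wgrad \<Omega> w x) \<bullet> wgrad \<Omega> v x)"

definition bounded_form ::
    "(real ^ 'n::finite) set \<Rightarrow> ((real ^ 'n \<Rightarrow> real) \<Rightarrow> (real ^ 'n \<Rightarrow> real) \<Rightarrow> real) \<Rightarrow> bool" where
  "bounded_form \<Omega> a \<longleftrightarrow>
     (\<exists>C. \<forall>w\<in>Vsp \<Omega>. \<forall>v\<in>Vsp \<Omega>. \<bar>a w v\<bar> \<le> C * V_nrm \<Omega> w * V_nrm \<Omega> v)"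

definition completely_monotone :: "(real \<Rightarrow> real) \<Rightarrow> bool" where
  "completely_monotone k \<longleftrightarrow>
     (\<forall>m. \<forall>t>0. (deriv ^^ m) k differentiable at t \<and> 0 \<le> (- 1) ^ m * (deriv ^^ m) k t)"

text \<open>A Borel measure \<open>\<nu>\<close> on \<open>[0,\<infinity>)\<close> has \<^term>\<open>space \<nu> = {0..}\<close>.\<close>

definition represents_kernel :: "real measure \<Rightarrow> (real \<Rightarrow> real) \<Rightarrow> bool" where
  "represents_kernel \<nu> k \<longleftrightarrow>
     sets \<nu> = sets (restrict_space borel {0..}) \<and>
     (\<forall>t>0. integrable \<nu> (\<lambda>l. exp (- l * t)) \<and> k t = (LINT l|\<nu>. exp (- l * t)))"

subsection \<open>The history space and the operator of the extended system\<close>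

type_synonym 'n hist = "real \<Rightarrow> real ^ 'n \<Rightarrow> real"

text \<open>
  For a strongly \<open>\<nu>\<close>-measurable \<open>\<zeta>\<close> the integrand below agrees \<open>\<nu>\<close>-almost everywhere with a Borel
  function, and the nonnegative integral ignores changes on null sets, so it is unaffected by
  \<open>\<nu>\<close> not being complete.
\<close>

definition Ksq ::
    "(real ^ 'n::finite) set \<Rightarrow> (real ^ 'n \<Rightarrow> real ^ 'n ^ 'n) \<Rightarrow> real measure \<Rightarrow> 'n hist \<Rightarrow> ennreal" where
  "Ksq \<Omega> A1 \<nu> \<zeta> = (\<integral>\<^sup>+l. ennreal (form \<Omega> A1 (\<zeta> l) (\<zeta> l)) \<partial>\<nu>)"

definition Ksp ::
    "(real ^ 'n::finite) set \<Rightarrow> (real ^ 'n \<Rightarrow> real ^ 'n ^ 'n) \<Rightarrow> real measure \<Rightarrow> 'n hist set" where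
  "Ksp \<Omega> A1 \<nu> = {\<zeta>. (\<forall>l\<ge>0. \<zeta> l \<in> Vsp \<Omega>) \<and> strongly_measurable \<nu> (Vsp \<Omega>) (V_nrm \<Omega>) \<zeta> \<and>
                     Ksq \<Omega> A1 \<nu> \<zeta> < \<infinity>}"

definition Wsp ::
    "(real ^ 'n::finite) set \<Rightarrow> (real ^ 'n \<Rightarrow> real ^ 'n ^ 'n) \<Rightarrow> real measure \<Rightarrow>
     ((real ^ 'n \<Rightarrow> real) \<times> 'n hist) set" where
  "Wsp \<Omega> A1 \<nu> = Hsp \<Omega> \<times> Ksp \<Omega> A1 \<nu>"

definition W_nrm ::
    "(real ^ 'n::finite) set \<Rightarrow> (real ^ 'n \<Rightarrow> real ^ 'n ^ 'n) \<Rightarrow> real measure \<Rightarrow>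
     (real ^ 'n \<Rightarrow> real) \<times> 'n hist \<Rightarrow> real" where
  "W_nrm \<Omega> A1 \<nu> = (\<lambda>(u, \<zeta>). sqrt ((H_nrm \<Omega> u)\<^sup>2 + enn2real (Ksq \<Omega> A1 \<nu> \<zeta>)))"

definition J_op :: "(real ^ 'n::finite) set \<Rightarrow> real measure \<Rightarrow> 'n hist \<Rightarrow> real ^ 'n \<Rightarrow> real" where
  "J_op \<Omega> \<nu> \<zeta> = bochner_integral_in \<nu> (Vsp \<Omega>) (V_nrm \<Omega>) \<zeta>"

definition E_op :: "(real ^ 'n::finite \<Rightarrow> real) \<Rightarrow> 'n hist" where
  "E_op u = (\<lambda>l. u)"

definition Lambda_op :: "('n::finite) hist \<Rightarrow> 'n hist" where
  "Lambda_op \<zeta> = (\<lambda>l. l *\<^sub>R \<zeta> l)"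

text \<open>
  The functional \<open>A\<^sub>0 u + A\<^sub>1 J \<zeta> \<in> V'\<close>, and the statement that such a functional is the image of
  \<open>h \<in> H\<close> under the identification of \<open>H\<close> with a subspace of \<open>V'\<close>.
\<close>

definition spatial_functional ::
    "(real ^ 'n::finite) set \<Rightarrow> (real ^ 'n \<Rightarrow> real ^ 'n ^ 'n) \<Rightarrow> (real ^ 'n \<Rightarrow> real ^ 'n ^ 'n) \<Rightarrow>
     real measure \<Rightarrow> (real ^ 'n \<Rightarrow> real) \<times> 'n hist \<Rightarrow> (real ^ 'n \<Rightarrow> real) \<Rightarrow> real" where
  "spatial_functional \<Omega> A0 A1 \<nu> = (\<lambda>(u, \<zeta>) v. form \<Omega> A0 u v + form \<Omega> A1 (J_op \<Omega> \<nu> \<zeta>) v)"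

definition functional_is_H_element ::
    "(real ^ 'n::finite) set \<Rightarrow> ((real ^ 'n \<Rightarrow> real) \<Rightarrow> real) \<Rightarrow> (real ^ 'n \<Rightarrow> real) \<Rightarrow> bool" where
  "functional_is_H_element \<Omega> F h \<longleftrightarrow> h \<in> Hsp \<Omega> \<and> (\<forall>v\<in>Vsp \<Omega>. F v = H_inner \<Omega> h v)"

definition gen_dom ::
    "(real ^ 'n::finite) set \<Rightarrow> (real ^ 'n \<Rightarrow> real ^ 'n ^ 'n) \<Rightarrow> (real ^ 'n \<Rightarrow> real ^ 'n ^ 'n) \<Rightarrow>
     real measure \<Rightarrow> ((real ^ 'n \<Rightarrow> real) \<times> 'n hist) set" where
  "gen_dom \<Omega> A0 A1 \<nu> = {(u, \<zeta>). u \<in> Vsp \<Omega> \<and> \<zeta> \<in> Ksp \<Omega> A1 \<nu> \<and>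
     (\<exists>h. functional_is_H_element \<Omega> (spatial_functional \<Omega> A0 A1 \<nu> (u, \<zeta>)) h) \<and>
     E_op u - Lambda_op \<zeta> \<in> Ksp \<Omega> A1 \<nu>}"

definition gen_op ::
    "(real ^ 'n::finite) set \<Rightarrow> (real ^ 'n \<Rightarrow> real ^ 'n ^ 'n) \<Rightarrow> (real ^ 'n \<Rightarrow> real ^ 'n ^ 'n) \<Rightarrow>
     real measure \<Rightarrow> (real ^ 'n \<Rightarrow> real) \<times> 'n hist \<Rightarrow> (real ^ 'n \<Rightarrow> real) \<times> 'n hist" where
  "gen_op \<Omega> A0 A1 \<nu> = (\<lambda>(u, \<zeta>).
     (- (SOME h. functional_is_H_element \<Omega> (spatial_functional \<Omega> A0 A1 \<nu> (u, \<zeta>)) h),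
      E_op u - Lambda_op \<zeta>))"

end

theory Submission
  imports Defs
begin

text \<open>
  Formally one multiplies the equation \<open>X' = \<A> X + (f, 0)\<close> by \<open>X = (u, \<zeta>)\<close>.  In the inner product of
  the energy space the coupling terms \<open>a1 (J \<zeta>) u\<close> and \<open>\<integral>a1 u \<zeta> d\<nu>\<close> cancel, so that
  \<open>- \<langle>\<A> X, X\<rangle> = a0 u u + \<integral>\<lambda> a1 \<zeta> \<zeta> d\<nu>\<close>, and Gronwall's inequality with
  \<open>2 \<langle>f, u\<rangle> \<le> |f|\<^sup>2 + |u|\<^sup>2\<close> bounds the energy by \<open>e\<^sup>T D\<^sub>0\<close> and twice the dissipation by
  \<open>(1 + T e\<^sup>T) D\<^sub>0\<close>; the two constants add up to at most \<open>(2 + T) e\<^sup>T\<close>.  The bounds for \<open>\<xi>\<close> and \<open>\<eta>\<close> follow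
  by the Cauchy--Schwarz inequality with the weights \<open>1\<close> and \<open>\<lambda>\<close> (\<open>weighted_integral\<close>).

  A mild solution need not take values in the domain of \<open>\<A>\<close>, so the computation is made for its
  Steklov averages \<open>(1 / h) \<integral>\<^sub>t\<^sup>t\<^sup>+\<^sup>h X\<close>.  They lie in the domain and solve the equation with averaged
  forcing (\<open>Z_generator_limit\<close>, \<open>Y_generator\<close>), hence satisfy the energy identity in the classical sense
  (\<open>Y_energy\<close>).  As \<open>h\<close> tends to zero the energies converge (\<open>mild_energy_bound\<close>), while for the dissipation
  only Fatou's lemma is available (\<open>mild_dissipation_bound\<close>).  This suffices because
  \<open>\<zeta> \<mapsto> \<integral>\<lambda> a1 \<zeta> \<zeta> d\<nu>\<close> is lower semicontinuous on the history space (\<open>damping_lsc\<close>).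

  The form \<open>a0\<close> may degenerate and is not lower semicontinuous along sequences that converge in \<open>H\<close> only.
  If \<open>u\<close> is square integrable with values in \<open>V\<close>, each tangent \<open>v \<mapsto> 2 a0 v c - a0 c c\<close> of \<open>a0\<close> is
  evaluated on the averages through a scalar Steklov average, which converges almost everywhere
  (\<open>Steklov_average_AE\<close>); countably many tangents determine \<open>a0 (u t) (u t)\<close> (\<open>viscous_damping_bound\<close>).

  Elements of the spaces are represented by functions up to null elements of a seminorm.  Vector
  valued integrals are therefore handled through bounded functionals alone, and an identity between
  vectors is proved by pairing its two sides with every element.
\<close>

section \<open>Spaces of representatives with a semi-inner product\<close>

lemma squeeze_zero:
  fixes f g :: "'i \<Rightarrow> real"
  assumes "\<And>i. 0 \<le> f i" "\<And>i. f i \<le> g i" "(g \<longlongrightarrow> 0) F"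
  shows "(f \<longlongrightarrow> 0) F"
  by (rule tendsto_sandwich[OF _ _ tendsto_const assms(3)]) (use assms in auto)

text \<open>
  The form is only positive semidefinite: distinct representatives may have distance zero, so an
  equation between elements of a Hilbert space becomes \<open>p (x - y) = 0\<close>.  Nothing is said about
  \<open>B\<close> and \<open>p\<close> outside \<open>V\<close>, since weak gradients and integrals have no meaning there.
\<close>

locale semi_inner =
  fixes V :: "'a::real_vector set" and B :: "'a \<Rightarrow> 'a \<Rightarrow> real" and p :: "'a \<Rightarrow> real"
  assumes zero_mem: "0 \<in> V"
    and add_mem: "x \<in> V \<Longrightarrow> y \<in> V \<Longrightarrow> x + y \<in> V"
    and scale_mem: "x \<in> V \<Longrightarrow> c *\<^sub>R x \<in> V"
    and sym: "x \<in> V \<Longrightarrow> y \<in> V \<Longrightarrow> B x y = B y x"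
    and add_left: "x \<in> V \<Longrightarrow> y \<in> V \<Longrightarrow> z \<in> V \<Longrightarrow> B (x + y) z = B x z + B y z"
    and scale_left: "x \<in> V \<Longrightarrow> z \<in> V \<Longrightarrow> B (c *\<^sub>R x) z = c * B x z"
    and nonneg: "x \<in> V \<Longrightarrow> 0 \<le> B x x"
    and nrm: "x \<in> V \<Longrightarrow> p x = sqrt (B x x)"
begin

lemma uminus_mem: "x \<in> V \<Longrightarrow> - x \<in> V"
  using scale_mem[of x "-1"] by simp

lemma diff_mem: "x \<in> V \<Longrightarrow> y \<in> V \<Longrightarrow> x - y \<in> V"
  using add_mem[of x "- y"] uminus_mem[of y] by simp

lemmas mem = zero_mem add_mem scale_mem uminus_mem diff_mem

lemma sum_mem: "finite I \<Longrightarrow> (\<And>i. i \<in> I \<Longrightarrow> f i \<in> V) \<Longrightarrow> sum f I \<in> V"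
  by (induction I rule: finite_induct) (auto simp: mem)

lemma add_right: "x \<in> V \<Longrightarrow> y \<in> V \<Longrightarrow> z \<in> V \<Longrightarrow> B z (x + y) = B z x + B z y"
  using add_left sym mem by metis

lemma scale_right: "x \<in> V \<Longrightarrow> z \<in> V \<Longrightarrow> B z (c *\<^sub>R x) = c * B z x"
  using scale_left sym mem by metis

lemma diff_left: "x \<in> V \<Longrightarrow> y \<in> V \<Longrightarrow> z \<in> V \<Longrightarrow> B (x - y) z = B x z - B y z"
  using add_left[of x "(-1) *\<^sub>R y" z] scale_left[of y z "-1"] mem by simp

lemma diff_right: "x \<in> V \<Longrightarrow> y \<in> V \<Longrightarrow> z \<in> V \<Longrightarrow> B z (x - y) = B z x - B z y"
  using diff_left sym mem by metis

lemma zero_left: "z \<in> V \<Longrightarrow> B 0 z = 0"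
  using scale_left[of 0 z 0] mem by simp

lemma nrm_sq: "x \<in> V \<Longrightarrow> (p x)\<^sup>2 = B x x"
  by (simp add: nrm nonneg)

lemma nrm_nonneg: "x \<in> V \<Longrightarrow> 0 \<le> p x"
  by (simp add: nrm nonneg)

lemma nrm_zero: "p 0 = 0"
  using nrm[of 0] zero_left[of 0] mem by simp

lemma nrm_scale: "x \<in> V \<Longrightarrow> p (c *\<^sub>R x) = \<bar>c\<bar> * p x"
  using nrm[of "c *\<^sub>R x"] nrm[of x]
  by (simp add: mem scale_left scale_right real_sqrt_mult flip: mult.assoc power2_eq_square)

lemma nrm_uminus: "x \<in> V \<Longrightarrow> p (- x) = p x"
  using nrm_scale[of x "-1"] by simp

lemma nrm_minus_commute: "x \<in> V \<Longrightarrow> y \<in> V \<Longrightarrow> p (x - y) = p (y - x)"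
  using nrm_uminus[of "x - y"] by (simp add: mem)

lemma Cauchy_Schwarz:
  assumes x: "x \<in> V" and y: "y \<in> V" shows "\<bar>B x y\<bar> \<le> p x * p y"
proof -
  have quad: "0 \<le> B x x - 2 * c * B x y + c\<^sup>2 * B y y" for c
  proof -
    have "0 \<le> B (x - c *\<^sub>R y) (x - c *\<^sub>R y)"
      using x y by (intro nonneg mem)
    then show ?thesis
      using x y by (simp add: mem diff_left diff_right scale_left scale_right sym[of y x]
          power2_eq_square algebra_simps)
  qed
  have "(B x y)\<^sup>2 \<le> B x x * B y y"
  proof (cases "B y y = 0")
    case True
    have "B x y = 0"
    proof (rule ccontr)
      assume "B x y \<noteq> 0"
      then show False
        (* this parameter turns the quadratic into the constant -1 *)
        using quad[of "(B x x + 1) / (2 * B x y)"] True by simp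
    qed
    then show ?thesis using True by simp
  next
    case False
    then have pos: "B y y > 0" using nonneg[OF y] by simp
    have "0 \<le> (B x x - 2 * (B x y / B y y) * B x y + (B x y / B y y)\<^sup>2 * B y y) * B y y"
      by (intro mult_nonneg_nonneg quad) (use pos in auto)
    also have "\<dots> = B x x * B y y - (B x y)\<^sup>2"
      using pos by (simp add: field_simps power2_eq_square)
    finally show ?thesis by simp
  qed
  then have "sqrt ((B x y)\<^sup>2) \<le> sqrt (B x x * B y y)" by (rule real_sqrt_le_mono)
  then show ?thesis using x y by (simp add: nrm real_sqrt_mult)
qed

lemma nrm_triangle:
  assumes x: "x \<in> V" and y: "y \<in> V" shows "p (x + y) \<le> p x + p y"
proof -
  have "(p (x + y))\<^sup>2 = B x x + 2 * B x y + B y y"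
    using x y by (simp add: nrm_sq mem add_left add_right sym[of y x])
  also have "\<dots> \<le> (p x + p y)\<^sup>2"
    using Cauchy_Schwarz[OF x y] by (simp add: power2_sum nrm_sq x y)
  finally show ?thesis
    by (rule power2_le_imp_le) (use nrm_nonneg x y in auto)
qed

lemma nrm_diff_triangle: "x \<in> V \<Longrightarrow> y \<in> V \<Longrightarrow> p (x - y) \<le> p x + p y"
  using nrm_triangle[of x "- y"] by (simp add: nrm_uminus mem)

lemma nrm_dist_triangle: "x \<in> V \<Longrightarrow> y \<in> V \<Longrightarrow> z \<in> V \<Longrightarrow> p (x - z) \<le> p (x - y) + p (y - z)"
  using nrm_triangle[of "x - y" "y - z"] by (simp add: mem)

lemma nrm_abs_diff: "x \<in> V \<Longrightarrow> y \<in> V \<Longrightarrow> \<bar>p x - p y\<bar> \<le> p (x - y)"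
  using nrm_triangle[of "x - y" y] nrm_triangle[of "y - x" x] nrm_minus_commute[of x y]
  by (simp add: mem abs_le_iff)

text \<open>
  Pairing a vector with itself reduces a bound for its norm to a bound for one functional; vector
  valued integrals and limits are estimated in this way throughout.
\<close>

lemma nrm_le_if_functional_le:
  assumes x: "x \<in> V" and e: "0 \<le> e" and le: "B x x \<le> e * p x" shows "p x \<le> e"
proof (cases "p x = 0")
  case False
  then have "0 < p x" using nrm_nonneg[OF x] by simp
  moreover have "p x * p x \<le> e * p x" using le x by (simp flip: nrm_sq add: power2_eq_square)
  ultimately show ?thesis by simp
qed (use e in simp)

lemma nrm_diff_null: "x \<in> V \<Longrightarrow> y \<in> V \<Longrightarrow> p (x - y) = 0 \<Longrightarrow> p x = p y"
  using nrm_abs_diff[of x y] by simp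

lemma null_left:
  assumes "x \<in> V" "y \<in> V" "z \<in> V" "p (x - y) = 0" shows "B x z = B y z"
  using Cauchy_Schwarz[of "x - y" z] assms by (simp add: mem diff_left)

definition bounded_functional :: "('a \<Rightarrow> real) \<Rightarrow> bool" where
  "bounded_functional L \<longleftrightarrow>
     (\<forall>x\<in>V. \<forall>y\<in>V. L (x + y) = L x + L y) \<and> (\<forall>x\<in>V. \<forall>c. L (c *\<^sub>R x) = c * L x) \<and>
     (\<exists>C\<ge>0. \<forall>x\<in>V. \<bar>L x\<bar> \<le> C * p x)"

lemma bounded_functional_inner: "w \<in> V \<Longrightarrow> bounded_functional (\<lambda>x. B x w)"
  unfolding bounded_functional_def
  by (intro conjI ballI allI exI[of _ "p w"])
     (auto simp: add_left scale_left nrm_nonneg intro: order_trans[OF Cauchy_Schwarz]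
        simp: mult.commute)

lemma bounded_functional_diff:
  assumes "bounded_functional L" "x \<in> V" "y \<in> V" shows "L (x - y) = L x - L y"
proof -
  have "L (x + (-1) *\<^sub>R y) = L x + (-1) * L y"
    using assms mem unfolding bounded_functional_def by metis
  then show ?thesis by simp
qed

lemma bounded_functional_lipschitz:
  assumes "bounded_functional L"
  obtains C where "C \<ge> 0" "\<And>x. x \<in> V \<Longrightarrow> \<bar>L x\<bar> \<le> C * p x"
    "\<And>x y. x \<in> V \<Longrightarrow> y \<in> V \<Longrightarrow> \<bar>L x - L y\<bar> \<le> C * p (x - y)"
proof -
  obtain C where C: "C \<ge> 0" "\<And>x. x \<in> V \<Longrightarrow> \<bar>L x\<bar> \<le> C * p x"
    using assms unfolding bounded_functional_def by auto
  have "\<bar>L x - L y\<bar> \<le> C * p (x - y)" if "x \<in> V" "y \<in> V" for x y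
    using C(2)[of "x - y"] bounded_functional_diff[OF assms that] that by (simp add: mem)
  with C show ?thesis by (rule that)
qed

definition complete_space :: bool where
  "complete_space \<longleftrightarrow>
     (\<forall>x :: nat \<Rightarrow> 'a. range x \<subseteq> V \<and> (\<forall>e>0. \<exists>N. \<forall>m\<ge>N. \<forall>n\<ge>N. p (x m - x n) < e) \<longrightarrow>
        (\<exists>y\<in>V. (\<lambda>n. p (x n - y)) \<longlonglongrightarrow> 0))"

end

section \<open>Strong measurability\<close>

lemma (in complete_measure) measurable_AE_cong:
  assumes f: "f \<in> measurable M N" and ae: "AE x in M. f x = g x"
    and g: "g \<in> space M \<rightarrow> space N"
  shows "g \<in> measurable M N"
proof (rule measurableI)
  fix A assume "A \<in> sets N"
  have "AE x in M. x \<in> f -` A \<inter> space M \<longleftrightarrow> x \<in> g -` A \<inter> space M"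
    using ae by eventually_elim auto
  then show "g -` A \<inter> space M \<in> sets M"
    using measurable_sets[OF f \<open>A \<in> sets N\<close>] by (rule in_sets_AE) auto
qed (use g in auto)

lemma (in complete_measure) borel_measurable_AE_cong:
  assumes "f \<in> borel_measurable M" "AE x in M. f x = g x"
  shows "g \<in> borel_measurable M"
  using assms by (rule measurable_AE_cong) auto

lemma (in complete_measure) borel_measurable_AE_limit:
  fixes f :: "nat \<Rightarrow> 'a \<Rightarrow> 'b::{banach, second_countable_topology}"
  assumes f: "\<And>i. f i \<in> borel_measurable M" and lim: "AE x in M. (\<lambda>i. f i x) \<longlonglongrightarrow> g x"
  shows "g \<in> borel_measurable M"
proof (rule borel_measurable_AE_cong)
  show "(\<lambda>x. lim (\<lambda>i. f i x)) \<in> borel_measurable M"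
    using f by (rule borel_measurable_lim_metric)
  show "AE x in M. lim (\<lambda>i. f i x) = g x"
    using lim by eventually_elim (simp add: limI)
qed

text \<open>
  Lebesgue measure on a measurable set is complete, so the facts about completions apply to it as
  they stand.
\<close>

lemma (in complete_measure) completion_eq: "completion M = M"
proof (rule measure_eqI)
  show "sets (completion M) = sets M"
  proof (intro equalityI subsetI)
    fix A assume "A \<in> sets (completion M)"
    then show "A \<in> sets M"
      by (elim sets_completionE) (metis complete2 null_setsD2 sets.Un)
  qed auto
next
  fix A assume "A \<in> sets (completion M)"
  then have "emeasure (completion M) A = emeasure M (main_part M A)" "A = main_part M A \<union> null_part M A"
    by (auto simp: main_part_null_part_Un)
  moreover obtain N where "N \<in> null_sets M" "null_part M A \<subseteq> N"
    using null_part[OF \<open>A \<in> sets (completion M)\<close>] by auto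
  then have "null_part M A \<in> null_sets M" using complete2 by auto
  ultimately show "emeasure (completion M) A = emeasure M A"
    using emeasure_Un_null_set[of "main_part M A" M "null_part M A"] main_part_sets[OF \<open>A \<in> sets (completion M)\<close>]
    by simp
qed

lemma complete_measure_lebesgue_on:
  assumes S: "S \<in> sets lebesgue" shows "complete_measure (lebesgue_on S)"
proof
  fix A B assume AB: "A \<subseteq> B" "B \<in> null_sets (lebesgue_on S)"
  then have "B \<in> null_sets lebesgue" "A \<subseteq> S"
    using S by (auto simp: null_sets_restrict_space)
  then have "A \<in> null_sets lebesgue" using AB(1) by (metis completion.complete2)
  then show "A \<in> sets (lebesgue_on S)"
    using S \<open>A \<subseteq> S\<close> by (auto simp: sets_restrict_space_iff)
qed

context semi_inner
begin

lemma strongly_measurable_simple: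
  assumes "simple_function M s" "s ` space M \<subseteq> V" shows "strongly_measurable M V p s"
  unfolding strongly_measurable_def
  using assms by (intro conjI exI[of _ "\<lambda>i. s"] AE_I2) (auto simp: nrm_zero)

lemma strongly_measurable_diff:
  assumes f: "strongly_measurable M V p f" and g: "strongly_measurable M V p g"
  shows "strongly_measurable M V p (\<lambda>x. f x - g x)"
proof -
  obtain s :: "nat \<Rightarrow> _ \<Rightarrow> 'a" where s: "\<And>i. simple_function M (s i)" "\<And>i. s i ` space M \<subseteq> V"
    "AE x in M. (\<lambda>i. p (f x - s i x)) \<longlonglongrightarrow> 0" and fV: "AE x in M. f x \<in> V"
    using f unfolding strongly_measurable_def by auto
  obtain r :: "nat \<Rightarrow> _ \<Rightarrow> 'a" where r: "\<And>i. simple_function M (r i)" "\<And>i. r i ` space M \<subseteq> V"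
    "AE x in M. (\<lambda>i. p (g x - r i x)) \<longlonglongrightarrow> 0" and gV: "AE x in M. g x \<in> V"
    using g unfolding strongly_measurable_def by auto
  have "AE x in M. (\<lambda>i. p (f x - g x - (s i x - r i x))) \<longlonglongrightarrow> 0"
    using s(3) r(3) fV gV AE_space[of M]
  proof eventually_elim
    case (elim x)
    have V: "s i x \<in> V" "r i x \<in> V" for i using s(2)[of i] r(2)[of i] elim(5) by auto
    have le: "p (f x - g x - (s i x - r i x)) \<le> p (f x - s i x) + p (g x - r i x)" for i
    proof -
      have eq: "f x - g x - (s i x - r i x) = (f x - s i x) - (g x - r i x)" by simp
      show ?thesis unfolding eq using elim V[of i] by (intro nrm_diff_triangle mem)
    qed
    have "(\<lambda>i. p (f x - s i x) + p (g x - r i x)) \<longlonglongrightarrow> 0 + 0" using elim(1,2) by (rule tendsto_add)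
    then have "(\<lambda>i. p (f x - s i x) + p (g x - r i x)) \<longlonglongrightarrow> 0" by simp
    then show ?case
      by (rule squeeze_zero[rotated 2]) (use le V elim in \<open>auto simp: mem nrm_nonneg\<close>)
  qed
  moreover have "AE x in M. f x - g x \<in> V" using fV gV by eventually_elim (rule mem)
  ultimately show ?thesis
    unfolding strongly_measurable_def using s r
    by (intro conjI exI[of _ "\<lambda>i x. s i x - r i x"]) (auto intro!: simple_function_compose2 mem simp: image_subset_iff)
qed

text \<open>
  The values of \<open>h\<close> on approximating simple functions converge almost everywhere, and such a limit
  is measurable for the completed measure only.
\<close>

lemma measurable_lipschitz:
  fixes h :: "'a \<Rightarrow> real"
  assumes f: "strongly_measurable M V p f"
    and h: "\<And>x y. x \<in> V \<Longrightarrow> y \<in> V \<Longrightarrow> \<bar>h x - h y\<bar> \<le> C * p (x - y)"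
  shows "(\<lambda>x. h (f x)) \<in> borel_measurable (completion M)"
proof -
  obtain s :: "nat \<Rightarrow> _ \<Rightarrow> 'a" where s: "\<And>i. simple_function M (s i)" "\<And>i. s i ` space M \<subseteq> V"
    "AE x in M. (\<lambda>i. p (f x - s i x)) \<longlonglongrightarrow> 0" and fV: "AE x in M. f x \<in> V"
    using f unfolding strongly_measurable_def by auto
  show ?thesis
  proof (rule completion.borel_measurable_AE_limit)
    show "(\<lambda>x. h (s i x)) \<in> borel_measurable (completion M)" for i
      using simple_function_compose1[OF s(1), of h i]
      by (intro measurable_completion borel_measurable_simple_function)
    have "AE x in M. (\<lambda>i. h (s i x)) \<longlonglongrightarrow> h (f x)"
      using s(3) fV AE_space
    proof eventually_elim
      case (elim x)
      have le: "norm (h (s i x) - h (f x)) \<le> C * p (f x - s i x)" for i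
        using h[of "f x" "s i x"] elim s(2)[of i] by (auto simp: image_subset_iff abs_minus_commute)
      have "(\<lambda>i. C * p (f x - s i x)) \<longlonglongrightarrow> 0"
        using tendsto_mult_left[OF elim(1), of C] by simp
      then have "(\<lambda>i. h (s i x) - h (f x)) \<longlonglongrightarrow> 0"
        by (rule Lim_null_comparison[rotated]) (use le in auto)
      then show ?case by (simp add: LIM_zero_iff)
    qed
    then show "AE x in completion M. (\<lambda>i. h (s i x)) \<longlonglongrightarrow> h (f x)" by (rule AE_completion)
  qed
qed

lemma measurable_nrm_diff:
  assumes "strongly_measurable M V p f" "c \<in> V"
  shows "(\<lambda>x. p (f x - c)) \<in> borel_measurable (completion M)"
proof (rule measurable_lipschitz[OF assms(1), where C = 1])
  fix x y assume "x \<in> V" "y \<in> V"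
  then show "\<bar>p (x - c) - p (y - c)\<bar> \<le> 1 * p (x - y)"
    using nrm_abs_diff[of "x - c" "y - c"] assms(2) by (simp add: mem)
qed

lemma measurable_nrm:
  "strongly_measurable M V p f \<Longrightarrow> (\<lambda>x. p (f x)) \<in> borel_measurable (completion M)"
  using measurable_nrm_diff[of M f 0] by (simp add: mem)

text \<open>
  The approximating simple functions take countably many values in all, and these come arbitrarily
  close to almost every value of \<open>f\<close>.  The point \<open>0\<close> is put first so that it always competes when
  a best approximation among the first points is chosen.
\<close>

lemma strongly_measurable_dense_sequence:
  assumes f: "strongly_measurable M V p f"
  obtains c :: "nat \<Rightarrow> 'a" where "range c \<subseteq> V" "c 0 = 0"
    "AE x in M. \<forall>e>0. \<exists>k. p (f x - c k) < e"
proof -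
  obtain s :: "nat \<Rightarrow> _ \<Rightarrow> 'a" where s: "\<And>i. simple_function M (s i)" "\<And>i. s i ` space M \<subseteq> V"
    "AE x in M. (\<lambda>i. p (f x - s i x)) \<longlonglongrightarrow> 0" and fV: "AE x in M. f x \<in> V"
    using f unfolding strongly_measurable_def by auto
  define D where "D = insert 0 (\<Union>i. s i ` space M)"
  have "countable (s i ` space M)" for i
    using s(1)[of i] by (auto simp: simple_function_def intro: countable_finite)
  then have "countable D" unfolding D_def by auto
  have "0 \<in> D" "D \<subseteq> V" using s(2) by (auto simp: D_def mem)
  define c where "c = case_nat 0 (from_nat_into D)"
  have rc: "range c = D"
  proof -
    have "range c = insert (c 0) (range (\<lambda>n. c (Suc n)))"
      by (auto simp: image_iff) (metis not0_implies_Suc)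
    also have "range (\<lambda>n. c (Suc n)) = D"
      using range_from_nat_into[OF _ \<open>countable D\<close>] \<open>0 \<in> D\<close> by (auto simp: c_def)
    finally show ?thesis using \<open>0 \<in> D\<close> by (auto simp: c_def)
  qed
  show thesis
  proof (rule that[of c])
    show "range c \<subseteq> V" using rc \<open>D \<subseteq> V\<close> by simp
    show "c 0 = 0" by (simp add: c_def)
    show "AE x in M. \<forall>e>0. \<exists>k. p (f x - c k) < e"
      using s(3) AE_space
    proof eventually_elim
      case (elim x)
      show ?case
      proof (intro allI impI)
        fix e :: real assume "e > 0"
        then have "eventually (\<lambda>i. p (f x - s i x) < e) sequentially"
          using elim(1) by (rule order_tendstoD(2)[rotated])
        then obtain i where i: "p (f x - s i x) < e" by (auto simp: eventually_sequentially)
        have "s i x \<in> range c" unfolding rc D_def using elim(2) by auto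
        then show "\<exists>k. p (f x - c k) < e" using i by auto
      qed
    qed
  qed
qed

text \<open>
  Among the first points of a dense sequence one picks, for each argument, the one closest to the
  value.  As the sequence starts with \<open>0\<close>, the resulting simple functions are never farther
  from \<open>f\<close> than \<open>0\<close> is, which makes dominated convergence available.
\<close>

lemma simple_approximation:
  fixes c :: "nat \<Rightarrow> 'a" and f :: "'s \<Rightarrow> 'a"
  assumes fV: "AE x in M. f x \<in> V" and c: "range c \<subseteq> V" "c 0 = 0"
    and meas: "\<And>k. (\<lambda>x. p (f x - c k)) \<in> borel_measurable (completion M)"
    and dense: "AE x in M. \<forall>e>0. \<exists>k. p (f x - c k) < e"
  obtains s :: "nat \<Rightarrow> 's \<Rightarrow> 'a" where
    "\<And>i. simple_function M (s i)" "\<And>i. s i ` space M \<subseteq> V"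
    "AE x in M. \<forall>i. p (f x - s i x) \<le> p (f x)"
    "AE x in M. (\<lambda>i. p (f x - s i x)) \<longlonglongrightarrow> 0"
    "\<And>i. (\<lambda>x. p (f x - s i x)) \<in> borel_measurable (completion M)"
proof -
  have "\<exists>g. g \<in> borel_measurable M \<and> (AE x in M. p (f x - c k) = g x)" for k
    using completion_ex_borel_measurable_real[OF meas[of k]] by auto
  then obtain g where g[measurable]: "\<And>k. g k \<in> borel_measurable M"
    and geq: "\<And>k. AE x in M. p (f x - c k) = g k x" by metis
  define J where "J = rec_nat (\<lambda>x. 0::nat) (\<lambda>i j x. if g (Suc i) x < g (j x) x then Suc i else j x)"
  have J0: "J 0 = (\<lambda>x. 0)" and JS: "J (Suc i) = (\<lambda>x. if g (Suc i) x < g (J i x) x then Suc i else J i x)" for i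
    by (auto simp: J_def fun_eq_iff)
  have J_meas[measurable]: "J i \<in> measurable M (count_space UNIV)" for i
  proof (induction i)
    case 0 then show ?case by (simp add: J0)
  next
    case (Suc i)
    note Suc[measurable]
    have [measurable]: "(\<lambda>x. g (J i x) x) \<in> borel_measurable M"
      by (rule measurable_compose_countable) measurable
    show ?case unfolding JS by measurable
  qed
  have J_le: "J i x \<le> i" for i x by (induction i) (auto simp: J0 JS intro: le_SucI)
  have J_min: "g (J i x) x \<le> g k x" if "k \<le> i" for i k x
    using that
  proof (induction i)
    case (Suc i)
    show ?case
    proof (cases "k = Suc i")
      case True
      then show ?thesis by (simp add: JS not_less)
    next
      case False
      then have "g (J i x) x \<le> g k x" using Suc by simp
      then show ?thesis by (simp add: JS)
    qed
  qed (simp add: J0)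
  define s where "s = (\<lambda>i x. c (J i x))"
  have sfJ: "simple_function M (J i)" for i
    unfolding simple_function_def
  proof (intro conjI ballI)
    show "finite (J i ` space M)" using J_le by (auto intro!: finite_subset[of "J i ` space M" "{..i}"])
    fix y show "J i -` {y} \<inter> space M \<in> sets M" using J_meas[of i] by (rule measurable_sets) simp
  qed
  have ae: "AE x in M. \<forall>k. p (f x - c k) = g k x" using geq by (simp add: AE_all_countable)
  show thesis
  proof (rule that[of s])
    show "simple_function M (s i)" for i
      unfolding s_def using sfJ by (rule simple_function_compose1)
    show "s i ` space M \<subseteq> V" for i using c by (auto simp: s_def)
    show "AE x in M. \<forall>i. p (f x - s i x) \<le> p (f x)"
      using ae
    proof eventually_elim
      case (elim x)
      then show ?case using J_min[of 0 _ x] c(2) by (simp add: s_def) (metis diff_zero)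
    qed
    show "AE x in M. (\<lambda>i. p (f x - s i x)) \<longlonglongrightarrow> 0"
      using ae dense fV
    proof eventually_elim
      case (elim x)
      show ?case
      proof (rule LIMSEQ_I)
        fix r :: real assume "0 < r"
        then obtain k where k: "p (f x - c k) < r" using elim(2) by auto
        have "norm (p (f x - s i x) - 0) < r" if "k \<le> i" for i
          using J_min[OF that, of x] k elim(1,3) c(1) nrm_nonneg[of "f x - s i x"]
          by (auto simp: s_def mem range_subsetD)
        then show "\<exists>no. \<forall>n\<ge>no. norm (p (f x - s n x) - 0) < r" by auto
      qed
    qed
    fix i
    show "(\<lambda>x. p (f x - s i x)) \<in> borel_measurable (completion M)"
      unfolding s_def
      by (rule measurable_compose_countable[where g = "J i" and f = "\<lambda>k x. p (f x - c k)"])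
         (use meas J_meas in \<open>auto intro: measurable_completion\<close>)
  qed
qed

text \<open>
  A criterion of Pettis type: almost all values lie in a separable part of the space and the
  distances to fixed points are measurable.
\<close>

lemma strongly_measurableI:
  fixes c :: "nat \<Rightarrow> 'a" and f :: "'s \<Rightarrow> 'a"
  assumes "AE x in M. f x \<in> V" and c: "range c \<subseteq> V"
    and meas: "\<And>y. y \<in> V \<Longrightarrow> (\<lambda>x. p (f x - y)) \<in> borel_measurable (completion M)"
    and dense: "AE x in M. \<forall>e>0. \<exists>k. p (f x - c k) < e"
  shows "strongly_measurable M V p f"
proof -
  define c' where "c' = case_nat 0 c"
  have c': "range c' \<subseteq> V" "c' 0 = 0"
    using c by (auto simp: c'_def mem range_subsetD split: nat.split)
  have dense': "AE x in M. \<forall>e>0. \<exists>k. p (f x - c' k) < e"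
    using dense
  proof eventually_elim
    case (elim x)
    then show ?case by (metis c'_def old.nat.simps(5))
  qed
  have meas': "(\<lambda>x. p (f x - c' k)) \<in> borel_measurable (completion M)" for k
    using c' by (intro meas) auto
  obtain s :: "nat \<Rightarrow> 's \<Rightarrow> 'a" where "\<And>i. simple_function M (s i)" "\<And>i. s i ` space M \<subseteq> V"
    "AE x in M. \<forall>i. p (f x - s i x) \<le> p (f x)" "AE x in M. (\<lambda>i. p (f x - s i x)) \<longlonglongrightarrow> 0"
    "\<And>i. (\<lambda>x. p (f x - s i x)) \<in> borel_measurable (completion M)"
    by (rule simple_approximation[OF assms(1) c' meas' dense']) (rule that; assumption)
  then show ?thesis unfolding strongly_measurable_def using assms(1)
    by (intro conjI exI[of _ s]) auto
qed

section \<open>Bochner integrals\<close>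

lemma simple_bochner_integral_mem:
  assumes "simple_function M s" "s ` space M \<subseteq> V"
  shows "Bochner_Integration.simple_bochner_integral M s \<in> V"
  unfolding Bochner_Integration.simple_bochner_integral_def
  using assms by (intro sum_mem) (auto simp: simple_function_def intro!: mem)

lemma functional_sum:
  assumes L: "bounded_functional L" and "finite I" "\<And>i. i \<in> I \<Longrightarrow> f i \<in> V"
  shows "L (\<Sum>i\<in>I. c i *\<^sub>R f i) = (\<Sum>i\<in>I. c i * L (f i))"
  using assms(2,3)
proof (induction I rule: finite_induct)
  case empty
  have "L (0 *\<^sub>R 0) = 0 * L 0" using L mem(1) unfolding bounded_functional_def by metis
  then show ?case by simp
next
  case (insert i I)
  have "L (c i *\<^sub>R f i + (\<Sum>i\<in>I. c i *\<^sub>R f i)) = L (c i *\<^sub>R f i) + L (\<Sum>i\<in>I. c i *\<^sub>R f i)"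
    using L insert unfolding bounded_functional_def by (simp add: mem sum_mem)
  moreover have "L (c i *\<^sub>R f i) = c i * L (f i)"
    using L insert unfolding bounded_functional_def by simp
  ultimately show ?case using insert by simp
qed

lemma nrm_sum:
  assumes "finite I" "\<And>i. i \<in> I \<Longrightarrow> f i \<in> V"
  shows "p (\<Sum>i\<in>I. f i) \<le> (\<Sum>i\<in>I. p (f i))"
  using assms
proof (induction I rule: finite_induct)
  case (insert i I)
  then show ?case using nrm_triangle[of "f i" "sum f I"] by (simp add: sum_mem)
qed (simp add: nrm_zero)

lemma simple_bochner_integral_functional:
  assumes L: "bounded_functional L"
    and s: "Bochner_Integration.simple_bochner_integrable M s" "s ` space M \<subseteq> V"
  shows "Bochner_Integration.simple_bochner_integral M (\<lambda>x. L (s x)) =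
    L (Bochner_Integration.simple_bochner_integral M s)"
proof -
  have sf: "simple_function M s" using s(1) by (simp add: simple_bochner_integrable.simps)
  have L0: "L 0 = 0" using functional_sum[OF L, of "{}"] by simp
  have "Bochner_Integration.simple_bochner_integral M (\<lambda>x. L (s x)) =
      (\<Sum>y\<in>s ` space M. measure M {x \<in> space M. s x = y} *\<^sub>R L y)"
    using sf simple_bochner_integrable_compose2[of "\<lambda>x y. L x" M s s] s(1) L0
    by (intro simple_bochner_integral_partition) auto
  also have "\<dots> = L (Bochner_Integration.simple_bochner_integral M s)"
    unfolding Bochner_Integration.simple_bochner_integral_def
    using sf s(2) by (subst functional_sum[OF L]) (auto simp: simple_function_def)
  finally show ?thesis .
qed

lemma simple_bochner_integral_nrm_le:
  assumes s: "Bochner_Integration.simple_bochner_integrable M s" "s ` space M \<subseteq> V"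
  shows "ennreal (p (Bochner_Integration.simple_bochner_integral M s)) \<le> (\<integral>\<^sup>+x. ennreal (p (s x)) \<partial>M)"
proof -
  have sf: "simple_function M s" using s(1) by (simp add: simple_bochner_integrable.simps)
  have "p (Bochner_Integration.simple_bochner_integral M s) \<le>
      (\<Sum>y\<in>s ` space M. p (measure M {x \<in> space M. s x = y} *\<^sub>R y))"
    unfolding Bochner_Integration.simple_bochner_integral_def
    using sf s(2) by (intro nrm_sum) (auto simp: simple_function_def mem)
  also have "\<dots> = (\<Sum>y\<in>s ` space M. measure M {x \<in> space M. s x = y} *\<^sub>R \<bar>p y\<bar>)"
    using s(2) by (intro sum.cong) (auto simp: nrm_scale nrm_nonneg)
  also have "\<dots> = Bochner_Integration.simple_bochner_integral M (\<lambda>x. \<bar>p (s x)\<bar>)"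
    using sf simple_bochner_integrable_compose2[of "\<lambda>x y. \<bar>p x\<bar>" M s s] s(1) nrm_zero
    by (intro simple_bochner_integral_partition[symmetric]) auto
  finally have "ennreal (p (Bochner_Integration.simple_bochner_integral M s)) \<le>
      ennreal (Bochner_Integration.simple_bochner_integral M (\<lambda>x. \<bar>p (s x)\<bar>))"
    by (rule ennreal_leI)
  also have "\<dots> = (\<integral>\<^sup>+x. ennreal \<bar>p (s x)\<bar> \<partial>M)"
    using simple_bochner_integrable_compose2[of "\<lambda>x y. \<bar>p x\<bar>" M s s] s(1) nrm_zero
    by (intro simple_bochner_integral_eq_nn_integral) auto
  also have "\<dots> = (\<integral>\<^sup>+x. ennreal (p (s x)) \<partial>M)"
    using s(2) nrm_nonneg by (intro nn_integral_cong) (auto simp: image_subset_iff)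
  finally show ?thesis .
qed

text \<open>
  Scalar integrals are taken with respect to the completed measure: a functional of a strongly
  measurable function is only almost everywhere equal to a measurable function.
\<close>

lemma has_bochner_integral_functional:
  assumes I: "has_bochner_integral_in M V p f I" and L: "bounded_functional L"
  shows "has_bochner_integral (completion M) (\<lambda>x. L (f x)) (L I)"
proof -
  obtain C where C: "C \<ge> 0" "\<And>x. x \<in> V \<Longrightarrow> \<bar>L x\<bar> \<le> C * p x"
      "\<And>x y. x \<in> V \<Longrightarrow> y \<in> V \<Longrightarrow> \<bar>L x - L y\<bar> \<le> C * p (x - y)"
    using bounded_functional_lipschitz[OF L] by blast
  obtain s :: "nat \<Rightarrow> _ \<Rightarrow> 'a"
    where s: "\<And>i. Bochner_Integration.simple_bochner_integrable M (s i)" "\<And>i. s i ` space M \<subseteq> V"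
      and s1: "(\<lambda>i. \<integral>\<^sup>+x. ennreal (p (f x - s i x)) \<partial>M) \<longlonglongrightarrow> 0"
      and s2: "(\<lambda>i. p (Bochner_Integration.simple_bochner_integral M (s i) - I)) \<longlonglongrightarrow> 0"
      and IV: "I \<in> V" and sm: "strongly_measurable M V p f"
    using I unfolding has_bochner_integral_in_def by auto
  have fV: "AE x in M. f x \<in> V" using sm unfolding strongly_measurable_def by auto
  have sf: "simple_function M (s i)" for i
    using s(1)[of i] by (simp add: simple_bochner_integrable.simps)
  have L0: "L 0 = 0" using functional_sum[OF L, of "{}"] by simp
  have Ls: "Bochner_Integration.simple_bochner_integrable M (\<lambda>x. L (s i x))" for i
    using simple_bochner_integrable_compose2[of "\<lambda>x y. L x" M "s i" "s i"] s(1) L0 by simp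
  have *: "simple_function M (\<lambda>x. L (s i x))" for i
    using sf by (rule simple_function_compose1)
  have sets: "{x \<in> space M. L (s i x) = y} \<in> sets M" for i y
    using borel_measurable_simple_function[OF *] by measurable
  show ?thesis
  proof (rule has_bochner_integral.intros)
    show "(\<lambda>x. L (f x)) \<in> borel_measurable (completion M)"
      by (rule measurable_lipschitz[OF sm C(3)])
    show "Bochner_Integration.simple_bochner_integrable (completion M) (\<lambda>x. L (s i x))" for i
      using Ls[of i] sets[of i] by (auto simp: simple_bochner_integrable.simps simple_function_completion)
    have le: "(\<integral>\<^sup>+x. norm (L (f x) - L (s i x)) \<partial>completion M)
        \<le> ennreal C * (\<integral>\<^sup>+x. ennreal (p (f x - s i x)) \<partial>M)" for i
    proof -
      have "(\<integral>\<^sup>+x. norm (L (f x) - L (s i x)) \<partial>completion M)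
          \<le> (\<integral>\<^sup>+x. ennreal C * ennreal (p (f x - s i x)) \<partial>completion M)"
        using AE_completion[OF fV] AE_space[of "completion M"]
      proof (intro nn_integral_mono_AE, eventually_elim)
        case (elim x)
        then have "s i x \<in> V" using s(2)[of i] by auto
        then show ?case using C(1) C(3)[of "f x" "s i x"] elim
          by (simp add: nrm_nonneg mem flip: ennreal_mult)
      qed
      also have "\<dots> = ennreal C * (\<integral>\<^sup>+x. ennreal (p (f x - s i x)) \<partial>completion M)"
      proof (rule nn_integral_cmult)
        have "(\<lambda>x. p (f x - s i x)) \<in> borel_measurable (completion M)"
          using sf s(2) by (intro measurable_nrm strongly_measurable_diff sm strongly_measurable_simple)
        then show "(\<lambda>x. ennreal (p (f x - s i x))) \<in> borel_measurable (completion M)" by measurable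
      qed
      finally show ?thesis by (simp add: nn_integral_completion)
    qed
    have "(\<lambda>i. ennreal C * (\<integral>\<^sup>+x. ennreal (p (f x - s i x)) \<partial>M)) \<longlonglongrightarrow> ennreal C * 0"
      using s1 by (intro ennreal_tendsto_cmult) auto
    then have h: "(\<lambda>i. ennreal C * (\<integral>\<^sup>+x. ennreal (p (f x - s i x)) \<partial>M)) \<longlonglongrightarrow> 0" by simp
    show "(\<lambda>i. \<integral>\<^sup>+x. norm (L (f x) - L (s i x)) \<partial>completion M) \<longlonglongrightarrow> 0"
      by (rule tendsto_sandwich[OF _ _ tendsto_const h]) (use le in auto)
    have eq: "Bochner_Integration.simple_bochner_integral (completion M) (\<lambda>x. L (s i x)) =
        L (Bochner_Integration.simple_bochner_integral M (s i))" for i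
      using simple_bochner_integral_functional[OF L s(1,2), of i] sets[of i]
      by (simp add: Bochner_Integration.simple_bochner_integral_def)
    have "(\<lambda>i. L (Bochner_Integration.simple_bochner_integral M (s i)) - L I) \<longlonglongrightarrow> 0"
    proof (rule Lim_null_comparison)
      show "\<forall>\<^sub>F i in sequentially. norm (L (Bochner_Integration.simple_bochner_integral M (s i)) - L I)
          \<le> C * p (Bochner_Integration.simple_bochner_integral M (s i) - I)"
        using C(3) simple_bochner_integral_mem[OF sf s(2)] IV by auto
      show "(\<lambda>i. C * p (Bochner_Integration.simple_bochner_integral M (s i) - I)) \<longlonglongrightarrow> 0"
        using tendsto_mult_left[OF s2, of C] by simp
    qed
    then show "(\<lambda>i. Bochner_Integration.simple_bochner_integral (completion M) (\<lambda>x. L (s i x))) \<longlonglongrightarrow> L I"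
      unfolding eq by (simp add: LIM_zero_iff)
  qed
qed

lemma functional_bochner:
  assumes "has_bochner_integral_in M V p f I" "bounded_functional L"
  shows "integrable (completion M) (\<lambda>x. L (f x))" "L I = (LINT x|completion M. L (f x))"
  using has_bochner_integral_functional[OF assms]
  by (auto simp: has_bochner_integral_iff)

lemma bochner_mem: "has_bochner_integral_in M V p f I \<Longrightarrow> I \<in> V"
  by (simp add: has_bochner_integral_in_def)

lemma complete_spaceD:
  assumes complete_space "\<And>n. x n \<in> V" "\<And>e. e > 0 \<Longrightarrow> \<exists>N. \<forall>m\<ge>N. \<forall>n\<ge>N. p (x m - x n) < e"
  shows "\<exists>y\<in>V. (\<lambda>n. p (x n - y)) \<longlonglongrightarrow> 0"
proof -
  have "range x \<subseteq> V \<and> (\<forall>e>0. \<exists>N. \<forall>m\<ge>N. \<forall>n\<ge>N. p (x m - x n) < e)"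
    using assms(2,3) by auto
  then show ?thesis using assms(1) unfolding complete_space_def by blast
qed

text \<open>
  Dominated convergence makes the integrals of the simple approximations a Cauchy sequence.
\<close>

lemma bochner_integral_exists:
  fixes f :: "'s \<Rightarrow> 'a"
  assumes complete: complete_space and "finite_measure M"
    and f: "strongly_measurable M V p f" and fin: "(\<integral>\<^sup>+x. ennreal (p (f x)) \<partial>M) < \<infinity>"
  shows "bochner_integrable_in M V p f"
proof -
  interpret finite_measure M by fact
  have fV: "AE x in M. f x \<in> V" using f unfolding strongly_measurable_def by auto
  obtain c :: "nat \<Rightarrow> 'a" where c: "range c \<subseteq> V" "c 0 = 0"
    "AE x in M. \<forall>e>0. \<exists>k. p (f x - c k) < e"
    using strongly_measurable_dense_sequence[OF f] .
  have "(\<lambda>x. p (f x - c k)) \<in> borel_measurable (completion M)" for k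
    using c by (intro measurable_nrm_diff f) auto
  note meas_c = this
  obtain s :: "nat \<Rightarrow> 's \<Rightarrow> 'a" where sf: "\<And>i. simple_function M (s i)" and sV: "\<And>i. s i ` space M \<subseteq> V"
    and dom: "AE x in M. \<forall>i. p (f x - s i x) \<le> p (f x)"
    and lim: "AE x in M. (\<lambda>i. p (f x - s i x)) \<longlonglongrightarrow> 0"
    and meas: "\<And>i. (\<lambda>x. p (f x - s i x)) \<in> borel_measurable (completion M)"
    by (rule simple_approximation[OF fV c(1,2) meas_c c(3)]) (rule that; assumption)
  have sb: "Bochner_Integration.simple_bochner_integrable M (s i)" for i
    using sf by (simp add: simple_bochner_integrable.simps)
  have "(\<lambda>i. \<integral>\<^sup>+x. ennreal (p (f x - s i x)) \<partial>completion M) \<longlonglongrightarrow> (\<integral>\<^sup>+x. 0 \<partial>completion M)"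
  proof (rule nn_integral_dominated_convergence[where w = "\<lambda>x. ennreal (p (f x))"])
    show "(\<lambda>x. ennreal (p (f x - s i x))) \<in> borel_measurable (completion M)" for i
      using meas[of i] by measurable
    show "(\<lambda>x. ennreal (p (f x))) \<in> borel_measurable (completion M)"
      using measurable_nrm[OF f] by measurable
    show "AE x in completion M. ennreal (p (f x - s i x)) \<le> ennreal (p (f x))" for i
      using AE_completion[OF dom] by eventually_elim (auto intro: ennreal_leI)
    show "AE x in completion M. (\<lambda>i. ennreal (p (f x - s i x))) \<longlonglongrightarrow> 0"
      using AE_completion[OF lim] by eventually_elim (auto dest: tendsto_ennrealI)
  qed (use fin in \<open>auto simp: nn_integral_completion\<close>)
  then have lim1: "(\<lambda>i. \<integral>\<^sup>+x. ennreal (p (f x - s i x)) \<partial>M) \<longlonglongrightarrow> 0"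
    by (simp add: nn_integral_completion)
  define J where "J = (\<lambda>i. Bochner_Integration.simple_bochner_integral M (s i))"
  have JV: "J i \<in> V" for i unfolding J_def by (rule simple_bochner_integral_mem[OF sf sV])
  have Jdiff: "ennreal (p (J i - J j)) \<le>
      (\<integral>\<^sup>+x. ennreal (p (f x - s i x)) \<partial>M) + (\<integral>\<^sup>+x. ennreal (p (f x - s j x)) \<partial>M)" for i j
  proof -
    have "J i - J j = Bochner_Integration.simple_bochner_integral M (\<lambda>x. s i x - s j x)"
      unfolding J_def using sb by (simp add: simple_bochner_integral_diff)
    also have "ennreal (p \<dots>) \<le> (\<integral>\<^sup>+x. ennreal (p (s i x - s j x)) \<partial>M)"
    proof (rule simple_bochner_integral_nrm_le)
      show "Bochner_Integration.simple_bochner_integrable M (\<lambda>x. s i x - s j x)"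
        using simple_bochner_integrable_compose2[of "\<lambda>x y. x - y" M "s i" "s j"] sb by simp
      show "(\<lambda>x. s i x - s j x) ` space M \<subseteq> V"
        using sV by (auto intro!: mem simp: image_subset_iff)
    qed
    also have "\<dots> = (\<integral>\<^sup>+x. ennreal (p (s i x - s j x)) \<partial>completion M)"
      by (simp add: nn_integral_completion)
    also have "\<dots> \<le> (\<integral>\<^sup>+x. ennreal (p (f x - s i x)) + ennreal (p (f x - s j x)) \<partial>completion M)"
      using AE_completion[OF fV] AE_space[of "completion M"]
    proof (intro nn_integral_mono_AE, eventually_elim)
      case (elim x)
      then have "s i x \<in> V" "s j x \<in> V" using sV[of i] sV[of j] by auto
      then show ?case
        using nrm_dist_triangle[of "s i x" "f x" "s j x"] nrm_minus_commute[of "s i x" "f x"] elim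
        by (simp add: nrm_nonneg mem flip: ennreal_plus)
    qed
    also have "\<dots> = (\<integral>\<^sup>+x. ennreal (p (f x - s i x)) \<partial>M) + (\<integral>\<^sup>+x. ennreal (p (f x - s j x)) \<partial>M)"
    proof -
      have [measurable]: "(\<lambda>x. p (f x - s i x)) \<in> borel_measurable (completion M)" for i by (rule meas)
      show ?thesis by (subst nn_integral_add) (auto simp: nn_integral_completion)
    qed
    finally show ?thesis .
  qed
  have "\<exists>N. \<forall>m\<ge>N. \<forall>n\<ge>N. p (J m - J n) < e" if "e > 0" for e
  proof -
    have "eventually (\<lambda>i. (\<integral>\<^sup>+x. ennreal (p (f x - s i x)) \<partial>M) < ennreal (e / 2)) sequentially"
      using lim1 that by (intro order_tendstoD(2)) auto
    then obtain N where N: "\<And>i. i \<ge> N \<Longrightarrow> (\<integral>\<^sup>+x. ennreal (p (f x - s i x)) \<partial>M) < ennreal (e / 2)"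
      by (auto simp: eventually_sequentially)
    have "p (J m - J n) < e" if "m \<ge> N" "n \<ge> N" for m n
    proof -
      have "ennreal (p (J m - J n)) < ennreal (e / 2) + ennreal (e / 2)"
        using Jdiff[of m n] add_strict_mono[OF N[OF that(1)] N[OF that(2)]] by (rule order.strict_trans1)
      then show ?thesis
        using \<open>e > 0\<close> by (simp add: nrm_nonneg JV mem ennreal_less_iff flip: ennreal_plus)
    qed
    then show ?thesis by blast
  qed
  then obtain I where "I \<in> V" "(\<lambda>n. p (J n - I)) \<longlonglongrightarrow> 0"
    using complete_spaceD[of J, OF complete JV] by blast
  then have "has_bochner_integral_in M V p f I"
    unfolding has_bochner_integral_in_def using f sb sV lim1 J_def by blast
  then show ?thesis unfolding bochner_integrable_in_def by blast
qed

lemma has_bochner_integral_bochner_integral: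
  "bochner_integrable_in M V p f \<Longrightarrow> has_bochner_integral_in M V p f (bochner_integral_in M V p f)"
  unfolding bochner_integral_in_def by (auto simp: bochner_integrable_in_def intro: someI)


end

context semi_inner
begin

text \<open>
  Along a subsequence with geometrically decreasing distances the weighted sum of the squared
  increments is integrable, hence finite almost everywhere, and the subsequence converges there.
  Fatou's lemma bounds the distance of the whole sequence to the pointwise limit.
\<close>

lemma Riesz_Fischer:
  fixes z :: "nat \<Rightarrow> 's \<Rightarrow> 'a"
  assumes complete: complete_space and zV: "\<And>n x. x \<in> space M \<Longrightarrow> z n x \<in> V"
    and meas: "\<And>m n. (\<lambda>x. p (z m x - z n x)) \<in> borel_measurable (completion M)"
    and Cauchy: "\<And>e. e > 0 \<Longrightarrow>
      \<exists>N. \<forall>m\<ge>N. \<forall>n\<ge>N. (\<integral>\<^sup>+x. ennreal ((p (z m x - z n x))\<^sup>2) \<partial>M) < ennreal e"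
  obtains y r where "\<And>x. x \<in> space M \<Longrightarrow> y x \<in> V" "strict_mono (r :: nat \<Rightarrow> nat)"
    "AE x in M. (\<lambda>k. p (z (r k) x - y x)) \<longlonglongrightarrow> 0"
    "(\<lambda>n. \<integral>\<^sup>+x. ennreal ((p (z n x - y x))\<^sup>2) \<partial>M) \<longlonglongrightarrow> 0"
proof -
  note meas[measurable]
  have "\<forall>k. \<exists>N. \<forall>m\<ge>N. \<forall>n\<ge>N. (\<integral>\<^sup>+x. ennreal ((p (z m x - z n x))\<^sup>2) \<partial>M) < ennreal ((1/4) ^ k)"
    by (intro allI Cauchy) simp
  then obtain N where N: "\<And>k m n. m \<ge> N k \<Longrightarrow> n \<ge> N k \<Longrightarrow>
      (\<integral>\<^sup>+x. ennreal ((p (z m x - z n x))\<^sup>2) \<partial>M) < ennreal ((1/4) ^ k)"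
    unfolding choice_iff by blast
  (* the sum dominates N k, the summand k makes r strictly increasing *)
  define r where "r = (\<lambda>k. (\<Sum>j\<le>k. N j) + k)"
  have r: "strict_mono r" unfolding r_def strict_mono_Suc_iff by simp
  have rN: "N k \<le> r k" for k
    using member_le_sum[of k "{..k}" N] by (simp add: r_def)
  define d where "d = (\<lambda>k x. p (z (r (Suc k)) x - z (r k) x))"
  have [measurable]: "d k \<in> borel_measurable (completion M)" for k unfolding d_def by measurable
  have "(\<integral>\<^sup>+x. (\<Sum>k. ennreal (2 ^ k * (d k x)\<^sup>2)) \<partial>completion M) = (\<Sum>k. \<integral>\<^sup>+x. ennreal (2 ^ k * (d k x)\<^sup>2) \<partial>completion M)"
    by (rule nn_integral_suminf) measurable
  also have "\<dots> \<le> (\<Sum>k. ennreal ((1/2) ^ k))"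
  proof (rule suminf_le)
    fix k
    have "(\<integral>\<^sup>+x. ennreal (2 ^ k * (d k x)\<^sup>2) \<partial>completion M) = ennreal (2 ^ k) * (\<integral>\<^sup>+x. ennreal ((d k x)\<^sup>2) \<partial>completion M)"
      by (subst nn_integral_cmult[symmetric]) (auto simp: ennreal_mult)
    also have "\<dots> \<le> ennreal (2 ^ k) * ennreal ((1/4) ^ k)"
    proof (rule mult_left_mono)
      have "N k \<le> r (Suc k)" using rN[of k] strict_monoD[OF r, of k "Suc k"] by simp
      from N[OF this rN[of k]] show "(\<integral>\<^sup>+x. ennreal ((d k x)\<^sup>2) \<partial>completion M) \<le> ennreal ((1/4) ^ k)"
        by (simp add: nn_integral_completion d_def less_imp_le)
    qed simp
    also have "\<dots> = ennreal ((1/2) ^ k)"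
      by (simp flip: ennreal_mult power_mult_distrib)
    finally show "(\<integral>\<^sup>+x. ennreal (2 ^ k * (d k x)\<^sup>2) \<partial>completion M) \<le> ennreal ((1/2) ^ k)" .
  qed auto
  also have "\<dots> < \<infinity>"
  proof -
    have "(\<Sum>k. ennreal ((1/2) ^ k)) = ennreal (\<Sum>k. (1/2) ^ k)"
      by (rule suminf_ennreal2) (auto simp: summable_geometric)
    then show ?thesis by (metis ennreal_less_top infinity_ennreal_def)
  qed
  finally have "AE x in completion M. (\<Sum>k. ennreal (2 ^ k * (d k x)\<^sup>2)) \<noteq> \<infinity>"
    by (intro nn_integral_PInf_AE) auto
  then have fin: "AE x in M. (\<Sum>k. ennreal (2 ^ k * (d k x)\<^sup>2)) \<noteq> top"
    by (simp add: AE_completion_iff)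
  have ex: "\<exists>y\<in>V. (\<lambda>k. p (z (r k) x - y)) \<longlonglongrightarrow> 0"
    if x: "x \<in> space M" and fx: "(\<Sum>k. ennreal (2 ^ k * (d k x)\<^sup>2)) \<noteq> top" for x
  proof -
    have "summable (\<lambda>k. 2 ^ k * (d k x)\<^sup>2)"
      using fx by (intro summable_suminf_not_top) auto
    then have "summable (\<lambda>k. (1/2) ^ k + 2 ^ k * (d k x)\<^sup>2)"
      by (intro summable_add) (auto simp: summable_geometric)
    (* the weights turn summability of squares into summability of the increments *)
    moreover have "norm (d k x) \<le> (1/2) ^ k + 2 ^ k * (d k x)\<^sup>2" for k
    proof -
      define c where "c = (2::real) ^ k"
      have c: "c > 0" "(1/2) ^ k = 1 / c" by (simp_all add: c_def power_one_over)
      have "0 \<le> (1 - c * \<bar>d k x\<bar>)\<^sup>2" by simp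
      then have "2 * (c * \<bar>d k x\<bar>) \<le> 1 + (c * \<bar>d k x\<bar>)\<^sup>2"
        by (simp add: power2_diff)
      moreover have "0 \<le> c * \<bar>d k x\<bar>" using c by simp
      ultimately have "c * \<bar>d k x\<bar> \<le> 1 + (c * \<bar>d k x\<bar>)\<^sup>2" by linarith
      then have "\<bar>d k x\<bar> \<le> (1 + (c * \<bar>d k x\<bar>)\<^sup>2) / c"
        using c by (simp add: pos_le_divide_eq mult.commute)
      also have "\<dots> = 1 / c + c * (d k x)\<^sup>2"
        using c by (simp add: field_simps power2_eq_square)
      finally show ?thesis using c by (simp add: c_def)
    qed
    ultimately have summ: "summable (\<lambda>k. d k x)"
      by (rule summable_comparison_test'[where N = 0])
    have tele: "p (z (r n) x - z (r m) x) \<le> sum (\<lambda>k. d k x) {m..<n}" if "m \<le> n" for m n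
      using that
    proof (induction n)
      case 0 then show ?case by (simp add: nrm_zero)
    next
      case (Suc n)
      show ?case
      proof (cases "m = Suc n")
        case True then show ?thesis by (simp add: nrm_zero)
      next
        case False
        then have "p (z (r n) x - z (r m) x) \<le> sum (\<lambda>k. d k x) {m..<n}" using Suc by simp
        then show ?thesis
          using nrm_dist_triangle[of "z (r (Suc n)) x" "z (r n) x" "z (r m) x"] zV[OF x] False Suc
          by (simp add: d_def)
      qed
    qed
    have "\<exists>N. \<forall>m\<ge>N. \<forall>n\<ge>N. p (z (r m) x - z (r n) x) < e" if e: "e > 0" for e
    proof -
      obtain N where N: "\<And>m n. m \<ge> N \<Longrightarrow> norm (sum (\<lambda>k. d k x) {m..<n}) < e"
        using summ e unfolding summable_Cauchy by metis
      have *: "p (z (r m) x - z (r n) x) < e" if "n \<le> m" "n \<ge> N" for m n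
        using tele[OF that(1)] N[OF that(2), of m] by simp
      have "p (z (r m) x - z (r n) x) < e" if "m \<ge> N" "n \<ge> N" for m n
        using *[of n m] *[of m n] that nrm_minus_commute[of "z (r m) x" "z (r n) x"] zV[OF x]
        by (cases "n \<le> m") auto
      then show ?thesis by blast
    qed
    then show ?thesis
      using complete_spaceD[of "\<lambda>k. z (r k) x", OF complete zV[OF x]] by blast
  qed
  (* the value 0 keeps y in V on the null set where there is no limit *)
  define y where "y = (\<lambda>x. if \<exists>y\<in>V. (\<lambda>k. p (z (r k) x - y)) \<longlonglongrightarrow> 0
      then SOME y. y \<in> V \<and> (\<lambda>k. p (z (r k) x - y)) \<longlonglongrightarrow> 0 else 0)"
  have y: "y x \<in> V \<and> (\<lambda>k. p (z (r k) x - y x)) \<longlonglongrightarrow> 0"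
    if "\<exists>y\<in>V. (\<lambda>k. p (z (r k) x - y)) \<longlonglongrightarrow> 0" for x
    using that someI_ex[of "\<lambda>y. y \<in> V \<and> (\<lambda>k. p (z (r k) x - y)) \<longlonglongrightarrow> 0"] unfolding y_def by auto
  have yV: "y x \<in> V" for x using y[of x] by (auto simp: y_def mem)
  have lim: "AE x in M. (\<lambda>k. p (z (r k) x - y x)) \<longlonglongrightarrow> 0"
    using fin AE_space[of M] by eventually_elim (use ex y in auto)
  have small: "(\<integral>\<^sup>+x. ennreal ((p (z n x - y x))\<^sup>2) \<partial>M) \<le> ennreal ((1/4) ^ j)" if n: "n \<ge> N j" for n j
  proof -
    have "(\<integral>\<^sup>+x. ennreal ((p (z n x - y x))\<^sup>2) \<partial>M) = (\<integral>\<^sup>+x. ennreal ((p (z n x - y x))\<^sup>2) \<partial>completion M)"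
      by (simp add: nn_integral_completion)
    also have "\<dots> = (\<integral>\<^sup>+x. liminf (\<lambda>k. ennreal ((p (z n x - z (r k) x))\<^sup>2)) \<partial>completion M)"
    proof (rule nn_integral_cong_AE)
      show "AE x in completion M. ennreal ((p (z n x - y x))\<^sup>2) = liminf (\<lambda>k. ennreal ((p (z n x - z (r k) x))\<^sup>2))"
        using AE_completion[OF lim] AE_space[of "completion M"]
      proof eventually_elim
        case (elim x)
        then have x: "x \<in> space M" by simp
        have "(\<lambda>k. p (z n x - z (r k) x) - p (z n x - y x)) \<longlonglongrightarrow> 0"
        proof (rule Lim_null_comparison[OF always_eventually elim(1)], intro allI)
          fix k
          show "norm (p (z n x - z (r k) x) - p (z n x - y x)) \<le> p (z (r k) x - y x)"
            using nrm_abs_diff[of "z n x - z (r k) x" "z n x - y x"] zV[OF x] yV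
              nrm_minus_commute[of "z (r k) x" "y x"] by (simp add: mem)
        qed
        then have "(\<lambda>k. p (z n x - z (r k) x)) \<longlonglongrightarrow> p (z n x - y x)" by (simp add: LIM_zero_iff)
        then have "(\<lambda>k. ennreal ((p (z n x - z (r k) x))\<^sup>2)) \<longlonglongrightarrow> ennreal ((p (z n x - y x))\<^sup>2)"
          by (intro tendsto_ennrealI tendsto_power)
        then show ?case by (rule lim_imp_Liminf[OF sequentially_bot, symmetric])
      qed
    qed
    also have "\<dots> \<le> liminf (\<lambda>k. \<integral>\<^sup>+x. ennreal ((p (z n x - z (r k) x))\<^sup>2) \<partial>completion M)"
      by (rule nn_integral_liminf) measurable
    also have "\<dots> \<le> limsup (\<lambda>k. \<integral>\<^sup>+x. ennreal ((p (z n x - z (r k) x))\<^sup>2) \<partial>completion M)"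
      by (rule Liminf_le_Limsup) simp
    also have "\<dots> \<le> ennreal ((1/4) ^ j)"
    proof (rule Limsup_bounded)
      have "(\<integral>\<^sup>+x. ennreal ((p (z n x - z (r k) x))\<^sup>2) \<partial>completion M) \<le> ennreal ((1/4) ^ j)" if "k \<ge> j" for k
      proof -
        have "N j \<le> r k" using rN[of j] strict_mono_leD[OF r that] by simp
        from N[OF n this] show ?thesis by (simp add: nn_integral_completion less_imp_le)
      qed
      then show "\<forall>\<^sub>F k in sequentially. (\<integral>\<^sup>+x. ennreal ((p (z n x - z (r k) x))\<^sup>2) \<partial>completion M) \<le> ennreal ((1/4) ^ j)"
        by (auto simp: eventually_sequentially)
    qed
    finally show ?thesis .
  qed
  have "(\<lambda>n. \<integral>\<^sup>+x. ennreal ((p (z n x - y x))\<^sup>2) \<partial>M) \<longlonglongrightarrow> 0"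
  proof (rule order_tendstoI)
    fix a :: ennreal assume "0 < a"
    have "(\<lambda>j. ennreal ((1/4) ^ j)) \<longlonglongrightarrow> ennreal 0"
      by (intro tendsto_ennrealI LIMSEQ_realpow_zero) auto
    then have "eventually (\<lambda>j. ennreal ((1/4) ^ j) < a) sequentially"
      using \<open>0 < a\<close> by (intro order_tendstoD(2)) auto
    then obtain j where "ennreal ((1/4) ^ j) < a" by (auto simp: eventually_sequentially)
    then show "\<forall>\<^sub>F n in sequentially. (\<integral>\<^sup>+x. ennreal ((p (z n x - y x))\<^sup>2) \<partial>M) < a"
      using small[of j] by (auto simp: eventually_sequentially intro: order.strict_trans1)
  qed simp
  with that yV r lim show thesis by blast
qed

end

section \<open>Integrals over a time interval\<close>

text \<open>
  After translation of the first summand the common part of the two ranges of integration cancels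
  and only two strips of width \<open>r\<close> remain.
\<close>

lemma integral_shift_difference:
  fixes g :: "real \<Rightarrow> real"
  assumes g: "continuous_on {0..c} g" and "0 \<le> t" "0 \<le> r" "t + r \<le> c"
  shows "integral {0..t} (\<lambda>s. g (s + r) - g s) = integral {t..t+r} g - integral {0..r} g"
proof -
  have int: "g integrable_on {a..b}" if "0 \<le> a" "b \<le> c" for a b
    using that by (intro integrable_continuous_real continuous_on_subset[OF g]) auto
  have "((\<lambda>s. g (s + r)) has_integral integral {r..t+r} g) {0..t}"
    using has_integral_shift_real_ivl[OF integrable_integral[OF int[of r "t + r"]], of r] assms by simp
  then have "integral {0..t} (\<lambda>s. g (s + r) - g s) = integral {r..t+r} g - integral {0..t} g"
    using assms int[of 0 t] by (subst Henstock_Kurzweil_Integration.integral_diff) (auto dest: integral_unique has_integral_integrable)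
  moreover have "integral {0..r} g + integral {r..t+r} g = integral {0..t+r} g"
    "integral {0..t} g + integral {t..t+r} g = integral {0..t+r} g"
    using assms by (auto intro!: Henstock_Kurzweil_Integration.integral_combine int)
  ultimately show ?thesis by simp
qed

lemma integral_le_const:
  fixes g :: "real \<Rightarrow> real"
  assumes "g integrable_on {a..b}" "a \<le> b" "\<And>s. s \<in> {a..b} \<Longrightarrow> g s \<le> c"
  shows "integral {a..b} g \<le> (b - a) * c"
  using integral_le[OF assms(1) integrable_const_ivl[of c a b] assms(3)] assms(2) by simp

lemma integral_near_const:
  fixes g :: "real \<Rightarrow> real"
  assumes g: "g integrable_on {a..b}" and "a \<le> b" and near: "\<And>s. s \<in> {a..b} \<Longrightarrow> \<bar>g s - c\<bar> \<le> e"
  shows "\<bar>integral {a..b} g - (b - a) * c\<bar> \<le> (b - a) * e"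
proof -
  have "norm (integral {a..b} (\<lambda>s. g s - c)) \<le> integral {a..b} (\<lambda>s. e)"
    using g near
    by (intro Henstock_Kurzweil_Integration.integral_norm_bound_integral integrable_diff integrable_const_ivl) auto
  moreover have "integral {a..b} (\<lambda>s. g s - c) = integral {a..b} g - (b - a) * c"
    using g \<open>a \<le> b\<close> by (subst Henstock_Kurzweil_Integration.integral_diff) auto
  ultimately show ?thesis using \<open>a \<le> b\<close> by simp
qed

lemma integral_antideriv_diff:
  fixes g :: "real \<Rightarrow> real"
  assumes "g integrable_on {0..c}" "0 \<le> a" "a \<le> b" "b \<le> c"
  shows "integral {0..b} g - integral {0..a} g = integral {a..b} g"
  using Henstock_Kurzweil_Integration.integral_combine[of 0 a b g] integrable_subinterval_real[OF assms(1), of 0 b] assms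
  by simp

lemma completion_lebesgue_on: "S \<in> sets lebesgue \<Longrightarrow> completion (lebesgue_on S) = lebesgue_on S"
  by (intro complete_measure.completion_eq complete_measure_lebesgue_on)

lemma completion_lebesgue_interval: "completion (lebesgue_on {a..b::real}) = lebesgue_on {a..b}"
  by (rule completion_lebesgue_on) simp

lemma eventually_at_within_mem: "(\<And>s. s \<in> I \<Longrightarrow> P s) \<Longrightarrow> eventually P (at t within I)"
  unfolding eventually_at_filter by (rule always_eventually) auto

lemma finite_measure_lebesgue_on_interval: "finite_measure (lebesgue_on {a..b::real})"
  by (rule finite_measure_lebesgue_on) simp

lemma simple_function_lebesgue_on_subset:
  assumes f: "simple_function (lebesgue_on S) f" and "A \<subseteq> S" "A \<in> sets lebesgue" "S \<in> sets lebesgue"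
  shows "simple_function (lebesgue_on A) f"
  unfolding simple_function_def
proof (intro conjI ballI)
  show "finite (f ` space (lebesgue_on A))"
    using f \<open>A \<subseteq> S\<close> unfolding simple_function_def by (auto intro: finite_subset[of _ "f ` S"])
  fix y assume "y \<in> f ` space (lebesgue_on A)"
  then have "f -` {y} \<inter> S \<in> sets (lebesgue_on S)"
    using f \<open>A \<subseteq> S\<close> unfolding simple_function_def by auto
  then have "f -` {y} \<inter> S \<inter> A \<in> sets lebesgue"
    using assms by (auto simp: sets_restrict_space_iff)
  moreover have "f -` {y} \<inter> S \<inter> A = f -` {y} \<inter> A" using \<open>A \<subseteq> S\<close> by auto
  ultimately show "f -` {y} \<inter> space (lebesgue_on A) \<in> sets (lebesgue_on A)"
    using assms by (auto simp: sets_restrict_space_iff)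
qed

lemma AE_lebesgue_on_subset:
  assumes "AE x in lebesgue_on S. P x" "A \<subseteq> S" "A \<in> sets lebesgue" "S \<in> sets lebesgue"
  shows "AE x in lebesgue_on A. P x"
  using assms by (simp add: AE_restrict_space_iff) (auto elim!: eventually_mono)

lemma strongly_measurable_subset:
  assumes f: "strongly_measurable (lebesgue_on S) V p f" and "A \<subseteq> S" "A \<in> sets lebesgue" "S \<in> sets lebesgue"
  shows "strongly_measurable (lebesgue_on A) V p f"
proof -
  obtain s :: "nat \<Rightarrow> _ \<Rightarrow> _" where s: "\<And>i. simple_function (lebesgue_on S) (s i)"
    "\<And>i. s i ` space (lebesgue_on S) \<subseteq> V"
    "AE x in lebesgue_on S. (\<lambda>i. p (f x - s i x)) \<longlonglongrightarrow> 0" and fV: "AE x in lebesgue_on S. f x \<in> V"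
    using f unfolding strongly_measurable_def by auto
  show ?thesis unfolding strongly_measurable_def
  proof (intro conjI exI[of _ s] allI)
    show "simple_function (lebesgue_on A) (s i)" for i
      using s(1) assms(2-) by (rule simple_function_lebesgue_on_subset)
    show "s i ` space (lebesgue_on A) \<subseteq> V" for i using s(2)[of i] assms by auto
    show "AE x in lebesgue_on A. f x \<in> V" using fV assms(2-) by (rule AE_lebesgue_on_subset)
    show "AE x in lebesgue_on A. (\<lambda>i. p (f x - s i x)) \<longlonglongrightarrow> 0"
      using s(3) assms(2-) by (rule AE_lebesgue_on_subset)
  qed
qed

lemma nn_integral_lebesgue_on_continuous:
  fixes g :: "real \<Rightarrow> real"
  assumes "continuous_on {a..b} g" "\<And>s. s \<in> {a..b} \<Longrightarrow> 0 \<le> g s"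
  shows "(\<integral>\<^sup>+s. ennreal (g s) \<partial>lebesgue_on {a..b}) = ennreal (integral {a..b} g)"
proof -
  have int: "integrable (lebesgue_on {a..b}) g"
    using assms(1) by (metis continuous_imp_integrable_real)
  have "(\<integral>\<^sup>+s. ennreal (g s) \<partial>lebesgue_on {a..b}) = ennreal (integral\<^sup>L (lebesgue_on {a..b}) g)"
    using assms(2) by (intro nn_integral_eq_integral int AE_I2) auto
  also have "integral\<^sup>L (lebesgue_on {a..b}) g = integral {a..b} g"
    using int by (rule lebesgue_integral_eq_integral) simp
  finally show ?thesis .
qed

section \<open>Paths in a space with a semi-inner product\<close>

context semi_inner
begin

lemma functional_bochner_interval:
  fixes f :: "real \<Rightarrow> 'a"
  assumes "has_bochner_integral_in (lebesgue_on {a..b}) V p f I" "bounded_functional L"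
  shows "(\<lambda>s. L (f s)) integrable_on {a..b}" "L I = integral {a..b} (\<lambda>s. L (f s))"
proof -
  have "integrable (lebesgue_on {a..b}) (\<lambda>s. L (f s))" "L I = integral\<^sup>L (lebesgue_on {a..b}) (\<lambda>s. L (f s))"
    using functional_bochner[OF assms] by (simp_all add: completion_lebesgue_interval)
  then show "(\<lambda>s. L (f s)) integrable_on {a..b}" "L I = integral {a..b} (\<lambda>s. L (f s))"
    by (auto intro: integrable_on_lebesgue_on simp: lebesgue_integral_eq_integral)
qed

text \<open>
  Continuity is expressed through the seminorm, as representatives carry no topology.
\<close>

definition path_on :: "real set \<Rightarrow> (real \<Rightarrow> 'a) \<Rightarrow> bool" where
  "path_on I x \<longleftrightarrow> (\<forall>t\<in>I. x t \<in> V \<and> ((\<lambda>s. p (x s - x t)) \<longlongrightarrow> 0) (at t within I))"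

lemma path_onI:
  assumes "\<And>t. t \<in> I \<Longrightarrow> x t \<in> V" "\<And>t. t \<in> I \<Longrightarrow> (g t \<longlongrightarrow> 0) (at t within I)"
    "\<And>s t. s \<in> I \<Longrightarrow> t \<in> I \<Longrightarrow> p (x s - x t) \<le> g t s"
  shows "path_on I x"
  unfolding path_on_def
proof (intro ballI conjI)
  fix t assume t: "t \<in> I"
  show "((\<lambda>s. p (x s - x t)) \<longlongrightarrow> 0) (at t within I)"
  proof (rule tendsto_sandwich[OF _ _ tendsto_const assms(2)[OF t]])
    show "\<forall>\<^sub>F s in at t within I. 0 \<le> p (x s - x t)"
      "\<forall>\<^sub>F s in at t within I. p (x s - x t) \<le> g t s"
      using assms(1,3) t by (auto intro!: eventually_at_within_mem nrm_nonneg mem)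
  qed
qed (use assms in auto)

lemma path_on_subset: "path_on I x \<Longrightarrow> J \<subseteq> I \<Longrightarrow> path_on J x"
  unfolding path_on_def by (auto intro: tendsto_within_subset)

lemma continuous_on_inner:
  assumes x: "path_on I x" and y: "path_on I y"
  shows "continuous_on I (\<lambda>t. B (x t) (y t))"
  unfolding continuous_on_def
proof
  fix t assume t: "t \<in> I"
  let ?F = "at t within I"
  have V: "s \<in> I \<Longrightarrow> x s \<in> V" "s \<in> I \<Longrightarrow> y s \<in> V" for s using x y by (auto simp: path_on_def)
  have lim: "((\<lambda>s. p (x s - x t)) \<longlongrightarrow> 0) ?F" "((\<lambda>s. p (y s - y t)) \<longlongrightarrow> 0) ?F"
    using x y t by (auto simp: path_on_def)
  have "((\<lambda>s. p (x s - x t) * p (y s - y t) + p (x s - x t) * p (y t) + p (x t) * p (y s - y t)) \<longlongrightarrow>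
      0 * 0 + 0 * p (y t) + p (x t) * 0) ?F"
    by (intro tendsto_add tendsto_mult tendsto_const lim)
  then have "((\<lambda>s. p (x s - x t) * p (y s - y t) + p (x s - x t) * p (y t) + p (x t) * p (y s - y t)) \<longlongrightarrow> 0) ?F"
    by simp
  moreover have "\<forall>\<^sub>F s in ?F. norm (B (x s) (y s) - B (x t) (y t)) \<le>
      p (x s - x t) * p (y s - y t) + p (x s - x t) * p (y t) + p (x t) * p (y s - y t)"
  proof -
    have "norm (B (x s) (y s) - B (x t) (y t)) \<le>
      p (x s - x t) * p (y s - y t) + p (x s - x t) * p (y t) + p (x t) * p (y s - y t)" if s: "s \<in> I" for s
    proof -
      have "B (x s) (y s) - B (x t) (y t) =
          B (x s - x t) (y s - y t) + B (x s - x t) (y t) + B (x t) (y s - y t)"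
        using V s t by (simp add: mem diff_left diff_right)
      then show ?thesis
        using Cauchy_Schwarz[of "x s - x t" "y s - y t"] Cauchy_Schwarz[of "x s - x t" "y t"]
          Cauchy_Schwarz[of "x t" "y s - y t"] V s t by (simp add: mem)
    qed
    then show ?thesis by (rule eventually_at_within_mem)
  qed
  ultimately have "((\<lambda>s. B (x s) (y s) - B (x t) (y t)) \<longlongrightarrow> 0) ?F"
    by (rule Lim_null_comparison[rotated])
  then show "((\<lambda>s. B (x s) (y s)) \<longlongrightarrow> B (x t) (y t)) ?F" by (simp add: LIM_zero_iff)
qed

lemma path_on_const: "c \<in> V \<Longrightarrow> path_on I (\<lambda>t. c)"
  by (simp add: path_on_def nrm_zero)

lemma path_on_scale: "path_on I x \<Longrightarrow> path_on I (\<lambda>t. c *\<^sub>R x t)"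
proof (rule path_onI[where g = "\<lambda>t s. \<bar>c\<bar> * p (x s - x t)"])
  assume x: "path_on I x"
  show "t \<in> I \<Longrightarrow> c *\<^sub>R x t \<in> V" for t using x by (auto simp: path_on_def mem)
  show "t \<in> I \<Longrightarrow> ((\<lambda>s. \<bar>c\<bar> * p (x s - x t)) \<longlongrightarrow> 0) (at t within I)" for t
    using x by (auto simp: path_on_def intro: tendsto_mult_right_zero)
  show "s \<in> I \<Longrightarrow> t \<in> I \<Longrightarrow> p (c *\<^sub>R x s - c *\<^sub>R x t) \<le> \<bar>c\<bar> * p (x s - x t)" for s t
    using x by (simp add: path_on_def nrm_scale mem flip: scaleR_diff_right)
qed

lemma path_on_diff: "path_on I x \<Longrightarrow> path_on I y \<Longrightarrow> path_on I (\<lambda>t. x t - y t)"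
proof (rule path_onI[where g = "\<lambda>t s. p (x s - x t) + p (y s - y t)"])
  assume x: "path_on I x" and y: "path_on I y"
  show "t \<in> I \<Longrightarrow> x t - y t \<in> V" for t using x y by (auto simp: path_on_def mem)
  show "((\<lambda>s. p (x s - x t) + p (y s - y t)) \<longlongrightarrow> 0) (at t within I)" if "t \<in> I" for t
    using x y that by (intro tendsto_add_zero) (auto simp: path_on_def)
  show "p (x s - y s - (x t - y t)) \<le> p (x s - x t) + p (y s - y t)" if "s \<in> I" "t \<in> I" for s t
  proof -
    have eq: "x s - y s - (x t - y t) = (x s - x t) - (y s - y t)" by simp
    show ?thesis unfolding eq using x y that by (intro nrm_diff_triangle mem) (auto simp: path_on_def)
  qed
qed

lemma path_on_shift:
  assumes x: "path_on {a..b} x" shows "path_on {a - c..b - c} (\<lambda>t. x (t + c))"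
  unfolding path_on_def
proof (intro ballI conjI)
  fix t assume t: "t \<in> {a - c..b - c}"
  then show "x (t + c) \<in> V" using x by (auto simp: path_on_def)
  have lim: "((\<lambda>s. p (x s - x (t + c))) \<longlongrightarrow> 0) (at (t + c) within {a..b})"
    using x t by (auto simp: path_on_def)
  have shift: "filterlim (\<lambda>s. s + c) (at (t + c) within {a..b}) (at t within {a - c..b - c})"
    unfolding filterlim_at
  proof
    show "\<forall>\<^sub>F s in at t within {a - c..b - c}. s + c \<in> {a..b} \<and> s + c \<noteq> t + c"
      unfolding eventually_at_filter by (rule always_eventually) auto
    show "((\<lambda>s. s + c) \<longlongrightarrow> t + c) (at t within {a - c..b - c})"
      by (intro tendsto_intros)
  qed
  show "((\<lambda>s. p (x (s + c) - x (t + c))) \<longlongrightarrow> 0) (at t within {a - c..b - c})"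
    using filterlim_compose[OF lim shift] .
qed

lemma path_on_functional:
  assumes x: "path_on I x" and L: "bounded_functional L"
  shows "continuous_on I (\<lambda>t. L (x t))"
  unfolding continuous_on_def
proof
  fix t assume t: "t \<in> I"
  obtain C where "C \<ge> 0" "\<And>x. x \<in> V \<Longrightarrow> \<bar>L x\<bar> \<le> C * p x"
    and C: "\<And>x y. x \<in> V \<Longrightarrow> y \<in> V \<Longrightarrow> \<bar>L x - L y\<bar> \<le> C * p (x - y)"
    using bounded_functional_lipschitz[OF L] by blast
  have "((\<lambda>s. C * p (x s - x t)) \<longlongrightarrow> 0) (at t within I)"
    using x t by (auto simp: path_on_def intro: tendsto_mult_right_zero)
  moreover have "\<forall>\<^sub>F s in at t within I. norm (L (x s) - L (x t)) \<le> C * p (x s - x t)"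
    using C x t by (auto simp: path_on_def intro!: eventually_at_within_mem)
  ultimately have "((\<lambda>s. L (x s) - L (x t)) \<longlongrightarrow> 0) (at t within I)"
    by (rule Lim_null_comparison[rotated])
  then show "((\<lambda>s. L (x s)) \<longlongrightarrow> L (x t)) (at t within I)" by (simp add: LIM_zero_iff)
qed

lemma path_on_nrm: "path_on I x \<Longrightarrow> continuous_on I (\<lambda>t. p (x t))"
proof -
  assume x: "path_on I x"
  have "continuous_on I (\<lambda>t. sqrt (B (x t) (x t)))"
    by (intro continuous_intros continuous_on_inner x)
  also have "?this \<longleftrightarrow> ?thesis"
    using x by (intro continuous_on_cong) (auto simp: path_on_def nrm)
  finally show ?thesis .
qed

lemma path_on_strongly_measurable:
  assumes x: "path_on {a..b} x" shows "strongly_measurable (lebesgue_on {a..b}) V p x"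
proof (cases "a \<le> b")
  case True
  define c where "c = (\<lambda>k::nat. x (max a (min b (real_of_rat (from_nat k)))))"
  show ?thesis
  proof (rule strongly_measurableI[where c = c])
    have V: "t \<in> {a..b} \<Longrightarrow> x t \<in> V" for t using x by (auto simp: path_on_def)
    show "AE t in lebesgue_on {a..b}. x t \<in> V" by (rule AE_I2) (use V in auto)
    show "range c \<subseteq> V" using V True by (auto simp: c_def max_def min_def)
    show "(\<lambda>t. p (x t - y)) \<in> borel_measurable (completion (lebesgue_on {a..b}))" if "y \<in> V" for y
      using path_on_nrm[OF path_on_diff[OF x path_on_const[OF that]]]
      by (simp add: completion_lebesgue_interval continuous_imp_measurable_on_sets_lebesgue)
    have "\<exists>k. p (x t - c k) < e" if t: "t \<in> {a..b}" and e: "e > 0" for t e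
    proof -
      have cont: "continuous_on {a..b} (\<lambda>s. p (x t - x s))"
        by (intro path_on_nrm path_on_diff path_on_const x V t)
      have "continuous_on UNIV (\<lambda>s. max a (min b s))" by (intro continuous_intros)
      then have "continuous_on UNIV (\<lambda>s. p (x t - x (max a (min b s))))"
        by (rule continuous_on_compose2[OF cont]) (use True in auto)
      then have "open ((\<lambda>s. p (x t - x (max a (min b s)))) -` {..<e})"
        by (rule open_vimage[rotated]) simp
      moreover have "t \<in> (\<lambda>s. p (x t - x (max a (min b s)))) -` {..<e}"
        using t e by (simp add: nrm_zero)
      ultimately obtain d where d: "d > 0" "ball t d \<subseteq> (\<lambda>s. p (x t - x (max a (min b s)))) -` {..<e}"
        by (metis open_contains_ball)
      obtain q where q: "t < real_of_rat q" "real_of_rat q < t + d"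
        using of_rat_dense[of t "t + d"] d(1) by auto
      then have "real_of_rat q \<in> ball t d" by (simp add: dist_real_def)
      then have "p (x t - c (to_nat q)) < e" using d(2) by (auto simp: c_def)
      then show ?thesis ..
    qed
    then show "AE t in lebesgue_on {a..b}. \<forall>e>0. \<exists>k. p (x t - c k) < e"
      by (intro AE_I2) auto
  qed
next
  case False
  then have "AE t in lebesgue_on {a..b}. P t" for P by (intro AE_I2) auto
  then show ?thesis unfolding strongly_measurable_def
    using False by (intro conjI exI[of _ "\<lambda>i x. 0"]) auto
qed

lemma path_on_bounded:
  assumes x: "path_on {a..b} x" obtains C where "C \<ge> 0" "\<And>t. t \<in> {a..b} \<Longrightarrow> p (x t) \<le> C"
proof -
  have "compact ((\<lambda>t. p (x t)) ` {a..b})"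
    by (intro compact_continuous_image path_on_nrm x) auto
  then have "bounded ((\<lambda>t. p (x t)) ` {a..b})" by (rule compact_imp_bounded)
  then obtain C where C: "\<forall>t\<in>{a..b}. \<bar>p (x t)\<bar> \<le> C" by (auto simp: bounded_iff)
  have "p (x t) \<le> \<bar>C\<bar>" if "t \<in> {a..b}" for t
    using C that by (meson abs_le_D1 abs_ge_self order_trans)
  then show ?thesis by (intro that[of "\<bar>C\<bar>"]) auto
qed

lemma path_integral_exists:
  assumes x: "path_on {a..b} x" and complete: complete_space
  shows "\<exists>I. has_bochner_integral_in (lebesgue_on {a..b}) V p x I"
proof -
  obtain C where C: "C \<ge> 0" "\<And>t. t \<in> {a..b} \<Longrightarrow> p (x t) \<le> C"
    using path_on_bounded[OF x] by metis
  interpret finite_measure "lebesgue_on {a..b}" by (rule finite_measure_lebesgue_on_interval)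
  have "(\<integral>\<^sup>+t. ennreal (p (x t)) \<partial>lebesgue_on {a..b}) \<le> (\<integral>\<^sup>+t. ennreal C \<partial>lebesgue_on {a..b})"
    using C by (intro nn_integral_mono ennreal_leI) auto
  also have "\<dots> < \<infinity>" by (simp add: ennreal_mult_less_top) (metis emeasure_finite top.not_eq_extremum)
  finally show ?thesis
    using bochner_integral_exists[OF complete finite_measure_lebesgue_on_interval path_on_strongly_measurable[OF x]]
    unfolding bochner_integrable_in_def by blast
qed

end

section \<open>Mild solutions of dissipative evolution equations\<close>

text \<open>
  An abstract equation \<open>X' = A X + F\<close> with a dissipative generator.  The forcing is required to take
  its values in \<open>W\<close> at every time; changing it on a null set of times does not affect the mild
  solution.
\<close>

locale mild_evolution = semi_inner W B p
  for W :: "'a::real_vector set" and B p +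
  fixes S :: "real \<Rightarrow> 'a \<Rightarrow> 'a" and D :: "'a set" and A :: "'a \<Rightarrow> 'a"
    and T :: real and x0 :: 'a and F X :: "real \<Rightarrow> 'a"
  assumes complete: complete_space
    and semigroup: "contraction_C0_semigroup W p S"
    and generator: "is_generator W p S D A"
    and dissipative: "\<And>x. x \<in> D \<Longrightarrow> B (A x) x \<le> 0"
    and T_pos: "0 < T"
    and F_mem: "\<And>t. F t \<in> W"
    and F_L2: "bochner_L2 (lebesgue_on {0..T}) W p F"
    and x0_mem: "x0 \<in> W"
    and mild: "mild_solution W p S T x0 F X"
begin

lemma S_mem: "0 \<le> t \<Longrightarrow> x \<in> W \<Longrightarrow> S t x \<in> W"
  and S_contr: "0 \<le> t \<Longrightarrow> x \<in> W \<Longrightarrow> p (S t x) \<le> p x"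
  and S_linear: "0 \<le> t \<Longrightarrow> x \<in> W \<Longrightarrow> y \<in> W \<Longrightarrow>
    p (S t (a *\<^sub>R x + b *\<^sub>R y) - (a *\<^sub>R S t x + b *\<^sub>R S t y)) = 0"
  and S_zero: "x \<in> W \<Longrightarrow> p (S 0 x - x) = 0"
  and S_add: "0 \<le> s \<Longrightarrow> 0 \<le> t \<Longrightarrow> x \<in> W \<Longrightarrow> p (S (s + t) x - S s (S t x)) = 0"
  and S_cont: "x \<in> W \<Longrightarrow> ((\<lambda>t. p (S t x - x)) \<longlongrightarrow> 0) (at_right 0)"
  using semigroup unfolding contraction_C0_semigroup_def by blast+

lemma functional_null:
  assumes L: "bounded_functional L" and "x \<in> W" "y \<in> W" "p (x - y) = 0" shows "L x = L y"
proof -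
  obtain C where "C \<ge> 0" "\<And>x. x \<in> W \<Longrightarrow> \<bar>L x\<bar> \<le> C * p x"
    "\<And>x y. x \<in> W \<Longrightarrow> y \<in> W \<Longrightarrow> \<bar>L x - L y\<bar> \<le> C * p (x - y)"
    using bounded_functional_lipschitz[OF L] by blast
  from this(3)[OF assms(2,3)] assms(4) show ?thesis by simp
qed

lemma functional_add: "bounded_functional L \<Longrightarrow> x \<in> W \<Longrightarrow> y \<in> W \<Longrightarrow> L (x + y) = L x + L y"
  and functional_scale: "bounded_functional L \<Longrightarrow> x \<in> W \<Longrightarrow> L (c *\<^sub>R x) = c * L x"
  unfolding bounded_functional_def by auto

text \<open>
  Testing against \<open>L \<circ> S t\<close> takes the place of moving the semigroup under integral signs.
\<close>

lemma bounded_functional_S: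
  assumes L: "bounded_functional L" and t: "0 \<le> t"
  shows "bounded_functional (\<lambda>x. L (S t x))"
  unfolding bounded_functional_def
proof (intro conjI ballI allI)
  fix x y assume x: "x \<in> W" and y: "y \<in> W"
  have "L (S t (1 *\<^sub>R x + 1 *\<^sub>R y)) = L (1 *\<^sub>R S t x + 1 *\<^sub>R S t y)"
    by (intro functional_null[OF L] S_linear t mem S_mem x y)
  then show "L (S t (x + y)) = L (S t x) + L (S t y)"
    by (simp add: functional_add[OF L] S_mem t x y)
next
  fix x c assume x: "x \<in> W"
  have "L (S t (c *\<^sub>R x + 0 *\<^sub>R x)) = L (c *\<^sub>R S t x + 0 *\<^sub>R S t x)"
    by (intro functional_null[OF L] S_linear t mem S_mem x)
  then show "L (S t (c *\<^sub>R x)) = c * L (S t x)"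
    by (simp add: functional_scale[OF L] S_mem t x)
next
  obtain C where C: "C \<ge> 0" "\<And>x. x \<in> W \<Longrightarrow> \<bar>L x\<bar> \<le> C * p x"
    using L unfolding bounded_functional_def by auto
  show "\<exists>C\<ge>0. \<forall>x\<in>W. \<bar>L (S t x)\<bar> \<le> C * p x"
    using C S_mem[OF t] mult_left_mono[OF S_contr[OF t] C(1)]
    by (intro exI[of _ C]) (auto intro: order_trans)
qed

lemma S_diff_contr:
  assumes t: "0 \<le> t" and x: "x \<in> W" and y: "y \<in> W"
  shows "p (S t x - S t y) \<le> p (x - y)"
proof -
  have "p (S t (1 *\<^sub>R x + (-1) *\<^sub>R y) - (1 *\<^sub>R S t x + (-1) *\<^sub>R S t y)) = 0"
    by (rule S_linear[OF t x y])
  then have "p (S t (x - y) - (S t x - S t y)) = 0" by simp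
  then have "p (S t (x - y)) = p (S t x - S t y)"
    by (intro nrm_diff_null mem S_mem t x y)
  then show ?thesis using S_contr[OF t, of "x - y"] x y by (simp add: mem)
qed

section \<open>The modulus of continuity of the semigroup\<close>

text \<open>
  How far the semigroup moves a vector within time \<open>r\<close>.  Evaluated on the forcing it bounds the error
  made when \<open>S (s + r - \<sigma>) (F \<sigma>)\<close> is replaced by \<open>F \<sigma>\<close> over a time interval of length \<open>r\<close>.
\<close>

definition modulus :: "real \<Rightarrow> 'a \<Rightarrow> real" where
  "modulus r x = (SUP \<tau>\<in>{0..r}. p (S \<tau> x - x))"

lemma modulus_bdd: "x \<in> W \<Longrightarrow> bdd_above ((\<lambda>\<tau>. p (S \<tau> x - x)) ` {0..r})"
  by (intro bdd_aboveI2[of _ _ "p x + p x"])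
     (auto intro!: order_trans[OF nrm_diff_triangle] add_mono S_mem S_contr)

lemma modulus_upper: "x \<in> W \<Longrightarrow> 0 \<le> \<tau> \<Longrightarrow> \<tau> \<le> r \<Longrightarrow> p (S \<tau> x - x) \<le> modulus r x"
  unfolding modulus_def by (intro cSUP_upper modulus_bdd) auto

lemma modulus_least: "0 \<le> r \<Longrightarrow> (\<And>\<tau>. 0 \<le> \<tau> \<Longrightarrow> \<tau> \<le> r \<Longrightarrow> p (S \<tau> x - x) \<le> c) \<Longrightarrow> modulus r x \<le> c"
  unfolding modulus_def by (intro cSUP_least) auto

lemma modulus_nonneg: "x \<in> W \<Longrightarrow> 0 \<le> r \<Longrightarrow> 0 \<le> modulus r x"
  using modulus_upper[of x 0 r] S_zero[of x] by simp

lemma modulus_le: "x \<in> W \<Longrightarrow> 0 \<le> r \<Longrightarrow> modulus r x \<le> 2 * p x"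
  by (intro modulus_least) (auto intro!: order_trans[OF nrm_diff_triangle] S_mem dest: S_contr)

lemma modulus_mono: "x \<in> W \<Longrightarrow> 0 \<le> r \<Longrightarrow> r \<le> r' \<Longrightarrow> modulus r x \<le> modulus r' x"
  by (intro modulus_least modulus_upper) auto

lemma modulus_lipschitz:
  assumes x: "x \<in> W" and y: "y \<in> W" and r: "0 \<le> r"
  shows "\<bar>modulus r x - modulus r y\<bar> \<le> 2 * p (x - y)"
proof -
  have *: "modulus r x \<le> modulus r y + 2 * p (x - y)" if x: "x \<in> W" and y: "y \<in> W" for x y
  proof (rule modulus_least[OF r])
    fix \<tau> assume \<tau>: "0 \<le> \<tau>" "\<tau> \<le> r"
    have "p (S \<tau> x - x) \<le> p (S \<tau> x - S \<tau> y) + (p (S \<tau> y - y) + p (y - x))"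
      using nrm_dist_triangle[of "S \<tau> x" "S \<tau> y" x] nrm_dist_triangle[of "S \<tau> y" y x] x y \<tau>
      by (simp add: S_mem)
    also have "\<dots> \<le> p (x - y) + (modulus r y + p (y - x))"
      using \<tau> x y by (intro add_mono S_diff_contr modulus_upper) auto
    finally show "p (S \<tau> x - x) \<le> modulus r y + 2 * p (x - y)"
      using nrm_minus_commute[OF x y] by simp
  qed
  show ?thesis
    using *[OF x y] *[OF y x] nrm_minus_commute[OF x y] by simp
qed

lemma modulus_tendsto: 
  assumes x: "x \<in> W" and r: "r \<longlonglongrightarrow> 0" "\<And>n. 0 < r n"
  shows "(\<lambda>n. modulus (r n) x) \<longlonglongrightarrow> 0"
proof (rule order_tendstoI)
  fix e :: real assume e: "0 < e"
  have "eventually (\<lambda>\<tau>. p (S \<tau> x - x) < e / 2) (at_right 0)"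
    using S_cont[OF x] e by (intro order_tendstoD(2)) auto
  then obtain d where d: "d > 0" "\<And>\<tau>. 0 < \<tau> \<Longrightarrow> \<tau> < d \<Longrightarrow> p (S \<tau> x - x) < e / 2"
    unfolding eventually_at_right_field by auto
  have "eventually (\<lambda>n. r n < d) sequentially" using r(1) d(1) by (rule order_tendstoD(2))
  then show "\<forall>\<^sub>F n in sequentially. modulus (r n) x < e"
  proof eventually_elim
    case (elim n)
    have "p (S \<tau> x - x) \<le> e / 2" if "0 \<le> \<tau>" "\<tau> \<le> r n" for \<tau>
      using d(2)[of \<tau>] elim that S_zero[OF x] e by (cases "\<tau> = 0") auto
    then have "modulus (r n) x \<le> e / 2" using r(2)[of n] by (intro modulus_least) auto
    then show ?case using e by simp
  qed
next
  fix e :: real assume "e < 0"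
  then show "\<forall>\<^sub>F n in sequentially. e < modulus (r n) x"
    using modulus_nonneg[OF x] r(2) by (intro always_eventually allI) (metis less_eq_real_def order.strict_trans2)
qed

section \<open>Integrals of the forcing\<close>

lemma F_measurable: "strongly_measurable (lebesgue_on {0..T}) W p F"
  using F_L2 by (simp add: bochner_L2_def)

lemma F_sq_integrable: "integrable (lebesgue_on {0..T}) (\<lambda>t. (p (F t))\<^sup>2)"
proof (rule integrableI_nonneg)
  have "(\<lambda>t. p (F t)) \<in> borel_measurable (lebesgue_on {0..T})"
    using measurable_nrm[OF F_measurable] by (simp add: completion_lebesgue_interval)
  then show "(\<lambda>t. (p (F t))\<^sup>2) \<in> borel_measurable (lebesgue_on {0..T})" by measurable
  show "(\<integral>\<^sup>+t. ennreal ((p (F t))\<^sup>2) \<partial>lebesgue_on {0..T}) < \<infinity>"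
    using F_L2 by (simp add: bochner_L2_def)
qed simp

lemma F_integrable: "integrable (lebesgue_on {0..T}) (\<lambda>t. p (F t))"
proof (rule Bochner_Integration.integrable_bound)
  interpret finite_measure "lebesgue_on {0..T}" by (rule finite_measure_lebesgue_on_interval)
  show "integrable (lebesgue_on {0..T}) (\<lambda>t. 1 + (p (F t))\<^sup>2)"
    by (intro Bochner_Integration.integrable_add F_sq_integrable) simp
  show "(\<lambda>t. p (F t)) \<in> borel_measurable (lebesgue_on {0..T})"
    using measurable_nrm[OF F_measurable] by (simp add: completion_lebesgue_interval)
  have "y \<le> 1 + y\<^sup>2" for y :: real
    using sum_power2_ge_zero[of "y - 1/2" 0] by (simp add: power2_eq_square algebra_simps)
  then show "AE t in lebesgue_on {0..T}. norm (p (F t)) \<le> norm (1 + (p (F t))\<^sup>2)"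
    by (intro AE_I2) (simp add: nrm_nonneg F_mem)
qed

lemma modulus_F_integrable: "0 \<le> r \<Longrightarrow> integrable (lebesgue_on {0..T}) (\<lambda>t. modulus r (F t))"
proof (rule Bochner_Integration.integrable_bound)
  assume r: "0 \<le> r"
  show "integrable (lebesgue_on {0..T}) (\<lambda>t. 2 * p (F t))" by (intro integrable_mult_right F_integrable)
  show "(\<lambda>t. modulus r (F t)) \<in> borel_measurable (lebesgue_on {0..T})"
    using measurable_lipschitz[OF F_measurable, of "modulus r" 2] modulus_lipschitz r
    by (simp add: completion_lebesgue_interval)
  show "AE t in lebesgue_on {0..T}. norm (modulus r (F t)) \<le> norm (2 * p (F t))"
    using r by (intro AE_I2) (simp add: modulus_nonneg modulus_le F_mem nrm_nonneg)
qed

definition F_mass :: "real \<Rightarrow> real" where "F_mass t = integral {0..t} (\<lambda>s. p (F s))"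

definition F_energy :: "real \<Rightarrow> real" where "F_energy t = integral {0..t} (\<lambda>s. (p (F s))\<^sup>2)"

definition modulus_mass :: "real \<Rightarrow> real \<Rightarrow> real" where
  "modulus_mass r t = integral {0..t} (\<lambda>s. modulus r (F s))"

lemma int_F: "(\<lambda>s. p (F s)) integrable_on {0..T}"
  and int_F_sq: "(\<lambda>s. (p (F s))\<^sup>2) integrable_on {0..T}"
  and int_modulus: "0 \<le> r \<Longrightarrow> (\<lambda>s. modulus r (F s)) integrable_on {0..T}"
  using F_integrable F_sq_integrable modulus_F_integrable by (auto intro!: integrable_on_lebesgue_on)

lemma F_mass_diff: "0 \<le> a \<Longrightarrow> a \<le> b \<Longrightarrow> b \<le> T \<Longrightarrow> F_mass b - F_mass a = integral {a..b} (\<lambda>s. p (F s))"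
  unfolding F_mass_def by (rule integral_antideriv_diff[OF int_F])

lemma F_energy_diff: "0 \<le> a \<Longrightarrow> a \<le> b \<Longrightarrow> b \<le> T \<Longrightarrow> F_energy b - F_energy a = integral {a..b} (\<lambda>s. (p (F s))\<^sup>2)"
  unfolding F_energy_def by (rule integral_antideriv_diff[OF int_F_sq])

lemma modulus_mass_diff: "0 \<le> r \<Longrightarrow> 0 \<le> a \<Longrightarrow> a \<le> b \<Longrightarrow> b \<le> T \<Longrightarrow>
    modulus_mass r b - modulus_mass r a = integral {a..b} (\<lambda>s. modulus r (F s))"
  unfolding modulus_mass_def by (rule integral_antideriv_diff[OF int_modulus])

lemma F_mass_continuous: "continuous_on {0..T} F_mass"
  and F_energy_continuous: "continuous_on {0..T} F_energy"
  and modulus_mass_continuous: "0 \<le> r \<Longrightarrow> continuous_on {0..T} (modulus_mass r)"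
  unfolding F_mass_def[abs_def] F_energy_def[abs_def] modulus_mass_def[abs_def]
  by (auto intro: indefinite_integral_continuous_1 int_F int_F_sq int_modulus)

lemma F_mass_mono: "0 \<le> a \<Longrightarrow> a \<le> b \<Longrightarrow> b \<le> T \<Longrightarrow> F_mass a \<le> F_mass b"
  using F_mass_diff[of a b] integral_nonneg[of "\<lambda>s. p (F s)" "{a..b}"] integrable_subinterval_real[OF int_F, of a b]
  by (auto simp: nrm_nonneg F_mem)

lemma F_energy_mono: "0 \<le> a \<Longrightarrow> a \<le> b \<Longrightarrow> b \<le> T \<Longrightarrow> F_energy a \<le> F_energy b"
  using F_energy_diff[of a b] integral_nonneg[of "\<lambda>s. (p (F s))\<^sup>2" "{a..b}"] integrable_subinterval_real[OF int_F_sq, of a b]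
  by auto

lemma modulus_mass_mono: "0 \<le> r \<Longrightarrow> 0 \<le> a \<Longrightarrow> a \<le> b \<Longrightarrow> b \<le> T \<Longrightarrow> modulus_mass r a \<le> modulus_mass r b"
  using modulus_mass_diff[of r a b] integral_nonneg[of "\<lambda>s. modulus r (F s)" "{a..b}"]
    integrable_subinterval_real[OF int_modulus, of r a b]
  by (auto simp: modulus_nonneg F_mem)

lemma F_energy_0: "F_energy 0 = 0" and modulus_mass_0: "modulus_mass r 0 = 0"
  by (simp_all add: F_energy_def modulus_mass_def)

text \<open>
  The modulus of continuity of every value of the forcing tends to zero with \<open>r\<close> and is at most twice
  its norm, so dominated convergence applies.
\<close>

lemma modulus_mass_small:
  assumes e: "0 < e" obtains r0 where "r0 > 0" "\<And>r. 0 < r \<Longrightarrow> r \<le> r0 \<Longrightarrow> modulus_mass r T \<le> e"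
proof -
  let ?r = "\<lambda>n. inverse (real (Suc n))"
  have "(\<lambda>n. integral\<^sup>L (lebesgue_on {0..T}) (\<lambda>t. modulus (?r n) (F t))) \<longlonglongrightarrow>
      integral\<^sup>L (lebesgue_on {0..T}) (\<lambda>t. 0)"
  proof (rule integral_dominated_convergence[where w = "\<lambda>t. 2 * p (F t)"])
    show "integrable (lebesgue_on {0..T}) (\<lambda>t. 2 * p (F t))" by (intro integrable_mult_right F_integrable)
    show "AE t in lebesgue_on {0..T}. (\<lambda>n. modulus (?r n) (F t)) \<longlonglongrightarrow> 0"
      by (intro AE_I2 modulus_tendsto F_mem LIMSEQ_inverse_real_of_nat) auto
    show "(\<lambda>t. modulus (?r n) (F t)) \<in> borel_measurable (lebesgue_on {0..T})" for n
      using modulus_F_integrable[of "?r n"] by (auto dest: borel_measurable_integrable)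
    show "AE t in lebesgue_on {0..T}. norm (modulus (?r n) (F t)) \<le> 2 * p (F t)" for n
      by (intro AE_I2) (simp add: modulus_nonneg modulus_le F_mem)
  qed simp
  then have "(\<lambda>n. integral\<^sup>L (lebesgue_on {0..T}) (\<lambda>t. modulus (?r n) (F t))) \<longlonglongrightarrow> 0" by simp
  then have "eventually (\<lambda>n. integral\<^sup>L (lebesgue_on {0..T}) (\<lambda>t. modulus (?r n) (F t)) < e) sequentially"
    using e by (rule order_tendstoD(2))
  then obtain n where n: "integral\<^sup>L (lebesgue_on {0..T}) (\<lambda>t. modulus (?r n) (F t)) < e"
    by (auto simp: eventually_sequentially)
  show thesis
  proof (rule that[of "?r n"])
    fix r assume r: "0 < r" "r \<le> ?r n"
    have "modulus_mass r T = integral\<^sup>L (lebesgue_on {0..T}) (\<lambda>t. modulus r (F t))"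
      unfolding modulus_mass_def using r
      by (intro lebesgue_integral_eq_integral[symmetric] modulus_F_integrable) auto
    also have "\<dots> \<le> integral\<^sup>L (lebesgue_on {0..T}) (\<lambda>t. modulus (?r n) (F t))"
      using r by (intro integral_mono modulus_F_integrable modulus_mono F_mem) auto
    finally show "modulus_mass r T \<le> e" using n by simp
  qed simp
qed

end

context mild_evolution
begin

section \<open>The mild solution and its primitive\<close>

lemma X_path: "path_on {0..T} X"
  using mild unfolding mild_solution_def continuous_path_def path_on_def by auto

lemma X_mem: "0 \<le> t \<Longrightarrow> t \<le> T \<Longrightarrow> X t \<in> W"
  using X_path by (auto simp: path_on_def)

lemma functional_F_integrable: 
  assumes L: "bounded_functional L" shows "(\<lambda>s. L (F s)) integrable_on {0..T}"
proof -
  obtain C where C: "C \<ge> 0" "\<And>x. x \<in> W \<Longrightarrow> \<bar>L x\<bar> \<le> C * p x"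
    "\<And>x y. x \<in> W \<Longrightarrow> y \<in> W \<Longrightarrow> \<bar>L x - L y\<bar> \<le> C * p (x - y)"
    using bounded_functional_lipschitz[OF L] by blast
  have "integrable (lebesgue_on {0..T}) (\<lambda>s. L (F s))"
  proof (rule Bochner_Integration.integrable_bound)
    show "integrable (lebesgue_on {0..T}) (\<lambda>t. C * p (F t))" by (intro integrable_mult_right F_integrable)
    show "(\<lambda>t. L (F t)) \<in> borel_measurable (lebesgue_on {0..T})"
      using measurable_lipschitz[OF F_measurable C(3)] by (simp add: completion_lebesgue_interval)
    show "AE t in lebesgue_on {0..T}. norm (L (F t)) \<le> norm (C * p (F t))"
      using C by (intro AE_I2) (simp add: nrm_nonneg F_mem)
  qed
  then show ?thesis by (rule integrable_on_lebesgue_on) simp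
qed

lemma mild_functional:
  assumes L: "bounded_functional L" and t: "0 \<le> t" "t \<le> T"
  shows "(\<lambda>s. L (S (t - s) (F s))) integrable_on {0..t}"
    and "L (X t) = L (S t x0) + integral {0..t} (\<lambda>s. L (S (t - s) (F s)))"
proof -
  obtain I where I: "has_bochner_integral_in (lebesgue_on {0..t}) W p (\<lambda>s. S (t - s) (F s)) I"
    and X: "p (X t - (S t x0 + I)) = 0"
    using mild t unfolding mild_solution_def by (meson atLeastAtMost_iff)
  note * = functional_bochner_interval[OF I L]
  show "(\<lambda>s. L (S (t - s) (F s))) integrable_on {0..t}" by (rule *)
  have "L (X t) = L (S t x0 + I)"
    using bochner_mem[OF I] t x0_mem by (intro functional_null[OF L _ _ X] X_mem mem S_mem) auto
  also have "\<dots> = L (S t x0) + L I"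
    using bochner_mem[OF I] t x0_mem by (intro functional_add[OF L] S_mem) auto
  finally show "L (X t) = L (S t x0) + integral {0..t} (\<lambda>s. L (S (t - s) (F s)))"
    using * by simp
qed

lemma X_zero: "p (X 0 - x0) = 0"
proof -
  have mem0: "X 0 - x0 \<in> W" using X_mem[of 0] x0_mem T_pos by (simp add: mem)
  have L: "bounded_functional (\<lambda>x. B x (X 0 - x0))" by (rule bounded_functional_inner[OF mem0])
  have "B (X 0) (X 0 - x0) = B (S 0 x0) (X 0 - x0)" using mild_functional(2)[OF L, of 0] T_pos by simp
  also have "\<dots> = B x0 (X 0 - x0)"
    by (intro functional_null[OF L] S_zero S_mem x0_mem) auto
  finally have "B (X 0 - x0) (X 0 - x0) = 0"
    using X_mem[of 0] x0_mem T_pos mem0 by (simp add: diff_left)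
  then show ?thesis using nrm[OF mem0] by simp
qed

text \<open>
  Up to an error controlled by the modulus of continuity of the semigroup on the forcing,
  the semigroup acts on the mild solution as the translation of \<open>X - \<integral>F\<close>.
\<close>

lemma S_X_increment:
  assumes w: "w \<in> W" and s: "0 \<le> s" "0 \<le> r" "s + r \<le> T"
  shows "\<bar>(B (X (s + r)) w - B (S r (X s)) w) - integral {s..s+r} (\<lambda>\<sigma>. B (F \<sigma>) w)\<bar>
    \<le> p w * (modulus_mass r (s + r) - modulus_mass r s)"
proof -
  define L where "L = (\<lambda>x. B x w)"
  have L: "bounded_functional L" unfolding L_def by (rule bounded_functional_inner[OF w])
  have LS: "bounded_functional (\<lambda>x. L (S r x))" by (rule bounded_functional_S[OF L s(2)])
  let ?g = "\<lambda>\<sigma>. L (S (s + r - \<sigma>) (F \<sigma>))"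
  have g_int: "?g integrable_on {0..s+r}" using mild_functional(1)[OF L, of "s + r"] s by simp
  have sF: "L (S r (S (s - \<sigma>) (F \<sigma>))) = ?g \<sigma>" if "\<sigma> \<in> {0..s}" for \<sigma>
  proof -
    have "p (S (r + (s - \<sigma>)) (F \<sigma>) - S r (S (s - \<sigma>) (F \<sigma>))) = 0"
      using that s by (intro S_add F_mem) auto
    then have "L (S (r + (s - \<sigma>)) (F \<sigma>)) = L (S r (S (s - \<sigma>) (F \<sigma>)))"
      using that s by (intro functional_null[OF L] S_mem F_mem) auto
    then show ?thesis by (simp add: algebra_simps)
  qed
  have "L (S r (X s)) = L (S r (S s x0)) + integral {0..s} (\<lambda>\<sigma>. L (S r (S (s - \<sigma>) (F \<sigma>))))"
    using mild_functional(2)[OF LS, of s] s by simp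
  also have "integral {0..s} (\<lambda>\<sigma>. L (S r (S (s - \<sigma>) (F \<sigma>)))) = integral {0..s} ?g"
    by (rule Henstock_Kurzweil_Integration.integral_cong) (rule sF)
  also have "L (S r (S s x0)) = L (S (s + r) x0)"
    using S_add[OF s(2,1) x0_mem] s
    by (intro functional_null[OF L, symmetric] S_mem x0_mem) (auto simp: add.commute)
  finally have "L (X (s + r)) - L (S r (X s)) = integral {0..s+r} ?g - integral {0..s} ?g"
    using mild_functional(2)[OF L, of "s + r"] s by simp
  also have "\<dots> = integral {s..s+r} ?g"
    using s by (intro integral_antideriv_diff[OF g_int]) auto
  finally have eq: "L (X (s + r)) - L (S r (X s)) = integral {s..s+r} ?g" .
  have sub: "{s..s+r} \<subseteq> {0..s+r}" "{s..s+r} \<subseteq> {0..T}" using s by auto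
  have "norm (integral {s..s+r} (\<lambda>\<sigma>. ?g \<sigma> - L (F \<sigma>))) \<le> integral {s..s+r} (\<lambda>\<sigma>. p w * modulus r (F \<sigma>))"
  proof (rule Henstock_Kurzweil_Integration.integral_norm_bound_integral)
    show "(\<lambda>\<sigma>. ?g \<sigma> - L (F \<sigma>)) integrable_on {s..s+r}"
      by (intro integrable_diff integrable_subinterval_real[OF g_int sub(1)]
          integrable_subinterval_real[OF functional_F_integrable[OF L] sub(2)])
    show "(\<lambda>\<sigma>. p w * modulus r (F \<sigma>)) integrable_on {s..s+r}"
      by (intro integrable_on_mult_right integrable_subinterval_real[OF int_modulus[OF s(2)] sub(2)])
    fix \<sigma> assume \<sigma>: "\<sigma> \<in> {s..s+r}"
    have S_F: "S (s + r - \<sigma>) (F \<sigma>) \<in> W" using \<sigma> by (intro S_mem F_mem) auto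
    have "?g \<sigma> - L (F \<sigma>) = B (S (s + r - \<sigma>) (F \<sigma>) - F \<sigma>) w"
      unfolding L_def using S_F w F_mem by (simp add: diff_left)
    also have "\<bar>\<dots>\<bar> \<le> p (S (s + r - \<sigma>) (F \<sigma>) - F \<sigma>) * p w"
      using S_F w F_mem by (intro Cauchy_Schwarz mem) auto
    also have "\<dots> \<le> modulus r (F \<sigma>) * p w"
      using \<sigma> w by (intro mult_right_mono modulus_upper F_mem nrm_nonneg) auto
    finally show "norm (?g \<sigma> - L (F \<sigma>)) \<le> p w * modulus r (F \<sigma>)" by (simp add: mult.commute)
  qed
  also have "\<dots> = p w * (modulus_mass r (s + r) - modulus_mass r s)"
    using s by (simp add: modulus_mass_diff)
  finally show ?thesis
    using eq integrable_subinterval_real[OF g_int sub(1)]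
      integrable_subinterval_real[OF functional_F_integrable[OF L] sub(2)]
    by (simp add: Henstock_Kurzweil_Integration.integral_diff L_def)
qed

text \<open>
  \<open>Z t\<close> and \<open>\<Phi> t\<close> are the integrals of \<open>X\<close> and \<open>F\<close> over \<open>[0, t]\<close>; only their action on
  functionals is used.
\<close>

definition Z :: "real \<Rightarrow> 'a" where
  "Z t = (SOME I. has_bochner_integral_in (lebesgue_on {0..t}) W p X I)"

definition \<Phi> :: "real \<Rightarrow> 'a" where
  "\<Phi> t = (SOME I. has_bochner_integral_in (lebesgue_on {0..t}) W p F I)"

lemma Z_integral: "0 \<le> t \<Longrightarrow> t \<le> T \<Longrightarrow> has_bochner_integral_in (lebesgue_on {0..t}) W p X (Z t)"
  unfolding Z_def
  by (rule someI_ex, rule path_integral_exists[OF path_on_subset[OF X_path] complete]) auto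

lemma \<Phi>_integral:
  assumes t: "0 \<le> t" "t \<le> T" shows "has_bochner_integral_in (lebesgue_on {0..t}) W p F (\<Phi> t)"
proof -
  have "(\<integral>\<^sup>+s. ennreal (p (F s)) \<partial>lebesgue_on {0..t}) \<le> (\<integral>\<^sup>+s. ennreal (p (F s)) \<partial>lebesgue_on {0..T})"
    using t by (simp add: nn_integral_restrict_space)
      (auto intro!: nn_integral_mono split: split_indicator)
  also have "\<dots> < \<infinity>" using F_integrable nn_integral_eq_integral[OF F_integrable] by (simp add: nrm_nonneg F_mem)
  finally have "bochner_integrable_in (lebesgue_on {0..t}) W p F"
    using t by (intro bochner_integral_exists[OF complete finite_measure_lebesgue_on_interval]
        strongly_measurable_subset[OF F_measurable]) auto
  then show ?thesis unfolding \<Phi>_def bochner_integrable_in_def by (rule someI_ex)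
qed

lemma Z_mem: "0 \<le> t \<Longrightarrow> t \<le> T \<Longrightarrow> Z t \<in> W" and \<Phi>_mem: "0 \<le> t \<Longrightarrow> t \<le> T \<Longrightarrow> \<Phi> t \<in> W"
  using Z_integral \<Phi>_integral by (auto dest: bochner_mem)

lemma functional_Z: "bounded_functional L \<Longrightarrow> 0 \<le> t \<Longrightarrow> t \<le> T \<Longrightarrow> L (Z t) = integral {0..t} (\<lambda>s. L (X s))"
  using functional_bochner_interval(2)[OF Z_integral] .

lemma functional_\<Phi>: "bounded_functional L \<Longrightarrow> 0 \<le> t \<Longrightarrow> t \<le> T \<Longrightarrow> L (\<Phi> t) = integral {0..t} (\<lambda>s. L (F s))"
  using functional_bochner_interval(2)[OF \<Phi>_integral] .

lemma functional_X_integrable: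
  "bounded_functional L \<Longrightarrow> 0 \<le> a \<Longrightarrow> b \<le> T \<Longrightarrow> (\<lambda>s. L (X s)) integrable_on {a..b}"
  by (intro integrable_continuous_real path_on_functional[OF path_on_subset[OF X_path]]) auto

lemma functional_Z_diff:
  assumes L: "bounded_functional L" and ab: "0 \<le> a" "a \<le> b" "b \<le> T"
  shows "L (Z b - Z a) = integral {a..b} (\<lambda>s. L (X s))"
proof -
  have "L (Z b - Z a) = integral {0..b} (\<lambda>s. L (X s)) - integral {0..a} (\<lambda>s. L (X s))"
    using ab by (simp add: bounded_functional_diff[OF L] Z_mem functional_Z[OF L])
  also have "\<dots> = integral {a..b} (\<lambda>s. L (X s))"
    using ab by (intro integral_antideriv_diff functional_X_integrable L) auto
  finally show ?thesis .
qed

lemma functional_\<Phi>_diff: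
  assumes L: "bounded_functional L" and ab: "0 \<le> a" "a \<le> b" "b \<le> T"
  shows "L (\<Phi> b - \<Phi> a) = integral {a..b} (\<lambda>s. L (F s))"
proof -
  have "L (\<Phi> b - \<Phi> a) = integral {0..b} (\<lambda>s. L (F s)) - integral {0..a} (\<lambda>s. L (F s))"
    using ab by (simp add: bounded_functional_diff[OF L] \<Phi>_mem functional_\<Phi>[OF L])
  also have "\<dots> = integral {a..b} (\<lambda>s. L (F s))"
    using ab by (intro integral_antideriv_diff[OF functional_F_integrable[OF L]]) auto
  finally show ?thesis .
qed

lemma functional_\<Phi>_diff_le:
  assumes w: "w \<in> W" and ab: "0 \<le> a" "a \<le> b" "b \<le> T"
  shows "\<bar>B (\<Phi> b - \<Phi> a) w\<bar> \<le> p w * (F_mass b - F_mass a)"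
proof -
  have L: "bounded_functional (\<lambda>x. B x w)" by (rule bounded_functional_inner[OF w])
  have sub: "{a..b} \<subseteq> {0..T}" using ab by auto
  have "norm (integral {a..b} (\<lambda>s. B (F s) w)) \<le> integral {a..b} (\<lambda>s. p w * p (F s))"
    by (intro Henstock_Kurzweil_Integration.integral_norm_bound_integral integrable_on_mult_right
        integrable_subinterval_real[OF int_F sub] integrable_subinterval_real[OF functional_F_integrable[OF L] sub])
      (use Cauchy_Schwarz[OF F_mem w] in \<open>simp add: mult.commute[of "p w"]\<close>)
  then show ?thesis
    using functional_\<Phi>_diff[OF L ab] ab by (simp add: F_mass_diff)
qed

lemma Z_diff_le:
  assumes c: "c \<in> W" and ab: "0 \<le> a" "a \<le> b" "b \<le> T" and e: "0 \<le> e"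
    and near: "\<And>s. s \<in> {a..b} \<Longrightarrow> p (X s - c) \<le> e"
  shows "p (Z b - Z a - (b - a) *\<^sub>R c) \<le> (b - a) * e"
proof (rule nrm_le_if_functional_le)
  let ?w = "Z b - Z a - (b - a) *\<^sub>R c"
  show w: "?w \<in> W" using ab c by (intro mem Z_mem) auto
  have L: "bounded_functional (\<lambda>x. B x ?w)" by (rule bounded_functional_inner[OF w])
  have "B ?w ?w = B (Z b - Z a) ?w - (b - a) * B c ?w"
    using ab c w by (subst diff_left) (auto simp: mem Z_mem scale_left)
  also have "B (Z b - Z a) ?w = integral {a..b} (\<lambda>s. B (X s) ?w)"
    using functional_Z_diff[OF L ab] .
  also have "\<bar>\<dots> - (b - a) * B c ?w\<bar> \<le> (b - a) * (e * p ?w)"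
  proof (rule integral_near_const)
    show "(\<lambda>s. B (X s) ?w) integrable_on {a..b}" using ab by (intro functional_X_integrable L) auto
    fix s assume s: "s \<in> {a..b}"
    have "B (X s) ?w - B c ?w = B (X s - c) ?w"
      using s ab by (intro diff_left[symmetric] X_mem c w) auto
    also have "\<bar>\<dots>\<bar> \<le> p (X s - c) * p ?w" using s ab by (intro Cauchy_Schwarz[OF _ w] diff_mem X_mem c) auto
    also have "\<dots> \<le> e * p ?w" using near[OF s] w by (intro mult_right_mono nrm_nonneg)
    finally show "\<bar>B (X s) ?w - B c ?w\<bar> \<le> e * p ?w" .
  qed fact
  finally show "B ?w ?w \<le> (b - a) * e * p ?w" by (simp add: mult.assoc)
qed (use ab e in simp)

lemma X_near:
  assumes t: "0 \<le> t" "t \<le> T" and e: "0 < e"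
  obtains d where "d > 0" "\<And>s. s \<in> {0..T} \<Longrightarrow> \<bar>s - t\<bar> \<le> d \<Longrightarrow> p (X s - X t) \<le> e"
proof -
  have "((\<lambda>s. p (X s - X t)) \<longlongrightarrow> 0) (at t within {0..T})"
    using X_path t by (auto simp: path_on_def)
  then have "eventually (\<lambda>s. p (X s - X t) < e) (at t within {0..T})"
    using e by (rule order_tendstoD(2))
  then obtain d where d: "d > 0" "\<And>s. s \<in> {0..T} \<Longrightarrow> s \<noteq> t \<Longrightarrow> dist s t < d \<Longrightarrow> p (X s - X t) < e"
    unfolding eventually_at by auto
  have "p (X s - X t) \<le> e" if "s \<in> {0..T}" "\<bar>s - t\<bar> \<le> d / 2" for s
    using d(1) d(2)[of s] that e by (cases "s = t") (auto simp: dist_real_def nrm_zero less_imp_le)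
  with d(1) show thesis by (intro that[of "d / 2"]) auto
qed

lemma F_mass_near:
  assumes t: "0 \<le> t" "t \<le> T" and e: "0 < e"
  obtains d where "d > 0" "\<And>s. s \<in> {0..T} \<Longrightarrow> \<bar>s - t\<bar> \<le> d \<Longrightarrow> \<bar>F_mass s - F_mass t\<bar> \<le> e"
proof -
  obtain d where d: "d > 0" "\<And>s. s \<in> {0..T} \<Longrightarrow> dist s t < d \<Longrightarrow> dist (F_mass s) (F_mass t) < e"
    using F_mass_continuous t e unfolding continuous_on_iff by (metis atLeastAtMost_iff)
  have "\<bar>F_mass s - F_mass t\<bar> \<le> e" if "s \<in> {0..T}" "\<bar>s - t\<bar> \<le> d / 2" for s
    using d(1) d(2)[of s] that by (auto simp: dist_real_def)
  with d(1) show thesis by (intro that[of "d / 2"]) auto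
qed

text \<open>
  The generator can be applied to the primitive of a mild solution although it cannot be applied
  to the solution itself.  Integrating the increments of \<open>X - \<integral>F\<close> over \<open>[0, t]\<close> leaves averages
  over short intervals at \<open>t\<close> and at \<open>0\<close>, and these converge by continuity.
\<close>

theorem Z_generator_limit:
  assumes t: "0 \<le> t" "t < T"
  shows "((\<lambda>r. p ((1 / r) *\<^sub>R (S r (Z t) - Z t) - (X t - X 0 - \<Phi> t))) \<longlongrightarrow> 0) (at_right 0)"
proof -
  have small: "\<exists>d>0. \<forall>r. 0 < r \<and> r < d \<longrightarrow> p ((1 / r) *\<^sub>R (S r (Z t) - Z t) - (X t - X 0 - \<Phi> t)) \<le> 5 * e"
    if e: "e > 0" for e
  proof -
    obtain d1 where d1: "d1 > 0" "\<And>s. s \<in> {0..T} \<Longrightarrow> \<bar>s - t\<bar> \<le> d1 \<Longrightarrow> p (X s - X t) \<le> e"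
      using X_near[of t e] t e by auto
    obtain d2 where d2: "d2 > 0" "\<And>s. s \<in> {0..T} \<Longrightarrow> \<bar>s - 0\<bar> \<le> d2 \<Longrightarrow> p (X s - X 0) \<le> e"
      using X_near[of 0 e] T_pos e by auto
    obtain d3 where d3: "d3 > 0" "\<And>s. s \<in> {0..T} \<Longrightarrow> \<bar>s - t\<bar> \<le> d3 \<Longrightarrow> \<bar>F_mass s - F_mass t\<bar> \<le> e"
      using F_mass_near[of t e] t e by auto
    obtain d4 where d4: "d4 > 0" "\<And>s. s \<in> {0..T} \<Longrightarrow> \<bar>s - 0\<bar> \<le> d4 \<Longrightarrow> \<bar>F_mass s - F_mass 0\<bar> \<le> e"
      using F_mass_near[of 0 e] T_pos e by auto
    obtain d5 where d5: "d5 > 0" "\<And>r. 0 < r \<Longrightarrow> r \<le> d5 \<Longrightarrow> modulus_mass r T \<le> e"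
      using modulus_mass_small[OF e] by blast
    define d where "d = min (T - t) (min d1 (min d2 (min d3 (min d4 d5))))"
    have "d > 0" using d1 d2 d3 d4 d5 t by (simp add: d_def)
    moreover have "p ((1 / r) *\<^sub>R (S r (Z t) - Z t) - (X t - X 0 - \<Phi> t)) \<le> 5 * e"
      if r: "0 < r" "r < d" for r
    proof (rule nrm_le_if_functional_le)
      let ?w = "(1 / r) *\<^sub>R (S r (Z t) - Z t) - (X t - X 0 - \<Phi> t)"
      have Zt: "Z t \<in> W" "S r (Z t) \<in> W" using t r by (auto intro!: Z_mem S_mem)
      have Xt: "X t \<in> W" "X 0 \<in> W" "\<Phi> t \<in> W" using t T_pos by (auto intro!: X_mem \<Phi>_mem)
      show w: "?w \<in> W" using Zt Xt by (intro mem)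
      define L where "L = (\<lambda>x. B x ?w)"
      have L: "bounded_functional L" unfolding L_def by (rule bounded_functional_inner[OF w])
      have LS: "bounded_functional (\<lambda>x. L (S r x))" using r by (intro bounded_functional_S[OF L]) auto
      have pw: "0 \<le> p ?w" by (rule nrm_nonneg[OF w])
      have tr: "t + r \<le> T" "r \<le> T" using r t by (auto simp: d_def)
      define q where "q = (\<lambda>s. L (X s) - integral {0..s} (\<lambda>\<sigma>. L (F \<sigma>)))"
      have q_cont: "continuous_on {0..T} q"
        unfolding q_def by (intro continuous_intros path_on_functional[OF X_path L]
            indefinite_integral_continuous_1 functional_F_integrable L)
      have q_int: "q integrable_on {a..b}" if "0 \<le> a" "b \<le> T" for a b
        using that by (intro integrable_continuous_real continuous_on_subset[OF q_cont]) auto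
      have mm_cont: "continuous_on {0..T} (modulus_mass r)" using r by (intro modulus_mass_continuous) auto
      have mm_int: "modulus_mass r integrable_on {a..b}" if "0 \<le> a" "b \<le> T" for a b
        using that by (intro integrable_continuous_real continuous_on_subset[OF mm_cont]) auto
      have mm_nonneg: "0 \<le> modulus_mass r s" if "s \<in> {0..T}" for s
        using modulus_mass_mono[of r 0 s] that r by (simp add: modulus_mass_0)
      have near_q: "\<bar>q s - q s0\<bar> \<le> 2 * e * p ?w"
        if s: "0 \<le> s0" "s0 \<le> s" "s \<le> T" and X: "p (X s - X s0) \<le> e" and Fm: "\<bar>F_mass s - F_mass s0\<bar> \<le> e" for s s0
      proof -
        have "q s - q s0 = L (X s - X s0) - L (\<Phi> s - \<Phi> s0)"
          using s by (simp add: q_def bounded_functional_diff[OF L] X_mem \<Phi>_mem functional_\<Phi>[OF L])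
        moreover have "\<bar>L (X s - X s0)\<bar> \<le> p (X s - X s0) * p ?w"
          unfolding L_def using s by (intro Cauchy_Schwarz w mem X_mem) auto
        moreover have "p (X s - X s0) * p ?w \<le> e * p ?w" by (rule mult_right_mono[OF X pw])
        moreover have "\<bar>L (\<Phi> s - \<Phi> s0)\<bar> \<le> p ?w * (F_mass s - F_mass s0)"
          unfolding L_def using s by (intro functional_\<Phi>_diff_le w)
        moreover have "p ?w * (F_mass s - F_mass s0) \<le> p ?w * e"
          using Fm by (intro mult_left_mono pw) auto
        ultimately show ?thesis by (simp add: algebra_simps)
      qed
      (* each end of the interval contributes an error 2 * e; the modulus of continuity contributes e *)
      have I1: "\<bar>integral {t..t+r} q - r * q t\<bar> \<le> r * (2 * e * p ?w)"
        using integral_near_const[OF q_int[of t "t + r"], of "q t" "2 * e * p ?w"]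
          near_q[of t] d1(2) d3(2) r t tr by (auto simp: d_def)
      have I2: "\<bar>integral {0..r} q - r * q 0\<bar> \<le> r * (2 * e * p ?w)"
        using integral_near_const[OF q_int[of 0 r], of "q 0" "2 * e * p ?w"]
          near_q[of 0] d2(2) d4(2) r t tr by (auto simp: d_def)
      have LSX_int: "(\<lambda>s. L (S r (X s))) integrable_on {0..t}"
        using t by (intro functional_X_integrable LS) auto
      have LX_int: "(\<lambda>s. L (X s)) integrable_on {0..t}"
        using t by (intro functional_X_integrable L) auto
      have qr_int: "(\<lambda>s. q (s + r) - q s) integrable_on {0..t}"
      proof (rule integrable_diff)
        have "q integrable_on {r..t+r}" using r tr by (intro q_int) auto
        then show "(\<lambda>s. q (s + r)) integrable_on {0..t}"
          using integrable_shift_real_ivl[of q r "t + r" r] by simp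
        show "q integrable_on {0..t}" using t by (intro q_int) auto
      qed
      have mr_int: "(\<lambda>s. modulus_mass r (s + r) - modulus_mass r s) integrable_on {0..t}"
      proof (rule integrable_diff)
        have "modulus_mass r integrable_on {r..t+r}" using r tr by (intro mm_int) auto
        then show "(\<lambda>s. modulus_mass r (s + r)) integrable_on {0..t}"
          using integrable_shift_real_ivl[of "modulus_mass r" r "t + r" r] by simp
        show "modulus_mass r integrable_on {0..t}" using t by (intro mm_int) auto
      qed
      have "norm (integral {0..t} (\<lambda>s. L (S r (X s)) - L (X s) - (q (s + r) - q s)))
          \<le> integral {0..t} (\<lambda>s. p ?w * (modulus_mass r (s + r) - modulus_mass r s))"
      proof (rule Henstock_Kurzweil_Integration.integral_norm_bound_integral)
        show "(\<lambda>s. L (S r (X s)) - L (X s) - (q (s + r) - q s)) integrable_on {0..t}"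
          by (intro integrable_diff[OF integrable_diff] LSX_int LX_int qr_int)
        show "(\<lambda>s. p ?w * (modulus_mass r (s + r) - modulus_mass r s)) integrable_on {0..t}"
          by (intro integrable_on_mult_right mr_int)
        fix s assume s: "s \<in> {0..t}"
        have "integral {0..s+r} (\<lambda>\<sigma>. L (F \<sigma>)) - integral {0..s} (\<lambda>\<sigma>. L (F \<sigma>)) = integral {s..s+r} (\<lambda>\<sigma>. L (F \<sigma>))"
          using s r tr by (intro integral_antideriv_diff[OF functional_F_integrable[OF L]]) auto
        moreover have "\<bar>(L (X (s + r)) - L (S r (X s))) - integral {s..s+r} (\<lambda>\<sigma>. L (F \<sigma>))\<bar>
            \<le> p ?w * (modulus_mass r (s + r) - modulus_mass r s)"
          unfolding L_def using s r tr by (intro S_X_increment w) auto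
        ultimately show "norm (L (S r (X s)) - L (X s) - (q (s + r) - q s))
            \<le> p ?w * (modulus_mass r (s + r) - modulus_mass r s)"
          by (simp add: q_def abs_minus_commute algebra_simps)
      qed
      also have "\<dots> = p ?w * (integral {t..t+r} (modulus_mass r) - integral {0..r} (modulus_mass r))"
        using integral_shift_difference[OF mm_cont, of t r] t r tr by simp
      also have "\<dots> \<le> p ?w * (r * e)"
      proof (intro mult_left_mono pw)
        have "integral {t..t+r} (modulus_mass r) \<le> (t + r - t) * modulus_mass r T"
          using r t tr by (intro integral_le_const mm_int modulus_mass_mono) auto
        also have "\<dots> \<le> r * e" using d5(2)[of r] r by (auto simp: d_def)
        moreover have "0 \<le> integral {0..r} (modulus_mass r)"
          using r tr mm_nonneg by (intro Henstock_Kurzweil_Integration.integral_nonneg mm_int) auto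
        ultimately show "integral {t..t+r} (modulus_mass r) - integral {0..r} (modulus_mass r) \<le> r * e" by linarith
      qed
      finally have I3: "\<bar>integral {0..t} (\<lambda>s. L (S r (X s)) - L (X s) - (q (s + r) - q s))\<bar> \<le> p ?w * (r * e)"
        by simp
      have "integral {0..t} (\<lambda>s. L (S r (X s)) - L (X s) - (q (s + r) - q s)) =
          L (S r (Z t)) - L (Z t) - (integral {t..t+r} q - integral {0..r} q)"
        using functional_Z[OF LS, of t] functional_Z[OF L, of t] t r tr
          integral_shift_difference[OF q_cont, of t r]
        by (simp add: Henstock_Kurzweil_Integration.integral_diff LSX_int LX_int qr_int integrable_diff)
      then have "\<bar>L (S r (Z t)) - L (Z t) - r * (q t - q 0)\<bar> \<le> r * (5 * e * p ?w)"
        using I1 I2 I3 by (simp add: algebra_simps)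
      moreover have "r * L ?w = L (S r (Z t)) - L (Z t) - r * (q t - q 0)"
      proof -
        have "L ?w = (1 / r) * (L (S r (Z t)) - L (Z t)) - (L (X t) - L (X 0) - L (\<Phi> t))"
          using Zt Xt by (simp add: bounded_functional_diff[OF L] functional_scale[OF L] mem)
        moreover have "q t - q 0 = L (X t) - L (X 0) - L (\<Phi> t)"
          using t by (simp add: q_def functional_\<Phi>[OF L])
        ultimately have "L ?w = (1 / r) * (L (S r (Z t)) - L (Z t)) - (q t - q 0)" by linarith
        then have "r * L ?w = r * ((1 / r) * (L (S r (Z t)) - L (Z t)) - (q t - q 0))" by (rule arg_cong)
        also have "\<dots> = L (S r (Z t)) - L (Z t) - r * (q t - q 0)"
          using r by (simp add: right_diff_distrib)
        finally show ?thesis .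
      qed
      ultimately have "r * L ?w \<le> r * (5 * e * p ?w)" by linarith
      then show "B ?w ?w \<le> 5 * e * p ?w" using r by (simp add: L_def)
    qed (use e in simp)
    ultimately show ?thesis by blast
  qed
  show ?thesis
  proof (rule order_tendstoI)
    fix a :: real assume "a > 0"
    then obtain d where d: "d > 0"
      "\<And>r. 0 < r \<Longrightarrow> r < d \<Longrightarrow> p ((1 / r) *\<^sub>R (S r (Z t) - Z t) - (X t - X 0 - \<Phi> t)) \<le> 5 * (a / 10)"
      using small[of "a / 10"] by auto
    then show "\<forall>\<^sub>F r in at_right 0. p ((1 / r) *\<^sub>R (S r (Z t) - Z t) - (X t - X 0 - \<Phi> t)) < a"
      using \<open>a > 0\<close> unfolding eventually_at_right_field by (intro exI[of _ d]) fastforce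
  next
    fix a :: real assume "a < 0"
    have "0 \<le> p ((1 / r) *\<^sub>R (S r (Z t) - Z t) - (X t - X 0 - \<Phi> t))" if "0 < r" for r
      using t that T_pos by (intro nrm_nonneg mem S_mem Z_mem X_mem \<Phi>_mem) auto
    then show "\<forall>\<^sub>F r in at_right 0. a < p ((1 / r) *\<^sub>R (S r (Z t) - Z t) - (X t - X 0 - \<Phi> t))"
      using \<open>a < 0\<close> unfolding eventually_at_right_field by (intro exI[of _ 1]) fastforce
  qed
qed

end

text \<open>
  The product rule for the square of the norm, with the derivative of the path taken in the seminorm.
\<close>

lemma (in semi_inner) inner_path_derivative:
  assumes y: "path_on I y" and t: "t \<in> I" and y': "y' \<in> V"
    and lim: "((\<lambda>s. p ((1 / (s - t)) *\<^sub>R (y s - y t) - y')) \<longlongrightarrow> 0) (at t within I)"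
  shows "((\<lambda>t. B (y t) (y t)) has_real_derivative 2 * B y' (y t)) (at t within I)"
  unfolding has_field_derivative_iff
proof -
  let ?F = "at t within I" and ?q = "\<lambda>s. (1 / (s - t)) *\<^sub>R (y s - y t)"
  have V: "s \<in> I \<Longrightarrow> y s \<in> V" for s using y by (auto simp: path_on_def)
  have cont: "((\<lambda>s. p (y s - y t)) \<longlongrightarrow> 0) ?F" using y t by (auto simp: path_on_def)
  have "((\<lambda>s. p (?q s - y') * (p (y s - y t) + 2 * p (y t)) + p y' * p (y s - y t)) \<longlongrightarrow>
      0 * (0 + 2 * p (y t)) + p y' * 0) ?F"
    by (intro tendsto_add tendsto_mult tendsto_const lim cont)
  then have bound: "((\<lambda>s. p (?q s - y') * (p (y s - y t) + 2 * p (y t)) + p y' * p (y s - y t)) \<longlongrightarrow> 0) ?F"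
    by simp
  have "\<forall>\<^sub>F s in ?F. norm ((B (y s) (y s) - B (y t) (y t)) / (s - t) - 2 * B y' (y t)) \<le>
      p (?q s - y') * (p (y s - y t) + 2 * p (y t)) + p y' * p (y s - y t)"
  proof -
    have "norm ((B (y s) (y s) - B (y t) (y t)) / (s - t) - 2 * B y' (y t)) \<le>
      p (?q s - y') * (p (y s - y t) + 2 * p (y t)) + p y' * p (y s - y t)" if s: "s \<in> I" for s
    proof -
      note Vs = V[OF s] V[OF t] y'
      have q: "?q s \<in> V" using Vs by (intro mem)
      have "B (?q s) (y s + y t) = (B (y s) (y s) - B (y t) (y t)) / (s - t)"
        using Vs by (simp add: mem scale_left diff_left add_right sym[of "y s" "y t"] flip: add_divide_distrib)
      moreover have "B (?q s) (y s + y t) = B (?q s - y') (y s + y t) + B y' (y s - y t) + 2 * B y' (y t)"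
        using Vs q by (simp add: mem diff_left[OF q] add_right diff_right)
      moreover have "\<bar>B (?q s - y') (y s + y t)\<bar> \<le> p (?q s - y') * (p (y s - y t) + 2 * p (y t))"
      proof -
        have "p (y s + y t) \<le> p (y s - y t) + 2 * p (y t)"
        proof -
          have eq: "y s + y t = (y s - y t) + 2 *\<^sub>R y t" by (simp add: scaleR_2)
          have "p (2 *\<^sub>R y t) = 2 * p (y t)" using Vs by (simp add: nrm_scale)
          then show ?thesis unfolding eq using nrm_triangle[of "y s - y t" "2 *\<^sub>R y t"] Vs by (simp add: mem)
        qed
        then have "p (?q s - y') * p (y s + y t) \<le> p (?q s - y') * (p (y s - y t) + 2 * p (y t))"
          using q Vs by (intro mult_left_mono nrm_nonneg mem)
        moreover have "\<bar>B (?q s - y') (y s + y t)\<bar> \<le> p (?q s - y') * p (y s + y t)"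
          using q Vs by (intro Cauchy_Schwarz mem)
        ultimately show ?thesis by linarith
      qed
      moreover have "\<bar>B y' (y s - y t)\<bar> \<le> p y' * p (y s - y t)"
        using Vs by (intro Cauchy_Schwarz mem)
      ultimately show ?thesis by simp
    qed
    then show ?thesis by (rule eventually_at_within_mem)
  qed
  then have "((\<lambda>s. (B (y s) (y s) - B (y t) (y t)) / (s - t) - 2 * B y' (y t)) \<longlongrightarrow> 0) ?F"
    using bound by (rule Lim_null_comparison)
  then show "((\<lambda>s. (B (y s) (y s) - B (y t) (y t)) / (s - t)) \<longlongrightarrow> 2 * B y' (y t)) ?F"
    by (simp add: LIM_zero_iff)
qed

context mild_evolution
begin

lemma Z_path: "path_on {0..T} Z"
proof -
  obtain C where C: "C \<ge> 0" "\<And>t. t \<in> {0..T} \<Longrightarrow> p (X t) \<le> C"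
    using path_on_bounded[OF X_path] by metis
  have *: "p (Z b - Z a) \<le> (b - a) * C" if "0 \<le> a" "a \<le> b" "b \<le> T" for a b
    using Z_diff_le[of 0 a b C] C that by (simp add: mem)
  show ?thesis
  proof (rule path_onI[where g = "\<lambda>t s. \<bar>s - t\<bar> * C"])
    show "((\<lambda>s. \<bar>s - t\<bar> * C) \<longlongrightarrow> 0) (at t within {0..T})" for t
    proof -
      have "((\<lambda>s. \<bar>s - t\<bar> * C) \<longlongrightarrow> \<bar>t - t\<bar> * C) (at t within {0..T})" by (intro tendsto_intros)
      then show ?thesis by simp
    qed
    show "p (Z s - Z t) \<le> \<bar>s - t\<bar> * C" if "s \<in> {0..T}" "t \<in> {0..T}" for s t
      using *[of s t] *[of t s] that nrm_minus_commute[of "Z s" "Z t"] Z_mem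
      by (cases "s \<le> t") auto
  qed (auto simp: Z_mem)
qed

lemma \<Phi>_path: "path_on {0..T} \<Phi>"
proof -
  have *: "p (\<Phi> b - \<Phi> a) \<le> F_mass b - F_mass a" if "0 \<le> a" "a \<le> b" "b \<le> T" for a b
  proof (rule nrm_le_if_functional_le)
    show w: "\<Phi> b - \<Phi> a \<in> W" using that by (intro mem \<Phi>_mem) auto
    show "0 \<le> F_mass b - F_mass a" using F_mass_mono that by simp
    show "B (\<Phi> b - \<Phi> a) (\<Phi> b - \<Phi> a) \<le> (F_mass b - F_mass a) * p (\<Phi> b - \<Phi> a)"
      using functional_\<Phi>_diff_le[OF w that] by (simp add: mult.commute)
  qed
  show ?thesis
  proof (rule path_onI[where g = "\<lambda>t s. \<bar>F_mass s - F_mass t\<bar>"])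
    show "((\<lambda>s. \<bar>F_mass s - F_mass t\<bar>) \<longlongrightarrow> 0) (at t within {0..T})" if "t \<in> {0..T}" for t
      using F_mass_continuous that by (intro tendsto_rabs_zero LIM_zero) (auto simp: continuous_on_def)
    show "p (\<Phi> s - \<Phi> t) \<le> \<bar>F_mass s - F_mass t\<bar>" if "s \<in> {0..T}" "t \<in> {0..T}" for s t
      using *[of s t] *[of t s] that nrm_minus_commute[of "\<Phi> s" "\<Phi> t"] \<Phi>_mem
      by (cases "s \<le> t") auto
  qed (auto simp: \<Phi>_mem)
qed

lemma Z_derivative:
  assumes t: "0 \<le> t" "t \<le> T"
  shows "((\<lambda>s. p ((1 / (s - t)) *\<^sub>R (Z s - Z t) - X t)) \<longlongrightarrow> 0) (at t within {0..T})"
proof (rule tendstoI)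
  fix e :: real assume e: "e > 0"
  obtain d where d: "d > 0" "\<And>s. s \<in> {0..T} \<Longrightarrow> \<bar>s - t\<bar> \<le> d \<Longrightarrow> p (X s - X t) \<le> e / 2"
    using X_near[OF t, of "e / 2"] e by auto
  have Xt: "X t \<in> W" using t by (rule X_mem)
  have le: "p ((1 / (s - t)) *\<^sub>R (Z s - Z t) - X t) \<le> e / 2" if s: "s \<in> {0..T}" "s \<noteq> t" "\<bar>s - t\<bar> \<le> d" for s
  proof -
    have ZZ: "Z s \<in> W" "Z t \<in> W" using s t by (auto intro: Z_mem)
    have *: "p ((1 / (b - a)) *\<^sub>R (Z b - Z a) - X t) \<le> e / 2"
      if ab: "0 \<le> a" "a < b" "b \<le> T" "\<And>\<sigma>. \<sigma> \<in> {a..b} \<Longrightarrow> \<bar>\<sigma> - t\<bar> \<le> d" for a b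
    proof -
      have "p (Z b - Z a - (b - a) *\<^sub>R X t) \<le> (b - a) * (e / 2)"
        using ab d e by (intro Z_diff_le Xt) auto
      then have "p ((1 / (b - a)) *\<^sub>R (Z b - Z a - (b - a) *\<^sub>R X t)) \<le> e / 2"
        using ab Xt Z_mem by (subst nrm_scale) (auto simp: mem field_simps)
      moreover have "(1 / (b - a)) *\<^sub>R (Z b - Z a - (b - a) *\<^sub>R X t) = (1 / (b - a)) *\<^sub>R (Z b - Z a) - X t"
        using ab by (simp add: scaleR_diff_right)
      ultimately show ?thesis by simp
    qed
    show ?thesis
    proof (cases "t < s")
      case True then show ?thesis using *[of t s] s t by auto
    next
      case False
      have "1 / (s - t) = - (1 / (t - s))" by (metis minus_diff_eq minus_divide_right)
      then have eq: "(1 / (s - t)) *\<^sub>R (Z s - Z t) = (1 / (t - s)) *\<^sub>R (Z t - Z s)"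
        by (simp only: scaleR_minus_left scaleR_diff_right) simp
      show ?thesis unfolding eq using False *[of s t] s t by auto
    qed
  qed
  have nonneg_p: "0 \<le> p ((1 / (s - t)) *\<^sub>R (Z s - Z t) - X t)" if "s \<in> {0..T}" for s
    using that t Xt by (intro nrm_nonneg mem Z_mem) auto
  show "\<forall>\<^sub>F s in at t within {0..T}. dist (p ((1 / (s - t)) *\<^sub>R (Z s - Z t) - X t)) 0 < e"
    unfolding eventually_at
  proof (intro exI[of _ d] conjI ballI impI)
    fix s assume s: "s \<in> {0..T}" "s \<noteq> t \<and> dist s t < d"
    have "p ((1 / (s - t)) *\<^sub>R (Z s - Z t) - X t) \<le> e / 2"
      using s by (intro le) (auto simp: dist_real_def)
    then show "dist (p ((1 / (s - t)) *\<^sub>R (Z s - Z t) - X t)) 0 < e"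
      using nonneg_p[OF s(1)] e by (simp add: dist_real_def)
  qed (rule d(1))
qed

section \<open>Steklov averages\<close>

text \<open>
  Difference quotients of the primitives \<open>Z\<close> and \<open>\<Phi>\<close> are the Steklov averages of \<open>X\<close> and \<open>F\<close> over
  \<open>[t, t + h]\<close>.
\<close>

definition avg :: "(real \<Rightarrow> 'a) \<Rightarrow> real \<Rightarrow> real \<Rightarrow> 'a" where
  "avg x h t = (1 / h) *\<^sub>R (x (t + h) - x t)"

abbreviation "Y \<equiv> avg Z"

lemma avg_path:
  assumes x: "path_on {0..T} x" and h: "0 < h" "b + h \<le> T"
  shows "path_on {0..b} (avg x h)"
proof -
  have "path_on {0..b} (\<lambda>t. x (t + h))"
    using path_on_subset[OF path_on_shift[OF x, of h], of "{0..b}"] h by auto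
  moreover have "path_on {0..b} x" using h by (intro path_on_subset[OF x]) auto
  ultimately show ?thesis unfolding avg_def[abs_def] by (intro path_on_scale path_on_diff)
qed

lemma avg_mem: "path_on {0..T} x \<Longrightarrow> 0 < h \<Longrightarrow> 0 \<le> t \<Longrightarrow> t + h \<le> T \<Longrightarrow> avg x h t \<in> W"
  using avg_path[of x h t] by (auto simp: path_on_def)

lemma functional_Y:
  assumes L: "bounded_functional L" and h: "0 < h" "0 \<le> t" "t + h \<le> T"
  shows "L (Y h t) = (1 / h) * integral {t..t+h} (\<lambda>s. L (X s))"
proof -
  have "L (Y h t) = (1 / h) * L (Z (t + h) - Z t)"
    unfolding avg_def using h by (intro functional_scale[OF L] mem Z_mem) auto
  then show ?thesis using h by (simp add: functional_Z_diff[OF L])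
qed

text \<open>
  The averages lie in the domain because the primitive does, at both ends of the interval.
\<close>

lemma Y_generator:
  assumes h: "0 < h" "0 \<le> t" "t + h < T"
  shows "Y h t \<in> D" and "p (A (Y h t) - (avg X h t - avg \<Phi> h t)) = 0"
proof -
  let ?v = "\<lambda>t r. (1 / r) *\<^sub>R (S r (Z t) - Z t) - (X t - X 0 - \<Phi> t)"
  let ?y = "avg X h t - avg \<Phi> h t"
  have Ym: "Y h t \<in> W" using h by (intro avg_mem Z_path) auto
  have ym: "?y \<in> W" using h by (intro mem avg_mem X_path \<Phi>_path) auto
  have "((\<lambda>r. p (?v (t + h) r)) \<longlongrightarrow> 0) (at_right 0)" "((\<lambda>r. p (?v t r)) \<longlongrightarrow> 0) (at_right 0)"
    using h by (auto intro!: Z_generator_limit)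
  then have "((\<lambda>r. (1 / h) * (p (?v (t + h) r) + p (?v t r))) \<longlongrightarrow> (1 / h) * (0 + 0)) (at_right 0)"
    by (intro tendsto_intros)
  then have lim: "((\<lambda>r. (1 / h) * (p (?v (t + h) r) + p (?v t r))) \<longlongrightarrow> 0) (at_right 0)" by simp
  have "((\<lambda>r. p ((1 / r) *\<^sub>R (S r (Y h t) - Y h t) - ?y)) \<longlongrightarrow> 0) (at_right 0)"
  proof (rule tendsto_sandwich[OF _ _ tendsto_const lim])
    show "\<forall>\<^sub>F r in at_right 0. 0 \<le> p ((1 / r) *\<^sub>R (S r (Y h t) - Y h t) - ?y)"
      unfolding eventually_at_right_field
      by (intro exI[of _ 1]) (auto intro!: nrm_nonneg mem S_mem Ym ym)
    have "p ((1 / r) *\<^sub>R (S r (Y h t) - Y h t) - ?y) \<le> (1 / h) * (p (?v (t + h) r) + p (?v t r))" if r: "0 < r" for r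
    proof -
      have Zm: "Z (t + h) \<in> W" "Z t \<in> W" using h by (auto intro!: Z_mem)
      have Xm: "X (t + h) \<in> W" "X t \<in> W" "X 0 \<in> W" "\<Phi> (t + h) \<in> W" "\<Phi> t \<in> W" using h T_pos by (auto intro!: X_mem \<Phi>_mem)
      have vm: "?v (t + h) r \<in> W" "?v t r \<in> W" using r Zm Xm by (auto intro!: mem S_mem)
      define n where "n = S r ((1/h) *\<^sub>R Z (t + h) + (-(1/h)) *\<^sub>R Z t) - ((1/h) *\<^sub>R S r (Z (t + h)) + (-(1/h)) *\<^sub>R S r (Z t))"
      have n: "n \<in> W" "p n = 0"
        unfolding n_def using r Zm by (intro mem S_mem S_linear; simp)+
      have Yeq: "Y h t = (1/h) *\<^sub>R Z (t + h) + (-(1/h)) *\<^sub>R Z t"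
        by (simp add: avg_def scaleR_diff_right)
      have "(1 / r) *\<^sub>R (S r (Y h t) - Y h t) - ?y = (1 / r) *\<^sub>R n + (1 / h) *\<^sub>R (?v (t + h) r - ?v t r)"
        unfolding Yeq n_def by (simp add: avg_def algebra_simps)
      then have "p ((1 / r) *\<^sub>R (S r (Y h t) - Y h t) - ?y) = p ((1 / r) *\<^sub>R n + (1 / h) *\<^sub>R (?v (t + h) r - ?v t r))"
        by (rule arg_cong)
      also have "\<dots> \<le> p ((1 / r) *\<^sub>R n) + p ((1 / h) *\<^sub>R (?v (t + h) r - ?v t r))"
        by (rule nrm_triangle[OF scale_mem[OF n(1)] scale_mem[OF diff_mem[OF vm]]])
      also have "\<dots> = (1 / h) * p (?v (t + h) r - ?v t r)"
      proof -
        define v where "v = ?v (t + h) r - ?v t r"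
        have v: "v \<in> W" unfolding v_def by (rule diff_mem[OF vm])
        have "p ((1 / r) *\<^sub>R n) + p ((1 / h) *\<^sub>R v) = (1 / h) * p v"
          using n v h by (simp add: nrm_scale)
        then show ?thesis unfolding v_def .
      qed
      also have "\<dots> \<le> (1 / h) * (p (?v (t + h) r) + p (?v t r))"
        using h by (intro mult_left_mono nrm_diff_triangle vm) auto
      finally show ?thesis .
    qed
    then show "\<forall>\<^sub>F r in at_right 0. p ((1 / r) *\<^sub>R (S r (Y h t) - Y h t) - ?y)
        \<le> (1 / h) * (p (?v (t + h) r) + p (?v t r))"
      unfolding eventually_at_right_field by (intro exI[of _ 1]) auto
  qed
  then have "Y h t \<in> D \<and> p (A (Y h t) - ?y) = 0"
    using generator Ym ym unfolding is_generator_def by blast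
  then show "Y h t \<in> D" "p (A (Y h t) - ?y) = 0" by auto
qed

lemma A_mem: "x \<in> D \<Longrightarrow> A x \<in> W"
  using generator unfolding is_generator_def by auto

definition dissipation :: "'a \<Rightarrow> real" where "dissipation x = - B (A x) x"

lemma dissipation_Y:
  assumes h: "0 < h" "0 \<le> t" "t + h < T"
  shows "dissipation (Y h t) = B (avg \<Phi> h t) (Y h t) - B (avg X h t) (Y h t)"
proof -
  have m: "Y h t \<in> W" "avg X h t \<in> W" "avg \<Phi> h t \<in> W"
    using h by (auto intro!: avg_mem X_path Z_path \<Phi>_path)
  have "B (A (Y h t)) (Y h t) = B (avg X h t - avg \<Phi> h t) (Y h t)"
    using Y_generator[OF h] m by (intro null_left A_mem mem)
  then show ?thesis using m by (simp add: dissipation_def diff_left)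
qed

lemma Y_energy_derivative:
  assumes h: "0 < h" "0 \<le> b" "b + h < T" and t: "t \<in> {0..b}"
  shows "((\<lambda>t. B (Y h t) (Y h t)) has_real_derivative 2 * B (avg X h t) (Y h t)) (at t within {0..b})"
proof (rule inner_path_derivative[OF avg_path[OF Z_path] t])
  show "avg X h t \<in> W" using h t by (intro avg_mem X_path) auto
  let ?F = "at t within {0..b}"
  let ?q = "\<lambda>t s. (1 / (s - t)) *\<^sub>R (Z s - Z t) - X t"
  have "((\<lambda>s. p (?q t s)) \<longlongrightarrow> 0) ?F"
    using h t by (intro tendsto_within_subset[OF Z_derivative]) auto
  moreover have "((\<lambda>s. p (?q (t + h) (s + h))) \<longlongrightarrow> 0) ?F"
  proof -
    have shift: "filterlim (\<lambda>s. s + h) (at (t + h) within {0..T}) ?F"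
      unfolding filterlim_at
    proof
      show "\<forall>\<^sub>F s in ?F. s + h \<in> {0..T} \<and> s + h \<noteq> t + h"
        unfolding eventually_at_filter using h by (intro always_eventually) auto
      show "((\<lambda>s. s + h) \<longlongrightarrow> t + h) ?F" by (intro tendsto_intros)
    qed
    have lim: "((\<lambda>s. p (?q (t + h) s)) \<longlongrightarrow> 0) (at (t + h) within {0..T})"
      using h t by (intro Z_derivative) auto
    show ?thesis using filterlim_compose[OF lim shift] .
  qed
  ultimately have "((\<lambda>s. (1 / h) * (p (?q (t + h) (s + h)) + p (?q t s))) \<longlongrightarrow> (1 / h) * (0 + 0)) ?F"
    by (intro tendsto_intros)
  then have lim: "((\<lambda>s. (1 / h) * (p (?q (t + h) (s + h)) + p (?q t s))) \<longlongrightarrow> 0) ?F" by simp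
  show "((\<lambda>s. p ((1 / (s - t)) *\<^sub>R (Y h s - Y h t) - avg X h t)) \<longlongrightarrow> 0) ?F"
  proof (rule tendsto_sandwich[OF _ _ tendsto_const lim])
    show "\<forall>\<^sub>F s in ?F. 0 \<le> p ((1 / (s - t)) *\<^sub>R (Y h s - Y h t) - avg X h t)"
      using h t by (intro eventually_at_within_mem nrm_nonneg mem avg_mem Z_path X_path) auto
    have "p ((1 / (s - t)) *\<^sub>R (Y h s - Y h t) - avg X h t) \<le> (1 / h) * (p (?q (t + h) (s + h)) + p (?q t s))"
      if s: "s \<in> {0..b}" for s
    proof -
      have m: "?q (t + h) (s + h) \<in> W" "?q t s \<in> W" using s t h by (auto intro!: mem X_mem Z_mem)
      have "(1 / (s - t)) *\<^sub>R (Y h s - Y h t) - avg X h t = (1 / h) *\<^sub>R (?q (t + h) (s + h) - ?q t s)"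
        by (simp add: avg_def algebra_simps)
      then have "p ((1 / (s - t)) *\<^sub>R (Y h s - Y h t) - avg X h t) = p ((1 / h) *\<^sub>R (?q (t + h) (s + h) - ?q t s))"
        by (rule arg_cong)
      also have "\<dots> = (1 / h) * p (?q (t + h) (s + h) - ?q t s)"
      proof -
        have "\<bar>1 / h\<bar> = 1 / h" using h by simp
        then show ?thesis using nrm_scale[OF diff_mem[OF m], of "1 / h"] by (simp only:)
      qed
      also have "\<dots> \<le> (1 / h) * (p (?q (t + h) (s + h)) + p (?q t s))"
        using h by (intro mult_left_mono nrm_diff_triangle m) auto
      finally show ?thesis .
    qed
    then show "\<forall>\<^sub>F s in ?F. p ((1 / (s - t)) *\<^sub>R (Y h s - Y h t) - avg X h t)
        \<le> (1 / h) * (p (?q (t + h) (s + h)) + p (?q t s))"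
      by (rule eventually_at_within_mem)
  qed
qed (use h in auto)

text \<open>
  Jensen's inequality, obtained by pairing the average with itself.
\<close>

lemma avg_\<Phi>_sq_le:
  assumes h: "0 < h" "0 \<le> t" "t + h \<le> T"
  shows "(p (avg \<Phi> h t))\<^sup>2 \<le> (1 / h) * (F_energy (t + h) - F_energy t)"
proof -
  let ?w = "avg \<Phi> h t"
  have w: "?w \<in> W" using h by (intro avg_mem \<Phi>_path) auto
  have L: "bounded_functional (\<lambda>x. B x ?w)" by (rule bounded_functional_inner[OF w])
  have sub: "{t..t+h} \<subseteq> {0..T}" using h by auto
  have "(p ?w)\<^sup>2 = B ?w ?w" by (rule nrm_sq[OF w])
  also have "\<dots> = B ((1 / h) *\<^sub>R (\<Phi> (t + h) - \<Phi> t)) ?w" by (simp add: avg_def)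
  also have "\<dots> = (1 / h) * B (\<Phi> (t + h) - \<Phi> t) ?w"
    using h by (intro scale_left[OF _ w] diff_mem \<Phi>_mem) auto
  also have "B (\<Phi> (t + h) - \<Phi> t) ?w = integral {t..t+h} (\<lambda>s. B (F s) ?w)"
    using functional_\<Phi>_diff[OF L, of t "t + h"] h by simp
  also have "(1 / h) * \<dots> \<le> (1 / h) * integral {t..t+h} (\<lambda>s. ((p (F s))\<^sup>2 + (p ?w)\<^sup>2) / 2)"
  proof (intro mult_left_mono integral_le)
    show "(\<lambda>s. B (F s) ?w) integrable_on {t..t+h}"
      by (rule integrable_subinterval_real[OF functional_F_integrable[OF L] sub])
    show "(\<lambda>s. ((p (F s))\<^sup>2 + (p ?w)\<^sup>2) / 2) integrable_on {t..t+h}"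
      by (intro integrable_on_divide integrable_add integrable_const_ivl integrable_subinterval_real[OF int_F_sq sub])
    fix s
    have "0 \<le> (p (F s) - p ?w)\<^sup>2" by simp
    then have "p (F s) * p ?w \<le> ((p (F s))\<^sup>2 + (p ?w)\<^sup>2) / 2" by (simp add: power2_diff)
    then show "B (F s) ?w \<le> ((p (F s))\<^sup>2 + (p ?w)\<^sup>2) / 2"
      using Cauchy_Schwarz[OF F_mem w, of s] by linarith
  qed (use h in auto)
  also have "integral {t..t+h} (\<lambda>s. ((p (F s))\<^sup>2 + (p ?w)\<^sup>2) / 2) =
      (F_energy (t + h) - F_energy t) / 2 + h * (p ?w)\<^sup>2 / 2"
  proof -
    have "integral {t..t+h} (\<lambda>s. (p (F s))\<^sup>2 + (p ?w)\<^sup>2) =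
        integral {t..t+h} (\<lambda>s. (p (F s))\<^sup>2) + integral {t..t+h} (\<lambda>s. (p ?w)\<^sup>2)"
      by (intro Henstock_Kurzweil_Integration.integral_add integrable_subinterval_real[OF int_F_sq sub]
          integrable_const_ivl)
    then have "integral {t..t+h} (\<lambda>s. (p (F s))\<^sup>2 + (p ?w)\<^sup>2) / 2 =
        (F_energy (t + h) - F_energy t + h * (p ?w)\<^sup>2) / 2"
      using h by (simp add: F_energy_diff)
    then show ?thesis
      unfolding Henstock_Kurzweil_Integration.integral_divide by (simp only: add_divide_distrib)
  qed
  finally have "(p ?w)\<^sup>2 \<le> (1 / h) * (F_energy (t + h) - F_energy t) / 2 + (p ?w)\<^sup>2 / 2"
    using h by (simp add: field_simps)
  then show ?thesis by simp
qed

text \<open>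
  Averaging does not increase the energy, as every time enters the averages with total weight at
  most one.
\<close>

lemma avg_\<Phi>_energy:
  assumes h: "0 < h" "0 \<le> b" "b + h \<le> T"
  shows "integral {0..b} (\<lambda>t. (p (avg \<Phi> h t))\<^sup>2) \<le> F_energy T"
proof -
  have int: "F_energy integrable_on {c..d}" if "0 \<le> c" "d \<le> T" for c d
    using that by (intro integrable_continuous_real continuous_on_subset[OF F_energy_continuous]) auto
  have int_shift: "(\<lambda>s. F_energy (s + h)) integrable_on {0..b}"
    using integrable_shift_real_ivl[of F_energy h "b + h" h] int[of h "b + h"] h by simp
  have "integral {0..b} (\<lambda>t. (p (avg \<Phi> h t))\<^sup>2) \<le> integral {0..b} (\<lambda>t. (1 / h) * (F_energy (t + h) - F_energy t))"
  proof (rule integral_le)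
    show "(\<lambda>t. (p (avg \<Phi> h t))\<^sup>2) integrable_on {0..b}"
      using h by (intro integrable_continuous_real continuous_intros path_on_nrm avg_path \<Phi>_path) auto
    show "(\<lambda>t. (1 / h) * (F_energy (t + h) - F_energy t)) integrable_on {0..b}"
      using h by (intro integrable_on_mult_right integrable_diff int_shift int) auto
    show "(p (avg \<Phi> h t))\<^sup>2 \<le> (1 / h) * (F_energy (t + h) - F_energy t)" if "t \<in> {0..b}" for t
      using h that by (intro avg_\<Phi>_sq_le) auto
  qed
  also have "\<dots> = (1 / h) * (integral {b..b+h} F_energy - integral {0..h} F_energy)"
    using integral_shift_difference[OF F_energy_continuous, of b h] h by simp
  also have "\<dots> \<le> (1 / h) * (h * F_energy T)"
  proof (intro mult_left_mono)
    have "integral {b..b+h} F_energy \<le> (b + h - b) * F_energy T"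
      using h by (intro integral_le_const int F_energy_mono) auto
    moreover have "0 \<le> integral {0..h} F_energy"
      using h F_energy_mono[of 0] by (intro Henstock_Kurzweil_Integration.integral_nonneg int) (auto simp: F_energy_0)
    ultimately show "integral {b..b+h} F_energy - integral {0..h} F_energy \<le> h * F_energy T" by simp
  qed (use h in simp)
  finally show ?thesis using h by simp
qed

text \<open>
  The derivative of \<open>exp (- t) * G t\<close> is at most \<open>f t\<close>.
\<close>

lemma Gronwall_smooth:
  fixes G G' f :: "real \<Rightarrow> real"
  assumes b: "0 \<le> b" and G: "\<And>t. t \<in> {0..b} \<Longrightarrow> (G has_real_derivative G' t) (at t within {0..b})"
    and f: "f integrable_on {0..b}" "\<And>t. t \<in> {0..b} \<Longrightarrow> 0 \<le> f t"
    and le: "\<And>t. t \<in> {0..b} \<Longrightarrow> G' t \<le> f t + G t"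
  shows "G b \<le> exp b * (G 0 + integral {0..b} f)"
proof -
  have "((\<lambda>t. exp (- t) * (G' t - G t)) has_integral (exp (- b) * G b - exp (- 0) * G 0)) {0..b}"
  proof (rule fundamental_theorem_of_calculus[OF b])
    fix t assume t: "t \<in> {0..b}"
    have "((\<lambda>t. exp (- t) * G t) has_real_derivative exp (- t) * (G' t - G t)) (at t within {0..b})"
      by (rule derivative_eq_intros G[OF t] refl)+ (simp add: algebra_simps)
    then show "((\<lambda>t. exp (- t) * G t) has_vector_derivative exp (- t) * (G' t - G t)) (at t within {0..b})"
      by (simp add: has_real_derivative_iff_has_vector_derivative)
  qed
  then have "exp (- b) * G b - exp (- 0) * G 0 \<le> integral {0..b} f"
  proof (rule has_integral_le[OF _ integrable_integral[OF f(1)]])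
    fix t assume t: "t \<in> {0..b}"
    have "exp (- t) * (G' t - G t) \<le> exp (- t) * f t"
      using le[OF t] by (intro mult_left_mono) auto
    also have "\<dots> \<le> 1 * f t" using f(2)[OF t] t by (intro mult_right_mono) auto
    finally show "exp (- t) * (G' t - G t) \<le> f t" by simp
  qed
  then have "exp b * (exp (- b) * G b) \<le> exp b * (G 0 + integral {0..b} f)"
    by (intro mult_left_mono) auto
  then show ?thesis by (simp flip: mult.assoc exp_add)
qed

text \<open>
  The averages satisfy the energy identity in the classical sense.  Young's inequality
  \<open>2 * B F Y \<le> (p F)\<^sup>2 + (p Y)\<^sup>2\<close> and Gronwall's inequality bound the energy when the dissipation is
  dropped; integrating the identity and inserting this bound controls the dissipation.
\<close>

lemma Y_energy:
  assumes h: "0 < h" "0 \<le> b" "b + h < T"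
  defines "K \<equiv> (p (Y h 0))\<^sup>2 + F_energy T"
  shows "(p (Y h b))\<^sup>2 \<le> exp b * K"
    and "continuous_on {0..b} (\<lambda>t. dissipation (Y h t))"
    and "2 * integral {0..b} (\<lambda>t. dissipation (Y h t)) \<le> K * (1 + T * exp T)"
proof -
  let ?G = "\<lambda>t. B (Y h t) (Y h t)" and ?e = "\<lambda>t. (p (avg \<Phi> h t))\<^sup>2"
  let ?f = "\<lambda>t. B (avg \<Phi> h t) (Y h t)" and ?g = "\<lambda>t. B (avg X h t) (Y h t)"
  have paths: "path_on {0..c} (Y h)" "path_on {0..c} (avg X h)" "path_on {0..c} (avg \<Phi> h)" if "c \<le> b" for c
    using h that by (auto intro!: avg_path Z_path X_path \<Phi>_path)
  have m: "Y h t \<in> W" "avg X h t \<in> W" "avg \<Phi> h t \<in> W" if "t \<in> {0..b}" for t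
    using paths[of b] that by (auto simp: path_on_def)
  have Gp: "?G t = (p (Y h t))\<^sup>2" if "t \<in> {0..b}" for t
    using m[OF that] by (simp add: nrm_sq)
  have diss: "dissipation (Y h t) = ?f t - ?g t" if "t \<in> {0..b}" for t
    using h that by (intro dissipation_Y) auto
  have "continuous_on {0..b} (\<lambda>t. ?f t - ?g t)"
    by (intro continuous_intros continuous_on_inner paths) auto
  also have "?this \<longleftrightarrow> continuous_on {0..b} (\<lambda>t. dissipation (Y h t))"
    by (intro continuous_on_cong) (use diss in auto)
  finally show cont_d: "continuous_on {0..b} (\<lambda>t. dissipation (Y h t))" .
  have d_nonneg: "0 \<le> dissipation (Y h t)" if "t \<in> {0..b}" for t
    using dissipative[OF Y_generator(1)[of h t]] h that by (simp add: dissipation_def)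
  have two_f: "2 * ?f t \<le> ?e t + ?G t" if t: "t \<in> {0..b}" for t
  proof -
    have "0 \<le> (p (avg \<Phi> h t) - p (Y h t))\<^sup>2" by simp
    then have "2 * (p (avg \<Phi> h t) * p (Y h t)) \<le> ?e t + (p (Y h t))\<^sup>2" by (simp add: power2_diff)
    then show ?thesis using Cauchy_Schwarz[of "avg \<Phi> h t" "Y h t"] m[OF t] Gp[OF t] by simp
  qed
  have e_int: "?e integrable_on {0..c}" if "c \<le> b" for c
    using that by (intro integrable_continuous_real continuous_intros path_on_nrm paths)
  have G_le: "?G c \<le> exp c * K" if c: "0 \<le> c" "c \<le> b" for c
  proof -
    have "?G c \<le> exp c * (?G 0 + integral {0..c} ?e)"
    proof (rule Gronwall_smooth[where G' = "\<lambda>t. 2 * ?g t"])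
      show "(?G has_real_derivative 2 * ?g t) (at t within {0..c})" if "t \<in> {0..c}" for t
        using h c that by (intro Y_energy_derivative) auto
      show "2 * ?g t \<le> ?e t + ?G t" if "t \<in> {0..c}" for t
        using two_f[of t] d_nonneg[of t] diss[of t] that c by auto
    qed (use c e_int in auto)
    also have "\<dots> \<le> exp c * K"
      unfolding K_def using avg_\<Phi>_energy[of h c] h c Gp[of 0] by (intro mult_left_mono) auto
    finally show ?thesis .
  qed
  then show "(p (Y h b))\<^sup>2 \<le> exp b * K" using G_le[of b] h Gp[of b] by auto
  have K: "0 \<le> K" unfolding K_def using F_energy_mono[of 0 T] T_pos by (simp add: F_energy_0)
  have f_int: "?f integrable_on {0..b}" and g_int: "?g integrable_on {0..b}" and G_int: "?G integrable_on {0..b}"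
    by (intro integrable_continuous_real continuous_on_inner paths order_refl)+
  have "((\<lambda>t. 2 * ?g t) has_integral (?G b - ?G 0)) {0..b}"
    using h by (intro fundamental_theorem_of_calculus)
      (auto intro!: Y_energy_derivative simp flip: has_real_derivative_iff_has_vector_derivative)
  then have g_eq: "2 * integral {0..b} ?g = ?G b - ?G 0"
    using g_int by (simp add: integral_unique flip: Henstock_Kurzweil_Integration.integral_mult_right)
  have "integral {0..b} (\<lambda>t. dissipation (Y h t)) = integral {0..b} (\<lambda>t. ?f t - ?g t)"
    by (intro Henstock_Kurzweil_Integration.integral_cong diss)
  then have d_eq: "2 * integral {0..b} (\<lambda>t. dissipation (Y h t)) =
      integral {0..b} (\<lambda>t. 2 * ?f t) - (?G b - ?G 0)"
    using f_int g_int g_eq by (simp add: Henstock_Kurzweil_Integration.integral_diff)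
  have f_le: "integral {0..b} (\<lambda>t. 2 * ?f t) \<le> integral {0..b} (\<lambda>t. ?e t + ?G t)"
    using f_int G_int e_int two_f by (intro integral_le integrable_on_mult_right integrable_add) auto
  have eG: "integral {0..b} (\<lambda>t. ?e t + ?G t) = integral {0..b} ?e + integral {0..b} ?G"
    using e_int G_int by (intro Henstock_Kurzweil_Integration.integral_add) auto
  have e_le: "integral {0..b} ?e \<le> F_energy T" using h by (intro avg_\<Phi>_energy) auto
  have "integral {0..b} ?G \<le> (b - 0) * (exp T * K)"
  proof (rule integral_le_const[OF G_int])
    fix t assume t: "t \<in> {0..b}"
    have "exp t * K \<le> exp T * K" using t h K by (intro mult_right_mono) auto
    then show "?G t \<le> exp T * K" using G_le[of t] t by auto
  qed (use h in auto)
  moreover have "(b - 0) * (exp T * K) \<le> T * (exp T * K)" using h K by (intro mult_right_mono) auto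
  ultimately have "2 * integral {0..b} (\<lambda>t. dissipation (Y h t)) \<le> F_energy T + T * (exp T * K) - (?G b - ?G 0)"
    using d_eq f_le eG e_le by linarith
  moreover have "0 \<le> ?G b" using m[of b] h by (intro nonneg) auto
  ultimately show "2 * integral {0..b} (\<lambda>t. dissipation (Y h t)) \<le> K * (1 + T * exp T)"
    using Gp[of 0] h by (simp add: K_def algebra_simps)
qed

section \<open>Removing the averages\<close>

lemma Y_near:
  assumes h: "0 < h" "0 \<le> t" "t + h \<le> T" and e: "0 \<le> e" and near: "\<And>s. s \<in> {t..t+h} \<Longrightarrow> p (X s - X t) \<le> e"
  shows "p (Y h t - X t) \<le> e"
proof -
  have Xt: "X t \<in> W" using h by (intro X_mem) auto
  have m: "Z (t + h) - Z t - h *\<^sub>R X t \<in> W" using h Xt by (intro mem Z_mem) auto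
  have "p (Z (t + h) - Z t - h *\<^sub>R X t) \<le> h * e"
    using Z_diff_le[OF Xt, of t "t + h" e] h e near by simp
  then have "(1 / h) * p (Z (t + h) - Z t - h *\<^sub>R X t) \<le> e" using h by (simp add: field_simps)
  moreover have "Y h t - X t = (1 / h) *\<^sub>R (Z (t + h) - Z t - h *\<^sub>R X t)"
    using h by (simp add: avg_def scaleR_diff_right)
  ultimately show ?thesis using nrm_scale[OF m, of "1 / h"] h by simp
qed

lemma Y_tendsto:
  assumes t: "0 \<le> t" "t < T" and h: "\<And>n. 0 < h n" "h \<longlonglongrightarrow> 0"
  shows "(\<lambda>n. p (Y (h n) t - X t)) \<longlonglongrightarrow> 0"
proof (rule tendstoI)
  fix e :: real assume e: "e > 0"
  obtain d where d: "d > 0" "\<And>s. s \<in> {0..T} \<Longrightarrow> \<bar>s - t\<bar> \<le> d \<Longrightarrow> p (X s - X t) \<le> e / 2"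
    using X_near[of t "e / 2"] t e by auto
  have "eventually (\<lambda>n. h n < min d (T - t)) sequentially"
    using h(2) d(1) t by (intro order_tendstoD(2)) auto
  then show "\<forall>\<^sub>F n in sequentially. dist (p (Y (h n) t - X t)) 0 < e"
  proof eventually_elim
    case (elim n)
    have "p (Y (h n) t - X t) \<le> e / 2"
      using elim h(1)[of n] t e d(2) by (intro Y_near) auto
    moreover have "0 \<le> p (Y (h n) t - X t)"
      using elim h(1)[of n] t by (intro nrm_nonneg mem X_mem avg_mem Z_path) auto
    ultimately show ?case using e by (simp add: dist_real_def)
  qed
qed

lemma Y_nrm_tendsto:
  assumes t: "0 \<le> t" "t < T" and h: "\<And>n. 0 < h n" "h \<longlonglongrightarrow> 0"
  shows "(\<lambda>n. (p (Y (h n) t))\<^sup>2) \<longlonglongrightarrow> (p (X t))\<^sup>2"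
proof -
  have "eventually (\<lambda>n. h n < T - t) sequentially"
    using h(2) t by (intro order_tendstoD(2)) auto
  then have "\<forall>\<^sub>F n in sequentially. norm (p (Y (h n) t) - p (X t)) \<le> p (Y (h n) t - X t)"
  proof eventually_elim
    case (elim n)
    have "Y (h n) t \<in> W" using elim h(1)[of n] t by (intro avg_mem Z_path) auto
    then show ?case using nrm_abs_diff[of "Y (h n) t" "X t"] X_mem t by simp
  qed
  then have "(\<lambda>n. p (Y (h n) t) - p (X t)) \<longlonglongrightarrow> 0"
    using Y_tendsto[OF t h] by (rule Lim_null_comparison)
  then show ?thesis by (intro tendsto_power) (simp add: LIM_zero_iff)
qed

lemma nrm_X_zero: "p (X 0) = p x0"
  using X_zero X_mem[of 0] x0_mem T_pos by (intro nrm_diff_null) auto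

lemma F_energy_nonneg: "0 \<le> F_energy T"
  using F_energy_mono[of 0 T] T_pos by (simp add: F_energy_0)

text \<open>
  The averages look forward in time, so they approximate the solution only before \<open>T\<close>; the final
  time is reached by continuity.
\<close>

theorem mild_energy_bound:
  assumes t: "t \<in> {0..T}"
  shows "(p (X t))\<^sup>2 \<le> exp T * ((p x0)\<^sup>2 + F_energy T)"
proof -
  have *: "(p (X t))\<^sup>2 \<le> exp T * ((p x0)\<^sup>2 + F_energy T)" if t: "t \<in> {0..<T}" for t
  proof (rule tendsto_le)
    let ?h = "\<lambda>n. (T - t) * inverse (real (Suc n)) / 2"
    have h: "\<And>n. 0 < ?h n" "?h \<longlonglongrightarrow> 0"
    proof -
      have "?h \<longlonglongrightarrow> (T - t) * 0 / 2" by (intro tendsto_intros LIMSEQ_inverse_real_of_nat) auto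
      then show "?h \<longlonglongrightarrow> 0" by simp
    qed (use t in simp)
    have hle: "t + ?h n < T" for n
    proof -
      have "inverse (real (Suc n)) \<le> 1" by (simp add: inverse_le_1_iff)
      then have "(T - t) * inverse (real (Suc n)) \<le> (T - t) * 1" using t by (intro mult_left_mono) auto
      moreover define a where "a = (T - t) * inverse (real (Suc n))"
      ultimately have "a \<le> T - t" by (simp only: mult_1_right)
      then have "t + a / 2 < T" using t by (simp add: field_simps)
      then show ?thesis unfolding a_def .
    qed
    show "(\<lambda>n. (p (Y (?h n) t))\<^sup>2) \<longlonglongrightarrow> (p (X t))\<^sup>2" using h t by (intro Y_nrm_tendsto) auto
    show "(\<lambda>n. exp T * ((p (Y (?h n) 0))\<^sup>2 + F_energy T)) \<longlonglongrightarrow> exp T * ((p x0)\<^sup>2 + F_energy T)"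
      unfolding nrm_X_zero[symmetric] using h T_pos by (intro tendsto_intros Y_nrm_tendsto) auto
    show "\<forall>\<^sub>F n in sequentially. (p (Y (?h n) t))\<^sup>2 \<le> exp T * ((p (Y (?h n) 0))\<^sup>2 + F_energy T)"
    proof (intro always_eventually allI)
      fix n
      have "(p (Y (?h n) t))\<^sup>2 \<le> exp t * ((p (Y (?h n) 0))\<^sup>2 + F_energy T)"
        using h(1)[of n] hle[of n] t by (intro Y_energy) auto
      also have "\<dots> \<le> exp T * ((p (Y (?h n) 0))\<^sup>2 + F_energy T)"
        using t F_energy_nonneg by (intro mult_right_mono) auto
      finally show "(p (Y (?h n) t))\<^sup>2 \<le> exp T * ((p (Y (?h n) 0))\<^sup>2 + F_energy T)" .
    qed
  qed simp
  have cl: "closure {0..<T} = {0..T}" using T_pos by simp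
  have "continuous_on (closure {0..<T}) (\<lambda>t. (p (X t))\<^sup>2)"
    unfolding cl by (intro continuous_intros path_on_nrm X_path)
  from continuous_le_on_closure[OF this _ *, of t] show ?thesis
    using t unfolding cl by simp
qed

text \<open>
  The dissipation of the averages is integrable uniformly in the averaging length. By Fatou's lemma
  the bound passes to every function dominated by the lower limit of these dissipations.
\<close>

theorem mild_dissipation_bound:
  assumes h: "\<And>n. 0 < h n" "h \<longlonglongrightarrow> 0"
    and g: "AE t in lebesgue_on {0..T}. t < T \<longrightarrow> g t \<le> liminf (\<lambda>n. ennreal (dissipation (Y (h n) t)))"
  shows "2 * (\<integral>\<^sup>+t. g t \<partial>lebesgue_on {0..T}) \<le> ennreal ((1 + T * exp T) * ((p x0)\<^sup>2 + F_energy T))"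
proof -
  (* averages at time t exist for t + h n < T; the factor 2 keeps this strict up to b n *)
  define b where "b = (\<lambda>n. T - 2 * h n)"
  define \<psi> where "\<psi> = (\<lambda>n t. ennreal (dissipation (Y (h n) t)) * indicator {0..b n} t)"
  define c where "c = (\<lambda>n. (1 + T * exp T) * ((p (Y (h n) 0))\<^sup>2 + F_energy T) / 2)"
  have bT: "b n < T" "b n + h n < T" for n using h(1)[of n] by (simp_all add: b_def)
  have sub: "{0..b n} \<subseteq> {0..T}" for n using bT[of n] by auto
  have cont: "continuous_on {0..b n} (\<lambda>t. dissipation (Y (h n) t))" for n
    using Y_energy(2)[of "h n" "b n"] h(1)[of n] bT[of n] by (cases "0 \<le> b n") auto
  have diss_nonneg: "0 \<le> dissipation (Y (h n) t)" if "t \<in> {0..b n}" for n t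
    using dissipative[OF Y_generator(1)[of "h n" t]] h(1)[of n] bT[of n] that by (simp add: dissipation_def)
  have lim_ind: "liminf (\<lambda>n. ennreal (dissipation (Y (h n) t))) = liminf (\<lambda>n. \<psi> n t)" if t: "t \<in> {0..<T}" for t
  proof (rule Liminf_eq)
    have "eventually (\<lambda>n. h n < (T - t) / 2) sequentially"
      using h(2) t by (intro order_tendstoD(2)) auto
    then show "\<forall>\<^sub>F n in sequentially. ennreal (dissipation (Y (h n) t)) = \<psi> n t"
      by eventually_elim (use t in \<open>auto simp: \<psi>_def b_def\<close>)
  qed
  have meas: "\<psi> n \<in> borel_measurable (lebesgue_on {0..T})" for n
  proof -
    have "(\<lambda>t. dissipation (Y (h n) t)) \<in> borel_measurable (lebesgue_on {0..b n})"
      using cont by (intro continuous_imp_measurable_on_sets_lebesgue) auto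
    then have "(\<lambda>t. ennreal (dissipation (Y (h n) t))) \<in> borel_measurable (lebesgue_on {0..b n})" by measurable
    then have "\<psi> n \<in> borel_measurable lebesgue"
      unfolding \<psi>_def by (subst (asm) borel_measurable_restrict_space_iff_ennreal) auto
    then show ?thesis by (rule measurable_restrict_space1)
  qed
  have bound: "(\<integral>\<^sup>+t. \<psi> n t \<partial>lebesgue_on {0..T}) \<le> ennreal (c n)" for n
  proof (cases "0 \<le> b n")
    case True
    have "(\<integral>\<^sup>+t. \<psi> n t \<partial>lebesgue_on {0..T}) = (\<integral>\<^sup>+t. ennreal (dissipation (Y (h n) t)) \<partial>lebesgue_on {0..b n})"
      unfolding \<psi>_def using sub[of n]
      by (simp add: nn_integral_restrict_space) (auto intro!: nn_integral_cong split: split_indicator)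
    also have "\<dots> = ennreal (integral {0..b n} (\<lambda>t. dissipation (Y (h n) t)))"
      by (intro nn_integral_lebesgue_on_continuous cont diss_nonneg)
    also have "\<dots> \<le> ennreal (c n)"
      using Y_energy(3)[of "h n" "b n"] h(1)[of n] bT[of n] True
      by (intro ennreal_leI) (simp add: c_def mult.commute)
    finally show ?thesis .
  next
    case False
    then have "\<psi> n = (\<lambda>t. 0)" by (auto simp: \<psi>_def fun_eq_iff)
    then show ?thesis by simp
  qed
  have "AE t in lebesgue_on {0..T}. t \<noteq> T"
    by (simp add: AE_restrict_space_iff) (metis (mono_tags, lifting) AE_completion AE_lborel_singleton eventually_mono)
  then have "(\<integral>\<^sup>+t. g t \<partial>lebesgue_on {0..T}) \<le> (\<integral>\<^sup>+t. liminf (\<lambda>n. \<psi> n t) \<partial>lebesgue_on {0..T})"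
    using g AE_space[of "lebesgue_on {0..T}"]
    by (intro nn_integral_mono_AE, eventually_elim) (use lim_ind in fastforce)
  also have "\<dots> \<le> liminf (\<lambda>n. \<integral>\<^sup>+t. \<psi> n t \<partial>lebesgue_on {0..T})"
    by (rule nn_integral_liminf) (rule meas)
  also have "\<dots> \<le> liminf (\<lambda>n. ennreal (c n))"
    by (intro Liminf_mono always_eventually allI bound)
  also have "\<dots> = ennreal ((1 + T * exp T) * ((p (X 0))\<^sup>2 + F_energy T) / 2)"
    unfolding c_def using h T_pos
    by (intro lim_imp_Liminf tendsto_ennrealI tendsto_intros Y_nrm_tendsto) auto
  finally have "2 * (\<integral>\<^sup>+t. g t \<partial>lebesgue_on {0..T}) \<le> 2 * ennreal ((1 + T * exp T) * ((p (X 0))\<^sup>2 + F_energy T) / 2)"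
    by (intro mult_left_mono) auto
  also have "\<dots> = ennreal (2 * ((1 + T * exp T) * ((p (X 0))\<^sup>2 + F_energy T) / 2))"
    using T_pos F_energy_nonneg by (subst ennreal_mult) auto
  finally show ?thesis by (simp add: nrm_X_zero)
qed

end

section \<open>Almost everywhere convergence of Steklov averages\<close>

text \<open>
  Truncating the function costs little.  The pointwise approximation of the truncated function by
  continuous functions can be truncated as well, and then converges boundedly.
\<close>

lemma L1_continuous_approximation:
  fixes \<phi> :: "real \<Rightarrow> real"
  assumes \<phi>: "integrable (lebesgue_on {0..T}) \<phi>" and e: "0 < e"
  obtains g where "continuous_on UNIV g" "integral\<^sup>L (lebesgue_on {0..T}) (\<lambda>t. \<bar>\<phi> t - g t\<bar>) < e"
proof -
  let ?M = "lebesgue_on {0..T}"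
  interpret finite_measure ?M by (rule finite_measure_lebesgue_on_interval)
  define c where "c = (\<lambda>(K::real) x. max (- K) (min K x))"
  have c_meas[measurable]: "c K \<in> borel_measurable borel" for K unfolding c_def by measurable
  have [measurable]: "\<phi> \<in> borel_measurable ?M" using \<phi> by (rule borel_measurable_integrable)
  have "(\<lambda>n. integral\<^sup>L ?M (\<lambda>t. \<bar>\<phi> t - c (real n) (\<phi> t)\<bar>)) \<longlonglongrightarrow> integral\<^sup>L ?M (\<lambda>t. 0)"
  proof (rule integral_dominated_convergence[where w = "\<lambda>t. \<bar>\<phi> t\<bar>"])
    show "integrable ?M (\<lambda>t. \<bar>\<phi> t\<bar>)" using \<phi> by simp
    show "AE t in ?M. (\<lambda>n. \<bar>\<phi> t - c (real n) (\<phi> t)\<bar>) \<longlonglongrightarrow> 0"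
    proof (intro AE_I2)
      fix t
      obtain N where "\<bar>\<phi> t\<bar> \<le> real N" using real_arch_simple by auto
      then have "\<forall>\<^sub>F n in sequentially. \<bar>\<phi> t - c (real n) (\<phi> t)\<bar> = 0"
        unfolding eventually_sequentially by (intro exI[of _ N]) (auto simp: c_def)
      then show "(\<lambda>n. \<bar>\<phi> t - c (real n) (\<phi> t)\<bar>) \<longlonglongrightarrow> 0" by (rule tendsto_eventually)
    qed
    show "AE t in ?M. norm \<bar>\<phi> t - c (real n) (\<phi> t)\<bar> \<le> \<bar>\<phi> t\<bar>" for n
      by (intro AE_I2) (auto simp: c_def)
  qed measurable
  then have "eventually (\<lambda>n. integral\<^sup>L ?M (\<lambda>t. \<bar>\<phi> t - c (real n) (\<phi> t)\<bar>) < e / 2) sequentially"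
    using e by (intro order_tendstoD(2)) auto
  then obtain K where K: "integral\<^sup>L ?M (\<lambda>t. \<bar>\<phi> t - c (real K) (\<phi> t)\<bar>) < e / 2"
    by (auto simp: eventually_sequentially)
  have "\<phi> measurable_on {0..T}" by (simp add: measurable_on_iff_borel_measurable)
  then obtain N g where N: "negligible N" and g: "\<And>n::nat. continuous_on UNIV (g n)"
    "\<And>t. t \<notin> N \<Longrightarrow> (\<lambda>n. g n t) \<longlonglongrightarrow> (if t \<in> {0..T} then \<phi> t else 0)"
    unfolding measurable_on_def by auto
  have cg: "continuous_on UNIV (\<lambda>t. c K (g n t))" for n K
    unfolding c_def by (intro continuous_intros g)
  have [measurable]: "(\<lambda>t. c K (g n t)) \<in> borel_measurable ?M" for n K
    by (intro continuous_imp_measurable_on_sets_lebesgue continuous_on_subset[OF cg]) auto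
  have "AE t in lebesgue. t \<notin> N"
    using N by (simp add: negligible_iff_null_sets AE_not_in)
  then have notN: "AE t in ?M. t \<notin> N" by (simp add: AE_restrict_space_iff) (auto elim: eventually_mono)
  have "(\<lambda>n. integral\<^sup>L ?M (\<lambda>t. \<bar>c (real K) (\<phi> t) - c (real K) (g n t)\<bar>)) \<longlonglongrightarrow> integral\<^sup>L ?M (\<lambda>t. 0)"
  proof (rule integral_dominated_convergence[where w = "\<lambda>t. 2 * real K"])
    show "AE t in ?M. (\<lambda>n. \<bar>c (real K) (\<phi> t) - c (real K) (g n t)\<bar>) \<longlonglongrightarrow> 0"
      using notN AE_space[of ?M]
    proof eventually_elim
      case (elim t)
      then have "(\<lambda>n. g n t) \<longlonglongrightarrow> \<phi> t" using g(2)[of t] by simp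
      then have "(\<lambda>n. c (real K) (\<phi> t) - c (real K) (g n t)) \<longlonglongrightarrow> c (real K) (\<phi> t) - c (real K) (\<phi> t)"
        unfolding c_def by (intro tendsto_intros)
      then show ?case by (simp add: tendsto_rabs_zero_iff)
    qed
    show "AE t in ?M. norm \<bar>c (real K) (\<phi> t) - c (real K) (g n t)\<bar> \<le> 2 * real K" for n
      by (intro AE_I2) (auto simp: c_def)
  qed auto
  then have "eventually (\<lambda>n. integral\<^sup>L ?M (\<lambda>t. \<bar>c (real K) (\<phi> t) - c (real K) (g n t)\<bar>) < e / 2) sequentially"
    using e by (intro order_tendstoD(2)) auto
  then obtain n where n: "integral\<^sup>L ?M (\<lambda>t. \<bar>c (real K) (\<phi> t) - c (real K) (g n t)\<bar>) < e / 2"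
    by (auto simp: eventually_sequentially)
  have int1: "integrable ?M (\<lambda>t. \<bar>\<phi> t - c (real K) (\<phi> t)\<bar>)"
    by (rule Bochner_Integration.integrable_bound[OF \<phi>]) (auto simp: c_def)
  have int2: "integrable ?M (\<lambda>t. \<bar>c (real K) (\<phi> t) - c (real K) (g n t)\<bar>)"
    proof (rule integrable_const_bound[where B = "2 * real K"])
    show "AE t in ?M. norm \<bar>c (real K) (\<phi> t) - c (real K) (g n t)\<bar> \<le> 2 * real K"
      by (intro AE_I2) (auto simp: c_def)
  qed measurable
  have int3: "integrable ?M (\<lambda>t. \<bar>\<phi> t - c (real K) (g n t)\<bar>)"
    by (rule Bochner_Integration.integrable_bound[OF Bochner_Integration.integrable_add[OF int1 int2]]) auto
  have "integral\<^sup>L ?M (\<lambda>t. \<bar>\<phi> t - c (real K) (g n t)\<bar>) \<le>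
      integral\<^sup>L ?M (\<lambda>t. \<bar>\<phi> t - c (real K) (\<phi> t)\<bar> + \<bar>c (real K) (\<phi> t) - c (real K) (g n t)\<bar>)"
    by (intro integral_mono int3 Bochner_Integration.integrable_add int1 int2) auto
  also have "\<dots> < e" using K n int1 int2 by simp
  finally show thesis by (intro that[OF cg])
qed

text \<open>
  The averages of a continuous approximation are uniformly close to it, and averaging the error does
  not increase its integral.
\<close>

lemma Steklov_average_L1:
  fixes \<phi> :: "real \<Rightarrow> real"
  assumes \<phi>: "integrable (lebesgue_on {0..T}) \<phi>" and T: "0 < T" and e: "0 < e"
  shows "\<exists>d>0. \<forall>h. 0 < h \<and> h < d \<and> h < T \<longrightarrow>
    (\<integral>\<^sup>+t. ennreal \<bar>(1 / h) * integral {t..t+h} \<phi> - \<phi> t\<bar> \<partial>lebesgue_on {0..T-h}) \<le> ennreal e"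
proof -
  obtain g where g: "continuous_on UNIV g" "integral\<^sup>L (lebesgue_on {0..T}) (\<lambda>t. \<bar>\<phi> t - g t\<bar>) < e / 4"
    using L1_continuous_approximation[OF \<phi>, of "e / 4"] e by auto
  define \<rho> where "\<rho> = (\<lambda>t. \<bar>\<phi> t - g t\<bar>)"
  have g_int: "integrable (lebesgue_on {0..T}) g"
    by (intro continuous_imp_integrable_real continuous_on_subset[OF g(1)]) auto
  have \<rho>: "integrable (lebesgue_on {0..T}) \<rho>" unfolding \<rho>_def using \<phi> g_int by simp
  have \<rho>_int: "\<rho> integrable_on {0..T}" and \<phi>_int: "\<phi> integrable_on {0..T}"
    using \<rho> \<phi> by (auto intro: integrable_on_lebesgue_on)
  define R where "R = (\<lambda>t. integral {0..t} \<rho>)"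
  have R_cont: "continuous_on {0..T} R" unfolding R_def by (rule indefinite_integral_continuous_1[OF \<rho>_int])
  have R_diff: "R b - R a = integral {a..b} \<rho>" if "0 \<le> a" "a \<le> b" "b \<le> T" for a b
    unfolding R_def using that by (rule integral_antideriv_diff[OF \<rho>_int])
  have \<rho>_sub: "\<rho> integrable_on {a..b}" if "0 \<le> a" "b \<le> T" for a b
    using that by (intro integrable_subinterval_real[OF \<rho>_int]) auto
  have \<rho>_nonneg: "0 \<le> integral {a..b} \<rho>" if "0 \<le> a" "b \<le> T" for a b
    using that by (intro Henstock_Kurzweil_Integration.integral_nonneg \<rho>_sub) (auto simp: \<rho>_def)
  have R_mono: "R a \<le> R b" if "0 \<le> a" "a \<le> b" "b \<le> T" for a b
    using R_diff[OF that] \<rho>_nonneg[of a b] that by simp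
  have RT: "R T < e / 4"
    using g(2) lebesgue_integral_eq_integral[OF \<rho>] by (simp add: R_def \<rho>_def)
  have R0: "R 0 = 0" by (simp add: R_def)
  have "uniformly_continuous_on {0..T} g"
    by (intro compact_uniformly_continuous continuous_on_subset[OF g(1)]) auto
  then obtain d where d: "d > 0" "\<And>s t. s \<in> {0..T} \<Longrightarrow> t \<in> {0..T} \<Longrightarrow> dist s t < d \<Longrightarrow> dist (g s) (g t) < e / (4 * T)"
    unfolding uniformly_continuous_on_def using e T by (metis divide_pos_pos mult_pos_pos zero_less_numeral)
  show ?thesis
  proof (intro exI[of _ d] conjI allI impI d(1))
    fix h assume h: "0 < h \<and> h < d \<and> h < T"
    define b where "b = T - h"
    have b: "0 \<le> b" "b + h = T" using h by (auto simp: b_def)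
    let ?r = "\<lambda>t. (1 / h) * (R (t + h) - R t) + (e / (4 * T) + \<rho> t)"
    have le: "\<bar>(1 / h) * integral {t..t+h} \<phi> - \<phi> t\<bar> \<le> ?r t" if t: "t \<in> {0..b}" for t
    proof -
      have sub: "{t..t+h} \<subseteq> {0..T}" using t b by auto
      have gi: "g integrable_on {t..t+h}" by (intro integrable_continuous_real continuous_on_subset[OF g(1)]) auto
      have \<phi>i: "\<phi> integrable_on {t..t+h}" by (rule integrable_subinterval_real[OF \<phi>_int sub])
      have "norm (integral {t..t+h} (\<lambda>s. \<phi> s - g s)) \<le> integral {t..t+h} \<rho>"
        using t b by (intro Henstock_Kurzweil_Integration.integral_norm_bound_integral integrable_diff gi \<phi>i \<rho>_sub)
          (auto simp: \<rho>_def)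
      then have 1: "\<bar>integral {t..t+h} \<phi> - integral {t..t+h} g\<bar> \<le> R (t + h) - R t"
        using gi \<phi>i R_diff[of t "t + h"] t b h by (simp add: Henstock_Kurzweil_Integration.integral_diff)
      have "\<bar>integral {t..t+h} g - (t + h - t) * g t\<bar> \<le> (t + h - t) * (e / (4 * T))"
      proof (rule integral_near_const[OF gi])
        fix s assume "s \<in> {t..t+h}"
        then have "dist (g s) (g t) < e / (4 * T)"
          using sub t h b by (intro d(2)) (auto simp: dist_real_def)
        then show "\<bar>g s - g t\<bar> \<le> e / (4 * T)" by (simp add: dist_real_def)
      qed (use h in simp)
      then have 2: "\<bar>integral {t..t+h} g - h * g t\<bar> \<le> h * (e / (4 * T))" by simp
      have "\<bar>h * g t - h * \<phi> t\<bar> = h * \<rho> t"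
        using h by (simp add: \<rho>_def abs_mult abs_minus_commute flip: right_diff_distrib)
      then have "\<bar>integral {t..t+h} \<phi> - h * \<phi> t\<bar> \<le> (R (t + h) - R t) + h * (e / (4 * T)) + h * \<rho> t"
        using 1 2 by linarith
      then have "(1 / h) * \<bar>integral {t..t+h} \<phi> - h * \<phi> t\<bar> \<le> (1 / h) * ((R (t + h) - R t) + h * (e / (4 * T)) + h * \<rho> t)"
        using h by (intro mult_left_mono) auto
      moreover have "(1 / h) * \<bar>integral {t..t+h} \<phi> - h * \<phi> t\<bar> = \<bar>(1 / h) * integral {t..t+h} \<phi> - \<phi> t\<bar>"
      proof -
        have "(1 / h) * integral {t..t+h} \<phi> - \<phi> t = (1 / h) * (integral {t..t+h} \<phi> - h * \<phi> t)"
          using h by (simp add: right_diff_distrib)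
        then show ?thesis using h by (simp add: abs_mult)
      qed
      moreover have "(1 / h) * ((R (t + h) - R t) + h * (e / (4 * T)) + h * \<rho> t) = ?r t"
        using h by (simp add: distrib_left)
      ultimately show ?thesis by linarith
    qed
    have R_cont': "continuous_on {0..b} (\<lambda>t. R (t + h) - R t)"
      by (intro continuous_intros continuous_on_compose2[OF R_cont] continuous_on_subset[OF R_cont])
         (use b h in auto)
    have R_int': "(\<lambda>t. R (t + h) - R t) integrable_on {0..b}" by (rule integrable_continuous_real[OF R_cont'])
    have r_int: "integrable (lebesgue_on {0..b}) ?r"
    proof (intro Bochner_Integration.integrable_add integrable_mult_right)
      show "integrable (lebesgue_on {0..b}) (\<lambda>t. R (t + h) - R t)"
        by (rule continuous_imp_integrable_real[OF R_cont'])
      show "integrable (lebesgue_on {0..b}) \<rho>"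
        using integrable_subinterval[OF \<rho>, of 0 b] b h by auto
      show "integrable (lebesgue_on {0..b}) (\<lambda>t. e / (4 * T))"
        by (intro continuous_imp_integrable_real continuous_intros)
    qed
    have "(\<integral>\<^sup>+t. ennreal \<bar>(1 / h) * integral {t..t+h} \<phi> - \<phi> t\<bar> \<partial>lebesgue_on {0..b}) \<le> (\<integral>\<^sup>+t. ennreal (?r t) \<partial>lebesgue_on {0..b})"
      using le by (intro nn_integral_mono ennreal_leI) auto
    also have "\<dots> = ennreal (integral\<^sup>L (lebesgue_on {0..b}) ?r)"
    proof (rule nn_integral_eq_integral[OF r_int], intro AE_I2)
      fix t assume "t \<in> space (lebesgue_on {0..b})"
      then show "0 \<le> ?r t" using le[of t] by auto
    qed
    also have "integral\<^sup>L (lebesgue_on {0..b}) ?r = integral {0..b} ?r"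
      by (intro lebesgue_integral_eq_integral r_int) simp
    also have "\<dots> \<le> e"
    proof -
      have "integral {0..b} ?r = (1 / h) * integral {0..b} (\<lambda>t. R (t + h) - R t) + (integral {0..b} (\<lambda>t. e / (4 * T)) + integral {0..b} \<rho>)"
      proof -
        have \<rho>b: "\<rho> integrable_on {0..b}" using b h by (intro \<rho>_sub) auto
        have "integral {0..b} ?r = integral {0..b} (\<lambda>t. (1 / h) * (R (t + h) - R t)) + integral {0..b} (\<lambda>t. e / (4 * T) + \<rho> t)"
          by (intro Henstock_Kurzweil_Integration.integral_add integrable_on_mult_right R_int' integrable_add
              integrable_const_ivl \<rho>b)
        also have "integral {0..b} (\<lambda>t. e / (4 * T) + \<rho> t) = integral {0..b} (\<lambda>t. e / (4 * T)) + integral {0..b} \<rho>"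
          by (intro Henstock_Kurzweil_Integration.integral_add integrable_const_ivl \<rho>b)
        finally show ?thesis by simp
      qed
      also have "(1 / h) * integral {0..b} (\<lambda>t. R (t + h) - R t) \<le> e / 4"
      proof -
        have "integral {0..b} (\<lambda>t. R (t + h) - R t) = integral {b..b+h} R - integral {0..h} R"
          using integral_shift_difference[OF R_cont, of b h] b h by simp
        also have "\<dots> \<le> (b + h - b) * R T - 0"
        proof (intro diff_mono)
          show "integral {b..b+h} R \<le> (b + h - b) * R T"
            using b h by (intro integral_le_const integrable_continuous_real continuous_on_subset[OF R_cont] R_mono) auto
          show "0 \<le> integral {0..h} R"
            using b h R_mono[of 0] R0
            by (intro Henstock_Kurzweil_Integration.integral_nonneg integrable_continuous_real continuous_on_subset[OF R_cont]) auto
        qed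
        finally have "integral {0..b} (\<lambda>t. R (t + h) - R t) \<le> h * R T" by simp
        then have "(1 / h) * integral {0..b} (\<lambda>t. R (t + h) - R t) \<le> (1 / h) * (h * R T)"
          using h by (intro mult_left_mono) auto
        also have "\<dots> = R T" using h by simp
        finally show ?thesis using RT by linarith
      qed
      moreover have "integral {0..b} (\<lambda>t. e / (4 * T)) \<le> e / 4"
      proof -
        have "b * (e / (4 * T)) \<le> T * (e / (4 * T))" using b h e T by (intro mult_right_mono) auto
        then show ?thesis using b T by simp
      qed
      moreover have "integral {0..b} \<rho> \<le> e / 4"
        using R_mono[of b T] RT b h by (simp add: R_def)
      ultimately show ?thesis using e by linarith
    qed
    finally show "(\<integral>\<^sup>+t. ennreal \<bar>(1 / h) * integral {t..t+h} \<phi> - \<phi> t\<bar> \<partial>lebesgue_on {0..T-h}) \<le> ennreal e"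
      by (simp add: b_def ennreal_leI)
  qed
qed

text \<open>
  Steps along which the distances in \<open>L\<^sup>1\<close> are summable give convergence almost everywhere.  The
  \<open>n\<close>-th step is chosen for the first \<open>n\<close> functions simultaneously, so that one sequence of steps
  serves all of them.
\<close>

theorem Steklov_average_AE:
  fixes \<phi> :: "nat \<Rightarrow> real \<Rightarrow> real"
  assumes \<phi>: "\<And>k. integrable (lebesgue_on {0..T}) (\<phi> k)" and T: "0 < T"
  obtains h :: "nat \<Rightarrow> real" where "\<And>n. 0 < h n" "h \<longlonglongrightarrow> 0"
    "\<And>k. AE t in lebesgue_on {0..T}. t < T \<longrightarrow> (\<lambda>n. (1 / h n) * integral {t..t+h n} (\<phi> k)) \<longlonglongrightarrow> \<phi> k t"
proof -
  define J where "J = (\<lambda>k h. \<integral>\<^sup>+t. ennreal \<bar>(1 / h) * integral {t..t+h} (\<phi> k) - \<phi> k t\<bar> \<partial>lebesgue_on {0..T-h})"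
  have "\<exists>d>0. \<forall>h. 0 < h \<and> h < d \<and> h < T \<longrightarrow> J k h \<le> ennreal ((1/2) ^ n)" for k n
    unfolding J_def by (rule Steklov_average_L1[OF \<phi> T]) simp
  then obtain d where d: "\<And>k n. d k n > 0" "\<And>k n h. 0 < h \<Longrightarrow> h < d k n \<Longrightarrow> h < T \<Longrightarrow> J k h \<le> ennreal ((1/2) ^ n)"
    by metis
  (* halving the minimum makes all the upper bounds strict *)
  define h where "h = (\<lambda>n. min (Min ((\<lambda>k. d k n) ` {..n})) (min T (inverse (real (Suc n)))) / 2)"
  have h_pos: "0 < h n" for n using d(1) T by (simp add: h_def)
  have h_d: "h n < d k n" if "k \<le> n" for k n
  proof -
    have "Min ((\<lambda>k. d k n) ` {..n}) \<le> d k n" using that by (intro Min_le) auto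
    then have "2 * h n \<le> d k n" by (simp add: h_def)
    then show ?thesis using h_pos[of n] by simp
  qed
  have h_T: "h n < T" for n
  proof -
    have "2 * h n \<le> T" by (simp add: h_def)
    then show ?thesis using h_pos[of n] by simp
  qed
  have h_lim: "h \<longlonglongrightarrow> 0"
  proof (rule squeeze_zero[OF _ _ LIMSEQ_inverse_real_of_nat])
    show "h n \<le> inverse (real (Suc n))" for n
    proof -
      have "2 * h n \<le> inverse (real (Suc n))" by (simp add: h_def)
      then show ?thesis using h_pos[of n] by linarith
    qed
  qed (use h_pos in \<open>simp add: less_imp_le\<close>)
  have conv: "AE t in lebesgue_on {0..T}. t < T \<longrightarrow> (\<lambda>n. (1 / h n) * integral {t..t+h n} (\<phi> k)) \<longlonglongrightarrow> \<phi> k t" for k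
  proof -
    define P where "P = (\<lambda>t. integral {0..t} (\<phi> k))"
    have \<phi>_int: "\<phi> k integrable_on {0..T}" using \<phi> by (auto intro: integrable_on_lebesgue_on)
    have P_cont: "continuous_on {0..T} P" unfolding P_def by (rule indefinite_integral_continuous_1[OF \<phi>_int])
    have [measurable]: "\<phi> k \<in> borel_measurable (lebesgue_on {0..T})" using \<phi> by (rule borel_measurable_integrable)
    (* the minimum keeps P on its domain; the indicator removes the times at which it matters *)
    define u where "u = (\<lambda>n t. \<bar>(1 / h n) * (P (min T (t + h n)) - P t) - \<phi> k t\<bar> * indicator {0..T - h n} t)"
    have u_eq: "u n t = \<bar>(1 / h n) * integral {t..t+h n} (\<phi> k) - \<phi> k t\<bar>" if "t \<in> {0..T - h n}" for n t
    proof -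
      have "P (t + h n) - P t = integral {t..t+h n} (\<phi> k)"
        unfolding P_def using that h_pos[of n] by (intro integral_antideriv_diff[OF \<phi>_int]) auto
      then show ?thesis using that by (simp add: u_def min_absorb2)
    qed
    have u_meas[measurable]: "u n \<in> borel_measurable (lebesgue_on {0..T})" for n
    proof -
      have [measurable]: "(\<lambda>t. P (min T (t + h n)) - P t) \<in> borel_measurable (lebesgue_on {0..T})"
        using h_pos[of n] T
        by (intro continuous_imp_measurable_on_sets_lebesgue continuous_intros P_cont continuous_on_compose2[OF P_cont])
           (auto simp: less_imp_le)
      have [measurable]: "indicator {0..T - h n} \<in> borel_measurable (lebesgue_on {0..T})"
        by (intro measurable_restrict_space1 borel_measurable_indicator) simp
      show ?thesis unfolding u_def by measurable
    qed
    have u_le: "(\<integral>\<^sup>+t. ennreal (u n t) \<partial>lebesgue_on {0..T}) \<le> ennreal ((1/2) ^ n)" if "k \<le> n" for n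
    proof -
      have "(\<integral>\<^sup>+t. ennreal (u n t) \<partial>lebesgue_on {0..T}) = (\<integral>\<^sup>+t. ennreal (u n t) \<partial>lebesgue_on {0..T - h n})"
        using h_pos[of n] by (simp add: nn_integral_restrict_space)
          (auto intro!: nn_integral_cong split: split_indicator simp: u_def)
      also have "\<dots> = J k (h n)"
        unfolding J_def by (intro nn_integral_cong) (simp add: u_eq)
      also have "\<dots> \<le> ennreal ((1/2) ^ n)" using that by (intro d h_pos h_d h_T)
      finally show ?thesis .
    qed
    have "(\<integral>\<^sup>+t. (\<Sum>n. ennreal (u (n + k) t)) \<partial>lebesgue_on {0..T}) = (\<Sum>n. \<integral>\<^sup>+t. ennreal (u (n + k) t) \<partial>lebesgue_on {0..T})"
      by (rule nn_integral_suminf) measurable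
    also have "\<dots> \<le> (\<Sum>n. ennreal ((1/2) ^ (n + k)))" by (intro suminf_le u_le) auto
    also have "\<dots> = ennreal (\<Sum>n. (1/2) ^ (n + k))"
      by (rule suminf_ennreal2) (auto simp: power_add intro!: summable_mult2 summable_geometric)
    also have "\<dots> < \<infinity>" by (metis ennreal_less_top infinity_ennreal_def)
    finally have "AE t in lebesgue_on {0..T}. (\<Sum>n. ennreal (u (n + k) t)) \<noteq> \<infinity>"
      by (intro nn_integral_PInf_AE) auto
    then show ?thesis using AE_space[of "lebesgue_on {0..T}"]
    proof eventually_elim
      case (elim t)
      show ?case
      proof
        assume t: "t < T"
        have "summable (\<lambda>n. u (n + k) t)"
          using elim by (intro summable_suminf_not_top) (auto simp: u_def)
        then have "(\<lambda>n. u (n + k) t) \<longlonglongrightarrow> 0" by (rule summable_LIMSEQ_zero)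
        then have u0: "(\<lambda>n. u n t) \<longlonglongrightarrow> 0" by (rule LIMSEQ_offset)
        have "eventually (\<lambda>n. h n < T - t) sequentially" using h_lim t by (intro order_tendstoD(2)) auto
        then have "\<forall>\<^sub>F n in sequentially. norm ((1 / h n) * integral {t..t+h n} (\<phi> k) - \<phi> k t) \<le> u n t"
        proof eventually_elim
          case (elim n)
          then show ?case using u_eq[of t n] \<open>t \<in> space _\<close> by simp
        qed
        then have "(\<lambda>n. (1 / h n) * integral {t..t+h n} (\<phi> k) - \<phi> k t) \<longlonglongrightarrow> 0"
          using u0 by (rule Lim_null_comparison)
        then show "(\<lambda>n. (1 / h n) * integral {t..t+h n} (\<phi> k)) \<longlonglongrightarrow> \<phi> k t" by (simp add: LIM_zero_iff)
      qed
    qed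
  qed
  show thesis by (rule that[OF h_pos h_lim conv])
qed

section \<open>Smooth bump functions\<close>

text \<open>
  The smooth function \<open>exp (- 1 / x)\<close> on the positive axis, together with the multiples by powers of
  \<open>1 / x\<close> that appear in its derivatives.
\<close>

definition flat :: "nat \<Rightarrow> real \<Rightarrow> real" where
  "flat n x = (if x > 0 then (1 / x) ^ n * exp (- (1 / x)) else 0)"

lemma flat_div_tendsto: "((\<lambda>x. flat n x / x) \<longlongrightarrow> 0) (at 0)"
proof -
  have "((\<lambda>x::real. (1 / x) ^ Suc n / exp (1 / x)) \<longlongrightarrow> 0) (at_right 0)"
  proof (rule filterlim_compose[OF tendsto_power_div_exp_0])
    show "filterlim (\<lambda>x::real. 1 / x) at_top (at_right 0)"
      using filterlim_inverse_at_top_right by (simp add: inverse_eq_divide)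
  qed
  also have "?this \<longleftrightarrow> ((\<lambda>x. flat n x / x) \<longlongrightarrow> 0) (at_right 0)"
    by (intro filterlim_cong refl eventually_at_rightI[of 0 1]) (auto simp: flat_def exp_minus field_simps)
  finally have right: "((\<lambda>x. flat n x / x) \<longlongrightarrow> 0) (at_right 0)" .
  have "((\<lambda>x::real. 0::real) \<longlongrightarrow> 0) (at_left 0)" by simp
  also have "?this \<longleftrightarrow> ((\<lambda>x. flat n x / x) \<longlongrightarrow> 0) (at_left 0)"
    by (intro filterlim_cong refl eventually_at_leftI[of "-1" 0]) (auto simp: flat_def)
  finally show ?thesis using right by (simp add: filterlim_split_at_real)
qed

lemma flat_derivative:
  "(flat n has_real_derivative flat (n + 2) x - real n * flat (n + 1) x) (at x)"
proof -
  consider "x > 0" | "x < 0" | "x = 0" by linarith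
  then show ?thesis
  proof cases
    case 1
    have "((\<lambda>x. (1 / x) ^ n * exp (- (1 / x))) has_real_derivative
        real n * (1 / x) ^ (n - 1) * (- 1 / x\<^sup>2) * exp (- (1 / x)) + (1 / x) ^ n * (exp (- (1 / x)) * (1 / x\<^sup>2))) (at x)"
      using 1 by (auto intro!: derivative_eq_intros simp: power2_eq_square)
    moreover have "real n * (1 / x) ^ (n - 1) * (- 1 / x\<^sup>2) * exp (- (1 / x)) + (1 / x) ^ n * (exp (- (1 / x)) * (1 / x\<^sup>2)) =
        flat (n + 2) x - real n * flat (n + 1) x"
      using 1 by (cases n) (simp_all add: flat_def power2_eq_square field_simps)
    ultimately have "((\<lambda>x. (1 / x) ^ n * exp (- (1 / x))) has_real_derivative flat (n + 2) x - real n * flat (n + 1) x) (at x)"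
      by simp
    then show ?thesis
      by (rule has_field_derivative_transform_within_open[where S = "{0<..}"]) (use 1 in \<open>auto simp: flat_def\<close>)
  next
    case 2
    have "((\<lambda>x. 0) has_real_derivative flat (n + 2) x - real n * flat (n + 1) x) (at x)"
      using 2 by (simp add: flat_def)
    then show ?thesis
      by (rule has_field_derivative_transform_within_open[where S = "{..<0}"]) (use 2 in \<open>auto simp: flat_def\<close>)
  next
    case 3
    have "((\<lambda>y. (flat n y - flat n 0) / (y - 0)) \<longlongrightarrow> 0) (at 0)"
      using flat_div_tendsto[of n] by (simp add: flat_def[of n 0])
    then show ?thesis
      unfolding 3 has_field_derivative_iff by (simp add: flat_def[of _ 0])
  qed
qed

lemma flat_bounds: "0 \<le> flat 0 x" "flat 0 x \<le> 1"
  by (auto simp: flat_def)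

lemma flat_pos_iff: "flat 0 x \<noteq> 0 \<longleftrightarrow> 0 < x"
  by (simp add: flat_def)

lemma flat_scaled_tendsto: "(\<lambda>m. flat 0 (real (Suc m) * x)) \<longlonglongrightarrow> (if 0 < x then 1 else 0)"
proof (cases "0 < x")
  case True
  have "(\<lambda>m. exp (- (inverse (real (Suc m)) * (1 / x)))) \<longlonglongrightarrow> exp (- (0 * (1 / x)))"
    by (intro tendsto_intros LIMSEQ_inverse_real_of_nat)
  moreover have "flat 0 (real (Suc m) * x) = exp (- (inverse (real (Suc m)) * (1 / x)))" for m
  proof -
    have "0 < real (Suc m) * x" using True by simp
    then show ?thesis by (simp add: flat_def divide_simps)
  qed
  ultimately show ?thesis using True by simp
next
  case False
  then have "flat 0 (real (Suc m) * x) = 0" for m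
    using flat_pos_iff[of "real (Suc m) * x"] by (simp add: zero_less_mult_iff)
  then show ?thesis using False by simp
qed

text \<open>
  This class contains the bumps and is closed under partial derivatives, so its members are
  smooth of every order.
\<close>

inductive_set bump_algebra :: "(real ^ 'n::finite \<Rightarrow> real) set" where
  const: "(\<lambda>x. c) \<in> bump_algebra"
| flat: "(\<lambda>x. flat n (a * (x $ i) + b)) \<in> bump_algebra"
| add: "\<phi> \<in> bump_algebra \<Longrightarrow> \<psi> \<in> bump_algebra \<Longrightarrow> (\<lambda>x. \<phi> x + \<psi> x) \<in> bump_algebra"
| mult: "\<phi> \<in> bump_algebra \<Longrightarrow> \<psi> \<in> bump_algebra \<Longrightarrow> (\<lambda>x. \<phi> x * \<psi> x) \<in> bump_algebra"

lemma bump_algebra_prod: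
  "finite I \<Longrightarrow> (\<And>i. i \<in> I \<Longrightarrow> \<phi> i \<in> bump_algebra) \<Longrightarrow> (\<lambda>x. \<Prod>i\<in>I. \<phi> i x) \<in> bump_algebra"
  by (induction I rule: finite_induct) (auto intro: bump_algebra.intros)

lemma partial_eqI:
  assumes "(\<phi> has_derivative D) (at x)" shows "partial i \<phi> x = D (axis i 1)"
  using frechet_derivative_at[OF assms] by (simp add: partial_def)

lemma bump_algebra_derivative:
  fixes \<phi> :: "real ^ 'n::finite \<Rightarrow> real"
  assumes "\<phi> \<in> bump_algebra"
  shows "\<phi> differentiable_on UNIV \<and> (\<forall>i. partial i \<phi> \<in> bump_algebra)"
  using assms
proof induction
  case (const c)
  have "partial i (\<lambda>x. c) = (\<lambda>x::real^'n. 0)" for i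
    using partial_eqI[OF has_derivative_const] by (auto simp: fun_eq_iff)
  then show ?case by (simp add: bump_algebra.const)
next
  case (flat n a i b)
  have D: "((\<lambda>x::real^'n. flat n (a * (x $ i) + b)) has_derivative
      (\<lambda>h. (a * h $ i) * (flat (n + 2) (a * (x $ i) + b) - real n * flat (n + 1) (a * (x $ i) + b)))) (at x)" for x
  proof -
    have "((\<lambda>x::real^'n. a * (x $ i) + b) has_derivative (\<lambda>h. a * h $ i)) (at x)"
      by (auto intro!: derivative_eq_intros bounded_linear.has_derivative[OF bounded_linear_vec_nth])
    from has_derivative_compose[OF this flat_derivative[unfolded has_field_derivative_def]]
    show ?thesis by (simp add: mult.commute)
  qed
  have "partial j (\<lambda>x::real^'n. flat n (a * (x $ i) + b)) =
      (\<lambda>x. (if i = j then a else 0) * flat (n + 2) (a * (x $ i) + b) +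
           (if i = j then - a * real n else 0) * flat (n + 1) (a * (x $ i) + b))" for j
    using partial_eqI[OF D, of j] by (auto simp: fun_eq_iff axis_def algebra_simps)
  moreover have "(\<lambda>x::real^'n. c * flat (n + 2) (a * (x $ i) + b) + d * flat (n + 1) (a * (x $ i) + b)) \<in> bump_algebra" for c d
    by (intro bump_algebra.intros)
  ultimately have "partial j (\<lambda>x::real^'n. flat n (a * (x $ i) + b)) \<in> bump_algebra" for j
    by simp
  then show ?case
    using D unfolding differentiable_on_def differentiable_def by blast
next
  case (add \<phi> \<psi>)
  have d: "(\<phi> has_derivative frechet_derivative \<phi> (at x)) (at x)" "(\<psi> has_derivative frechet_derivative \<psi> (at x)) (at x)" for x
    using add by (auto simp: differentiable_on_def frechet_derivative_works)
  have "partial i (\<lambda>x. \<phi> x + \<psi> x) = (\<lambda>x. partial i \<phi> x + partial i \<psi> x)" for i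
    using partial_eqI[OF has_derivative_add[OF d]] by (auto simp: partial_def)
  then show ?case using add by (auto intro!: bump_algebra.add differentiable_on_add)
next
  case (mult \<phi> \<psi>)
  have d: "(\<phi> has_derivative frechet_derivative \<phi> (at x)) (at x)" "(\<psi> has_derivative frechet_derivative \<psi> (at x)) (at x)" for x
    using mult by (auto simp: differentiable_on_def frechet_derivative_works)
  have "partial i (\<lambda>x. \<phi> x * \<psi> x) = (\<lambda>x. \<phi> x * partial i \<psi> x + partial i \<phi> x * \<psi> x)" for i
    using partial_eqI[OF has_derivative_mult[OF d]] by (auto simp: partial_def)
  then show ?case using mult by (auto intro!: bump_algebra.intros differentiable_on_mult)
qed

lemma bump_algebra_Ck: "\<phi> \<in> bump_algebra \<Longrightarrow> Ck k \<phi>"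
proof (induction k arbitrary: \<phi>)
  case 0
  then show ?case using bump_algebra_derivative[OF 0] by (simp add: differentiable_imp_continuous_on)
next
  case (Suc k)
  then show ?case using bump_algebra_derivative[OF Suc.prems] by simp
qed

lemma mem_box_vec: "x \<in> box a b \<longleftrightarrow> (\<forall>i. a $ i < x $ i \<and> x $ i < b $ i)" for x :: "real ^ 'n::finite"
  by (simp add: mem_box_cart)

text \<open>
  Products of \<open>exp (- 1 / (m * (x - a)))\<close> and \<open>exp (- 1 / (m * (b - x)))\<close> over the coordinates.
\<close>

lemma box_bumps:
  fixes a b :: "real ^ 'n::finite"
  assumes sub: "cbox a b \<subseteq> \<Omega>"
  obtains \<phi> :: "nat \<Rightarrow> real ^ 'n \<Rightarrow> real" where "\<And>m. \<phi> m \<in> test_functions \<Omega>"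
    "\<And>m x. 0 \<le> \<phi> m x \<and> \<phi> m x \<le> 1" "\<And>x. (\<lambda>m. \<phi> m x) \<longlonglongrightarrow> indicator (box a b) x"
proof -
  define \<phi> where "\<phi> = (\<lambda>m (x::real^'n). \<Prod>i\<in>UNIV. flat 0 (real (Suc m) * (x $ i - a $ i)) * flat 0 (real (Suc m) * (b $ i - x $ i)))"
  have alg: "\<phi> m \<in> bump_algebra" for m
  proof -
    have "(\<lambda>x::real^'n. flat 0 (real (Suc m) * (x $ i - a $ i)) * flat 0 (real (Suc m) * (b $ i - x $ i))) \<in> bump_algebra" for i
    proof (rule bump_algebra.mult)
      show "(\<lambda>x::real^'n. flat 0 (real (Suc m) * (x $ i - a $ i))) \<in> bump_algebra"
        using bump_algebra.flat[of 0 "real (Suc m)" i "- real (Suc m) * a $ i"] by (simp add: algebra_simps)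
      show "(\<lambda>x::real^'n. flat 0 (real (Suc m) * (b $ i - x $ i))) \<in> bump_algebra"
        using bump_algebra.flat[of 0 "- real (Suc m)" i "real (Suc m) * b $ i"] by (simp add: algebra_simps)
    qed
    then show ?thesis unfolding \<phi>_def by (intro bump_algebra_prod) auto
  qed
  have supp: "{x. \<phi> m x \<noteq> 0} \<subseteq> box a b" for m
  proof
    fix x assume "x \<in> {x. \<phi> m x \<noteq> 0}"
    then have "flat 0 (real (Suc m) * (x $ i - a $ i)) \<noteq> 0 \<and> flat 0 (real (Suc m) * (b $ i - x $ i)) \<noteq> 0" for i
      by (auto simp: \<phi>_def prod_zero_iff)
    then have "0 < real (Suc m) * (x $ i - a $ i) \<and> 0 < real (Suc m) * (b $ i - x $ i)" for i
      by (simp only: flat_pos_iff)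
    then have "a $ i < x $ i \<and> x $ i < b $ i" for i
      by (metis diff_gt_0_iff_gt of_nat_0_less_iff zero_less_Suc zero_less_mult_pos)
    then show "x \<in> box a b" by (simp add: mem_box_vec)
  qed
  have cl: "closure {x. \<phi> m x \<noteq> 0} \<subseteq> cbox a b" for m
    by (rule closure_minimal[OF order_trans[OF supp box_subset_cbox] closed_cbox])
  show thesis
  proof (rule that[of \<phi>])
    show "\<phi> m \<in> test_functions \<Omega>" for m
      unfolding test_functions_def using bump_algebra_Ck[OF alg] cl[of m] sub
      by (auto simp: compact_eq_bounded_closed intro: bounded_subset[OF bounded_cbox])
    show "0 \<le> \<phi> m x \<and> \<phi> m x \<le> 1" for m x
      unfolding \<phi>_def by (intro conjI prod_nonneg prod_le_1) (auto simp: flat_bounds intro!: mult_le_one)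
    show "(\<lambda>m. \<phi> m x) \<longlonglongrightarrow> indicator (box a b) x" for x
    proof -
      have "(\<lambda>m. \<phi> m x) \<longlonglongrightarrow> (\<Prod>i\<in>UNIV. (if 0 < x $ i - a $ i then 1 else 0) * (if 0 < b $ i - x $ i then 1 else 0))"
        unfolding \<phi>_def by (intro tendsto_prod tendsto_mult flat_scaled_tendsto)
      also have "(\<Prod>i\<in>UNIV. (if 0 < x $ i - a $ i then 1 else 0) * (if 0 < b $ i - x $ i then 1 else 0)) = (indicator (box a b) x :: real)"
      proof (cases "x \<in> box a b")
        case True
        then show ?thesis by (simp add: mem_box_vec)
      next
        case False
        then obtain i where "\<not> (a $ i < x $ i \<and> x $ i < b $ i)" by (auto simp: mem_box_vec)
        then show ?thesis using False by (auto intro!: prod_zero)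
      qed
      finally show ?thesis .
    qed
  qed
qed

section \<open>The fundamental lemma of the calculus of variations\<close>

text \<open>
  Open boxes generate the Borel sets and are stable under intersection, so all Borel sets have
  integral zero.
\<close>

lemma AE_zero_if_box_integrals_zero:
  fixes g :: "'a::euclidean_space \<Rightarrow> real"
  assumes g: "integrable lborel g" and all: "integral\<^sup>L lborel g = 0"
    and box: "\<And>a b. (LINT x:box a b|lborel. g x) = 0"
  shows "AE x in lborel. g x = 0"
proof (rule sigma_finite_measure.density_zero[OF lborel.sigma_finite_measure_axioms g])
  have gA: "set_integrable lborel A g" if "A \<in> sets lborel" for A
    unfolding set_integrable_def using that g by (intro integrable_mult_indicator)
  fix A :: "'a set" assume "A \<in> sets lborel"
  then have "A \<in> sigma_sets UNIV (range (\<lambda>(a, b). box a b :: 'a set))"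
    by (simp add: borel_eq_box)
  moreover have "Int_stable (range (\<lambda>(a, b). box a b :: 'a set))"
    by (auto simp: Int_stable_def box_Int_box)
  moreover have "range (\<lambda>(a, b). box a b :: 'a set) \<subseteq> Pow UNIV" by simp
  moreover note A = calculation
  show "(LINT x:A|lborel. g x) = 0"
    using A(2) A(3) A(1)
  proof (induction rule: sigma_sets_induct_disjoint[consumes 3, case_names basic empty compl union])
    case (basic A) then show ?case using box by auto
  next
    case empty then show ?case by (simp add: set_lebesgue_integral_def)
  next
    case (compl A)
    then have A: "A \<in> sets lborel" by (simp add: borel_eq_box)
    have "(LINT x:UNIV|lborel. g x) = (LINT x:A|lborel. g x) + (LINT x:UNIV - A|lborel. g x)"
      using A by (subst set_integral_Un[symmetric]) (auto intro!: gA simp: Un_absorb1)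
    then show ?case using compl all by (simp add: set_lebesgue_integral_def)
  next
    case (union A)
    then have "A i \<in> sets lborel" for i by (auto simp: borel_eq_box)
    then have "(LINT x:(\<Union>i. A i)|lborel. g x) = (\<Sum>i. LINT x:A i|lborel. g x)"
      using union by (intro lebesgue_integral_countable_add gA) (auto simp: disjoint_family_on_def)
    then show ?case using union by simp
  qed
qed

text \<open>
  Bumps that converge to the indicator of a box show that the integral over every box with closure in
  \<open>\<Omega>\<close> vanishes.  Countably many of these boxes cover \<open>\<Omega>\<close>, which makes the argument local.
\<close>

lemma fundamental_lemma:
  fixes g :: "real ^ 'n::finite \<Rightarrow> real"
  assumes \<Omega>: "open \<Omega>" and g: "integrable (lebesgue_on \<Omega>) g"
    and zero: "\<And>\<phi>. \<phi> \<in> test_functions \<Omega> \<Longrightarrow> (LINT x|lebesgue_on \<Omega>. g x * \<phi> x) = 0"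
  shows "AE x in lebesgue_on \<Omega>. g x = 0"
proof -
  have \<Omega>l: "\<Omega> \<in> sets lebesgue" using \<Omega> by (simp add: borel_open)
  have gl: "integrable lebesgue (\<lambda>x. indicator \<Omega> x * g x)"
    using g \<Omega>l by (simp add: integrable_restrict_space)
  then obtain g' where g'[measurable]: "g' \<in> borel_measurable lborel"
    and g'eq: "AE x in lborel. indicator \<Omega> x * g x = g' x"
    using completion_ex_borel_measurable_real[OF borel_measurable_integrable] by blast
  have g'int: "integrable lborel g'"
  proof -
    have "integrable lebesgue g'"
      using gl AE_completion[OF g'eq] measurable_completion[OF g']
      by (rule_tac iffD1[OF integrable_cong_AE]) (auto intro: borel_measurable_integrable)
    then show ?thesis using g' by (simp add: integrable_completion)
  qed
  have boxes: "(LINT x:box a b|lborel. g' x) = 0" if sub: "cbox a b \<subseteq> \<Omega>" for a b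
  proof -
    obtain \<phi> :: "nat \<Rightarrow> real ^ 'n \<Rightarrow> real" where \<phi>: "\<And>m. \<phi> m \<in> test_functions \<Omega>"
      "\<And>m x. 0 \<le> \<phi> m x \<and> \<phi> m x \<le> 1" "\<And>x. (\<lambda>m. \<phi> m x) \<longlonglongrightarrow> indicator (box a b) x"
      using box_bumps[OF sub] by blast
    have \<phi>_meas: "\<phi> m \<in> borel_measurable (lebesgue_on \<Omega>)" for m
    proof -
      have "Ck 0 (\<phi> m)" using \<phi>(1)[of m] unfolding test_functions_def by blast
      then show ?thesis by (intro continuous_imp_measurable_on_sets_lebesgue \<Omega>l) (auto intro: continuous_on_subset)
    qed
    note [measurable] = \<phi>_meas borel_measurable_integrable[OF g]
    have ind[measurable]: "indicator (box a b) \<in> borel_measurable (lebesgue_on \<Omega>)"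
      by (intro measurable_restrict_space1 borel_measurable_indicator) simp
    have "(\<lambda>m. LINT x|lebesgue_on \<Omega>. g x * \<phi> m x) \<longlonglongrightarrow> (LINT x|lebesgue_on \<Omega>. g x * indicator (box a b) x)"
    proof (rule integral_dominated_convergence[where w = "\<lambda>x. \<bar>g x\<bar>"])
      show "integrable (lebesgue_on \<Omega>) (\<lambda>x. \<bar>g x\<bar>)" using g by simp
      show "AE x in lebesgue_on \<Omega>. (\<lambda>m. g x * \<phi> m x) \<longlonglongrightarrow> g x * indicator (box a b) x"
        by (intro AE_I2 tendsto_mult tendsto_const \<phi>)
      show "AE x in lebesgue_on \<Omega>. norm (g x * \<phi> m x) \<le> \<bar>g x\<bar>" for m
        using \<phi>(2)[of m] by (intro AE_I2) (simp add: abs_mult mult_left_le)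
    qed measurable
    then have "(LINT x|lebesgue_on \<Omega>. g x * indicator (box a b) x) = 0"
      using zero[OF \<phi>(1)] by (simp add: LIMSEQ_const_iff)
    also have "(LINT x|lebesgue_on \<Omega>. g x * indicator (box a b) x) = (LINT x|lebesgue. indicator \<Omega> x *\<^sub>R (g x * indicator (box a b) x))"
      using \<Omega>l by (simp add: integral_restrict_space)
    also have "\<dots> = (LINT x|lebesgue. indicator (box a b) x *\<^sub>R g' x)"
    proof (rule integral_cong_AE)
      show "AE x in lebesgue. indicator \<Omega> x *\<^sub>R (g x * indicator (box a b) x) = indicator (box a b) x *\<^sub>R g' x"
        using AE_completion[OF g'eq] by eventually_elim (auto simp: mult.assoc[symmetric])
      have [measurable]: "(\<lambda>x. indicator \<Omega> x * g x) \<in> borel_measurable lebesgue"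
        using gl by (rule borel_measurable_integrable)
      have [measurable]: "indicator (box a b) \<in> borel_measurable lebesgue" by (intro borel_measurable_indicator) simp
      have "(\<lambda>x. (indicator \<Omega> x * g x) * indicator (box a b) x) \<in> borel_measurable lebesgue" by measurable
      then show "(\<lambda>x. indicator \<Omega> x *\<^sub>R (g x * indicator (box a b) x)) \<in> borel_measurable lebesgue"
        by (simp add: mult.assoc)
      have [measurable]: "g' \<in> borel_measurable lebesgue" using measurable_completion[OF g'] .
      show "(\<lambda>x. indicator (box a b) x *\<^sub>R g' x) \<in> borel_measurable lebesgue" by measurable
    qed
    also have "\<dots> = (LINT x:box a b|lborel. g' x)"
      unfolding set_lebesgue_integral_def by (rule integral_completion) measurable
    finally show ?thesis .
  qed
  have local: "AE x in lborel. indicator (box a b) x * g' x = 0" if sub: "cbox a b \<subseteq> \<Omega>" for a b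
  proof (rule AE_zero_if_box_integrals_zero)
    show "integrable lborel (\<lambda>x. indicator (box a b) x * g' x)"
      using integrable_mult_indicator[OF _ g'int, of "box a b"] by simp
    show "(LINT x|lborel. indicator (box a b) x * g' x) = 0"
      using boxes[OF sub] by (simp add: set_lebesgue_integral_def)
    fix c d :: "real ^ 'n"
    obtain a' b' where ab: "box a b \<inter> box c d = box a' b'" by (auto simp: box_Int_box)
    show "(LINT x:box c d|lborel. indicator (box a b) x * g' x) = 0"
    proof (cases "box a' b' = {}")
      case True
      then have "indicator (box c d) x * (indicator (box a b) x * g' x) = 0" for x
        using ab by (auto split: split_indicator)
      note z = this
      have "(LINT x:box c d|lborel. indicator (box a b) x * g' x) = (LINT x|(lborel :: (real^'n) measure). 0)"
        unfolding set_lebesgue_integral_def real_scaleR_def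
        by (rule Bochner_Integration.integral_cong[OF refl]) (rule z)
      then show ?thesis by simp
    next
      case False
      then have "cbox a' b' \<subseteq> cbox a b"
        using ab by (metis Int_lower1 closure_box closure_mono closure_box box_eq_empty(1) inf.strict_order_iff le_inf_iff subset_empty)
      then have "(LINT x:box a' b'|lborel. g' x) = 0" using sub by (intro boxes) auto
      moreover have "indicator (box a' b') x * g' x = indicator (box c d) x * (indicator (box a b) x * g' x)" for x
        using ab by (auto split: split_indicator)
      ultimately show ?thesis by (simp add: set_lebesgue_integral_def)
    qed
  qed
  define \<F> where "\<F> = {box a b | a b. cbox a b \<subseteq> \<Omega>}"
  obtain \<F>' where F': "\<F>' \<subseteq> \<F>" "countable \<F>'" "\<Union>\<F>' = \<Union>\<F>"
    using Lindelof[of \<F>] by (auto simp: \<F>_def open_box)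
  have cover: "\<Omega> \<subseteq> \<Union>\<F>'"
  proof
    fix x assume "x \<in> \<Omega>"
    then obtain a b where "cbox a b \<subseteq> \<Omega>" "x \<in> box a b"
      using open_contains_cbox[OF \<Omega>] by metis
    then show "x \<in> \<Union>\<F>'" unfolding F'(3) \<F>_def by auto
  qed
  have "AE x in lborel. \<forall>S\<in>\<F>'. indicator S x * g' x = 0"
    unfolding AE_ball_countable[OF F'(2)]
  proof
    fix S assume "S \<in> \<F>'"
    then obtain a b where "S = box a b" "cbox a b \<subseteq> \<Omega>" using F'(1) by (auto simp: \<F>_def)
    then show "AE x in lborel. indicator S x * g' x = 0" using local by blast
  qed
  then have "AE x in lborel. x \<in> \<Omega> \<longrightarrow> g x = 0"
    using g'eq
  proof eventually_elim
    case (elim x)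
    show ?case
    proof
      assume x: "x \<in> \<Omega>"
      then obtain S where "S \<in> \<F>'" "x \<in> S" using cover by auto
      then have "g' x = 0" using elim(1) by (auto simp: indicator_def)
      then show "g x = 0" using elim(2) x by simp
    qed
  qed
  then show ?thesis
    using \<Omega>l by (simp add: AE_restrict_space_iff AE_completion)
qed

section \<open>Integration by parts for test functions\<close>

lemma test_function_Ck: "\<phi> \<in> test_functions \<Omega> \<Longrightarrow> Ck k \<phi>"
  unfolding test_functions_def by blast

lemma test_function_continuous: "\<phi> \<in> test_functions \<Omega> \<Longrightarrow> continuous_on UNIV \<phi>"
  using test_function_Ck[of \<phi> \<Omega> 0] by simp

lemma test_function_differentiable: "\<phi> \<in> test_functions \<Omega> \<Longrightarrow> \<phi> differentiable (at x)"
  using test_function_Ck[of \<phi> \<Omega> 1] by (simp add: differentiable_on_def)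

lemma test_function_partial_continuous: "\<phi> \<in> test_functions \<Omega> \<Longrightarrow> continuous_on UNIV (partial i \<phi>)"
  using test_function_Ck[of \<phi> \<Omega> 1] by simp

lemma partial_add:
  "\<phi> differentiable (at x) \<Longrightarrow> \<psi> differentiable (at x) \<Longrightarrow>
    partial i (\<lambda>x. \<phi> x + \<psi> x) x = partial i \<phi> x + partial i \<psi> x"
  by (subst partial_eqI[OF has_derivative_add]) (auto simp: frechet_derivative_works partial_def)

lemma partial_mult:
  "\<phi> differentiable (at x) \<Longrightarrow> \<psi> differentiable (at x) \<Longrightarrow>
    partial i (\<lambda>x. \<phi> x * \<psi> x) x = \<phi> x * partial i \<psi> x + partial i \<phi> x * \<psi> x"
  by (subst partial_eqI[OF has_derivative_mult]) (auto simp: frechet_derivative_works partial_def)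

lemma partial_zero_outside_support:
  assumes "closed K" "\<And>x. x \<notin> K \<Longrightarrow> w x = 0" "x \<notin> K"
  shows "partial i w x = 0"
proof -
  have "((\<lambda>x. 0) has_derivative (\<lambda>h. 0)) (at x)" by simp
  then have "(w has_derivative (\<lambda>h. 0)) (at x)"
    by (rule has_derivative_transform_within_open[OF _ open_Compl[OF assms(1)]]) (use assms in auto)
  from partial_eqI[OF this] show ?thesis by simp
qed

lemma line_derivative:
  fixes w :: "real ^ 'n::finite \<Rightarrow> real"
  assumes w: "\<And>x. w differentiable (at x)"
  shows "((\<lambda>s. w (x + s *\<^sub>R axis i 1)) has_real_derivative partial i w (x + s *\<^sub>R axis i 1)) (at s)"
proof -
  have "((\<lambda>s. x + s *\<^sub>R axis i 1) has_derivative (\<lambda>h. h *\<^sub>R axis i 1)) (at s)"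
    by (auto intro!: derivative_eq_intros)
  moreover have D: "(w has_derivative frechet_derivative w (at (x + s *\<^sub>R axis i 1))) (at (x + s *\<^sub>R axis i 1))"
    using w by (simp add: frechet_derivative_works)
  ultimately have "((\<lambda>s. w (x + s *\<^sub>R axis i 1)) has_derivative
      (\<lambda>h. frechet_derivative w (at (x + s *\<^sub>R axis i 1)) (h *\<^sub>R axis i 1))) (at s)"
    by (rule has_derivative_compose)
  moreover have "frechet_derivative w (at (x + s *\<^sub>R axis i 1)) (h *\<^sub>R axis i 1) = partial i w (x + s *\<^sub>R axis i 1) * h" for h
    using linear_scale[OF has_derivative_linear[OF D], of h "axis i 1"] by (simp add: partial_def)
  ultimately show ?thesis by (simp add: has_field_derivative_def)
qed

text \<open>
  Translation does not change \<open>\<integral>w\<close>, so the difference quotients of \<open>w\<close> in a coordinate direction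
  have integral zero.
\<close>

lemma integral_partial_zero:
  fixes w :: "real ^ 'n::finite \<Rightarrow> real"
  assumes w: "\<And>x. w differentiable (at x)" and cont: "continuous_on UNIV (partial i w)"
    and K: "compact K" "\<And>x. x \<notin> K \<Longrightarrow> w x = 0"
  shows "integral\<^sup>L lborel (partial i w) = 0"
proof -
  define e where "e = (axis i 1 :: real ^ 'n)"
  have ne: "norm e = 1" by (simp add: e_def)
  have w_cont: "continuous_on UNIV w"
    using w by (intro differentiable_imp_continuous_on) (auto simp: differentiable_on_def)
  have [measurable]: "w \<in> borel_measurable lborel" "partial i w \<in> borel_measurable lborel"
    using w_cont cont by (auto intro: borel_measurable_continuous_onI)
  have pK: "partial i w x = 0" if "x \<notin> K" for x
    using partial_zero_outside_support[OF compact_imp_closed[OF K(1)] K(2) that] .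
  have "bounded (partial i w ` K)"
    by (intro compact_imp_bounded compact_continuous_image continuous_on_subset[OF cont] K) auto
  then obtain C where C: "\<And>x. x \<in> K \<Longrightarrow> \<bar>partial i w x\<bar> \<le> C" by (auto simp: bounded_iff)
  have C': "\<bar>partial i w x\<bar> \<le> \<bar>C\<bar>" for x
    using C[of x] pK[of x] by (cases "x \<in> K") auto
  obtain r where "\<And>x. x \<in> K \<Longrightarrow> norm x \<le> r" using compact_imp_bounded[OF K(1)] by (auto simp: bounded_iff)
  then have r: "K \<subseteq> cball 0 r" by auto
  let ?t = "\<lambda>n. inverse (real (Suc n))"
  let ?q = "\<lambda>n x. (w (x + ?t n *\<^sub>R e) - w x) / ?t n"
  have w_int: "integrable lborel w"
  proof -
    have "integrable lborel (\<lambda>x. indicator K x *\<^sub>R w x)"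
      using borel_integrable_compact[OF K(1) continuous_on_subset[OF w_cont]] by auto
    also have "(\<lambda>x. indicator K x *\<^sub>R w x) = w" using K(2) by (auto simp: fun_eq_iff indicator_def)
    finally show ?thesis .
  qed
  have shift_int: "integrable lborel (\<lambda>x. w (x + a))" "(LINT x|lborel. w (x + a)) = integral\<^sup>L lborel w" for a
  proof -
    have d: "distr lborel borel ((+) a) = (lborel :: (real^'n) measure)" by (rule lborel_distr_plus)
    have "integrable (distr lborel borel ((+) a)) w" unfolding d by (rule w_int)
    then show "integrable lborel (\<lambda>x. w (x + a))" by (subst (asm) integrable_distr_eq) (auto simp: add.commute)
    have "integral\<^sup>L lborel w = integral\<^sup>L (distr lborel borel ((+) a)) w" by (simp add: d)
    also have "\<dots> = (LINT x|lborel. w (a + x))" by (subst integral_distr) auto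
    finally show "(LINT x|lborel. w (x + a)) = integral\<^sup>L lborel w" by (simp add: add.commute)
  qed
  have "(\<lambda>n. LINT x|lborel. ?q n x) \<longlonglongrightarrow> integral\<^sup>L lborel (partial i w)"
  proof (rule integral_dominated_convergence[where w = "\<lambda>x. \<bar>C\<bar> * indicator (cball 0 (r + 1)) x"])
    show "integrable lborel (\<lambda>x::real^'n. \<bar>C\<bar> * indicator (cball 0 (r + 1)) x)"
      by (intro integrable_mult_right integrable_real_indicator) (auto intro: emeasure_bounded_finite[unfolded infinity_ennreal_def])
    show "AE x in lborel. (\<lambda>n. ?q n x) \<longlonglongrightarrow> partial i w x"
    proof (rule AE_I2)
      fix x
      have "((\<lambda>s. (w (x + s *\<^sub>R e) - w x) / s) \<longlongrightarrow> partial i w x) (at 0)"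
        using line_derivative[OF w, of x i 0] by (simp add: has_field_derivative_iff e_def)
      moreover have "filterlim ?t (at 0) sequentially"
        unfolding filterlim_at using LIMSEQ_inverse_real_of_nat by (auto intro!: always_eventually)
      ultimately show "(\<lambda>n. ?q n x) \<longlonglongrightarrow> partial i w x" by (rule filterlim_compose)
    qed
    show "AE x in lborel. norm (?q n x) \<le> \<bar>C\<bar> * indicator (cball 0 (r + 1)) x" for n
    proof (rule AE_I2)
      fix x
      have t: "0 < ?t n" "?t n \<le> 1" by (simp_all add: inverse_le_1_iff)
      show "norm (?q n x) \<le> \<bar>C\<bar> * indicator (cball 0 (r + 1)) x"
      proof (cases "x \<in> cball 0 (r + 1)")
        case True
        have "\<exists>z. 0 < z \<and> z < ?t n \<and> w (x + ?t n *\<^sub>R e) - w (x + 0 *\<^sub>R e) = (?t n - 0) * partial i w (x + z *\<^sub>R e)"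
          by (rule MVT2[OF t(1)]) (use line_derivative[OF w] in \<open>simp add: e_def\<close>)
        then obtain z where "w (x + ?t n *\<^sub>R e) - w x = ?t n * partial i w (x + z *\<^sub>R e)" by auto
        then have "?q n x = partial i w (x + z *\<^sub>R e)" by simp
        then show ?thesis using C'[of "x + z *\<^sub>R e"] True by simp
      next
        case False
        then have "norm x > r + 1" by simp
        moreover have "norm x \<le> norm (x + ?t n *\<^sub>R e) + norm (?t n *\<^sub>R e)"
          using norm_triangle_ineq4[of "x + ?t n *\<^sub>R e" "?t n *\<^sub>R e"] by simp
        ultimately have "x \<notin> K" "x + ?t n *\<^sub>R e \<notin> K"
          using r t ne by (auto simp: subset_iff)
        then show ?thesis using K(2) False by simp
      qed
    qed
  qed measurable
  moreover have "(LINT x|lborel. ?q n x) = 0" for n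
  proof -
    have "(LINT x|lborel. w (x + ?t n *\<^sub>R e) - w x) = 0"
      using shift_int[of "?t n *\<^sub>R e"] w_int by simp
    then show ?thesis by simp
  qed
  ultimately show ?thesis by (simp add: LIMSEQ_const_iff)
qed

lemma test_function_integration_by_parts:
  assumes \<Omega>: "open \<Omega>" and \<phi>: "\<phi> \<in> test_functions \<Omega>" and \<psi>: "\<psi> \<in> test_functions \<Omega>"
  shows "(LINT x|lebesgue_on \<Omega>. \<phi> x * partial i \<psi> x + partial i \<phi> x * \<psi> x) = 0"
proof -
  define w where "w = (\<lambda>x. \<phi> x * \<psi> x)"
  define K where "K = closure {x. \<phi> x \<noteq> 0}"
  have K: "compact K" "K \<subseteq> \<Omega>" using \<phi> by (auto simp: test_functions_def K_def)
  have \<phi>K: "\<phi> x = 0" if "x \<notin> K" for x using that closure_subset[of "{x. \<phi> x \<noteq> 0}"] by (auto simp: K_def)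
  have p: "partial i w x = \<phi> x * partial i \<psi> x + partial i \<phi> x * \<psi> x" for x
    unfolding w_def using partial_mult test_function_differentiable \<phi> \<psi> by metis
  have cont: "continuous_on UNIV (partial i w)"
    unfolding p[abs_def]
    by (intro continuous_on_add continuous_on_mult test_function_continuous[OF \<phi>] test_function_continuous[OF \<psi>]
        test_function_partial_continuous[OF \<phi>] test_function_partial_continuous[OF \<psi>])
  have [measurable]: "partial i w \<in> borel_measurable lborel" using cont by (auto intro: borel_measurable_continuous_onI)
  have "integral\<^sup>L lborel (partial i w) = 0"
  proof (rule integral_partial_zero[OF _ cont K(1)])
    show "w differentiable at x" for x unfolding w_def
      using test_function_differentiable \<phi> \<psi> by (intro differentiable_mult) auto
  qed (simp add: w_def \<phi>K)
  moreover have "partial i w x = 0" if "x \<notin> \<Omega>" for x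
    using that K by (intro partial_zero_outside_support[OF compact_imp_closed[OF K(1)]]) (auto simp: w_def \<phi>K)
  then have ind: "indicator \<Omega> x *\<^sub>R partial i w x = partial i w x" for x by (auto simp: indicator_def)
  have "(LINT x|lebesgue_on \<Omega>. partial i w x) = (LINT x|lebesgue. indicator \<Omega> x *\<^sub>R partial i w x)"
    using \<Omega> by (intro integral_restrict_space) (simp add: borel_open)
  then have "(LINT x|lebesgue_on \<Omega>. partial i w x) = integral\<^sup>L lebesgue (partial i w)"
    by (simp only: ind)
  moreover have "integral\<^sup>L lebesgue (partial i w) = integral\<^sup>L lborel (partial i w)"
    by (rule integral_completion) measurable
  ultimately show ?thesis by (simp add: p)
qed

section \<open>Square integrable functions with values in a space with a semi-inner product\<close>

context semi_inner
begin

lemma semi_inner_subspace: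
  assumes "V' \<subseteq> V" "0 \<in> V'" "\<And>x y. x \<in> V' \<Longrightarrow> y \<in> V' \<Longrightarrow> x + y \<in> V'"
    "\<And>c x. x \<in> V' \<Longrightarrow> c *\<^sub>R x \<in> V'"
  shows "semi_inner V' B p"
proof
  show "0 \<in> V'" by fact
  show "x + y \<in> V'" if "x \<in> V'" "y \<in> V'" for x y using assms(3)[OF that] .
  show "c *\<^sub>R x \<in> V'" if "x \<in> V'" for c x using assms(4)[OF that] .
  show "B x y = B y x" if "x \<in> V'" "y \<in> V'" for x y using that assms(1) by (auto intro: sym)
  show "B (x + y) z = B x z + B y z" if "x \<in> V'" "y \<in> V'" "z \<in> V'" for x y z
    using that assms(1) by (auto intro!: add_left)
  show "B (c *\<^sub>R x) z = c * B x z" if "x \<in> V'" "z \<in> V'" for x z c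
    using that assms(1) by (auto intro!: scale_left)
  show "0 \<le> B x x" "p x = sqrt (B x x)" if "x \<in> V'" for x
    using that assms(1) nonneg nrm by auto
qed

lemma strongly_measurable_le:
  fixes q :: "'a \<Rightarrow> real"
  assumes f: "strongly_measurable M V p f"
    and q: "\<And>x. x \<in> V \<Longrightarrow> 0 \<le> q x" "\<And>x. x \<in> V \<Longrightarrow> q x \<le> c * p x"
  shows "strongly_measurable M V q f"
proof -
  obtain s :: "nat \<Rightarrow> _ \<Rightarrow> 'a" where s: "\<And>i. simple_function M (s i)" "\<And>i. s i ` space M \<subseteq> V"
    "AE x in M. (\<lambda>i. p (f x - s i x)) \<longlonglongrightarrow> 0" and fV: "AE x in M. f x \<in> V"
    using f unfolding strongly_measurable_def by blast
  have "AE x in M. (\<lambda>i. q (f x - s i x)) \<longlonglongrightarrow> 0"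
    using s(3) fV AE_space[of M]
  proof eventually_elim
    case (elim x)
    have m: "f x - s i x \<in> V" for i using elim s(2)[of i] by (intro diff_mem) auto
    show ?case
      by (rule squeeze_zero[where g = "\<lambda>i. c * p (f x - s i x)"])
         (use q m elim in \<open>auto intro: tendsto_mult_right_zero\<close>)
  qed
  then show ?thesis unfolding strongly_measurable_def using s fV by blast
qed

lemma strongly_measurable_scaleR:
  fixes w :: "'s \<Rightarrow> real"
  assumes w: "w \<in> borel_measurable M" and f: "strongly_measurable M V p f"
  shows "strongly_measurable M V p (\<lambda>x. w x *\<^sub>R f x)"
proof -
  obtain s :: "nat \<Rightarrow> _ \<Rightarrow> 'a" where s: "\<And>i. simple_function M (s i)" "\<And>i. s i ` space M \<subseteq> V"
    "AE x in M. (\<lambda>i. p (f x - s i x)) \<longlonglongrightarrow> 0" and fV: "AE x in M. f x \<in> V"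
    using f unfolding strongly_measurable_def by blast
  obtain r :: "nat \<Rightarrow> _ \<Rightarrow> real" where r: "\<And>i. simple_function M (r i)"
    "\<And>x. x \<in> space M \<Longrightarrow> (\<lambda>i. r i x) \<longlonglongrightarrow> w x"
    using borel_measurable_implies_sequence_metric[OF w, of 0] by blast
  have "AE x in M. (\<lambda>i. p (w x *\<^sub>R f x - r i x *\<^sub>R s i x)) \<longlonglongrightarrow> 0"
    using s(3) fV AE_space[of M]
  proof eventually_elim
    case (elim x)
    have sV: "s i x \<in> V" for i using elim s(2)[of i] by auto
    have fx: "f x \<in> V" using elim by simp
    have le: "p (w x *\<^sub>R f x - r i x *\<^sub>R s i x) \<le> \<bar>w x - r i x\<bar> * p (f x) + \<bar>r i x\<bar> * p (f x - s i x)" for i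
    proof -
      have "w x *\<^sub>R f x - r i x *\<^sub>R s i x = (w x - r i x) *\<^sub>R f x + r i x *\<^sub>R (f x - s i x)"
        by (simp add: algebra_simps)
      then show ?thesis
        using nrm_triangle[OF scale_mem[OF fx] scale_mem[OF diff_mem[OF fx sV]]]
        by (simp add: nrm_scale fx diff_mem[OF fx sV])
    qed
    have r0: "(\<lambda>i. \<bar>w x - r i x\<bar>) \<longlonglongrightarrow> 0"
      using tendsto_rabs[OF tendsto_diff[OF tendsto_const[of "w x"] r(2)[OF elim(3)]]] by simp
    have "(\<lambda>i. \<bar>w x - r i x\<bar> * p (f x) + \<bar>r i x\<bar> * p (f x - s i x)) \<longlonglongrightarrow> 0 * p (f x) + \<bar>w x\<bar> * 0"
      by (rule tendsto_add[OF tendsto_mult[OF r0 tendsto_const] tendsto_mult[OF tendsto_rabs[OF r(2)[OF elim(3)]] elim(1)]])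
    then show ?case
      by (intro squeeze_zero[where g = "\<lambda>i. \<bar>w x - r i x\<bar> * p (f x) + \<bar>r i x\<bar> * p (f x - s i x)", OF _ le])
         (auto intro!: nrm_nonneg diff_mem scale_mem fx sV)
  qed
  moreover have "simple_function M (\<lambda>x. r i x *\<^sub>R s i x)" for i
    by (rule simple_function_compose2[where h = "(\<lambda>a b. a *\<^sub>R b)", OF r(1) s(1)])
  moreover have "(\<lambda>x. r i x *\<^sub>R s i x) ` space M \<subseteq> V" for i
    using s(2)[of i] by (auto intro!: scale_mem)
  moreover have "AE x in M. w x *\<^sub>R f x \<in> V" using fV by eventually_elim (rule scale_mem)
  ultimately show ?thesis unfolding strongly_measurable_def
    by (intro conjI exI[of _ "\<lambda>i x. r i x *\<^sub>R s i x"] allI)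
qed

lemma strongly_measurable_scale:
  assumes f: "strongly_measurable M V p f" shows "strongly_measurable M V p (\<lambda>x. c *\<^sub>R f x)"
  by (rule strongly_measurable_scaleR[OF borel_measurable_const f])

lemma strongly_measurable_add:
  assumes "strongly_measurable M V p f" "strongly_measurable M V p g"
  shows "strongly_measurable M V p (\<lambda>x. f x + g x)"
  using strongly_measurable_diff[OF assms(1) strongly_measurable_scale[OF assms(2), of "-1"]] by simp

lemma strongly_measurable_const: "c \<in> V \<Longrightarrow> strongly_measurable M V p (\<lambda>x. c)"
  by (rule strongly_measurable_simple) auto

text \<open>
  By polarisation, from the measurability of norms.
\<close>

lemma measurable_inner:
  assumes f: "strongly_measurable M V p f" and g: "strongly_measurable M V p g"
  shows "(\<lambda>x. B (f x) (g x)) \<in> borel_measurable (completion M)"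
proof (rule completion.borel_measurable_AE_cong)
  show "(\<lambda>x. ((p (f x + g x))\<^sup>2 - (p (f x - g x))\<^sup>2) / 4) \<in> borel_measurable (completion M)"
    by (intro borel_measurable_divide borel_measurable_diff borel_measurable_power borel_measurable_const
        measurable_nrm strongly_measurable_add strongly_measurable_diff f g)
  have "AE x in completion M. f x \<in> V" "AE x in completion M. g x \<in> V"
    using f g unfolding strongly_measurable_def by (auto intro: AE_completion)
  then show "AE x in completion M. ((p (f x + g x))\<^sup>2 - (p (f x - g x))\<^sup>2) / 4 = B (f x) (g x)"
  proof eventually_elim
    case (elim x)
    then show ?case
      using sym[of "g x" "f x"] by (simp add: nrm_sq mem add_left add_right diff_left diff_right)
  qed
qed

text \<open>
  The space \<open>L\<^sup>2(M; V)\<close>.  Values lie in \<open>V\<close> everywhere, which makes pointwise sums meaningful; the inner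
  product integrates over the completed measure because a strongly measurable integrand is only
  almost everywhere equal to a measurable one.
\<close>

definition L2v :: "'s measure \<Rightarrow> ('s \<Rightarrow> 'a) set" where
  "L2v M = {z. (\<forall>l\<in>space M. z l \<in> V) \<and> strongly_measurable M V p z \<and>
     (\<integral>\<^sup>+l. ennreal (B (z l) (z l)) \<partial>M) < \<infinity>}"

definition L2v_inner :: "'s measure \<Rightarrow> ('s \<Rightarrow> 'a) \<Rightarrow> ('s \<Rightarrow> 'a) \<Rightarrow> real" where
  "L2v_inner M z y = (LINT l|completion M. B (z l) (y l))"

definition L2v_nrm :: "'s measure \<Rightarrow> ('s \<Rightarrow> 'a) \<Rightarrow> real" where
  "L2v_nrm M z = sqrt (enn2real (\<integral>\<^sup>+l. ennreal (B (z l) (z l)) \<partial>M))"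

lemma L2v_sq_integrable: "z \<in> L2v M \<Longrightarrow> integrable (completion M) (\<lambda>l. B (z l) (z l))"
  by (rule integrableI_nonneg)
     (auto simp: L2v_def nn_integral_completion nonneg intro!: measurable_inner AE_I2)

lemma L2v_integrable:
  assumes z: "z \<in> L2v M" and y: "y \<in> L2v M"
  shows "integrable (completion M) (\<lambda>l. B (z l) (y l))"
proof (rule Bochner_Integration.integrable_bound)
  show "integrable (completion M) (\<lambda>l. B (z l) (z l) + B (y l) (y l))"
    by (intro Bochner_Integration.integrable_add L2v_sq_integrable z y)
  show "(\<lambda>l. B (z l) (y l)) \<in> borel_measurable (completion M)"
    using z y by (auto simp: L2v_def intro: measurable_inner)
  show "AE l in completion M. norm (B (z l) (y l)) \<le> norm (B (z l) (z l) + B (y l) (y l))"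
  proof (rule AE_I2)
    fix l assume "l \<in> space (completion M)"
    then have V: "z l \<in> V" "y l \<in> V" using z y by (auto simp: L2v_def)
    have "\<bar>B (z l) (y l)\<bar> \<le> p (z l) * p (y l)" by (rule Cauchy_Schwarz[OF V])
    also have "\<dots> \<le> (p (z l))\<^sup>2 + (p (y l))\<^sup>2"
    proof -
      have "0 \<le> (p (z l) - p (y l))\<^sup>2" "0 \<le> (p (z l))\<^sup>2 + (p (y l))\<^sup>2" by auto
      then show ?thesis unfolding power2_diff by linarith
    qed
    finally show "norm (B (z l) (y l)) \<le> norm (B (z l) (z l) + B (y l) (y l))"
      using V by (simp add: nrm_sq nonneg)
  qed
qed

lemma L2v_zero: "0 \<in> L2v M"
  using zero_mem by (auto simp: L2v_def zero_fun_def zero_left intro: strongly_measurable_const)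

lemma L2v_scale: assumes z: "z \<in> L2v M" shows "c *\<^sub>R z \<in> L2v M"
proof -
  have "(\<integral>\<^sup>+l. ennreal (B (c *\<^sub>R z l) (c *\<^sub>R z l)) \<partial>completion M) = ennreal (LINT l|completion M. c\<^sup>2 * B (z l) (z l))"
  proof (subst nn_integral_eq_integral[symmetric])
    show "integrable (completion M) (\<lambda>l. c\<^sup>2 * B (z l) (z l))" by (intro integrable_mult_right L2v_sq_integrable z)
    show "AE l in completion M. 0 \<le> c\<^sup>2 * B (z l) (z l)" using z by (intro AE_I2) (auto simp: L2v_def nonneg)
    show "(\<integral>\<^sup>+l. ennreal (B (c *\<^sub>R z l) (c *\<^sub>R z l)) \<partial>completion M) = (\<integral>\<^sup>+l. ennreal (c\<^sup>2 * B (z l) (z l)) \<partial>completion M)"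
      using z by (intro nn_integral_cong) (auto simp: L2v_def scale_left scale_right mem power2_eq_square mult.assoc)
  qed
  then show ?thesis using z
    by (auto simp: L2v_def scaleR_fun_def mem nn_integral_completion intro: strongly_measurable_scale)
qed

lemma L2v_add: assumes z: "z \<in> L2v M" and y: "y \<in> L2v M" shows "z + y \<in> L2v M"
proof -
  let ?g = "\<lambda>l. B (z l) (z l) + 2 * B (z l) (y l) + B (y l) (y l)"
  have g: "B (z l + y l) (z l + y l) = ?g l" if "l \<in> space M" for l
    using that z y sym[of "y l" "z l"] by (auto simp: L2v_def mem add_left add_right)
  have "(\<integral>\<^sup>+l. ennreal (B (z l + y l) (z l + y l)) \<partial>completion M) = (\<integral>\<^sup>+l. ennreal (?g l) \<partial>completion M)"
    by (intro nn_integral_cong) (simp add: g)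
  also have "\<dots> = ennreal (LINT l|completion M. ?g l)"
  proof (rule nn_integral_eq_integral)
    show "integrable (completion M) ?g"
      by (intro Bochner_Integration.integrable_add integrable_mult_right L2v_sq_integrable L2v_integrable z y)
    have "0 \<le> ?g l" if "l \<in> space M" for l
      unfolding g[OF that, symmetric] using that z y by (intro nonneg mem) (auto simp: L2v_def)
    then show "AE l in completion M. 0 \<le> ?g l" by (intro AE_I2) simp
  qed
  finally show ?thesis using z y
    by (auto simp: L2v_def plus_fun_def mem nn_integral_completion intro: strongly_measurable_add)
qed

lemma L2v_inner_self: "z \<in> L2v M \<Longrightarrow> enn2real (\<integral>\<^sup>+l. ennreal (B (z l) (z l)) \<partial>M) = L2v_inner M z z"
proof -
  assume z: "z \<in> L2v M"
  have "(\<integral>\<^sup>+l. ennreal (B (z l) (z l)) \<partial>completion M) = ennreal (LINT l|completion M. B (z l) (z l))"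
    using z by (intro nn_integral_eq_integral L2v_sq_integrable AE_I2) (auto simp: L2v_def nonneg)
  moreover have "0 \<le> (LINT l|completion M. B (z l) (z l))"
    using z by (intro integral_nonneg_AE AE_I2) (auto simp: L2v_def nonneg)
  ultimately show ?thesis by (simp add: L2v_inner_def nn_integral_completion)
qed

lemma L2v_nn_integral: "z \<in> L2v M \<Longrightarrow> (\<integral>\<^sup>+l. ennreal (B (z l) (z l)) \<partial>M) = ennreal ((L2v_nrm M z)\<^sup>2)"
  by (simp add: L2v_nrm_def L2v_def)

lemma L2v_semi_inner: "semi_inner (L2v M) (L2v_inner M) (L2v_nrm M)"
proof
  show "0 \<in> L2v M" by (rule L2v_zero)
  show "z + y \<in> L2v M" if "z \<in> L2v M" "y \<in> L2v M" for z y using that by (rule L2v_add)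
  show "c *\<^sub>R z \<in> L2v M" if "z \<in> L2v M" for c z using that by (rule L2v_scale)
  show "L2v_inner M z y = L2v_inner M y z" if "z \<in> L2v M" "y \<in> L2v M" for z y
    unfolding L2v_inner_def using that by (intro Bochner_Integration.integral_cong refl sym) (auto simp: L2v_def)
  show "L2v_inner M (z + y) w = L2v_inner M z w + L2v_inner M y w"
    if "z \<in> L2v M" "y \<in> L2v M" "w \<in> L2v M" for z y w
  proof -
    have "L2v_inner M (z + y) w = (LINT l|completion M. B (z l) (w l) + B (y l) (w l))"
      unfolding L2v_inner_def using that
      by (intro Bochner_Integration.integral_cong) (auto simp: L2v_def add_left)
    then show ?thesis unfolding L2v_inner_def using that
      by (simp add: Bochner_Integration.integral_add L2v_integrable)
  qed
  show "L2v_inner M (c *\<^sub>R z) w = c * L2v_inner M z w" if "z \<in> L2v M" "w \<in> L2v M" for c z w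
  proof -
    have "L2v_inner M (c *\<^sub>R z) w = (LINT l|completion M. c * B (z l) (w l))"
      unfolding L2v_inner_def using that
      by (intro Bochner_Integration.integral_cong) (auto simp: L2v_def scale_left scaleR_fun_def)
    then show ?thesis unfolding L2v_inner_def by simp
  qed
  show "0 \<le> L2v_inner M z z" if "z \<in> L2v M" for z
    unfolding L2v_inner_self[OF that, symmetric] by simp
  show "L2v_nrm M z = sqrt (L2v_inner M z z)" if "z \<in> L2v M" for z
    unfolding L2v_inner_self[OF that, symmetric] by (simp add: L2v_nrm_def)
qed

lemma L2v_complete:
  fixes M :: "'s measure"
  assumes complete: complete_space
  shows "semi_inner.complete_space (L2v M) (L2v_nrm M)"
proof -
  interpret L: semi_inner "L2v M" "L2v_inner M" "L2v_nrm M" by (rule L2v_semi_inner)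
  show ?thesis unfolding L.complete_space_def
  proof (intro allI impI)
    fix z :: "nat \<Rightarrow> 's \<Rightarrow> 'a"
    assume "range z \<subseteq> L2v M \<and> (\<forall>e>0. \<exists>N. \<forall>m\<ge>N. \<forall>n\<ge>N. L2v_nrm M (z m - z n) < e)"
    then have z: "\<And>n. z n \<in> L2v M" and Cauchy: "\<And>e. e > 0 \<Longrightarrow> \<exists>N. \<forall>m\<ge>N. \<forall>n\<ge>N. L2v_nrm M (z m - z n) < e"
      by auto
    have zV: "z n l \<in> V" if "l \<in> space M" for n l using z[of n] that by (auto simp: L2v_def)
    have zm: "strongly_measurable M V p (z n)" for n using z[of n] by (auto simp: L2v_def)
    have sq: "(\<integral>\<^sup>+l. ennreal ((p (y l - w l))\<^sup>2) \<partial>M) = ennreal ((L2v_nrm M (y - w))\<^sup>2)"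
      if "y \<in> L2v M" "w \<in> L2v M" for y w
    proof -
      have "(\<integral>\<^sup>+l. ennreal ((p (y l - w l))\<^sup>2) \<partial>M) = (\<integral>\<^sup>+l. ennreal (B ((y - w) l) ((y - w) l)) \<partial>M)"
        using that by (intro nn_integral_cong) (auto simp: L2v_def nrm_sq mem fun_diff_def)
      then show ?thesis using L2v_nn_integral[OF L.diff_mem[OF that]] by simp
    qed
    obtain y r where y: "\<And>x. x \<in> space M \<Longrightarrow> y x \<in> V" "strict_mono (r :: nat \<Rightarrow> nat)"
      "AE x in M. (\<lambda>k. p (z (r k) x - y x)) \<longlonglongrightarrow> 0"
      "(\<lambda>n. \<integral>\<^sup>+x. ennreal ((p (z n x - y x))\<^sup>2) \<partial>M) \<longlonglongrightarrow> 0"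
    proof (rule Riesz_Fischer[OF complete, of M z])
      show "z n x \<in> V" if "x \<in> space M" for n x using zV[OF that] .
      show "(\<lambda>x. p (z m x - z n x)) \<in> borel_measurable (completion M)" for m n
        by (intro measurable_nrm strongly_measurable_diff zm)
      show "\<exists>N. \<forall>m\<ge>N. \<forall>n\<ge>N. (\<integral>\<^sup>+x. ennreal ((p (z m x - z n x))\<^sup>2) \<partial>M) < ennreal e" if e: "e > 0" for e
      proof -
        obtain N where N: "\<forall>m\<ge>N. \<forall>n\<ge>N. L2v_nrm M (z m - z n) < sqrt e" using Cauchy[of "sqrt e"] e by auto
        have "(L2v_nrm M (z m - z n))\<^sup>2 < e" if "m \<ge> N" "n \<ge> N" for m n
          using power_strict_mono[of "L2v_nrm M (z m - z n)" "sqrt e" 2] N that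
            L.nrm_nonneg[OF L.diff_mem[OF z z], of m n] e by simp
        then show ?thesis unfolding sq[OF z z] using e by (intro exI[of _ N]) (auto intro: ennreal_lessI)
      qed
    qed (rule that; assumption)
    have "\<exists>c :: nat \<Rightarrow> 'a. range c \<subseteq> V \<and> (AE x in M. \<forall>e>0. \<exists>k. p (z n x - c k) < e)" for n
    proof -
      obtain c :: "nat \<Rightarrow> 'a" where "range c \<subseteq> V" "c 0 = 0" "AE x in M. \<forall>e>0. \<exists>k. p (z n x - c k) < e"
        using strongly_measurable_dense_sequence[OF zm[of n]] .
      then show ?thesis by (intro exI[of _ c] conjI)
    qed
    then have "\<forall>n. \<exists>c :: nat \<Rightarrow> 'a. range c \<subseteq> V \<and> (AE x in M. \<forall>e>0. \<exists>k. p (z n x - c k) < e)" ..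
    then obtain c :: "nat \<Rightarrow> nat \<Rightarrow> 'a" where
      c': "\<forall>n. range (c n) \<subseteq> V \<and> (AE x in M. \<forall>e>0. \<exists>k. p (z n x - c n k) < e)"
      unfolding choice_iff ..
    then have c: "\<And>n. range (c n) \<subseteq> V"
      "\<And>n. AE x in M. \<forall>e>0. \<exists>k. p (z n x - c n k) < e" by auto
    have cV: "c n k \<in> V" for n k using c(1)[of n] by auto
    have ym: "strongly_measurable M V p y"
    proof (rule strongly_measurableI[where c = "\<lambda>j. c (fst (prod_decode j)) (snd (prod_decode j))"])
      show "AE x in M. y x \<in> V" using y(1) by (rule AE_I2)
      show "range (\<lambda>j. c (fst (prod_decode j)) (snd (prod_decode j))) \<subseteq> V" using cV by auto
      show "(\<lambda>x. p (y x - v)) \<in> borel_measurable (completion M)" if v: "v \<in> V" for v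
      proof (rule completion.borel_measurable_AE_limit)
        show "(\<lambda>x. p (z (r k) x - v)) \<in> borel_measurable (completion M)" for k
          by (rule measurable_nrm_diff[OF zm v])
        show "AE x in completion M. (\<lambda>k. p (z (r k) x - v)) \<longlonglongrightarrow> p (y x - v)"
          using AE_completion[OF y(3)] AE_space[of "completion M"]
        proof eventually_elim
          case (elim x)
          then have x: "x \<in> space M" by simp
          have "norm (p (z (r k) x - v) - p (y x - v)) \<le> p (z (r k) x - y x)" for k
            using nrm_abs_diff[of "z (r k) x - v" "y x - v"] zV[OF x] y(1)[OF x] v by (simp add: mem)
          then have "(\<lambda>k. p (z (r k) x - v) - p (y x - v)) \<longlonglongrightarrow> 0"
            by (intro Lim_null_comparison[OF always_eventually elim(1)]) auto
          then show ?case by (simp add: LIM_zero_iff)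
        qed
      qed
      have "AE x in M. \<forall>n. \<forall>e>0. \<exists>k. p (z n x - c n k) < e" using c(2) by (simp add: AE_all_countable)
      then show "AE x in M. \<forall>e>0. \<exists>j. p (y x - c (fst (prod_decode j)) (snd (prod_decode j))) < e"
        using y(3) AE_space[of M]
      proof eventually_elim
        case (elim x)
        show ?case
        proof (intro allI impI)
          fix e :: real assume e: "e > 0"
          have "eventually (\<lambda>k. p (z (r k) x - y x) < e / 2) sequentially"
            using elim(2) e by (intro order_tendstoD(2)) auto
          then obtain k where k: "p (z (r k) x - y x) < e / 2" by (auto simp: eventually_sequentially)
          obtain i where i: "p (z (r k) x - c (r k) i) < e / 2" using elim(1) e by (meson half_gt_zero)
          have "p (y x - c (r k) i) \<le> p (y x - z (r k) x) + p (z (r k) x - c (r k) i)"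
            using elim y(1) zV cV by (intro nrm_dist_triangle) auto
          then have "p (y x - c (r k) i) < e"
            using k i nrm_minus_commute[of "y x" "z (r k) x"] y(1) zV elim by simp
          then show "\<exists>j. p (y x - c (fst (prod_decode j)) (snd (prod_decode j))) < e"
            by (intro exI[of _ "prod_encode (r k, i)"]) simp
        qed
      qed
    qed
    have "eventually (\<lambda>n. (\<integral>\<^sup>+x. ennreal ((p (z n x - y x))\<^sup>2) \<partial>M) < 1) sequentially"
      using y(4) by (rule order_tendstoD(2)) simp
    then obtain n0 where n0: "(\<integral>\<^sup>+x. ennreal ((p (z n0 x - y x))\<^sup>2) \<partial>M) < 1" by (auto simp: eventually_sequentially)
    have d: "z n0 - y \<in> L2v M"
    proof -
      have "(\<integral>\<^sup>+x. ennreal (B ((z n0 - y) x) ((z n0 - y) x)) \<partial>M) = (\<integral>\<^sup>+x. ennreal ((p (z n0 x - y x))\<^sup>2) \<partial>M)"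
        using zV y(1) by (intro nn_integral_cong) (auto simp: nrm_sq mem fun_diff_def)
      also note n0
      also have "(1::ennreal) < \<infinity>" by simp
      finally show ?thesis unfolding L2v_def using zV y(1) strongly_measurable_diff[OF zm ym, of n0]
        by (auto simp: mem fun_diff_def)
    qed
    have yL: "y \<in> L2v M" using L.diff_mem[OF z[of n0] d] by simp
    have "(\<lambda>n. ennreal ((L2v_nrm M (z n - y))\<^sup>2)) \<longlonglongrightarrow> ennreal 0"
      using y(4) unfolding sq[OF z yL] by simp
    then have "(\<lambda>n. (L2v_nrm M (z n - y))\<^sup>2) \<longlonglongrightarrow> 0" by (subst (asm) tendsto_ennreal_iff) auto
    then have "(\<lambda>n. sqrt ((L2v_nrm M (z n - y))\<^sup>2)) \<longlonglongrightarrow> sqrt 0" by (rule tendsto_real_sqrt)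
    then have "(\<lambda>n. L2v_nrm M (z n - y)) \<longlonglongrightarrow> 0"
      using L.nrm_nonneg[OF L.diff_mem[OF z yL]] by simp
    with yL show "\<exists>y\<in>L2v M. (\<lambda>n. L2v_nrm M (z n - y)) \<longlonglongrightarrow> 0" by blast
  qed
qed

end

section \<open>Products\<close>

definition prod_inner :: "('a \<Rightarrow> 'a \<Rightarrow> real) \<Rightarrow> ('b \<Rightarrow> 'b \<Rightarrow> real) \<Rightarrow> 'a \<times> 'b \<Rightarrow> 'a \<times> 'b \<Rightarrow> real" where
  "prod_inner B1 B2 x y = B1 (fst x) (fst y) + B2 (snd x) (snd y)"

lemma semi_inner_prod:
  assumes 1: "semi_inner V1 B1 p1" and 2: "semi_inner V2 B2 p2"
    and p: "\<And>x. x \<in> V1 \<times> V2 \<Longrightarrow> p x = sqrt ((p1 (fst x))\<^sup>2 + (p2 (snd x))\<^sup>2)"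
  shows "semi_inner (V1 \<times> V2) (prod_inner B1 B2) p"
proof -
  interpret A: semi_inner V1 B1 p1 by fact
  interpret B: semi_inner V2 B2 p2 by fact
  show ?thesis
  proof
    show "p x = sqrt (prod_inner B1 B2 x x)" if "x \<in> V1 \<times> V2" for x
      using p[OF that] that by (auto simp: prod_inner_def A.nrm_sq B.nrm_sq)
    show "prod_inner B1 B2 x y = prod_inner B1 B2 y x" if "x \<in> V1 \<times> V2" "y \<in> V1 \<times> V2" for x y
      unfolding prod_inner_def using that by (intro arg_cong2[of _ _ _ _ "(+)"] A.sym B.sym) auto
  qed (auto simp: prod_inner_def A.mem B.mem A.add_left B.add_left A.scale_left B.scale_left
        A.nonneg B.nonneg distrib_left zero_prod_def)
qed

lemma complete_space_prod:
  assumes 1: "semi_inner V1 B1 p1" and 2: "semi_inner V2 B2 p2"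
    and c1: "semi_inner.complete_space V1 p1" and c2: "semi_inner.complete_space V2 p2"
    and p: "\<And>x. x \<in> V1 \<times> V2 \<Longrightarrow> p x = sqrt ((p1 (fst x))\<^sup>2 + (p2 (snd x))\<^sup>2)"
  shows "semi_inner.complete_space (V1 \<times> V2) p"
proof -
  interpret A: semi_inner V1 B1 p1 by fact
  interpret B: semi_inner V2 B2 p2 by fact
  interpret P: semi_inner "V1 \<times> V2" "prod_inner B1 B2" p using 1 2 p by (rule semi_inner_prod)
  show ?thesis unfolding P.complete_space_def
  proof (intro allI impI)
    fix x :: "nat \<Rightarrow> _"
    assume "range x \<subseteq> V1 \<times> V2 \<and> (\<forall>e>0. \<exists>N. \<forall>m\<ge>N. \<forall>n\<ge>N. p (x m - x n) < e)"
    then have x: "\<And>n. x n \<in> V1 \<times> V2" and Cauchy: "\<And>e. e > 0 \<Longrightarrow> \<exists>N. \<forall>m\<ge>N. \<forall>n\<ge>N. p (x m - x n) < e" by auto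
    have le: "p1 (fst w) \<le> p w" "p2 (snd w) \<le> p w" if "w \<in> V1 \<times> V2" for w
      unfolding p[OF that] by (auto intro: real_le_rsqrt)
    have x1: "fst (x n) \<in> V1" and x2: "snd (x n) \<in> V2" for n using x[of n] by auto
    have "\<exists>y\<in>V1. (\<lambda>n. p1 (fst (x n) - y)) \<longlonglongrightarrow> 0"
    proof (rule A.complete_spaceD[OF c1 x1])
      fix e :: real assume "e > 0"
      then show "\<exists>N. \<forall>m\<ge>N. \<forall>n\<ge>N. p1 (fst (x m) - fst (x n)) < e"
        using Cauchy[of e] le(1)[OF P.diff_mem[OF x x]] by (metis fst_diff order.strict_trans1)
    qed
    then obtain y1 where y1: "y1 \<in> V1" "(\<lambda>n. p1 (fst (x n) - y1)) \<longlonglongrightarrow> 0" by blast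
    have "\<exists>y\<in>V2. (\<lambda>n. p2 (snd (x n) - y)) \<longlonglongrightarrow> 0"
    proof (rule B.complete_spaceD[OF c2 x2])
      fix e :: real assume "e > 0"
      then show "\<exists>N. \<forall>m\<ge>N. \<forall>n\<ge>N. p2 (snd (x m) - snd (x n)) < e"
        using Cauchy[of e] le(2)[OF P.diff_mem[OF x x]] by (metis snd_diff order.strict_trans1)
    qed
    then obtain y2 where y2: "y2 \<in> V2" "(\<lambda>n. p2 (snd (x n) - y2)) \<longlonglongrightarrow> 0" by blast
    have y: "(y1, y2) \<in> V1 \<times> V2" using y1 y2 by simp
    have "(\<lambda>n. sqrt ((p1 (fst (x n) - y1))\<^sup>2 + (p2 (snd (x n) - y2))\<^sup>2)) \<longlonglongrightarrow> sqrt (0\<^sup>2 + 0\<^sup>2)"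
      by (intro tendsto_intros y1 y2)
    then have "(\<lambda>n. p (x n - (y1, y2))) \<longlonglongrightarrow> 0"
      using p[OF P.diff_mem[OF x y]] by simp
    with y show "\<exists>y\<in>V1 \<times> V2. (\<lambda>n. p (x n - y)) \<longlonglongrightarrow> 0" by blast
  qed
qed

section \<open>The Lebesgue space of square integrable functions\<close>

definition L2_inner :: "'s measure \<Rightarrow> ('s \<Rightarrow> 'b::euclidean_space) \<Rightarrow> ('s \<Rightarrow> 'b) \<Rightarrow> real" where
  "L2_inner M f g = (LINT x|M. f x \<bullet> g x)"

lemma L2_space_measurable: "f \<in> L2_space M \<Longrightarrow> f \<in> borel_measurable M"
  and L2_space_integrable: "f \<in> L2_space M \<Longrightarrow> integrable M (\<lambda>x. (norm (f x))\<^sup>2)"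
  by (auto simp: L2_space_def)

lemma norm_mult_le_sum_squares: "(a::real) * b \<le> a\<^sup>2 + b\<^sup>2"
proof -
  have "0 \<le> (a - b)\<^sup>2" "0 \<le> a\<^sup>2 + b\<^sup>2" by auto
  then show ?thesis unfolding power2_diff by linarith
qed

lemma L2_inner_integrable:
  assumes "f \<in> L2_space M" "g \<in> L2_space M" shows "integrable M (\<lambda>x. f x \<bullet> g x)"
proof (rule Bochner_Integration.integrable_bound)
  show "integrable M (\<lambda>x. (norm (f x))\<^sup>2 + (norm (g x))\<^sup>2)"
    by (intro Bochner_Integration.integrable_add L2_space_integrable assms)
  show "(\<lambda>x. f x \<bullet> g x) \<in> borel_measurable M"
    by (intro borel_measurable_inner L2_space_measurable assms)
  show "AE x in M. norm (f x \<bullet> g x) \<le> norm ((norm (f x))\<^sup>2 + (norm (g x))\<^sup>2)"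
    using order_trans[OF Cauchy_Schwarz_ineq2 norm_mult_le_sum_squares] by (intro AE_I2) simp
qed

lemma L2_space_bound:
  assumes f: "f \<in> borel_measurable M" and g: "g \<in> L2_space M" and le: "AE x in M. norm (f x) \<le> c * norm (g x)"
  shows "f \<in> L2_space M"
proof -
  have "integrable M (\<lambda>x. (norm (f x))\<^sup>2)"
  proof (rule Bochner_Integration.integrable_bound)
    show "integrable M (\<lambda>x. c\<^sup>2 * (norm (g x))\<^sup>2)" by (intro integrable_mult_right L2_space_integrable g)
    show "(\<lambda>x. (norm (f x))\<^sup>2) \<in> borel_measurable M" using f by measurable
    show "AE x in M. norm ((norm (f x))\<^sup>2) \<le> norm (c\<^sup>2 * (norm (g x))\<^sup>2)"
      using le
    proof eventually_elim
      case (elim x)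
      then have "(norm (f x))\<^sup>2 \<le> (c * norm (g x))\<^sup>2" by (intro power_mono) auto
      then show ?case by (simp add: power_mult_distrib)
    qed
  qed
  with f show ?thesis by (simp add: L2_space_def)
qed

lemma L2_space_scale: "f \<in> L2_space M \<Longrightarrow> c *\<^sub>R f \<in> L2_space M"
  by (rule L2_space_bound[where c = "\<bar>c\<bar>"]) (auto simp: scaleR_fun_def dest: L2_space_measurable)

lemma L2_space_add:
  assumes f: "f \<in> L2_space M" and g: "g \<in> L2_space M" shows "f + g \<in> L2_space M"
proof -
  have "integrable M (\<lambda>x. (norm (f x))\<^sup>2 + 2 * (f x \<bullet> g x) + (norm (g x))\<^sup>2)"
    by (intro Bochner_Integration.integrable_add integrable_mult_right L2_inner_integrable L2_space_integrable f g)
  also have "(\<lambda>x. (norm (f x))\<^sup>2 + 2 * (f x \<bullet> g x) + (norm (g x))\<^sup>2) = (\<lambda>x. (norm (f x + g x))\<^sup>2)"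
    by (simp add: power2_norm_eq_inner inner_add inner_commute fun_eq_iff algebra_simps)
  finally show ?thesis
    using L2_space_measurable[OF f] L2_space_measurable[OF g] by (auto simp: L2_space_def plus_fun_def)
qed

lemma L2_semi_inner: "semi_inner (L2_space M) (L2_inner M) (L2_nrm M)"
proof
  show "0 \<in> L2_space M" by (simp add: L2_space_def zero_fun_def)
  show "f + g \<in> L2_space M" if "f \<in> L2_space M" "g \<in> L2_space M" for f g :: "'a \<Rightarrow> 'b"
    using that by (rule L2_space_add)
  show "c *\<^sub>R f \<in> L2_space M" if "f \<in> L2_space M" for f :: "'a \<Rightarrow> 'b" and c
    using that by (rule L2_space_scale)
  show "L2_inner M f g = L2_inner M g f" for f g :: "'a \<Rightarrow> 'b"
    by (simp add: L2_inner_def inner_commute)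
  show "L2_inner M (f + g) h = L2_inner M f h + L2_inner M g h"
    if "f \<in> L2_space M" "g \<in> L2_space M" "h \<in> L2_space M" for f g h :: "'a \<Rightarrow> 'b"
    using that by (simp add: L2_inner_def inner_add_left Bochner_Integration.integral_add L2_inner_integrable)
  show "L2_inner M (c *\<^sub>R f) h = c * L2_inner M f h" for f h :: "'a \<Rightarrow> 'b" and c
    by (simp add: L2_inner_def scaleR_fun_def)
  show "0 \<le> L2_inner M f f" for f :: "'a \<Rightarrow> 'b"
    unfolding L2_inner_def by (intro integral_nonneg_AE AE_I2) simp
  show "L2_nrm M f = sqrt (L2_inner M f f)" for f :: "'a \<Rightarrow> 'b"
    by (simp add: L2_nrm_def L2_inner_def power2_norm_eq_inner)
qed

lemma L2_nn_integral:
  "f \<in> L2_space M \<Longrightarrow> (\<integral>\<^sup>+x. ennreal ((norm (f x))\<^sup>2) \<partial>M) = ennreal ((L2_nrm M f)\<^sup>2)"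
  unfolding L2_nrm_def by (subst nn_integral_eq_integral) (auto intro: L2_space_integrable)

lemma L2_inner_cong_AE:
  assumes "f \<in> L2_space M" "g \<in> L2_space M" "f' \<in> L2_space M" "g' \<in> L2_space M"
    "AE x in M. f x = f' x" "AE x in M. g x = g' x"
  shows "L2_inner M f g = L2_inner M f' g'"
  unfolding L2_inner_def
proof (rule integral_cong_AE)
  show "AE x in M. f x \<bullet> g x = f' x \<bullet> g' x" using assms(5,6) by eventually_elim simp
qed (intro borel_measurable_inner L2_space_measurable assms)+

lemma semi_inner_euclidean: "semi_inner UNIV (\<bullet>) (norm :: 'b::euclidean_space \<Rightarrow> real)"
  by unfold_locales (auto simp: inner_commute inner_add_left inner_add_right norm_eq_sqrt_inner)

lemma complete_space_euclidean:
  "semi_inner.complete_space UNIV (norm :: 'b::euclidean_space \<Rightarrow> real)"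
  unfolding semi_inner.complete_space_def[OF semi_inner_euclidean]
proof (intro allI impI)
  fix x :: "nat \<Rightarrow> 'b"
  assume "range x \<subseteq> UNIV \<and> (\<forall>e>0. \<exists>N. \<forall>m\<ge>N. \<forall>n\<ge>N. norm (x m - x n) < e)"
  then have "Cauchy x" unfolding Cauchy_def dist_norm by auto
  then obtain y where "x \<longlonglongrightarrow> y" using Cauchy_convergent_iff convergent_def by blast
  then have "(\<lambda>n. norm (x n - y)) \<longlonglongrightarrow> 0" by (simp add: tendsto_norm_zero_iff LIM_zero_iff)
  then show "\<exists>y\<in>UNIV. (\<lambda>n. norm (x n - y)) \<longlonglongrightarrow> 0" by blast
qed

lemma L2_complete:
  fixes M :: "'s measure"
  assumes M: "complete_measure M"
  shows "semi_inner.complete_space (L2_space M) (L2_nrm M :: ('s \<Rightarrow> 'b::euclidean_space) \<Rightarrow> real)"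
  unfolding semi_inner.complete_space_def[OF L2_semi_inner]
proof (intro allI impI)
  interpret E: semi_inner UNIV "(\<bullet>)" "norm :: 'b \<Rightarrow> real" by (rule semi_inner_euclidean)
  interpret L: semi_inner "L2_space M" "L2_inner M" "L2_nrm M :: ('s \<Rightarrow> 'b) \<Rightarrow> real" by (rule L2_semi_inner)
  interpret complete_measure M by fact
  fix z :: "nat \<Rightarrow> 's \<Rightarrow> 'b"
  assume "range z \<subseteq> L2_space M \<and> (\<forall>e>0. \<exists>N. \<forall>m\<ge>N. \<forall>n\<ge>N. L2_nrm M (z m - z n) < e)"
  then have z: "\<And>n. z n \<in> L2_space M" and Cauchy: "\<And>e. e > 0 \<Longrightarrow> \<exists>N. \<forall>m\<ge>N. \<forall>n\<ge>N. L2_nrm M (z m - z n) < e"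
    by auto
  have sq: "(\<integral>\<^sup>+x. ennreal ((norm (f x - g x))\<^sup>2) \<partial>M) = ennreal ((L2_nrm M (f - g))\<^sup>2)"
    if "f \<in> L2_space M" "g \<in> L2_space M" for f g :: "'s \<Rightarrow> 'b"
    using L2_nn_integral[OF L.diff_mem[OF that]] by (simp add: fun_diff_def)
  obtain y r where y: "\<And>x. x \<in> space M \<Longrightarrow> y x \<in> UNIV" "strict_mono (r :: nat \<Rightarrow> nat)"
    "AE x in M. (\<lambda>k. norm (z (r k) x - y x)) \<longlonglongrightarrow> 0"
    "(\<lambda>n. \<integral>\<^sup>+x. ennreal ((norm (z n x - y x))\<^sup>2) \<partial>M) \<longlonglongrightarrow> 0"
  proof (rule E.Riesz_Fischer[OF complete_space_euclidean, of M z])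
    show "z n x \<in> UNIV" for n x by simp
    show "(\<lambda>x. norm (z m x - z n x)) \<in> borel_measurable (completion M)" for m n
      using L2_space_measurable[OF z] by (intro measurable_completion) measurable
    show "\<exists>N. \<forall>m\<ge>N. \<forall>n\<ge>N. (\<integral>\<^sup>+x. ennreal ((norm (z m x - z n x))\<^sup>2) \<partial>M) < ennreal e" if e: "e > 0" for e
    proof -
      obtain N where N: "\<forall>m\<ge>N. \<forall>n\<ge>N. L2_nrm M (z m - z n) < sqrt e" using Cauchy[of "sqrt e"] e by auto
      have "(L2_nrm M (z m - z n))\<^sup>2 < e" if "m \<ge> N" "n \<ge> N" for m n
        using power_strict_mono[of "L2_nrm M (z m - z n)" "sqrt e" 2] N that
          L.nrm_nonneg[OF L.diff_mem[OF z z], of m n] e by simp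
      then show ?thesis unfolding sq[OF z z] using e by (intro exI[of _ N]) (auto intro: ennreal_lessI)
    qed
  qed (rule that; assumption)
  have ym: "y \<in> borel_measurable M"
  proof (rule borel_measurable_AE_limit)
    show "z (r k) \<in> borel_measurable M" for k by (rule L2_space_measurable[OF z])
    show "AE x in M. (\<lambda>k. z (r k) x) \<longlonglongrightarrow> y x"
      using y(3) by eventually_elim (simp add: tendsto_norm_zero_iff LIM_zero_iff)
  qed
  have "eventually (\<lambda>n. (\<integral>\<^sup>+x. ennreal ((norm (z n x - y x))\<^sup>2) \<partial>M) < 1) sequentially"
    using y(4) by (rule order_tendstoD(2)) simp
  then obtain n0 where n0: "(\<integral>\<^sup>+x. ennreal ((norm (z n0 x - y x))\<^sup>2) \<partial>M) < 1" by (auto simp: eventually_sequentially)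
  have d: "z n0 - y \<in> L2_space M"
    unfolding L2_space_def fun_diff_def
  proof (intro CollectI conjI)
    show meas: "(\<lambda>x. z n0 x - y x) \<in> borel_measurable M"
      by (intro borel_measurable_diff L2_space_measurable[OF z] ym)
    show "integrable M (\<lambda>x. (norm (z n0 x - y x))\<^sup>2)"
    proof (rule integrableI_nonneg)
      show "(\<integral>\<^sup>+x. ennreal ((norm (z n0 x - y x))\<^sup>2) \<partial>M) < \<infinity>"
        by (rule order.strict_trans[OF n0]) simp
    qed (use meas in measurable)
  qed
  have yL: "y \<in> L2_space M" using L.diff_mem[OF z[of n0] d] by simp
  have "(\<lambda>n. ennreal ((L2_nrm M (z n - y))\<^sup>2)) \<longlonglongrightarrow> ennreal 0"
    using y(4) unfolding sq[OF z yL] by simp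
  then have "(\<lambda>n. (L2_nrm M (z n - y))\<^sup>2) \<longlonglongrightarrow> 0" by (subst (asm) tendsto_ennreal_iff) auto
  then have "(\<lambda>n. sqrt ((L2_nrm M (z n - y))\<^sup>2)) \<longlonglongrightarrow> sqrt 0" by (rule tendsto_real_sqrt)
  then have "(\<lambda>n. L2_nrm M (z n - y)) \<longlonglongrightarrow> 0"
    using L.nrm_nonneg[OF L.diff_mem[OF z yL]] by simp
  with yL show "\<exists>y\<in>L2_space M. (\<lambda>n. L2_nrm M (z n - y)) \<longlonglongrightarrow> 0" by blast
qed

lemma H_inner_eq: "H_inner \<Omega> = L2_inner (lebesgue_on \<Omega>)"
  by (simp add: H_inner_def[abs_def] L2_inner_def[abs_def])

lemma H_semi_inner: "semi_inner (Hsp \<Omega>) (H_inner \<Omega>) (H_nrm \<Omega>)"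
  unfolding Hsp_def H_nrm_def H_inner_eq by (rule L2_semi_inner)

lemma semi_inner_sum:
  assumes 1: "semi_inner V B1 p1" and 2: "semi_inner V B2 p2"
    and p: "\<And>x. x \<in> V \<Longrightarrow> p x = sqrt ((p1 x)\<^sup>2 + (p2 x)\<^sup>2)"
  shows "semi_inner V (\<lambda>x y. B1 x y + B2 x y) p"
proof -
  interpret A: semi_inner V B1 p1 by fact
  interpret B: semi_inner V B2 p2 by fact
  show ?thesis
  proof
    show "p x = sqrt (B1 x x + B2 x x)" if "x \<in> V" for x
      using p[OF that] that by (simp add: A.nrm_sq B.nrm_sq)
    show "B1 x y + B2 x y = B1 y x + B2 y x" if "x \<in> V" "y \<in> V" for x y
      using A.sym[OF that] B.sym[OF that] by simp
  qed (auto simp: A.mem A.add_left B.add_left A.scale_left B.scale_left A.nonneg B.nonneg distrib_left)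
qed

section \<open>Weak gradients\<close>

lemma Ck_add: "Ck k \<phi> \<Longrightarrow> Ck k \<psi> \<Longrightarrow> Ck k (\<lambda>x. \<phi> x + \<psi> x)"
proof (induction k arbitrary: \<phi> \<psi>)
  case 0 then show ?case by (auto intro: continuous_on_add)
next
  case (Suc k)
  have "partial i (\<lambda>x. \<phi> x + \<psi> x) = (\<lambda>x. partial i \<phi> x + partial i \<psi> x)" for i
    using Suc.prems by (intro ext partial_add) (auto simp: differentiable_on_def)
  then show ?case using Suc by (auto intro: differentiable_on_add)
qed

lemma Ck_scale:
  fixes \<phi> :: "real ^ 'n::finite \<Rightarrow> real"
  shows "Ck k \<phi> \<Longrightarrow> Ck k (\<lambda>x. c * \<phi> x)"
proof (induction k arbitrary: \<phi>)
  case 0 then show ?case by (auto intro!: continuous_intros)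
next
  case (Suc k)
  have "partial i (\<lambda>x. c * \<phi> x) x = partial i (\<lambda>x::real^'n. c) x * \<phi> x + c * partial i \<phi> x" for i x
    using partial_mult[of "\<lambda>x::real^'n. c" x \<phi> i] Suc.prems by (simp add: differentiable_on_def)
  moreover have "partial i (\<lambda>x::real^'n. c) x = 0" for i x using partial_eqI[OF has_derivative_const] .
  ultimately have "partial i (\<lambda>x. c * \<phi> x) = (\<lambda>x. c * partial i \<phi> x)" for i by (simp add: fun_eq_iff)
  then show ?case using Suc by (auto intro!: differentiable_on_mult)
qed

lemma test_functions_add:
  assumes "\<phi> \<in> test_functions \<Omega>" "\<psi> \<in> test_functions \<Omega>" shows "\<phi> + \<psi> \<in> test_functions \<Omega>"
proof -
  let ?S = "\<lambda>f. closure {x. f x \<noteq> (0::real)}"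
  have "{x. (\<phi> + \<psi>) x \<noteq> 0} \<subseteq> {x. \<phi> x \<noteq> 0} \<union> {x. \<psi> x \<noteq> 0}" by auto
  from closure_mono[OF this] have sub: "?S (\<phi> + \<psi>) \<subseteq> ?S \<phi> \<union> ?S \<psi>" unfolding closure_Un .
  have "compact (?S \<phi> \<union> ?S \<psi>)" using assms by (auto simp: test_functions_def)
  from bounded_subset[OF compact_imp_bounded[OF this] sub] have "compact (?S (\<phi> + \<psi>))"
    by (simp add: compact_eq_bounded_closed)
  then show ?thesis
    using assms sub Ck_add[of _ \<phi> \<psi>] by (auto simp: test_functions_def plus_fun_def)
qed

lemma test_functions_scale:
  assumes "\<phi> \<in> test_functions \<Omega>" shows "c *\<^sub>R \<phi> \<in> test_functions \<Omega>"
proof -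
  let ?S = "\<lambda>f. closure {x. f x \<noteq> (0::real)}"
  have sub: "?S (c *\<^sub>R \<phi>) \<subseteq> ?S \<phi>" by (intro closure_mono) (auto simp: scaleR_fun_def)
  have "compact (?S \<phi>)" using assms by (auto simp: test_functions_def)
  from bounded_subset[OF compact_imp_bounded[OF this] sub] have "compact (?S (c *\<^sub>R \<phi>))"
    by (simp add: compact_eq_bounded_closed)
  then show ?thesis
    using assms sub Ck_scale[of _ \<phi> c] by (auto simp: test_functions_def scaleR_fun_def)
qed

lemma test_functions_zero: "0 \<in> test_functions (\<Omega> :: (real ^ 'n::finite) set)"
proof -
  have "Ck k (\<lambda>x::real^'n. 0)" for k by (rule bump_algebra_Ck[OF bump_algebra.const])
  then show ?thesis by (simp add: test_functions_def zero_fun_def)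
qed

text \<open>
  Weak derivatives make sense on any open set; boundedness makes continuous functions square
  integrable, hence test functions elements of \<open>H\<^sup>1(\<Omega>)\<close>.
\<close>

locale bounded_open =
  fixes \<Omega> :: "(real ^ 'n::finite) set"
  assumes open_\<Omega>: "open \<Omega>" and bounded_\<Omega>: "bounded \<Omega>"
begin

abbreviation "\<mu> \<equiv> lebesgue_on \<Omega>"

lemma \<Omega>_lebesgue: "\<Omega> \<in> sets lebesgue"
  using open_\<Omega> by (simp add: borel_open)

lemma complete_\<mu>: "complete_measure \<mu>"
  by (rule complete_measure_lebesgue_on[OF \<Omega>_lebesgue])

lemma finite_\<mu>: "finite_measure \<mu>"
  by (intro finite_measure_lebesgue_on bounded_set_imp_lmeasurable bounded_\<Omega> \<Omega>_lebesgue)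

lemma continuous_L2:
  fixes f :: "real ^ 'n \<Rightarrow> 'b::euclidean_space"
  assumes f: "continuous_on UNIV f" shows "f \<in> L2_space \<mu>"
proof -
  interpret finite_measure \<mu> by (rule finite_\<mu>)
  have meas: "f \<in> borel_measurable \<mu>"
    by (intro continuous_imp_measurable_on_sets_lebesgue \<Omega>_lebesgue continuous_on_subset[OF f]) auto
  have "compact (f ` closure \<Omega>)"
    using bounded_\<Omega> by (intro compact_continuous_image continuous_on_subset[OF f]) (auto simp: compact_closure)
  then obtain C where C: "\<And>x. x \<in> closure \<Omega> \<Longrightarrow> norm (f x) \<le> C"
    using compact_imp_bounded bounded_iff by (metis imageI)
  have "integrable \<mu> (\<lambda>x. (norm (f x))\<^sup>2)"
  proof (rule integrable_const_bound[where B = "C\<^sup>2"])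
    show "AE x in \<mu>. norm ((norm (f x))\<^sup>2) \<le> C\<^sup>2"
      using C closure_subset by (intro AE_I2) (auto intro!: power_mono)
  qed (use meas in measurable)
  with meas show ?thesis by (simp add: L2_space_def)
qed

lemma L2_imp_integrable:
  fixes f :: "real ^ 'n \<Rightarrow> real"
  assumes "f \<in> L2_space \<mu>" shows "integrable \<mu> f"
  using L2_inner_integrable[OF assms continuous_L2[of "\<lambda>x. 1"]] by simp

lemma L2_nth: "g \<in> L2_space \<mu> \<Longrightarrow> (\<lambda>x. g x $ i) \<in> L2_space \<mu>" for g :: "real ^ 'n \<Rightarrow> real ^ 'n"
proof (rule L2_space_bound[where c = 1])
  assume g: "g \<in> L2_space \<mu>"
  have "(\<lambda>v::real^'n. v $ i) \<in> borel_measurable borel"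
    by (intro borel_measurable_continuous_onI continuous_intros)
  then show "(\<lambda>x. g x $ i) \<in> borel_measurable \<mu>"
    by (rule measurable_compose[OF L2_space_measurable[OF g]])
qed (auto intro!: AE_I2 simp: component_le_norm_cart)

lemma test_L2: "\<phi> \<in> test_functions \<Omega> \<Longrightarrow> \<phi> \<in> L2_space \<mu>"
  and test_partial_L2: "\<phi> \<in> test_functions \<Omega> \<Longrightarrow> partial i \<phi> \<in> L2_space \<mu>"
  by (auto intro: continuous_L2 test_function_continuous test_function_partial_continuous)

text \<open>
  Written with the inner product of \<open>L\<^sup>2(\<Omega>)\<close>, the defining equation of a weak gradient is continuous in
  both arguments and passes to limits.
\<close>

lemma weak_gradient_pairing:
  assumes v: "v \<in> Hsp \<Omega>" and g: "g \<in> L2_space \<mu>"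
  shows "is_weak_gradient \<Omega> v g \<longleftrightarrow>
    (\<forall>\<phi>\<in>test_functions \<Omega>. \<forall>i. L2_inner \<mu> v (partial i \<phi>) + L2_inner \<mu> (\<lambda>x. g x $ i) \<phi> = 0)"
  using g unfolding is_weak_gradient_def L2_inner_def by (auto simp: add_eq_0_iff2)

text \<open>
  By the fundamental lemma, applied to each component of the difference.
\<close>

lemma weak_gradient_unique:
  assumes g: "is_weak_gradient \<Omega> v g" and h: "is_weak_gradient \<Omega> v h"
  shows "AE x in \<mu>. g x = h x"
proof -
  have gL: "g \<in> L2_space \<mu>" and hL: "h \<in> L2_space \<mu>" using g h by (auto simp: is_weak_gradient_def)
  have "AE x in \<mu>. g x $ i - h x $ i = 0" for i
  proof (rule fundamental_lemma[OF open_\<Omega>])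
    show "integrable \<mu> (\<lambda>x. g x $ i - h x $ i)"
      by (intro Bochner_Integration.integrable_diff L2_imp_integrable L2_nth gL hL)
    fix \<phi> assume \<phi>: "\<phi> \<in> test_functions \<Omega>"
    have int: "integrable \<mu> (\<lambda>x. g x $ i * \<phi> x)" "integrable \<mu> (\<lambda>x. h x $ i * \<phi> x)"
      using L2_inner_integrable[OF L2_nth[OF gL] test_L2[OF \<phi>]] L2_inner_integrable[OF L2_nth[OF hL] test_L2[OF \<phi>]] by simp_all
    have "(LINT x|\<mu>. v x * partial i \<phi> x) = - (LINT x|\<mu>. g x $ i * \<phi> x)"
      "(LINT x|\<mu>. v x * partial i \<phi> x) = - (LINT x|\<mu>. h x $ i * \<phi> x)"
      using g h \<phi> unfolding is_weak_gradient_def by blast+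
    then have "(LINT x|\<mu>. g x $ i * \<phi> x) = (LINT x|\<mu>. h x $ i * \<phi> x)" by simp
    then show "(LINT x|\<mu>. (g x $ i - h x $ i) * \<phi> x) = 0"
      using int by (simp add: left_diff_distrib)
  qed
  then have "AE x in \<mu>. \<forall>i. g x $ i - h x $ i = 0" by (rule eventually_all_finite)
  then show ?thesis by eventually_elim (simp add: vec_eq_iff)
qed

lemma wgrad_weak_gradient: "v \<in> H1sp \<Omega> \<Longrightarrow> is_weak_gradient \<Omega> v (wgrad \<Omega> v)"
  unfolding H1sp_def wgrad_def using someI_ex[of "is_weak_gradient \<Omega> v"] by auto

lemma wgrad_L2: "v \<in> H1sp \<Omega> \<Longrightarrow> wgrad \<Omega> v \<in> L2_space \<mu>"
  using wgrad_weak_gradient by (auto simp: is_weak_gradient_def)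

lemma wgrad_eq: "is_weak_gradient \<Omega> v g \<Longrightarrow> AE x in \<mu>. wgrad \<Omega> v x = g x"
  by (rule weak_gradient_unique[OF someI[of "is_weak_gradient \<Omega> v", folded wgrad_def]])

lemma H1_imp_H: "v \<in> H1sp \<Omega> \<Longrightarrow> v \<in> Hsp \<Omega>" by (simp add: H1sp_def)

lemma weak_gradient_add:
  assumes u: "u \<in> Hsp \<Omega>" "is_weak_gradient \<Omega> u g" and v: "v \<in> Hsp \<Omega>" "is_weak_gradient \<Omega> v h"
  shows "is_weak_gradient \<Omega> (u + v) (g + h)"
proof -
  interpret H: semi_inner "L2_space \<mu> :: (real^'n \<Rightarrow> real) set" "L2_inner \<mu>" "L2_nrm \<mu>" by (rule L2_semi_inner)
  have uv: "u \<in> L2_space \<mu>" "v \<in> L2_space \<mu>" using u v by (auto simp: Hsp_def)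
  have gh: "g \<in> L2_space \<mu>" "h \<in> L2_space \<mu>" using u v by (auto simp: is_weak_gradient_def)
  have "L2_inner \<mu> (u + v) (partial i \<phi>) + L2_inner \<mu> (\<lambda>x. (g + h) x $ i) \<phi> = 0" if \<phi>: "\<phi> \<in> test_functions \<Omega>" for \<phi> i
  proof -
    have "L2_inner \<mu> (\<lambda>x. (g + h) x $ i) \<phi> = L2_inner \<mu> (\<lambda>x. g x $ i) \<phi> + L2_inner \<mu> (\<lambda>x. h x $ i) \<phi>"
      using H.add_left[OF L2_nth[OF gh(1)] L2_nth[OF gh(2)] test_L2[OF \<phi>]] by (simp add: plus_fun_def)
    moreover have "L2_inner \<mu> u (partial i \<phi>) + L2_inner \<mu> (\<lambda>x. g x $ i) \<phi> = 0"
      "L2_inner \<mu> v (partial i \<phi>) + L2_inner \<mu> (\<lambda>x. h x $ i) \<phi> = 0"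
      using weak_gradient_pairing[OF u(1) gh(1)] weak_gradient_pairing[OF v(1) gh(2)] u v \<phi> by auto
    ultimately show ?thesis using H.add_left[OF uv test_partial_L2[OF \<phi>]] by simp
  qed
  then show ?thesis
    using weak_gradient_pairing[of "u + v", OF _ L2_space_add[OF gh]] L2_space_add[OF uv] by (simp add: Hsp_def)
qed

lemma weak_gradient_scale:
  assumes u: "u \<in> Hsp \<Omega>" "is_weak_gradient \<Omega> u g"
  shows "is_weak_gradient \<Omega> (c *\<^sub>R u) (c *\<^sub>R g)"
proof -
  interpret H: semi_inner "L2_space \<mu> :: (real^'n \<Rightarrow> real) set" "L2_inner \<mu>" "L2_nrm \<mu>" by (rule L2_semi_inner)
  have uL: "u \<in> L2_space \<mu>" using u by (auto simp: Hsp_def)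
  have gL: "g \<in> L2_space \<mu>" using u by (auto simp: is_weak_gradient_def)
  have "L2_inner \<mu> (c *\<^sub>R u) (partial i \<phi>) + L2_inner \<mu> (\<lambda>x. (c *\<^sub>R g) x $ i) \<phi> = 0" if \<phi>: "\<phi> \<in> test_functions \<Omega>" for \<phi> i
  proof -
    have "L2_inner \<mu> (\<lambda>x. (c *\<^sub>R g) x $ i) \<phi> = c * L2_inner \<mu> (\<lambda>x. g x $ i) \<phi>"
      using H.scale_left[OF L2_nth[OF gL] test_L2[OF \<phi>]] by (simp add: scaleR_fun_def)
    moreover have "L2_inner \<mu> u (partial i \<phi>) + L2_inner \<mu> (\<lambda>x. g x $ i) \<phi> = 0"
      using weak_gradient_pairing[OF u(1) gL] u \<phi> by auto
    ultimately show ?thesis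
      using H.scale_left[OF uL test_partial_L2[OF \<phi>], of c] by (simp flip: distrib_left)
  qed
  then show ?thesis
    using weak_gradient_pairing[of "c *\<^sub>R u", OF _ L2_space_scale[OF gL, of c]] L2_space_scale[OF uL] by (simp add: Hsp_def)
qed

lemma test_function_H1: assumes \<phi>: "\<phi> \<in> test_functions \<Omega>" shows "\<phi> \<in> H1sp \<Omega>"
proof -
  define g :: "real^'n \<Rightarrow> real^'n" where "g = (\<lambda>x. \<chi> i. partial i \<phi> x)"
  have g: "g \<in> L2_space \<mu>"
    unfolding g_def by (intro continuous_L2 continuous_on_vec_lambda test_function_partial_continuous[OF \<phi>])
  have "is_weak_gradient \<Omega> \<phi> g"
    unfolding weak_gradient_pairing[OF test_L2[OF \<phi>, folded Hsp_def] g]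
  proof (intro ballI allI)
    fix \<psi> i assume \<psi>: "\<psi> \<in> test_functions \<Omega>"
    have "L2_inner \<mu> \<phi> (partial i \<psi>) + L2_inner \<mu> (\<lambda>x. g x $ i) \<psi> = (LINT x|\<mu>. \<phi> x * partial i \<psi> x + partial i \<phi> x * \<psi> x)"
      using L2_inner_integrable[OF test_L2[OF \<phi>] test_partial_L2[OF \<psi>]]
        L2_inner_integrable[OF test_partial_L2[OF \<phi>] test_L2[OF \<psi>]]
      by (simp add: L2_inner_def g_def)
    then show "L2_inner \<mu> \<phi> (partial i \<psi>) + L2_inner \<mu> (\<lambda>x. g x $ i) \<psi> = 0"
      using test_function_integration_by_parts[OF open_\<Omega> \<phi> \<psi>] by simp
  qed
  then show ?thesis using test_L2[OF \<phi>] by (auto simp: H1sp_def Hsp_def)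
qed

lemma H1_add: "u \<in> H1sp \<Omega> \<Longrightarrow> v \<in> H1sp \<Omega> \<Longrightarrow> u + v \<in> H1sp \<Omega>"
  using weak_gradient_add L2_space_add by (fastforce simp: H1sp_def Hsp_def)

lemma H1_scale: "u \<in> H1sp \<Omega> \<Longrightarrow> c *\<^sub>R u \<in> H1sp \<Omega>"
  using weak_gradient_scale L2_space_scale by (fastforce simp: H1sp_def Hsp_def)

lemma wgrad_add:
  assumes "u \<in> H1sp \<Omega>" "v \<in> H1sp \<Omega>" shows "AE x in \<mu>. wgrad \<Omega> (u + v) x = (wgrad \<Omega> u + wgrad \<Omega> v) x"
  using assms by (intro wgrad_eq weak_gradient_add wgrad_weak_gradient H1_imp_H)

lemma wgrad_scale:
  assumes "u \<in> H1sp \<Omega>" shows "AE x in \<mu>. wgrad \<Omega> (c *\<^sub>R u) x = (c *\<^sub>R wgrad \<Omega> u) x"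
  using assms by (intro wgrad_eq weak_gradient_scale wgrad_weak_gradient H1_imp_H)

end

lemma L2_nrm_cong_AE:
  assumes "f \<in> L2_space M" "g \<in> L2_space M" "AE x in M. f x = g x" shows "L2_nrm M f = L2_nrm M g"
proof -
  interpret semi_inner "L2_space M" "L2_inner M" "L2_nrm M" by (rule L2_semi_inner)
  show ?thesis using L2_inner_cong_AE[OF assms(1,1,2,2,3,3)] assms(1,2) by (simp add: nrm)
qed

context bounded_open
begin

section \<open>The spaces of weakly differentiable functions\<close>

definition G_inner :: "(real ^ 'n \<Rightarrow> real) \<Rightarrow> (real ^ 'n \<Rightarrow> real) \<Rightarrow> real" where
  "G_inner u v = L2_inner \<mu> (wgrad \<Omega> u) (wgrad \<Omega> v)"

definition H1_inner :: "(real ^ 'n \<Rightarrow> real) \<Rightarrow> (real ^ 'n \<Rightarrow> real) \<Rightarrow> real" where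
  "H1_inner u v = H_inner \<Omega> u v + G_inner u v"

lemma H1_zero: "0 \<in> H1sp \<Omega>"
  by (rule test_function_H1[OF test_functions_zero])

lemma V_seminrm_eq: "is_weak_gradient \<Omega> v g \<Longrightarrow> v \<in> H1sp \<Omega> \<Longrightarrow> V_seminrm \<Omega> v = L2_nrm \<mu> g"
  unfolding V_seminrm_def
  by (rule L2_nrm_cong_AE[OF wgrad_L2 _ wgrad_eq]) (auto simp: is_weak_gradient_def)

lemma G_semi_inner: "semi_inner (H1sp \<Omega>) G_inner (V_seminrm \<Omega>)"
proof -
  interpret L: semi_inner "L2_space \<mu> :: (real^'n \<Rightarrow> real^'n) set" "L2_inner \<mu>" "L2_nrm \<mu>" by (rule L2_semi_inner)
  show ?thesis
  proof
    show "0 \<in> H1sp \<Omega>" by (rule H1_zero)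
    show "u + v \<in> H1sp \<Omega>" if "u \<in> H1sp \<Omega>" "v \<in> H1sp \<Omega>" for u v using that by (rule H1_add)
    show "c *\<^sub>R u \<in> H1sp \<Omega>" if "u \<in> H1sp \<Omega>" for u c using that by (rule H1_scale)
    show "G_inner u v = G_inner v u" if "u \<in> H1sp \<Omega>" "v \<in> H1sp \<Omega>" for u v
      unfolding G_inner_def using that by (intro L.sym wgrad_L2)
    show "G_inner (u + v) w = G_inner u w + G_inner v w" if "u \<in> H1sp \<Omega>" "v \<in> H1sp \<Omega>" "w \<in> H1sp \<Omega>" for u v w
    proof -
      have "G_inner (u + v) w = L2_inner \<mu> (wgrad \<Omega> u + wgrad \<Omega> v) (wgrad \<Omega> w)"
        unfolding G_inner_def using that by (intro L2_inner_cong_AE wgrad_L2 H1_add L2_space_add wgrad_add AE_I2 refl)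
      then show ?thesis using that by (simp add: G_inner_def L.add_left wgrad_L2)
    qed
    show "G_inner (c *\<^sub>R u) w = c * G_inner u w" if "u \<in> H1sp \<Omega>" "w \<in> H1sp \<Omega>" for c u w
    proof -
      have "G_inner (c *\<^sub>R u) w = L2_inner \<mu> (c *\<^sub>R wgrad \<Omega> u) (wgrad \<Omega> w)"
        unfolding G_inner_def using that by (intro L2_inner_cong_AE wgrad_L2 H1_scale L2_space_scale wgrad_scale AE_I2 refl)
      then show ?thesis using that by (simp add: G_inner_def L.scale_left wgrad_L2)
    qed
    show "0 \<le> G_inner u u" if "u \<in> H1sp \<Omega>" for u
      unfolding G_inner_def using that by (intro L.nonneg wgrad_L2)
    show "V_seminrm \<Omega> u = sqrt (G_inner u u)" if "u \<in> H1sp \<Omega>" for u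
      unfolding G_inner_def V_seminrm_def using that by (intro L.nrm wgrad_L2)
  qed
qed

lemma H_semi_inner_H1: "semi_inner (H1sp \<Omega>) (H_inner \<Omega>) (H_nrm \<Omega>)"
  by (rule semi_inner.semi_inner_subspace[OF H_semi_inner]) (auto intro: H1_imp_H H1_zero H1_add H1_scale)

lemma H1_semi_inner: "semi_inner (H1sp \<Omega>) H1_inner (V_nrm \<Omega>)"
  unfolding H1_inner_def[abs_def]
  by (rule semi_inner_sum[OF H_semi_inner_H1 G_semi_inner]) (simp add: V_nrm_def)

lemma V_imp_H1: "v \<in> Vsp \<Omega> \<Longrightarrow> v \<in> H1sp \<Omega>" by (simp add: Vsp_def)

lemma V_imp_H: "v \<in> Vsp \<Omega> \<Longrightarrow> v \<in> Hsp \<Omega>" by (simp add: Vsp_def H1_imp_H)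

lemma test_function_V: assumes \<phi>: "\<phi> \<in> test_functions \<Omega>" shows "\<phi> \<in> Vsp \<Omega>"
proof -
  interpret H1: semi_inner "H1sp \<Omega>" H1_inner "V_nrm \<Omega>" by (rule H1_semi_inner)
  show ?thesis unfolding Vsp_def
    using test_function_H1[OF \<phi>] \<phi> by (auto intro!: exI[of _ "\<lambda>m. \<phi>"] simp: H1.nrm_zero)
qed

lemma V_add: assumes u: "u \<in> Vsp \<Omega>" and v: "v \<in> Vsp \<Omega>" shows "u + v \<in> Vsp \<Omega>"
proof -
  interpret H1: semi_inner "H1sp \<Omega>" H1_inner "V_nrm \<Omega>" by (rule H1_semi_inner)
  obtain \<phi> \<psi> where \<phi>: "\<And>m::nat. \<phi> m \<in> test_functions \<Omega>" "(\<lambda>m. V_nrm \<Omega> (u - \<phi> m)) \<longlonglongrightarrow> 0"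
    and \<psi>: "\<And>m::nat. \<psi> m \<in> test_functions \<Omega>" "(\<lambda>m. V_nrm \<Omega> (v - \<psi> m)) \<longlonglongrightarrow> 0"
    using u v unfolding Vsp_def by blast
  have m: "u - \<phi> m \<in> H1sp \<Omega>" "v - \<psi> m \<in> H1sp \<Omega>" for m
    by (intro H1.diff_mem V_imp_H1[OF u] V_imp_H1[OF v] test_function_H1[OF \<phi>(1)] test_function_H1[OF \<psi>(1)])+
  have eq: "u + v - (\<phi> m + \<psi> m) = (u - \<phi> m) + (v - \<psi> m)" for m by simp
  have "(\<lambda>m. V_nrm \<Omega> (u - \<phi> m) + V_nrm \<Omega> (v - \<psi> m)) \<longlonglongrightarrow> 0"
    using tendsto_add[OF \<phi>(2) \<psi>(2)] by simp
  then have "(\<lambda>m. V_nrm \<Omega> (u + v - (\<phi> m + \<psi> m))) \<longlonglongrightarrow> 0"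
    unfolding eq by (rule squeeze_zero[rotated 2]) (auto intro!: H1.nrm_nonneg H1.nrm_triangle H1.add_mem m)
  then show ?thesis
    using u v \<phi>(1) \<psi>(1) by (auto simp: Vsp_def intro!: H1_add exI[of _ "\<lambda>m. \<phi> m + \<psi> m"] test_functions_add)
qed

lemma V_scale: assumes u: "u \<in> Vsp \<Omega>" shows "c *\<^sub>R u \<in> Vsp \<Omega>"
proof -
  interpret H1: semi_inner "H1sp \<Omega>" H1_inner "V_nrm \<Omega>" by (rule H1_semi_inner)
  obtain \<phi> where \<phi>: "\<And>m::nat. \<phi> m \<in> test_functions \<Omega>" "(\<lambda>m. V_nrm \<Omega> (u - \<phi> m)) \<longlonglongrightarrow> 0"
    using u unfolding Vsp_def by blast
  have m: "u - \<phi> m \<in> H1sp \<Omega>" for m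
    by (intro H1.diff_mem V_imp_H1[OF u] test_function_H1[OF \<phi>(1)])
  have "V_nrm \<Omega> (c *\<^sub>R u - c *\<^sub>R \<phi> m) = \<bar>c\<bar> * V_nrm \<Omega> (u - \<phi> m)" for m
    using H1.nrm_scale[OF m, of c m] by (simp only: scaleR_diff_right)
  then have "(\<lambda>m. V_nrm \<Omega> (c *\<^sub>R u - c *\<^sub>R \<phi> m)) \<longlonglongrightarrow> 0"
    using tendsto_mult_right_zero[OF \<phi>(2), of "\<bar>c\<bar>"] by simp
  then show ?thesis
    using u \<phi>(1) by (auto simp: Vsp_def intro!: H1_scale exI[of _ "\<lambda>m. c *\<^sub>R \<phi> m"] test_functions_scale)
qed

lemma V_zero: "0 \<in> Vsp \<Omega>" by (rule test_function_V[OF test_functions_zero])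

lemma V_semi_inner: "semi_inner (Vsp \<Omega>) H1_inner (V_nrm \<Omega>)"
  by (rule semi_inner.semi_inner_subspace[OF H1_semi_inner]) (auto intro: V_imp_H1 V_zero V_add V_scale)

lemma V_G_semi_inner: "semi_inner (Vsp \<Omega>) G_inner (V_seminrm \<Omega>)"
  by (rule semi_inner.semi_inner_subspace[OF G_semi_inner]) (auto intro: V_imp_H1 V_zero V_add V_scale)

lemma H_nrm_le_V_nrm: "v \<in> H1sp \<Omega> \<Longrightarrow> H_nrm \<Omega> v \<le> V_nrm \<Omega> v"
  and V_seminrm_le_V_nrm: "V_seminrm \<Omega> v \<le> V_nrm \<Omega> v"
  unfolding V_nrm_def by (auto intro: real_le_rsqrt)

lemma V_nrm_sq: "(V_nrm \<Omega> v)\<^sup>2 = (H_nrm \<Omega> v)\<^sup>2 + (V_seminrm \<Omega> v)\<^sup>2"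
  by (simp add: V_nrm_def)

text \<open>
  Zero is a weak gradient of an element that vanishes in \<open>L\<^sup>2(\<Omega>)\<close>.  Two elements of \<open>V\<close> can
  therefore be identified by their pairings in \<open>H\<close>.
\<close>

lemma V_nrm_null_if_H_null:
  assumes v: "v \<in> H1sp \<Omega>" and null: "H_nrm \<Omega> v = 0" shows "V_nrm \<Omega> v = 0"
proof -
  interpret H: semi_inner "L2_space \<mu> :: (real^'n \<Rightarrow> real) set" "L2_inner \<mu>" "L2_nrm \<mu>" by (rule L2_semi_inner)
  interpret L: semi_inner "L2_space \<mu> :: (real^'n \<Rightarrow> real^'n) set" "L2_inner \<mu>" "L2_nrm \<mu>" by (rule L2_semi_inner)
  have vL: "v \<in> L2_space \<mu>" using H1_imp_H[OF v] by (simp add: Hsp_def)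
  have "L2_inner \<mu> v w = 0" if "w \<in> L2_space \<mu>" for w
    using H.Cauchy_Schwarz[OF vL that] null by (simp add: H_nrm_def)
  moreover have "L2_inner \<mu> (\<lambda>x. (0 :: real^'n \<Rightarrow> real^'n) x $ i) \<phi> = 0" for i and \<phi> :: "real^'n \<Rightarrow> real"
    by (simp add: L2_inner_def)
  ultimately have "is_weak_gradient \<Omega> v 0"
    unfolding weak_gradient_pairing[OF H1_imp_H[OF v] L.zero_mem] by (auto intro: test_partial_L2)
  then have "V_seminrm \<Omega> v = 0" using V_seminrm_eq v L.nrm_zero by simp
  then show ?thesis using null by (simp add: V_nrm_def)
qed

lemma L2_nrm_nth_le:
  fixes g :: "real ^ 'n \<Rightarrow> real ^ 'n"
  assumes g: "g \<in> L2_space \<mu>" shows "L2_nrm \<mu> (\<lambda>x. g x $ i) \<le> L2_nrm \<mu> g"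
  unfolding L2_nrm_def
  by (intro real_sqrt_le_mono integral_mono L2_space_integrable L2_nth g power_mono)
     (auto simp: component_le_norm_cart)

text \<open>
  The values and the weak gradients of a Cauchy sequence converge in \<open>L\<^sup>2(\<Omega>)\<close>, and the limit of the
  gradients is a weak gradient of the limit.  Test functions chosen closer and closer to the members
  of the sequence converge to the same limit.
\<close>

lemma V_complete: "semi_inner.complete_space (Vsp \<Omega>) (V_nrm \<Omega>)"
  unfolding semi_inner.complete_space_def[OF V_semi_inner]
proof (intro allI impI)
  interpret H1: semi_inner "H1sp \<Omega>" H1_inner "V_nrm \<Omega>" by (rule H1_semi_inner)
  interpret H: semi_inner "L2_space \<mu> :: (real^'n \<Rightarrow> real) set" "L2_inner \<mu>" "L2_nrm \<mu>" by (rule L2_semi_inner)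
  interpret L: semi_inner "L2_space \<mu> :: (real^'n \<Rightarrow> real^'n) set" "L2_inner \<mu>" "L2_nrm \<mu>" by (rule L2_semi_inner)
  fix v :: "nat \<Rightarrow> real ^ 'n \<Rightarrow> real"
  assume "range v \<subseteq> Vsp \<Omega> \<and> (\<forall>e>0. \<exists>N. \<forall>m\<ge>N. \<forall>n\<ge>N. V_nrm \<Omega> (v m - v n) < e)"
  then have v: "\<And>n. v n \<in> Vsp \<Omega>" and Cauchy: "\<And>e. e > 0 \<Longrightarrow> \<exists>N. \<forall>m\<ge>N. \<forall>n\<ge>N. V_nrm \<Omega> (v m - v n) < e" by auto
  have v1: "v n \<in> H1sp \<Omega>" for n by (rule V_imp_H1[OF v])
  have vL: "v n \<in> L2_space \<mu>" for n using V_imp_H[OF v] by (simp add: Hsp_def)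
  let ?g = "\<lambda>n. wgrad \<Omega> (v n)"
  have gL: "?g n \<in> L2_space \<mu>" for n by (rule wgrad_L2[OF v1])
  have wg_diff: "is_weak_gradient \<Omega> (a - b) (g - h)"
    if "a \<in> Hsp \<Omega>" "is_weak_gradient \<Omega> a g" "b \<in> Hsp \<Omega>" "is_weak_gradient \<Omega> b h" for a b g h
    using weak_gradient_add[OF that(1,2) _ weak_gradient_scale[OF that(3,4), of "-1"]] that(3) L2_space_scale[of b \<mu> "-1"]
    by (simp add: Hsp_def)
  have semi: "V_seminrm \<Omega> (v m - v n) = L2_nrm \<mu> (?g m - ?g n)" for m n
    by (intro V_seminrm_eq wg_diff H1_imp_H v1 wgrad_weak_gradient H1.diff_mem)
  have "\<exists>w\<in>L2_space \<mu>. (\<lambda>n. L2_nrm \<mu> (v n - w)) \<longlonglongrightarrow> 0"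
  proof (rule H.complete_spaceD[OF L2_complete[OF complete_\<mu>] vL])
    fix e :: real assume "e > 0"
    from Cauchy[OF this] obtain N where N: "\<forall>m\<ge>N. \<forall>n\<ge>N. V_nrm \<Omega> (v m - v n) < e" by auto
    have "L2_nrm \<mu> (v m - v n) < e" if "m \<ge> N" "n \<ge> N" for m n
      using N that H_nrm_le_V_nrm[OF H1.diff_mem[OF v1 v1], of m n] unfolding H_nrm_def by (meson order.strict_trans1)
    then show "\<exists>N. \<forall>m\<ge>N. \<forall>n\<ge>N. L2_nrm \<mu> (v m - v n) < e" by blast
  qed
  then obtain w where w: "w \<in> L2_space \<mu>" "(\<lambda>n. L2_nrm \<mu> (v n - w)) \<longlonglongrightarrow> 0" by blast
  have "\<exists>g\<in>L2_space \<mu>. (\<lambda>n. L2_nrm \<mu> (?g n - g)) \<longlonglongrightarrow> 0"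
  proof (rule L.complete_spaceD[OF L2_complete[OF complete_\<mu>] gL])
    fix e :: real assume "e > 0"
    from Cauchy[OF this] obtain N where N: "\<forall>m\<ge>N. \<forall>n\<ge>N. V_nrm \<Omega> (v m - v n) < e" by auto
    have "L2_nrm \<mu> (?g m - ?g n) < e" if "m \<ge> N" "n \<ge> N" for m n
      using N that V_seminrm_le_V_nrm[of "v m - v n"] unfolding semi by (meson order.strict_trans1)
    then show "\<exists>N. \<forall>m\<ge>N. \<forall>n\<ge>N. L2_nrm \<mu> (?g m - ?g n) < e" by blast
  qed
  then obtain g where g: "g \<in> L2_space \<mu>" "(\<lambda>n. L2_nrm \<mu> (?g n - g)) \<longlonglongrightarrow> 0" by blast
  have wH: "w \<in> Hsp \<Omega>" using w by (simp add: Hsp_def)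
  have wg: "is_weak_gradient \<Omega> w g"
    unfolding weak_gradient_pairing[OF wH g(1)]
  proof (intro ballI allI)
    fix \<phi> i assume \<phi>: "\<phi> \<in> test_functions \<Omega>"
    let ?c = "L2_inner \<mu> w (partial i \<phi>) + L2_inner \<mu> (\<lambda>x. g x $ i) \<phi>"
    note \<phi>L = test_L2[OF \<phi>] test_partial_L2[OF \<phi>, of i]
    have le: "\<bar>?c\<bar> \<le> L2_nrm \<mu> (v n - w) * L2_nrm \<mu> (partial i \<phi>) + L2_nrm \<mu> (?g n - g) * L2_nrm \<mu> \<phi>" for n
    proof -
      have "L2_inner \<mu> (v n) (partial i \<phi>) + L2_inner \<mu> (\<lambda>x. ?g n x $ i) \<phi> = 0"
        using wgrad_weak_gradient[OF v1] weak_gradient_pairing[OF V_imp_H[OF v] gL] \<phi> by blast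
      moreover have "L2_inner \<mu> (v n - w) (partial i \<phi>) = L2_inner \<mu> (v n) (partial i \<phi>) - L2_inner \<mu> w (partial i \<phi>)"
        by (rule H.diff_left[OF vL w(1) \<phi>L(2)])
      moreover have "L2_inner \<mu> (\<lambda>x. (?g n - g) x $ i) \<phi> = L2_inner \<mu> (\<lambda>x. ?g n x $ i) \<phi> - L2_inner \<mu> (\<lambda>x. g x $ i) \<phi>"
        using H.diff_left[OF L2_nth[OF gL] L2_nth[OF g(1)] \<phi>L(1)] by (simp add: fun_diff_def)
      moreover have "\<bar>L2_inner \<mu> (v n - w) (partial i \<phi>)\<bar> \<le> L2_nrm \<mu> (v n - w) * L2_nrm \<mu> (partial i \<phi>)"
        by (intro H.Cauchy_Schwarz H.diff_mem vL w \<phi>L)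
      moreover have "\<bar>L2_inner \<mu> (\<lambda>x. (?g n - g) x $ i) \<phi>\<bar> \<le> L2_nrm \<mu> (?g n - g) * L2_nrm \<mu> \<phi>"
        using H.Cauchy_Schwarz[OF L2_nth[OF L.diff_mem[OF gL g(1)]] \<phi>L(1)]
          mult_right_mono[OF L2_nrm_nth_le[OF L.diff_mem[OF gL g(1)]] H.nrm_nonneg[OF \<phi>L(1)]]
        by (rule order_trans)
      ultimately show ?thesis by linarith
    qed
    have "(\<lambda>n. L2_nrm \<mu> (v n - w) * L2_nrm \<mu> (partial i \<phi>) + L2_nrm \<mu> (?g n - g) * L2_nrm \<mu> \<phi>) \<longlonglongrightarrow>
        0 * L2_nrm \<mu> (partial i \<phi>) + 0 * L2_nrm \<mu> \<phi>"
      by (intro tendsto_add tendsto_mult tendsto_const w g)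
    from LIMSEQ_le_const[OF this, of "\<bar>?c\<bar>"] le show "?c = 0" by auto
  qed
  have w1: "w \<in> H1sp \<Omega>" using wH wg by (auto simp: H1sp_def)
  have "(\<lambda>n. sqrt ((H_nrm \<Omega> (v n - w))\<^sup>2 + (V_seminrm \<Omega> (v n - w))\<^sup>2)) \<longlonglongrightarrow> sqrt (0\<^sup>2 + 0\<^sup>2)"
  proof (intro tendsto_intros)
    show "(\<lambda>n. H_nrm \<Omega> (v n - w)) \<longlonglongrightarrow> 0" using w by (simp add: H_nrm_def)
    have "V_seminrm \<Omega> (v n - w) = L2_nrm \<mu> (?g n - g)" for n
      by (intro V_seminrm_eq wg_diff H1_imp_H v1 w1 wg wgrad_weak_gradient H1.diff_mem)
    then show "(\<lambda>n. V_seminrm \<Omega> (v n - w)) \<longlonglongrightarrow> 0" using g by simp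
  qed
  then have lim: "(\<lambda>n. V_nrm \<Omega> (v n - w)) \<longlonglongrightarrow> 0" by (simp add: V_nrm_def)
  have "\<exists>\<psi>\<in>test_functions \<Omega>. V_nrm \<Omega> (v n - \<psi>) < inverse (real (Suc n))" for n
  proof -
    obtain \<phi> where \<phi>: "\<And>m::nat. \<phi> m \<in> test_functions \<Omega>" "(\<lambda>m. V_nrm \<Omega> (v n - \<phi> m)) \<longlonglongrightarrow> 0"
      using v[of n] unfolding Vsp_def by blast
    have "eventually (\<lambda>m. V_nrm \<Omega> (v n - \<phi> m) < inverse (real (Suc n))) sequentially"
      using \<phi>(2) by (rule order_tendstoD(2)) simp
    then show ?thesis using \<phi>(1) by (auto simp: eventually_sequentially)
  qed
  then obtain \<psi> where \<psi>: "\<And>n. \<psi> n \<in> test_functions \<Omega>" "\<And>n. V_nrm \<Omega> (v n - \<psi> n) < inverse (real (Suc n))" by metis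
  have \<psi>1: "\<psi> n \<in> H1sp \<Omega>" for n by (rule test_function_H1[OF \<psi>(1)])
  have "(\<lambda>n. V_nrm \<Omega> (v n - w) + inverse (real (Suc n))) \<longlonglongrightarrow> 0"
    using tendsto_add[OF lim LIMSEQ_inverse_real_of_nat] by simp
  then have "(\<lambda>n. V_nrm \<Omega> (w - \<psi> n)) \<longlonglongrightarrow> 0"
  proof (rule squeeze_zero[rotated 2])
    fix n
    show "0 \<le> V_nrm \<Omega> (w - \<psi> n)" by (intro H1.nrm_nonneg H1.diff_mem w1 \<psi>1)
    show "V_nrm \<Omega> (w - \<psi> n) \<le> V_nrm \<Omega> (v n - w) + inverse (real (Suc n))"
      using H1.nrm_dist_triangle[OF w1 v1[of n] \<psi>1[of n]] H1.nrm_minus_commute[OF w1 v1[of n]] \<psi>(2)[of n] by linarith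
  qed
  then have "w \<in> Vsp \<Omega>" using w1 \<psi>(1) by (auto simp: Vsp_def)
  with lim show "\<exists>y\<in>Vsp \<Omega>. (\<lambda>n. V_nrm \<Omega> (v n - y)) \<longlonglongrightarrow> 0" by blast
qed

section \<open>The forms\<close>

lemma matrix_inner_expand: "(A *v g) \<bullet> h = (\<Sum>i\<in>UNIV. (\<Sum>j\<in>UNIV. A $ i $ j * g $ j) * h $ i)"
  for A :: "real ^ 'n ^ 'n" and g h :: "real ^ 'n"
  by (simp add: inner_vec_def matrix_vector_mult_def)

lemma matrix_inner_bound: "\<bar>(A *v g) \<bullet> h\<bar> \<le> (real CARD('n))\<^sup>2 * norm A * (norm g * norm h)"
  for A :: "real ^ 'n ^ 'n" and g h :: "real ^ 'n"
proof -
  have "\<bar>(A *v g) \<bullet> h\<bar> \<le> (\<Sum>i\<in>UNIV. \<Sum>j\<in>UNIV. \<bar>A $ i $ j * g $ j * h $ i\<bar>)"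
    unfolding matrix_inner_expand sum_distrib_right by (intro order_trans[OF sum_abs] sum_mono sum_abs)
  also have "\<dots> \<le> (\<Sum>i\<in>(UNIV::'n set). \<Sum>j\<in>(UNIV::'n set). norm A * (norm g * norm h))"
  proof (intro sum_mono)
    fix i j
    have "\<bar>A $ i $ j\<bar> \<le> norm A"
      by (rule order_trans[OF component_le_norm_cart Finite_Cartesian_Product.norm_nth_le])
    then show "\<bar>A $ i $ j * g $ j * h $ i\<bar> \<le> norm A * (norm g * norm h)"
      unfolding abs_mult mult.assoc by (intro mult_mono component_le_norm_cart) auto
  qed
  also have "\<dots> = (real CARD('n))\<^sup>2 * norm A * (norm g * norm h)" by (simp add: power2_eq_square)
  finally show ?thesis .
qed

lemma form_integrand_measurable:
  fixes A :: "real ^ 'n \<Rightarrow> real ^ 'n ^ 'n" and g h :: "real ^ 'n \<Rightarrow> real ^ 'n"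
  assumes A: "A \<in> borel_measurable \<mu>" and g: "g \<in> borel_measurable \<mu>" and h: "h \<in> borel_measurable \<mu>"
  shows "(\<lambda>x. (A x *v g x) \<bullet> h x) \<in> borel_measurable \<mu>"
proof -
  have nth: "(\<lambda>v::real^'n. v $ i) \<in> borel_measurable borel" for i
    by (intro borel_measurable_continuous_onI continuous_intros)
  have nth2: "(\<lambda>v::real^'n^'n. v $ i $ j) \<in> borel_measurable borel" for i j
    by (intro borel_measurable_continuous_onI continuous_intros)
  note [measurable] = measurable_compose[OF A nth2] measurable_compose[OF g nth] measurable_compose[OF h nth]
  show ?thesis unfolding matrix_inner_expand by measurable
qed

lemma form_integrable:
  assumes A: "symmetric_Linfty_field \<Omega> A" and g: "g \<in> L2_space \<mu>" and h: "h \<in> L2_space \<mu>"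
  shows "integrable \<mu> (\<lambda>x. (A x *v g x) \<bullet> h x)"
proof -
  obtain C where C: "AE x in \<mu>. norm (A x) \<le> C" and Am: "A \<in> borel_measurable \<mu>"
    using A unfolding symmetric_Linfty_field_def by auto
  show ?thesis
  proof (rule Bochner_Integration.integrable_bound)
    show "integrable \<mu> (\<lambda>x. (real CARD('n))\<^sup>2 * \<bar>C\<bar> * ((norm (g x))\<^sup>2 + (norm (h x))\<^sup>2))"
      by (intro integrable_mult_right Bochner_Integration.integrable_add L2_space_integrable g h)
    show "(\<lambda>x. (A x *v g x) \<bullet> h x) \<in> borel_measurable \<mu>"
      by (intro form_integrand_measurable Am L2_space_measurable g h)
    show "AE x in \<mu>. norm ((A x *v g x) \<bullet> h x) \<le> norm ((real CARD('n))\<^sup>2 * \<bar>C\<bar> * ((norm (g x))\<^sup>2 + (norm (h x))\<^sup>2))"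
      using C
    proof eventually_elim
      case (elim x)
      have "\<bar>(A x *v g x) \<bullet> h x\<bar> \<le> (real CARD('n))\<^sup>2 * norm (A x) * (norm (g x) * norm (h x))"
        by (rule matrix_inner_bound)
      also have "\<dots> \<le> (real CARD('n))\<^sup>2 * \<bar>C\<bar> * ((norm (g x))\<^sup>2 + (norm (h x))\<^sup>2)"
        using elim order_trans[OF norm_ge_zero elim]
        by (intro mult_mono norm_mult_le_sum_squares mult_nonneg_nonneg) auto
      finally show ?case by (simp add: abs_mult)
    qed
  qed
qed

text \<open>
  The form does not depend on which weak gradient the choice operator selects; this gives bilinearity
  although the selected gradients are additive only almost everywhere.
\<close>

lemma form_cong_AE:
  assumes A: "symmetric_Linfty_field \<Omega> A" and w: "is_weak_gradient \<Omega> w g" "w \<in> H1sp \<Omega>" and v: "v \<in> H1sp \<Omega>"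
  shows "form \<Omega> A w v = (LINT x|\<mu>. (A x *v g x) \<bullet> wgrad \<Omega> v x)"
  unfolding form_def
proof (rule integral_cong_AE)
  have Am: "A \<in> borel_measurable \<mu>" using A unfolding symmetric_Linfty_field_def by auto
  show "(\<lambda>x. (A x *v wgrad \<Omega> w x) \<bullet> wgrad \<Omega> v x) \<in> borel_measurable \<mu>"
    by (intro form_integrand_measurable Am L2_space_measurable wgrad_L2 w v)
  show "(\<lambda>x. (A x *v g x) \<bullet> wgrad \<Omega> v x) \<in> borel_measurable \<mu>"
    using w by (intro form_integrand_measurable Am L2_space_measurable wgrad_L2 v) (auto simp: is_weak_gradient_def)
  show "AE x in \<mu>. (A x *v wgrad \<Omega> w x) \<bullet> wgrad \<Omega> v x = (A x *v g x) \<bullet> wgrad \<Omega> v x"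
    using wgrad_eq[OF w(1)] by eventually_elim simp
qed

lemma form_add:
  assumes A: "symmetric_Linfty_field \<Omega> A" and u: "u \<in> H1sp \<Omega>" and v: "v \<in> H1sp \<Omega>" and w: "w \<in> H1sp \<Omega>"
  shows "form \<Omega> A (u + v) w = form \<Omega> A u w + form \<Omega> A v w"
proof -
  have "form \<Omega> A (u + v) w = (LINT x|\<mu>. (A x *v (wgrad \<Omega> u + wgrad \<Omega> v) x) \<bullet> wgrad \<Omega> w x)"
    by (intro form_cong_AE A w H1_add u v weak_gradient_add H1_imp_H wgrad_weak_gradient)
  also have "\<dots> = (LINT x|\<mu>. (A x *v wgrad \<Omega> u x) \<bullet> wgrad \<Omega> w x + (A x *v wgrad \<Omega> v x) \<bullet> wgrad \<Omega> w x)"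
    by (simp add: matrix_vector_right_distrib inner_add_left)
  finally show ?thesis
    unfolding form_def by (simp add: form_integrable[OF A] wgrad_L2 u v w)
qed

lemma form_scale:
  assumes A: "symmetric_Linfty_field \<Omega> A" and u: "u \<in> H1sp \<Omega>" and w: "w \<in> H1sp \<Omega>"
  shows "form \<Omega> A (c *\<^sub>R u) w = c * form \<Omega> A u w"
proof -
  have "form \<Omega> A (c *\<^sub>R u) w = (LINT x|\<mu>. (A x *v (c *\<^sub>R wgrad \<Omega> u) x) \<bullet> wgrad \<Omega> w x)"
    by (intro form_cong_AE A w H1_scale u weak_gradient_scale H1_imp_H wgrad_weak_gradient)
  also have "\<dots> = (LINT x|\<mu>. c * ((A x *v wgrad \<Omega> u x) \<bullet> wgrad \<Omega> w x))"
    by (simp add: scaleR_fun_def matrix_vector_mult_scaleR)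
  finally show ?thesis unfolding form_def by simp
qed

lemma form_sym:
  assumes A: "symmetric_Linfty_field \<Omega> A" and u: "u \<in> H1sp \<Omega>" and v: "v \<in> H1sp \<Omega>"
  shows "form \<Omega> A u v = form \<Omega> A v u"
  unfolding form_def
proof (rule integral_cong_AE)
  have Am: "A \<in> borel_measurable \<mu>" and sym: "AE x in \<mu>. transpose (A x) = A x"
    using A unfolding symmetric_Linfty_field_def by auto
  show "(\<lambda>x. (A x *v wgrad \<Omega> u x) \<bullet> wgrad \<Omega> v x) \<in> borel_measurable \<mu>" "(\<lambda>x. (A x *v wgrad \<Omega> v x) \<bullet> wgrad \<Omega> u x) \<in> borel_measurable \<mu>"
    by (intro form_integrand_measurable Am L2_space_measurable wgrad_L2 u v)+
  show "AE x in \<mu>. (A x *v wgrad \<Omega> u x) \<bullet> wgrad \<Omega> v x = (A x *v wgrad \<Omega> v x) \<bullet> wgrad \<Omega> u x"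
    using sym
  proof eventually_elim
    case (elim x)
    then show ?case
      using dot_lmul_matrix[of "wgrad \<Omega> v x" "A x" "wgrad \<Omega> u x"] by (simp add: inner_commute flip: transpose_matrix_vector)
  qed
qed

lemma form_semi_inner:
  assumes A: "symmetric_Linfty_field \<Omega> A" and nonneg: "\<And>v. v \<in> Vsp \<Omega> \<Longrightarrow> 0 \<le> form \<Omega> A v v"
  shows "semi_inner (Vsp \<Omega>) (form \<Omega> A) (\<lambda>v. sqrt (form \<Omega> A v v))"
  by unfold_locales
     (auto intro!: V_zero V_add V_scale form_sym[OF A] form_add[OF A] form_scale[OF A] V_imp_H1 nonneg)

end

section \<open>The history space and the energy space\<close>

lemma le_one_plus_square: "(x::real) \<le> 1 + x\<^sup>2"
proof -
  have "2 * x \<le> x\<^sup>2 + 1" using sum_squares_bound[of x 1] by simp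
  moreover have "0 \<le> x\<^sup>2" by simp
  ultimately show ?thesis by linarith
qed

text \<open>
  Young's inequality, optimised over its parameter, gives back the product bound.  The parameter
  \<open>1 / N\<close> with \<open>N\<close> slightly larger than \<open>M\<close> covers the case \<open>M = 0\<close> as well.
\<close>

lemma le_of_Young:
  fixes s K M :: real
  assumes M: "0 \<le> M" and K: "0 \<le> K"
    and young: "\<And>\<theta>. \<theta> > 0 \<Longrightarrow> s \<le> (\<theta> * s * M + K / \<theta>) / 2" and s: "0 \<le> s"
  shows "s \<le> M * K"
proof (rule field_le_epsilon)
  fix e :: real assume e: "0 < e"
  define N where "N = M + e / (K + 1)"
  have N: "N > 0" "M \<le> N" using M K e by (auto simp: N_def add_nonneg_pos)
  have "1 / N * s * M \<le> s"
    using N s mult_left_mono[OF N(2) s] by (simp add: field_simps)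
  then have "s \<le> K * N" using young[of "1 / N"] N by simp
  also have "\<dots> = M * K + e * (K / (K + 1))" by (simp add: N_def algebra_simps)
  also have "\<dots> \<le> M * K + e * 1" using e K by (intro add_left_mono mult_left_mono) auto
  finally show "s \<le> M * K + e" by simp
qed

text \<open>
  By coercivity and the Poincare inequality, \<open>a1\<close> is an inner product on \<open>V\<close> equivalent to the given
  one, while \<open>a0\<close> may degenerate.
\<close>

locale history_system = bounded_open \<Omega> for \<Omega> :: "(real ^ 'n::finite) set" +
  fixes A0 A1 :: "real ^ 'n \<Rightarrow> real ^ 'n ^ 'n" and \<nu> :: "real measure" and \<beta> C\<^sub>P :: real
  assumes A0: "symmetric_Linfty_field \<Omega> A0" and A1: "symmetric_Linfty_field \<Omega> A1"
    and a0_bounded: "bounded_form \<Omega> (form \<Omega> A0)" and a1_bounded: "bounded_form \<Omega> (form \<Omega> A1)"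
    and a0_nonneg: "v \<in> Vsp \<Omega> \<Longrightarrow> 0 \<le> form \<Omega> A0 v v"
    and beta: "0 < \<beta>"
    and coercive: "v \<in> Vsp \<Omega> \<Longrightarrow> \<beta> * (V_seminrm \<Omega> v)\<^sup>2 \<le> form \<Omega> A1 v v"
    and poincare: "v \<in> Vsp \<Omega> \<Longrightarrow> H_nrm \<Omega> v \<le> C\<^sub>P * V_seminrm \<Omega> v"
    and sets_\<nu>: "sets \<nu> = sets (restrict_space borel {0..})"
    and mass: "emeasure \<nu> {0..} < \<infinity>"
    and moment: "(\<integral>\<^sup>+l. ennreal l \<partial>\<nu>) < \<infinity>"
begin

lemma space_\<nu>: "space \<nu> = {0..}"
  using sets_eq_imp_space_eq[OF sets_\<nu>] by (simp add: space_restrict_space)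

lemma finite_\<nu>: "finite_measure \<nu>"
  by (rule finite_measureI) (use mass space_\<nu> in auto)

lemma measurable_\<nu>_ident: "(\<lambda>l. l) \<in> borel_measurable \<nu>"
  using measurable_restrict_space1[OF measurable_ident_sets[OF refl], of borel "{0..}"]
  by (simp add: measurable_cong_sets[OF sets_\<nu> refl])

lemma integrable_moment: "integrable \<nu> (\<lambda>l. l)"
  by (rule integrableI_nonneg) (use moment measurable_\<nu>_ident space_\<nu> in \<open>auto intro!: AE_I2\<close>)

lemma integrable_mass: "integrable \<nu> (\<lambda>l. 1 :: real)"
  using finite_\<nu> by (simp add: finite_measure.integrable_const)

abbreviation "a0 \<equiv> form \<Omega> A0"
abbreviation "a1 \<equiv> form \<Omega> A1"
abbreviation "a1_nrm v \<equiv> sqrt (a1 v v)"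

lemma a1_nonneg: "v \<in> Vsp \<Omega> \<Longrightarrow> 0 \<le> a1 v v"
  using coercive[of v] mult_nonneg_nonneg[OF less_imp_le[OF beta] zero_le_power2[of "V_seminrm \<Omega> v"]] by linarith

sublocale H: semi_inner "Hsp \<Omega>" "H_inner \<Omega>" "H_nrm \<Omega>" by (rule H_semi_inner)
sublocale V: semi_inner "Vsp \<Omega>" H1_inner "V_nrm \<Omega>" by (rule V_semi_inner)
sublocale G: semi_inner "Vsp \<Omega>" G_inner "V_seminrm \<Omega>" by (rule V_G_semi_inner)
sublocale V0: semi_inner "Vsp \<Omega>" a0 "\<lambda>v. sqrt (a0 v v)" by (rule form_semi_inner[OF A0 a0_nonneg])
sublocale V1: semi_inner "Vsp \<Omega>" a1 a1_nrm by (rule form_semi_inner[OF A1 a1_nonneg])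

lemma V_nrm_sq_le_seminrm: "v \<in> Vsp \<Omega> \<Longrightarrow> (V_nrm \<Omega> v)\<^sup>2 \<le> (1 + C\<^sub>P\<^sup>2) * (V_seminrm \<Omega> v)\<^sup>2"
  using power_mono[OF poincare H.nrm_nonneg[OF V_imp_H], of v 2]
  by (simp add: V_nrm_sq power_mult_distrib algebra_simps)

lemma V_nrm_sq_le: assumes v: "v \<in> Vsp \<Omega>" shows "(V_nrm \<Omega> v)\<^sup>2 \<le> (1 + C\<^sub>P\<^sup>2) / \<beta> * a1 v v"
proof -
  have "(V_seminrm \<Omega> v)\<^sup>2 \<le> a1 v v / \<beta>" using coercive[OF v] beta by (simp add: field_simps)
  then have "(1 + C\<^sub>P\<^sup>2) * (V_seminrm \<Omega> v)\<^sup>2 \<le> (1 + C\<^sub>P\<^sup>2) * (a1 v v / \<beta>)" by (intro mult_left_mono) auto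
  with V_nrm_sq_le_seminrm[OF v] show ?thesis by simp
qed

lemma V_nrm_le: assumes v: "v \<in> Vsp \<Omega>" shows "V_nrm \<Omega> v \<le> sqrt ((1 + C\<^sub>P\<^sup>2) / \<beta>) * a1_nrm v"
  using real_sqrt_le_mono[OF V_nrm_sq_le[OF v]] V.nrm_nonneg[OF v]
  unfolding real_sqrt_mult by simp

lemma bounded_formE:
  assumes "bounded_form \<Omega> a"
  obtains C where "C \<ge> 0" "\<And>w v. w \<in> Vsp \<Omega> \<Longrightarrow> v \<in> Vsp \<Omega> \<Longrightarrow> \<bar>a w v\<bar> \<le> C * V_nrm \<Omega> w * V_nrm \<Omega> v"
proof -
  obtain C where C: "\<And>w v. w \<in> Vsp \<Omega> \<Longrightarrow> v \<in> Vsp \<Omega> \<Longrightarrow> \<bar>a w v\<bar> \<le> C * V_nrm \<Omega> w * V_nrm \<Omega> v"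
    using assms unfolding bounded_form_def by blast
  have "\<bar>a w v\<bar> \<le> \<bar>C\<bar> * V_nrm \<Omega> w * V_nrm \<Omega> v" if "w \<in> Vsp \<Omega>" "v \<in> Vsp \<Omega>" for w v
    using C[OF that] mult_right_mono[OF abs_ge_self[of C] mult_nonneg_nonneg[OF V.nrm_nonneg[OF that(1)] V.nrm_nonneg[OF that(2)]]]
    by (simp add: mult.assoc)
  then show ?thesis using that[of "\<bar>C\<bar>"] by auto
qed

lemma bounded_functional_form:
  assumes A: "symmetric_Linfty_field \<Omega> A" and b: "bounded_form \<Omega> (form \<Omega> A)" and v: "v \<in> Vsp \<Omega>"
  shows "V.bounded_functional (\<lambda>x. form \<Omega> A x v)"
proof -
  obtain C where C: "C \<ge> 0" "\<And>w v. w \<in> Vsp \<Omega> \<Longrightarrow> v \<in> Vsp \<Omega> \<Longrightarrow> \<bar>form \<Omega> A w v\<bar> \<le> C * V_nrm \<Omega> w * V_nrm \<Omega> v"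
    by (rule bounded_formE[OF b]) (rule that; assumption)
  show ?thesis unfolding V.bounded_functional_def
    using C(1) V.nrm_nonneg[OF v] C(2)[OF _ v]
    by (auto intro!: form_add[OF A] form_scale[OF A] V_imp_H1 v exI[of _ "C * V_nrm \<Omega> v"] simp: mult_ac)
qed

lemma bounded_functional_G:
  assumes v: "v \<in> Vsp \<Omega>" shows "V.bounded_functional (\<lambda>x. G_inner x v)"
  unfolding V.bounded_functional_def
proof (intro conjI ballI allI exI[of _ "V_seminrm \<Omega> v"])
  fix x assume x: "x \<in> Vsp \<Omega>"
  show "\<bar>G_inner x v\<bar> \<le> V_seminrm \<Omega> v * V_nrm \<Omega> x"
    using G.Cauchy_Schwarz[OF x v] mult_right_mono[OF V_seminrm_le_V_nrm[of x] G.nrm_nonneg[OF v]]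
    by (simp add: mult.commute)
qed (auto intro: G.add_left G.scale_left v G.nrm_nonneg)

lemma a1_nrm_le: obtains C where "C \<ge> 0" "\<And>v. v \<in> Vsp \<Omega> \<Longrightarrow> a1_nrm v \<le> C * V_nrm \<Omega> v"
proof -
  obtain C where C: "C \<ge> 0" "\<And>w v. w \<in> Vsp \<Omega> \<Longrightarrow> v \<in> Vsp \<Omega> \<Longrightarrow> \<bar>a1 w v\<bar> \<le> C * V_nrm \<Omega> w * V_nrm \<Omega> v"
    by (rule bounded_formE[OF a1_bounded]) (rule that; assumption)
  have "a1_nrm v \<le> sqrt C * V_nrm \<Omega> v" if v: "v \<in> Vsp \<Omega>" for v
    using real_sqrt_le_mono[OF order_trans[OF abs_ge_self C(2)[OF v v]]] V.nrm_nonneg[OF v]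
    by (simp add: real_sqrt_mult mult.assoc)
  then show ?thesis using that[of "sqrt C"] C(1) by auto
qed

lemma strongly_measurable_V_iff:
  "strongly_measurable M (Vsp \<Omega>) (V_nrm \<Omega>) z \<longleftrightarrow> strongly_measurable M (Vsp \<Omega>) a1_nrm z"
proof -
  obtain C where C: "C \<ge> 0" "\<And>v. v \<in> Vsp \<Omega> \<Longrightarrow> a1_nrm v \<le> C * V_nrm \<Omega> v" by (rule a1_nrm_le) (rule that; assumption)
  show ?thesis
    using V.strongly_measurable_le[of M z a1_nrm, OF _ V1.nrm_nonneg C(2)]
      V1.strongly_measurable_le[of M z "V_nrm \<Omega>", OF _ V.nrm_nonneg V_nrm_le] by blast
qed

lemma V1_complete: "V1.complete_space"
  unfolding V1.complete_space_def
proof (intro allI impI)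
  fix x :: "nat \<Rightarrow> real ^ 'n \<Rightarrow> real"
  assume "range x \<subseteq> Vsp \<Omega> \<and> (\<forall>e>0. \<exists>N. \<forall>m\<ge>N. \<forall>n\<ge>N. a1_nrm (x m - x n) < e)"
  then have x: "\<And>n. x n \<in> Vsp \<Omega>"
    and Cauchy: "\<And>e. e > 0 \<Longrightarrow> \<exists>N. \<forall>m\<ge>N. \<forall>n\<ge>N. a1_nrm (x m - x n) < e" by auto
  let ?c = "sqrt ((1 + C\<^sub>P\<^sup>2) / \<beta>)"
  have cpos: "?c > 0" using beta by (simp add: add_pos_nonneg)
  have "\<exists>N. \<forall>m\<ge>N. \<forall>n\<ge>N. V_nrm \<Omega> (x m - x n) < e" if e: "e > 0" for e
  proof -
    obtain N where N: "\<And>m n. m \<ge> N \<Longrightarrow> n \<ge> N \<Longrightarrow> a1_nrm (x m - x n) < e / ?c"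
      using Cauchy[of "e / ?c"] e cpos divide_pos_pos by blast
    have "V_nrm \<Omega> (x m - x n) < e" if "m \<ge> N" "n \<ge> N" for m n
    proof -
      have "?c * a1_nrm (x m - x n) < ?c * (e / ?c)" by (rule mult_strict_left_mono[OF N[OF that] cpos])
      also have "\<dots> = e" by (simp only: times_divide_eq_right nonzero_mult_div_cancel_left[OF less_imp_neq[OF cpos, symmetric]])
      finally show ?thesis using V_nrm_le[OF V.diff_mem[OF x x], of m n] by linarith
    qed
    then show ?thesis by blast
  qed
  note conv = this
  have "\<exists>y\<in>Vsp \<Omega>. (\<lambda>n. V_nrm \<Omega> (x n - y)) \<longlonglongrightarrow> 0"
    by (rule V.complete_spaceD[OF V_complete]) (fact x, rule conv)
  then obtain y where y: "y \<in> Vsp \<Omega>" "(\<lambda>n. V_nrm \<Omega> (x n - y)) \<longlonglongrightarrow> 0" ..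
  obtain C where C: "C \<ge> 0" "\<And>v. v \<in> Vsp \<Omega> \<Longrightarrow> a1_nrm v \<le> C * V_nrm \<Omega> v" by (rule a1_nrm_le) (rule that; assumption)
  have m: "x n - y \<in> Vsp \<Omega>" for n by (rule V.diff_mem[OF x y(1)])
  have "(\<lambda>n. a1_nrm (x n - y)) \<longlonglongrightarrow> 0"
  proof (rule squeeze_zero[where g = "\<lambda>n. C * V_nrm \<Omega> (x n - y)"])
    show "0 \<le> a1_nrm (x n - y)" for n by (rule V1.nrm_nonneg[OF m])
    show "a1_nrm (x n - y) \<le> C * V_nrm \<Omega> (x n - y)" for n by (rule C(2)[OF m])
    show "(\<lambda>n. C * V_nrm \<Omega> (x n - y)) \<longlonglongrightarrow> 0" by (rule tendsto_mult_right_zero[OF y(2)])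
  qed
  with y(1) show "\<exists>y\<in>Vsp \<Omega>. (\<lambda>n. a1_nrm (x n - y)) \<longlonglongrightarrow> 0" by blast
qed

text \<open>
  As the two norms on \<open>V\<close> are equivalent, the history space is \<open>L\<^sup>2(\<nu>; V)\<close> over the inner product \<open>a1\<close>.
\<close>

lemma Ksp_eq: "Ksp \<Omega> A1 \<nu> = V1.L2v \<nu>"
  unfolding Ksp_def V1.L2v_def Ksq_def space_\<nu> strongly_measurable_V_iff by auto

sublocale K: semi_inner "Ksp \<Omega> A1 \<nu>" "V1.L2v_inner \<nu>" "V1.L2v_nrm \<nu>"
  unfolding Ksp_eq by (rule V1.L2v_semi_inner)

abbreviation "W_inner \<equiv> prod_inner (H_inner \<Omega>) (V1.L2v_inner \<nu>)"

lemma W_nrm_eq: "W_nrm \<Omega> A1 \<nu> x = sqrt ((H_nrm \<Omega> (fst x))\<^sup>2 + (V1.L2v_nrm \<nu> (snd x))\<^sup>2)"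
  by (simp add: W_nrm_def V1.L2v_nrm_def Ksq_def case_prod_beta)

lemma W_semi_inner: "semi_inner (Wsp \<Omega> A1 \<nu>) W_inner (W_nrm \<Omega> A1 \<nu>)"
  unfolding Wsp_def by (rule semi_inner_prod[OF H_semi_inner K.semi_inner_axioms]) (rule W_nrm_eq)

lemma H_complete: "H.complete_space"
  using L2_complete[OF complete_\<mu>] unfolding Hsp_def H_nrm_def by blast

lemma W_complete: "semi_inner.complete_space (Wsp \<Omega> A1 \<nu>) (W_nrm \<Omega> A1 \<nu>)"
  unfolding Wsp_def
proof (rule complete_space_prod[OF H_semi_inner K.semi_inner_axioms H_complete])
  show "semi_inner.complete_space (Ksp \<Omega> A1 \<nu>) (V1.L2v_nrm \<nu>)"
    unfolding Ksp_eq by (rule V1.L2v_complete[OF V1_complete])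
qed (rule W_nrm_eq)

lemma K_mem: "z \<in> Ksp \<Omega> A1 \<nu> \<Longrightarrow> 0 \<le> l \<Longrightarrow> z l \<in> Vsp \<Omega>"
  and K_measurable: "z \<in> Ksp \<Omega> A1 \<nu> \<Longrightarrow> strongly_measurable \<nu> (Vsp \<Omega>) (V_nrm \<Omega>) z"
  by (auto simp: Ksp_def)

section \<open>Weighted integrals of history variables\<close>

lemma measurable_a1:
  assumes "strongly_measurable \<nu> (Vsp \<Omega>) (V_nrm \<Omega>) z" "w \<in> borel_measurable \<nu>"
  shows "(\<lambda>l. w l * a1 (z l) (z l)) \<in> borel_measurable (completion \<nu>)"
  by (intro borel_measurable_times V1.measurable_inner measurable_completion assms(2)
      strongly_measurable_V_iff[THEN iffD1, OF assms(1)])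

text \<open>
  The Cauchy--Schwarz inequality in the form \<open>|\<integral>w z|\<^sup>2 \<le> \<integral>w * \<integral>w |z|\<^sup>2\<close>, read off by testing the integral
  against itself.  The weight \<open>1\<close> covers the integral of a history variable, the weight \<open>\<lambda>\<close> its first
  moment.
\<close>

lemma weighted_integral:
  fixes z :: "'n hist"
  assumes w: "integrable \<nu> w" "\<And>l. 0 \<le> l \<Longrightarrow> 0 \<le> w l"
    and z: "\<And>l. 0 \<le> l \<Longrightarrow> z l \<in> Vsp \<Omega>" "strongly_measurable \<nu> (Vsp \<Omega>) (V_nrm \<Omega>) z"
    and fin: "(\<integral>\<^sup>+l. ennreal (w l * a1 (z l) (z l)) \<partial>\<nu>) < \<infinity>"
  shows weighted_integrable: "bochner_integrable_in \<nu> (Vsp \<Omega>) (V_nrm \<Omega>) (\<lambda>l. w l *\<^sub>R z l)" (is ?A)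
    and weighted_integral_bound:
      "ennreal ((V_seminrm \<Omega> (bochner_integral_in \<nu> (Vsp \<Omega>) (V_nrm \<Omega>) (\<lambda>l. w l *\<^sub>R z l)))\<^sup>2)
        \<le> ennreal ((LINT l|\<nu>. w l) / \<beta>) * (\<integral>\<^sup>+l. ennreal (w l * a1 (z l) (z l)) \<partial>\<nu>)" (is ?B)
proof -
  interpret completion: complete_measure "completion \<nu>" by standard
  have wm: "w \<in> borel_measurable \<nu>" using w(1) by simp
  note q_meas = measurable_a1[OF z(2) wm]
  have space: "space (completion \<nu>) = {0..}" "space \<nu> = {0..}" by (simp_all add: space_\<nu>)
  have wc: "integrable (completion \<nu>) w" using w(1) wm by (simp add: integrable_completion)
  have q: "integrable (completion \<nu>) (\<lambda>l. w l * a1 (z l) (z l))"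
    by (rule integrableI_nonneg[OF q_meas])
       (use fin in \<open>auto simp: nn_integral_completion space intro!: AE_I2 mult_nonneg_nonneg w a1_nonneg z\<close>)
  have wz: "strongly_measurable \<nu> (Vsp \<Omega>) (V_nrm \<Omega>) (\<lambda>l. w l *\<^sub>R z l)"
    by (rule V.strongly_measurable_scaleR[OF wm z(2)])
  define c where "c = (1 + C\<^sub>P\<^sup>2) / \<beta>"
  have c: "c \<ge> 0" using beta by (simp add: c_def)
  have "(\<integral>\<^sup>+l. ennreal (V_nrm \<Omega> (w l *\<^sub>R z l)) \<partial>completion \<nu>)
      \<le> (\<integral>\<^sup>+l. ennreal (w l + c * (w l * a1 (z l) (z l))) \<partial>completion \<nu>)"
  proof (intro nn_integral_mono ennreal_leI)
    fix l assume "l \<in> space (completion \<nu>)"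
    then have l: "0 \<le> l" by (simp add: space)
    have "V_nrm \<Omega> (z l) \<le> 1 + (V_nrm \<Omega> (z l))\<^sup>2" by (rule le_one_plus_square)
    also have "\<dots> \<le> 1 + c * a1 (z l) (z l)" using V_nrm_sq_le[OF z(1)[OF l]] by (simp add: c_def)
    finally have "w l * V_nrm \<Omega> (z l) \<le> w l * (1 + c * a1 (z l) (z l))" by (rule mult_left_mono[OF _ w(2)[OF l]])
    then show "V_nrm \<Omega> (w l *\<^sub>R z l) \<le> w l + c * (w l * a1 (z l) (z l))"
      using w(2)[OF l] by (simp add: V.nrm_scale z(1)[OF l] algebra_simps)
  qed
  also have "\<dots> = ennreal (LINT l|completion \<nu>. w l + c * (w l * a1 (z l) (z l)))"
    by (intro nn_integral_eq_integral Bochner_Integration.integrable_add integrable_mult_right wc q AE_I2)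
       (auto simp: space intro!: add_nonneg_nonneg mult_nonneg_nonneg w a1_nonneg z c)
  finally have "(\<integral>\<^sup>+l. ennreal (V_nrm \<Omega> (w l *\<^sub>R z l)) \<partial>\<nu>) < \<infinity>"
    unfolding nn_integral_completion by (rule order_le_less_trans) simp
  then show A: ?A by (rule V.bochner_integral_exists[OF V_complete finite_\<nu> wz])
  define I where "I = bochner_integral_in \<nu> (Vsp \<Omega>) (V_nrm \<Omega>) (\<lambda>l. w l *\<^sub>R z l)"
  have I: "has_bochner_integral_in \<nu> (Vsp \<Omega>) (V_nrm \<Omega>) (\<lambda>l. w l *\<^sub>R z l) I"
    unfolding I_def by (rule V.has_bochner_integral_bochner_integral[OF A])
  have IV: "I \<in> Vsp \<Omega>" by (rule V.bochner_mem[OF I])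
  define s where "s = V_seminrm \<Omega> I"
  define Q where "Q = (LINT l|completion \<nu>. w l * a1 (z l) (z l))"
  define M where "M = (LINT l|\<nu>. w l)"
  have Mc: "M = (LINT l|completion \<nu>. w l)" using wm by (simp add: M_def integral_completion)
  have Q0: "Q \<ge> 0" unfolding Q_def
    by (intro Bochner_Integration.integral_nonneg_AE AE_I2) (auto simp: space intro!: mult_nonneg_nonneg w a1_nonneg z)
  have M0: "M \<ge> 0" unfolding M_def
    by (intro Bochner_Integration.integral_nonneg_AE AE_I2) (auto simp: space_\<nu> w)
  have "s\<^sup>2 \<le> M * (Q / \<beta>)"
  proof (rule le_of_Young[OF M0])
    show "0 \<le> Q / \<beta>" "0 \<le> s\<^sup>2" using Q0 beta by auto
    fix \<theta> :: real assume \<theta>: "\<theta> > 0"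
    note Gf = bounded_functional_G[OF IV]
    have "s\<^sup>2 = (LINT l|completion \<nu>. G_inner (w l *\<^sub>R z l) I)"
      using V.functional_bochner(2)[OF I Gf] G.nrm_sq[OF IV] by (simp add: s_def)
    also have "\<dots> \<le> (LINT l|completion \<nu>. \<theta> * s\<^sup>2 / 2 * w l + 1 / (2 * \<theta> * \<beta>) * (w l * a1 (z l) (z l)))"
    proof (intro integral_mono V.functional_bochner(1)[OF I Gf] Bochner_Integration.integrable_add integrable_mult_right wc q)
      fix l assume "l \<in> space (completion \<nu>)"
      then have l: "0 \<le> l" by (simp add: space)
      let ?g = "V_seminrm \<Omega> (z l)"
      have "?g * s \<le> \<theta> * s\<^sup>2 / 2 + ?g\<^sup>2 / (2 * \<theta>)"
      proof -
        have "0 \<le> (\<theta> * s - ?g)\<^sup>2 / (2 * \<theta>)" using \<theta> by simp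
        also have "\<dots> = \<theta> * s\<^sup>2 / 2 + ?g\<^sup>2 / (2 * \<theta>) - ?g * s"
          using \<theta> by (simp add: power2_eq_square field_simps)
        finally show ?thesis by simp
      qed
      also have "?g\<^sup>2 / (2 * \<theta>) \<le> 1 / (2 * \<theta> * \<beta>) * a1 (z l) (z l)"
        using coercive[OF z(1)[OF l]] \<theta> beta by (simp add: field_simps)
      finally have "?g * s \<le> \<theta> * s\<^sup>2 / 2 + 1 / (2 * \<theta> * \<beta>) * a1 (z l) (z l)" by simp
      then have "G_inner (z l) I \<le> \<theta> * s\<^sup>2 / 2 + 1 / (2 * \<theta> * \<beta>) * a1 (z l) (z l)"
        using G.Cauchy_Schwarz[OF z(1)[OF l] IV] unfolding s_def by linarith
      from mult_left_mono[OF this w(2)[OF l]]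
      show "G_inner (w l *\<^sub>R z l) I \<le> \<theta> * s\<^sup>2 / 2 * w l + 1 / (2 * \<theta> * \<beta>) * (w l * a1 (z l) (z l))"
        using G.scale_left[OF z(1)[OF l] IV, of "w l"] by (simp add: algebra_simps)
    qed
    also have "\<dots> = \<theta> * s\<^sup>2 / 2 * M + 1 / (2 * \<theta> * \<beta>) * Q"
      unfolding Mc Q_def by (subst Bochner_Integration.integral_add) (intro integrable_mult_right wc q, intro integrable_mult_right wc q, simp)
    also have "\<dots> = (\<theta> * s\<^sup>2 * M + Q / \<beta> / \<theta>) / 2" using \<theta> beta by (simp add: field_simps)
    finally show "s\<^sup>2 \<le> (\<theta> * s\<^sup>2 * M + Q / \<beta> / \<theta>) / 2" .
  qed
  moreover have "(\<integral>\<^sup>+l. ennreal (w l * a1 (z l) (z l)) \<partial>\<nu>) = ennreal Q"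
    unfolding Q_def nn_integral_completion[symmetric, where M = \<nu>]
    by (intro nn_integral_eq_integral q AE_I2) (auto simp: space intro!: mult_nonneg_nonneg w a1_nonneg z)
  ultimately show ?B
    unfolding I_def[symmetric] s_def[symmetric] M_def[symmetric] using M0 beta Q0
    by (simp add: ennreal_mult[symmetric] ennreal_leI)
qed

lemma K_integrable: "z \<in> Ksp \<Omega> A1 \<nu> \<Longrightarrow> bochner_integrable_in \<nu> (Vsp \<Omega>) (V_nrm \<Omega>) z"
  using weighted_integrable[of "\<lambda>l. 1" z] integrable_mass by (simp add: K_mem K_measurable) (simp add: Ksp_def Ksq_def)

lemma J_functional:
  assumes z: "z \<in> Ksp \<Omega> A1 \<nu>" and L: "V.bounded_functional L"
  shows "integrable (completion \<nu>) (\<lambda>l. L (z l))" "L (J_op \<Omega> \<nu> z) = (LINT l|completion \<nu>. L (z l))"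
  unfolding J_op_def using V.functional_bochner[OF V.has_bochner_integral_bochner_integral[OF K_integrable[OF z]] L] by auto

end

context history_system
begin

section \<open>Dissipation\<close>

definition damping :: "'n hist \<Rightarrow> ennreal" where
  "damping z = (\<integral>\<^sup>+l. ennreal (l * a1 (z l) (z l)) \<partial>\<nu>)"

text \<open>
  The coupling terms \<open>a1 (J z) u\<close> and \<open>\<integral>a1 u (z \<lambda>) d\<nu>\<close> cancel.  The integral of \<open>\<lambda> * a1 (z \<lambda>) (z \<lambda>)\<close> is
  finite on the domain because \<open>E u - \<Lambda> z\<close> belongs to the history space and is paired with \<open>z\<close>.
\<close>

lemma
  assumes x: "x \<in> gen_dom \<Omega> A0 A1 \<nu>"
  shows dissipative_gen_op: "W_inner (gen_op \<Omega> A0 A1 \<nu> x) x \<le> 0" (is ?A)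
    and dissipation_eq: "ennreal (- W_inner (gen_op \<Omega> A0 A1 \<nu> x) x) = ennreal (a0 (fst x) (fst x)) + damping (snd x)" (is ?B)
proof -
  obtain u z where xu: "x = (u, z)" by (cases x)
  let ?F = "spatial_functional \<Omega> A0 A1 \<nu> (u, z)"
  have u: "u \<in> Vsp \<Omega>" and z: "z \<in> Ksp \<Omega> A1 \<nu>" and ex: "\<exists>h. functional_is_H_element \<Omega> ?F h"
    and d: "E_op u - Lambda_op z \<in> Ksp \<Omega> A1 \<nu>"
    using x unfolding xu gen_dom_def by auto
  (* gen_op is defined with this choice; any other element would pair with u in the same way *)
  define h where "h = (SOME h. functional_is_H_element \<Omega> ?F h)"
  have "functional_is_H_element \<Omega> ?F h" unfolding h_def by (rule someI_ex[OF ex])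
  then have hH: "h \<in> Hsp \<Omega>" and hu: "H_inner \<Omega> h u = a0 u u + a1 (J_op \<Omega> \<nu> z) u"
    using u by (auto simp: functional_is_H_element_def spatial_functional_def)
  have hmu: "H_inner \<Omega> (- h) u = - H_inner \<Omega> h u"
    using H.scale_left[OF hH V_imp_H[OF u], of "-1"] by simp
  note J = J_functional[OF z bounded_functional_form[OF A1 a1_bounded u]]
  have int: "integrable (completion \<nu>) (\<lambda>l. a1 ((E_op u - Lambda_op z) l) (z l))"
    using d z unfolding Ksp_eq by (rule V1.L2v_integrable)
  have pw: "l * a1 (z l) (z l) = a1 (z l) u - a1 ((E_op u - Lambda_op z) l) (z l)"
    if "l \<in> space (completion \<nu>)" for l
  proof -
    have l: "0 \<le> l" using that by (simp add: space_\<nu>)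
    have zl: "z l \<in> Vsp \<Omega>" by (rule K_mem[OF z l])
    have "a1 ((E_op u - Lambda_op z) l) (z l) = a1 (u - l *\<^sub>R z l) (z l)"
      by (simp add: E_op_def Lambda_op_def)
    also have "\<dots> = a1 u (z l) - l * a1 (z l) (z l)"
      by (simp add: V1.diff_left[OF u V.scale_mem[OF zl] zl] V1.scale_left[OF zl zl])
    finally show ?thesis using V1.sym[OF u zl] by simp
  qed
  have q: "integrable (completion \<nu>) (\<lambda>l. l * a1 (z l) (z l))"
    by (subst Bochner_Integration.integrable_cong[OF refl pw]) (assumption, intro Bochner_Integration.integrable_diff J(1) int)
  have "(LINT l|completion \<nu>. l * a1 (z l) (z l)) = a1 (J_op \<Omega> \<nu> z) u - V1.L2v_inner \<nu> (E_op u - Lambda_op z) z"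
    unfolding V1.L2v_inner_def J(2) Bochner_Integration.integral_diff[OF J(1) int, symmetric]
    by (rule Bochner_Integration.integral_cong[OF refl pw])
  then have eq: "- W_inner (gen_op \<Omega> A0 A1 \<nu> x) x = a0 u u + (LINT l|completion \<nu>. l * a1 (z l) (z l))"
    by (simp add: xu gen_op_def prod_inner_def h_def[symmetric] hmu hu)
  have nonneg: "0 \<le> l * a1 (z l) (z l)" if "l \<in> space (completion \<nu>)" for l
    using that K_mem[OF z] by (auto simp: space_\<nu> intro!: mult_nonneg_nonneg a1_nonneg)
  have q0: "0 \<le> (LINT l|completion \<nu>. l * a1 (z l) (z l))"
    by (intro Bochner_Integration.integral_nonneg nonneg)
  have "damping z = ennreal (LINT l|completion \<nu>. l * a1 (z l) (z l))"
    unfolding damping_def nn_integral_completion[symmetric, where M = \<nu>]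
    by (intro nn_integral_eq_integral q AE_I2 nonneg)
  then show ?B unfolding eq using q0 a0_nonneg[OF u] by (simp add: xu)
  show ?A using eq q0 a0_nonneg[OF u] by linarith
qed

lemma truncation_mem:
  assumes z: "z \<in> Ksp \<Omega> A1 \<nu>"
  shows "(\<lambda>l. min l (real N) *\<^sub>R z l) \<in> Ksp \<Omega> A1 \<nu>"
proof -
  have wm: "(\<lambda>l. min l (real N)) \<in> borel_measurable \<nu>" by (intro borel_measurable_min measurable_\<nu>_ident) auto
  have "Ksq \<Omega> A1 \<nu> (\<lambda>l. min l (real N) *\<^sub>R z l) \<le> (\<integral>\<^sup>+l. ennreal ((real N)\<^sup>2) * ennreal (a1 (z l) (z l)) \<partial>\<nu>)"
    unfolding Ksq_def
  proof (rule nn_integral_mono)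
    fix l assume "l \<in> space \<nu>"
    then have l: "0 \<le> l" by (simp add: space_\<nu>)
    have zl: "z l \<in> Vsp \<Omega>" by (rule K_mem[OF z l])
    have w2: "(min l (real N))\<^sup>2 \<le> (real N)\<^sup>2" using l by (intro power_mono) auto
    have "a1 (min l (real N) *\<^sub>R z l) (min l (real N) *\<^sub>R z l) = (min l (real N))\<^sup>2 * a1 (z l) (z l)"
      by (simp add: V1.scale_left V1.scale_right zl V.scale_mem power2_eq_square)
    also have "\<dots> \<le> (real N)\<^sup>2 * a1 (z l) (z l)" by (rule mult_right_mono[OF w2 a1_nonneg[OF zl]])
    finally show "ennreal (a1 (min l (real N) *\<^sub>R z l) (min l (real N) *\<^sub>R z l)) \<le> ennreal ((real N)\<^sup>2) * ennreal (a1 (z l) (z l))"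
      by (simp add: ennreal_mult'[symmetric] ennreal_leI)
  qed
  also have "\<dots> = ennreal ((real N)\<^sup>2) * (\<integral>\<^sup>+l. ennreal (a1 (z l) (z l)) \<partial>completion \<nu>)"
    unfolding nn_integral_completion[symmetric, where M = \<nu>]
    by (rule nn_integral_cmult) (use measurable_a1[OF K_measurable[OF z], of "\<lambda>l. 1"] in simp)
  also have "\<dots> < \<infinity>" using z by (auto simp: nn_integral_completion Ksp_def Ksq_def ennreal_mult_less_top)
  finally have fin: "Ksq \<Omega> A1 \<nu> (\<lambda>l. min l (real N) *\<^sub>R z l) < \<infinity>" .
  show ?thesis unfolding Ksp_def
    using V.strongly_measurable_scaleR[OF wm K_measurable[OF z]] V.scale_mem[OF K_mem[OF z]] fin by simp
qed

lemma truncation_integral: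
  assumes z: "z \<in> Ksp \<Omega> A1 \<nu>"
  shows "integrable (completion \<nu>) (\<lambda>l. min l (real N) * a1 (z l) (z l))" (is ?A)
    and "(\<integral>\<^sup>+l. ennreal (min l (real N) * a1 (z l) (z l)) \<partial>\<nu>)
      = ennreal (LINT l|completion \<nu>. min l (real N) * a1 (z l) (z l))" (is ?B)
proof -
  have eq: "a1 (min l (real N) *\<^sub>R z l) (z l) = min l (real N) * a1 (z l) (z l)" if "l \<in> space (completion \<nu>)" for l
    using that by (intro V1.scale_left K_mem[OF z]) (auto simp: space_\<nu>)
  have "integrable (completion \<nu>) (\<lambda>l. a1 (min l (real N) *\<^sub>R z l) (z l))"
    using truncation_mem[OF z] z unfolding Ksp_eq by (rule V1.L2v_integrable)
  then show A: ?A by (subst (asm) Bochner_Integration.integrable_cong[OF refl eq])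
  show ?B unfolding nn_integral_completion[symmetric, where M = \<nu>]
    by (intro nn_integral_eq_integral A AE_I2 mult_nonneg_nonneg a1_nonneg K_mem[OF z]) (auto simp: space_\<nu>)
qed

text \<open>
  With the weight cut off at \<open>N\<close>, the damping is a continuous convex quadratic functional on the history
  space and lies above its tangents.  The full damping is the supremum over \<open>N\<close>.
\<close>

lemma damping_lsc:
  fixes z :: "'n hist" and zn :: "nat \<Rightarrow> 'n hist"
  assumes zn: "\<And>n. zn n \<in> Ksp \<Omega> A1 \<nu>" and z: "z \<in> Ksp \<Omega> A1 \<nu>"
    and lim: "(\<lambda>n. V1.L2v_nrm \<nu> (zn n - z)) \<longlonglongrightarrow> 0"
  shows "damping z \<le> liminf (\<lambda>n. damping (zn n))"
proof -
  define Q where "Q N y = (LINT l|completion \<nu>. min l (real N) * a1 (y l) (y l))" for N and y :: "'n hist"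
  have trunc: "ennreal (Q N z) \<le> liminf (\<lambda>n. damping (zn n))" for N
  proof -
    let ?wz = "\<lambda>l. min l (real N) *\<^sub>R z l"
    define r where "r n = V1.L2v_inner \<nu> (zn n - z) ?wz" for n
    have dK: "zn n - z \<in> Ksp \<Omega> A1 \<nu>" for n by (rule K.diff_mem[OF zn z])
    have r0: "r \<longlonglongrightarrow> 0"
    proof (rule tendsto_rabs_zero_cancel, rule squeeze_zero[where g = "\<lambda>n. V1.L2v_nrm \<nu> (zn n - z) * V1.L2v_nrm \<nu> ?wz"])
      show "\<bar>r n\<bar> \<le> V1.L2v_nrm \<nu> (zn n - z) * V1.L2v_nrm \<nu> ?wz" for n
        unfolding r_def by (rule K.Cauchy_Schwarz[OF dK truncation_mem[OF z]])
      show "(\<lambda>n. V1.L2v_nrm \<nu> (zn n - z) * V1.L2v_nrm \<nu> ?wz) \<longlonglongrightarrow> 0"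
        by (rule tendsto_mult_left_zero[OF lim])
    qed simp
    (* the tangent at z *)
    have le: "Q N z + 2 * r n \<le> Q N (zn n)" for n
    proof -
      have int: "integrable (completion \<nu>) (\<lambda>l. a1 ((zn n - z) l) (?wz l))"
        using dK[of n] truncation_mem[OF z] unfolding Ksp_eq by (rule V1.L2v_integrable)
      have "Q N z + 2 * r n = (LINT l|completion \<nu>. min l (real N) * a1 (z l) (z l) + 2 * a1 ((zn n - z) l) (?wz l))"
        unfolding Q_def r_def V1.L2v_inner_def using int by (simp add: truncation_integral(1)[OF z])
      also have "\<dots> \<le> Q N (zn n)" unfolding Q_def
      proof (intro integral_mono Bochner_Integration.integrable_add integrable_mult_right truncation_integral(1) z zn int)
        fix l assume "l \<in> space (completion \<nu>)"
        then have l: "0 \<le> l" by (simp add: space_\<nu>)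
        note m = K_mem[OF z l] K_mem[OF zn l, of n]
        have "0 \<le> a1 (zn n l - z l) (zn n l - z l)" by (intro a1_nonneg V.diff_mem m)
        also have "\<dots> = a1 (zn n l) (zn n l) - 2 * a1 (zn n l) (z l) + a1 (z l) (z l)"
          using V1.sym[OF m] by (simp add: V1.diff_left V1.diff_right m V.diff_mem)
        finally have "0 \<le> min l (real N) * (a1 (zn n l) (zn n l) - 2 * a1 (zn n l) (z l) + a1 (z l) (z l))"
          using l by (intro mult_nonneg_nonneg) auto
        moreover have "a1 ((zn n - z) l) (?wz l) = min l (real N) * (a1 (zn n l) (z l) - a1 (z l) (z l))"
          by (simp add: V1.scale_right V1.diff_left m V.diff_mem)
        ultimately show "min l (real N) * a1 (z l) (z l) + 2 * a1 ((zn n - z) l) (?wz l) \<le> min l (real N) * a1 (zn n l) (zn n l)"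
          by (simp add: algebra_simps)
      qed
      finally show ?thesis .
    qed
    have Qle: "ennreal (Q N (zn n)) \<le> damping (zn n)" for n
      unfolding Q_def truncation_integral(2)[OF zn, symmetric] damping_def
      by (intro nn_integral_mono ennreal_leI mult_right_mono a1_nonneg K_mem[OF zn]) (auto simp: space_\<nu>)
    have "(\<lambda>n. ennreal (Q N z + 2 * r n)) \<longlonglongrightarrow> ennreal (Q N z + 2 * 0)"
      by (intro tendsto_ennrealI tendsto_add tendsto_const tendsto_mult r0)
    then have "ennreal (Q N z) = liminf (\<lambda>n. ennreal (Q N z + 2 * r n))"
      using lim_imp_Liminf[OF trivial_limit_sequentially] by fastforce
    also have "\<dots> \<le> liminf (\<lambda>n. damping (zn n))"
      by (intro Liminf_mono always_eventually allI order_trans[OF ennreal_leI[OF le] Qle])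
    finally show ?thesis .
  qed
  have sup: "ennreal (l * a1 (z l) (z l)) = (SUP N. ennreal (min l (real N) * a1 (z l) (z l)))" if "l \<in> space \<nu>" for l
  proof (rule antisym)
    obtain N :: nat where "l \<le> real N" using real_arch_simple by blast
    then show "ennreal (l * a1 (z l) (z l)) \<le> (SUP N. ennreal (min l (real N) * a1 (z l) (z l)))"
      by (intro SUP_upper2[of N]) (auto simp: min_absorb1)
    show "(SUP N. ennreal (min l (real N) * a1 (z l) (z l))) \<le> ennreal (l * a1 (z l) (z l))"
      using that by (intro SUP_least ennreal_leI mult_right_mono a1_nonneg K_mem[OF z]) (auto simp: space_\<nu>)
  qed
  have "damping z = (\<integral>\<^sup>+l. (SUP N. ennreal (min l (real N) * a1 (z l) (z l))) \<partial>completion \<nu>)"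
    unfolding damping_def nn_integral_completion[where M = \<nu>] by (rule nn_integral_cong) (rule sup)
  also have "\<dots> = (SUP N. \<integral>\<^sup>+l. ennreal (min l (real N) * a1 (z l) (z l)) \<partial>completion \<nu>)"
  proof (rule nn_integral_monotone_convergence_SUP_AE)
    show "AE l in completion \<nu>. ennreal (min l (real N) * a1 (z l) (z l)) \<le> ennreal (min l (real (Suc N)) * a1 (z l) (z l))" for N
      by (intro AE_I2 ennreal_leI mult_right_mono a1_nonneg K_mem[OF z]) (auto simp: space_\<nu>)
    show "(\<lambda>l. ennreal (min l (real N) * a1 (z l) (z l))) \<in> borel_measurable (completion \<nu>)" for N
      using truncation_integral(1)[OF z, of N] by (intro measurable_compose[OF _ measurable_ennreal]) auto
  qed
  also have "\<dots> \<le> liminf (\<lambda>n. damping (zn n))"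
    unfolding nn_integral_completion[where M = \<nu>] truncation_integral(2)[OF z] using trunc by (intro SUP_least) (simp add: Q_def)
  finally show ?thesis .
qed

text \<open>
  Lower semicontinuity makes the sublevel sets closed.
\<close>

lemma damping_measurable:
  fixes z :: "real \<Rightarrow> 'n hist"
  assumes z: "\<And>t. t \<in> {0..T} \<Longrightarrow> z t \<in> Ksp \<Omega> A1 \<nu>"
    and cont: "\<And>t. t \<in> {0..T} \<Longrightarrow> ((\<lambda>s. V1.L2v_nrm \<nu> (z s - z t)) \<longlongrightarrow> 0) (at t within {0..T})"
  shows "(\<lambda>t. damping (z t)) \<in> borel_measurable (lebesgue_on {0..T})"
proof (rule borel_measurableI_le)
  fix y :: ennreal
  let ?S = "{t \<in> {0..T}. damping (z t) \<le> y}"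
  have "closed ?S" unfolding closed_sequential_limits
  proof (intro allI impI)
    fix x l assume "(\<forall>n::nat. x n \<in> ?S) \<and> x \<longlonglongrightarrow> l"
    then have xI: "\<And>n. x n \<in> {0..T}" and xy: "\<And>n. damping (z (x n)) \<le> y" and xl: "x \<longlonglongrightarrow> l" by auto
    have l: "l \<in> {0..T}" by (rule closed_sequentially[OF closed_atLeastAtMost xI xl])
    have c: "continuous (at l within {0..T}) (\<lambda>s. V1.L2v_nrm \<nu> (z s - z l))"
      using cont[OF l] by (simp add: continuous_within K.nrm_zero)
    have "(\<lambda>n. V1.L2v_nrm \<nu> (z (x n) - z l)) \<longlonglongrightarrow> V1.L2v_nrm \<nu> (z l - z l)"
      using continuous_within_tendsto_compose'[OF c xI xl] .
    then have "damping (z l) \<le> liminf (\<lambda>n. damping (z (x n)))"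
      by (intro damping_lsc z xI l) (simp add: K.nrm_zero)
    also have "\<dots> \<le> liminf (\<lambda>n. y)" using xy by (intro Liminf_mono always_eventually) auto
    also have "\<dots> = y" by (rule Liminf_const) simp
    finally show "l \<in> ?S" using l by simp
  qed
  then have "?S \<in> sets lebesgue" by (simp add: borel_closed)
  moreover have "{t \<in> space (lebesgue_on {0..T}). damping (z t) \<le> y} = ?S" by auto
  ultimately show "{t \<in> space (lebesgue_on {0..T}). damping (z t) \<le> y} \<in> sets (lebesgue_on {0..T})"
    by (auto simp: sets_restrict_space_iff)
qed

end

section \<open>Energy estimates for the system with history\<close>

lemma strongly_measurable_cong_AE:
  assumes ae: "AE x in M. f x = g x" and f: "strongly_measurable M V p f"
  shows "strongly_measurable M V p g"
proof -
  have fV: "AE x in M. f x \<in> V" and "\<exists>s. (\<forall>i :: nat. simple_function M (s i) \<and> s i ` space M \<subseteq> V) \<and>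
      (AE x in M. (\<lambda>i. p (f x - s i x)) \<longlonglongrightarrow> 0)"
    using f unfolding strongly_measurable_def by (rule conjunct1, rule conjunct2)
  then obtain s where s: "\<forall>i :: nat. simple_function M (s i) \<and> s i ` space M \<subseteq> V"
      and lim: "AE x in M. (\<lambda>i. p (f x - s i x)) \<longlonglongrightarrow> 0" by (elim exE conjE)
  have "AE x in M. (\<lambda>i. p (g x - s i x)) \<longlonglongrightarrow> 0" using lim ae by (rule AE_mp[OF _ AE_mp[OF _ AE_I2]]) simp
  with s have "\<exists>s. (\<forall>i :: nat. simple_function M (s i) \<and> s i ` space M \<subseteq> V) \<and>
      (AE x in M. (\<lambda>i. p (g x - s i x)) \<longlonglongrightarrow> 0)" by (intro exI[of _ s] conjI)
  moreover have "AE x in M. g x \<in> V" using fV ae by (rule AE_mp[OF _ AE_mp[OF _ AE_I2]]) simp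
  ultimately show ?thesis unfolding strongly_measurable_def by (rule conjI[rotated])
qed

lemma has_bochner_integral_in_cong_AE:
  assumes ae: "AE x in M. f x = g x" and I: "has_bochner_integral_in M V p f I"
  shows "has_bochner_integral_in M V p g I"
proof -
  have "(\<integral>\<^sup>+x. ennreal (p (f x - s i x)) \<partial>M) = (\<integral>\<^sup>+x. ennreal (p (g x - s i x)) \<partial>M)" for s and i :: nat
    using ae by (intro nn_integral_cong_AE) (elim AE_mp, intro AE_I2, simp)
  then show ?thesis
    using I strongly_measurable_cong_AE[OF ae, of V p] unfolding has_bochner_integral_in_def by simp
qed

locale history_evolution = history_system \<Omega> A0 A1 \<nu> \<beta> C\<^sub>P
  for \<Omega> :: "(real ^ 'n::finite) set" and A0 A1 \<nu> \<beta> C\<^sub>P +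
  fixes S :: "real \<Rightarrow> (real ^ 'n \<Rightarrow> real) \<times> 'n hist \<Rightarrow> (real ^ 'n \<Rightarrow> real) \<times> 'n hist"
    and T :: real and u0 :: "real ^ 'n \<Rightarrow> real" and f :: "real \<Rightarrow> real ^ 'n \<Rightarrow> real"
    and X :: "real \<Rightarrow> (real ^ 'n \<Rightarrow> real) \<times> 'n hist"
  assumes semigroup: "contraction_C0_semigroup (Wsp \<Omega> A1 \<nu>) (W_nrm \<Omega> A1 \<nu>) S"
    and generator: "is_generator (Wsp \<Omega> A1 \<nu>) (W_nrm \<Omega> A1 \<nu>) S (gen_dom \<Omega> A0 A1 \<nu>) (gen_op \<Omega> A0 A1 \<nu>)"
    and T_pos: "0 < T"
    and f_mem: "\<And>t. f t \<in> Hsp \<Omega>"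
    and f_L2: "bochner_L2 (lebesgue_on {0..T}) (Hsp \<Omega>) (H_nrm \<Omega>) f"
    and u0_mem: "u0 \<in> Hsp \<Omega>"
    and mild: "mild_solution (Wsp \<Omega> A1 \<nu>) (W_nrm \<Omega> A1 \<nu>) S T (u0, 0) (\<lambda>t. (f t, 0)) X"
begin

lemma W_nrm_zero_history: "W_nrm \<Omega> A1 \<nu> (v, 0) = H_nrm \<Omega> v" if "v \<in> Hsp \<Omega>"
  by (simp add: W_nrm_eq K.nrm_zero H.nrm_nonneg[OF that])

lemma source_L2: "bochner_L2 (lebesgue_on {0..T}) (Wsp \<Omega> A1 \<nu>) (W_nrm \<Omega> A1 \<nu>) (\<lambda>t. (f t, 0))"
proof -
  obtain s :: "nat \<Rightarrow> real \<Rightarrow> real ^ 'n \<Rightarrow> real" where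
    s: "\<And>i. simple_function (lebesgue_on {0..T}) (s i)" "\<And>i. s i ` space (lebesgue_on {0..T}) \<subseteq> Hsp \<Omega>"
      "AE t in lebesgue_on {0..T}. (\<lambda>i. H_nrm \<Omega> (f t - s i t)) \<longlonglongrightarrow> 0"
    using f_L2 unfolding bochner_L2_def strongly_measurable_def by blast
  define r :: "nat \<Rightarrow> real \<Rightarrow> (real ^ 'n \<Rightarrow> real) \<times> 'n hist" where "r i t = (s i t, 0)" for i t
  have "AE t in lebesgue_on {0..T}. (\<lambda>i. W_nrm \<Omega> A1 \<nu> ((f t, 0) - r i t)) \<longlonglongrightarrow> 0"
    using s(3) AE_space[of "lebesgue_on {0..T}"]
  proof eventually_elim
    case (elim t)
    have "W_nrm \<Omega> A1 \<nu> ((f t, 0) - r i t) = H_nrm \<Omega> (f t - s i t)" for i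
    proof -
      have "s i t \<in> Hsp \<Omega>" using s(2)[of i] elim(2) by blast
      from W_nrm_zero_history[OF H.diff_mem[OF f_mem this]] show ?thesis by (simp add: r_def)
    qed
    with elim(1) show ?case by simp
  qed
  moreover have "simple_function (lebesgue_on {0..T}) (r i)" for i
    unfolding r_def using simple_function_compose1[OF s(1), where g = "\<lambda>v. (v, 0 :: 'n hist)"] .
  moreover have "r i ` space (lebesgue_on {0..T}) \<subseteq> Wsp \<Omega> A1 \<nu>" for i
    using s(2)[of i] K.zero_mem by (auto simp: r_def Wsp_def)
  moreover have "AE t in lebesgue_on {0..T}. (f t, 0) \<in> Wsp \<Omega> A1 \<nu>"
    using f_mem K.zero_mem by (auto simp: Wsp_def)
  ultimately have "strongly_measurable (lebesgue_on {0..T}) (Wsp \<Omega> A1 \<nu>) (W_nrm \<Omega> A1 \<nu>) (\<lambda>t. (f t, 0))"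
    unfolding strongly_measurable_def by (intro conjI exI[of _ r] allI)
  then show ?thesis using f_L2 by (simp add: bochner_L2_def W_nrm_zero_history f_mem)
qed

sublocale E: mild_evolution "Wsp \<Omega> A1 \<nu>" W_inner "W_nrm \<Omega> A1 \<nu>" S
  "gen_dom \<Omega> A0 A1 \<nu>" "gen_op \<Omega> A0 A1 \<nu>" T "(u0, 0)" "\<lambda>t. (f t, 0)" X
  by (intro mild_evolution.intro mild_evolution_axioms.intro W_semi_inner W_complete semigroup generator
      dissipative_gen_op T_pos source_L2 mild)
     (auto simp: Wsp_def f_mem u0_mem intro: K.zero_mem)

abbreviation "u t \<equiv> fst (X t)"
abbreviation "\<zeta> t \<equiv> snd (X t)"
abbreviation "data \<equiv> (H_nrm \<Omega> u0)\<^sup>2 + (LINT t|lebesgue_on {0..T}. (H_nrm \<Omega> (f t))\<^sup>2)"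

lemma data_eq: "(W_nrm \<Omega> A1 \<nu> (u0, 0))\<^sup>2 + E.F_energy T = data"
proof -
  have "E.F_energy T = (LINT t|lebesgue_on {0..T}. (W_nrm \<Omega> A1 \<nu> (f t, 0))\<^sup>2)"
    unfolding E.F_energy_def by (rule lebesgue_integral_eq_integral[OF E.F_sq_integrable, symmetric]) simp
  then show ?thesis by (simp add: W_nrm_zero_history f_mem u0_mem)
qed

lemma data_nonneg: "0 \<le> data"
  by (intro add_nonneg_nonneg Bochner_Integration.integral_nonneg) auto

lemma \<zeta>_mem: "t \<in> {0..T} \<Longrightarrow> \<zeta> t \<in> Ksp \<Omega> A1 \<nu>"
  using E.X_mem[of t] by (auto simp: Wsp_def mem_Times_iff)

theorem energy_bound:
  assumes t: "t \<in> {0..T}"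
  shows "ennreal ((H_nrm \<Omega> (u t))\<^sup>2) + Ksq \<Omega> A1 \<nu> (\<zeta> t) \<le> ennreal (exp T * data)"
proof -
  have K: "Ksq \<Omega> A1 \<nu> (\<zeta> t) = ennreal ((V1.L2v_nrm \<nu> (\<zeta> t))\<^sup>2)"
    unfolding Ksq_def by (rule V1.L2v_nn_integral) (use \<zeta>_mem[OF t] in \<open>simp add: Ksp_eq\<close>)
  have "(W_nrm \<Omega> A1 \<nu> (X t))\<^sup>2 = (H_nrm \<Omega> (u t))\<^sup>2 + (V1.L2v_nrm \<nu> (\<zeta> t))\<^sup>2" by (simp add: W_nrm_eq)
  then show ?thesis unfolding K using E.mild_energy_bound[OF t] data_eq
    by (simp add: ennreal_plus[symmetric] ennreal_leI del: ennreal_plus)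
qed

lemma K_nrm_le_W_nrm: "V1.L2v_nrm \<nu> (snd x) \<le> W_nrm \<Omega> A1 \<nu> x"
  unfolding W_nrm_eq by (rule real_le_rsqrt) simp

lemma damping_of_solution_measurable: "(\<lambda>t. damping (\<zeta> t)) \<in> borel_measurable (lebesgue_on {0..T})"
proof (rule damping_measurable[OF \<zeta>_mem])
  fix t assume t: "t \<in> {0..T}"
  have K: "V1.L2v_nrm \<nu> (\<zeta> s - \<zeta> t) \<le> W_nrm \<Omega> A1 \<nu> (X s - X t)" for s
    using K_nrm_le_W_nrm[of "X s - X t"] by simp
  have lim: "((\<lambda>s. W_nrm \<Omega> A1 \<nu> (X s - X t)) \<longlongrightarrow> 0) (at t within {0..T})"
    using E.X_path t by (simp add: E.path_on_def)
  show "((\<lambda>s. V1.L2v_nrm \<nu> (\<zeta> s - \<zeta> t)) \<longlongrightarrow> 0) (at t within {0..T})"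
    by (rule squeeze_zero[OF _ K lim]) (simp add: V1.L2v_nrm_def)
qed

lemma eventually_step:
  fixes h :: "nat \<Rightarrow> real"
  assumes "t < T" "h \<longlonglongrightarrow> 0" shows "\<forall>\<^sub>F n in sequentially. t + h n < T"
proof -
  have "\<forall>\<^sub>F n in sequentially. h n < T - t" using assms by (intro order_tendstoD(2)[of h 0]) auto
  then show ?thesis by eventually_elim simp
qed

lemma dissipation_Y_eq:
  assumes "0 < h" "0 \<le> t" "t + h < T"
  shows "ennreal (E.dissipation (E.Y h t)) = ennreal (a0 (fst (E.Y h t)) (fst (E.Y h t))) + damping (snd (E.Y h t))"
  unfolding E.dissipation_def by (rule dissipation_eq[OF E.Y_generator(1)[OF assms]])

text \<open>
  The averages converge in the history space as soon as they are defined; the value at the limit is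
  used for the finitely many steps that are too long.
\<close>

lemma damping_liminf:
  fixes h :: "nat \<Rightarrow> real"
  assumes t: "0 \<le> t" "t < T" and h: "\<And>n. 0 < h n" "h \<longlonglongrightarrow> 0"
  shows "damping (\<zeta> t) \<le> liminf (\<lambda>n. damping (snd (E.Y (h n) t)))"
proof -
  define z where "z n = (if t + h n < T then snd (E.Y (h n) t) else \<zeta> t)" for n
  have tT: "t \<in> {0..T}" using t by auto
  have ev: "\<forall>\<^sub>F n in sequentially. z n = snd (E.Y (h n) t)"
    using eventually_step[OF t(2) h(2)] by eventually_elim (simp add: z_def)
  have zK: "z n \<in> Ksp \<Omega> A1 \<nu>" for n
  proof (cases "t + h n < T")
    case True
    have "E.Y (h n) t \<in> Wsp \<Omega> A1 \<nu>"
      by (rule E.avg_mem[OF E.Z_path]) (use t h(1)[of n] True in auto)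
    then show ?thesis using True by (auto simp: z_def Wsp_def mem_Times_iff)
  qed (simp add: z_def \<zeta>_mem[OF tT])
  have "(\<lambda>n. V1.L2v_nrm \<nu> (snd (E.Y (h n) t) - \<zeta> t)) \<longlonglongrightarrow> 0"
  proof (rule squeeze_zero[OF _ _ E.Y_tendsto[OF t h]])
    show "V1.L2v_nrm \<nu> (snd (E.Y (h n) t) - \<zeta> t) \<le> W_nrm \<Omega> A1 \<nu> (E.Y (h n) t - X t)" for n
      using K_nrm_le_W_nrm[of "E.Y (h n) t - X t"] by simp
  qed (simp add: V1.L2v_nrm_def)
  moreover have "\<forall>\<^sub>F n in sequentially. V1.L2v_nrm \<nu> (snd (E.Y (h n) t) - \<zeta> t) = V1.L2v_nrm \<nu> (z n - \<zeta> t)"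
    using ev by eventually_elim simp
  ultimately have "(\<lambda>n. V1.L2v_nrm \<nu> (z n - \<zeta> t)) \<longlonglongrightarrow> 0" by (rule Lim_transform_eventually)
  then have "damping (\<zeta> t) \<le> liminf (\<lambda>n. damping (z n))" by (rule damping_lsc[OF zK \<zeta>_mem[OF tT]])
  also have "\<dots> = liminf (\<lambda>n. damping (snd (E.Y (h n) t)))"
    by (rule Liminf_eq) (use ev in eventually_elim, simp)
  finally show ?thesis .
qed

text \<open>
  By lower semicontinuity, and because \<open>a0\<close> is nonnegative, the damping is dominated by the lower limit
  of the dissipation of the averages.
\<close>

theorem damping_bound:
  "2 * (\<integral>\<^sup>+t. damping (\<zeta> t) \<partial>lebesgue_on {0..T}) \<le> ennreal ((1 + T * exp T) * data)"
  unfolding data_eq[symmetric]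
proof (rule E.mild_dissipation_bound)
  let ?h = "\<lambda>n. inverse (real (Suc n))"
  show h: "0 < ?h n" for n by simp
  show h0: "?h \<longlonglongrightarrow> 0" by (rule LIMSEQ_inverse_real_of_nat)
  show "AE t in lebesgue_on {0..T}. t < T \<longrightarrow> damping (\<zeta> t) \<le> liminf (\<lambda>n. ennreal (E.dissipation (E.Y (?h n) t)))"
  proof (intro AE_I2 impI)
    fix t assume "t \<in> space (lebesgue_on {0..T})" and tT: "t < T"
    then have t: "0 \<le> t" by auto
    have "damping (\<zeta> t) \<le> liminf (\<lambda>n. damping (snd (E.Y (?h n) t)))" by (rule damping_liminf[OF t tT h h0])
    also have "\<dots> \<le> liminf (\<lambda>n. ennreal (E.dissipation (E.Y (?h n) t)))"
    proof (rule Liminf_mono)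
      show "\<forall>\<^sub>F n in sequentially. damping (snd (E.Y (?h n) t)) \<le> ennreal (E.dissipation (E.Y (?h n) t))"
        using eventually_step[OF tT h0] by eventually_elim (simp add: dissipation_Y_eq t)
    qed
    finally show "damping (\<zeta> t) \<le> liminf (\<lambda>n. ennreal (E.dissipation (E.Y (?h n) t)))" .
  qed
qed

lemma one_plus_sq: "0 \<le> 1 + C\<^sub>P\<^sup>2" by simp

lemma integral_bound_V_nrm:
  assumes I: "bochner_integrable_in \<nu> (Vsp \<Omega>) (V_nrm \<Omega>) z"
    and s: "ennreal ((V_seminrm \<Omega> (bochner_integral_in \<nu> (Vsp \<Omega>) (V_nrm \<Omega>) z))\<^sup>2) \<le> b"
  shows "ennreal ((V_nrm \<Omega> (bochner_integral_in \<nu> (Vsp \<Omega>) (V_nrm \<Omega>) z))\<^sup>2) \<le> ennreal (1 + C\<^sub>P\<^sup>2) * b"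
proof -
  have "bochner_integral_in \<nu> (Vsp \<Omega>) (V_nrm \<Omega>) z \<in> Vsp \<Omega>"
    by (rule V.bochner_mem[OF V.has_bochner_integral_bochner_integral[OF I]])
  from ennreal_leI[OF V_nrm_sq_le_seminrm[OF this]]
  have "ennreal ((V_nrm \<Omega> (bochner_integral_in \<nu> (Vsp \<Omega>) (V_nrm \<Omega>) z))\<^sup>2)
      \<le> ennreal (1 + C\<^sub>P\<^sup>2) * ennreal ((V_seminrm \<Omega> (bochner_integral_in \<nu> (Vsp \<Omega>) (V_nrm \<Omega>) z))\<^sup>2)"
    unfolding ennreal_mult[OF one_plus_sq zero_le_power2] .
  also have "\<dots> \<le> ennreal (1 + C\<^sub>P\<^sup>2) * b" by (rule mult_left_mono[OF s]) simp
  finally show ?thesis .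
qed

theorem memory_bound:
  assumes t: "t \<in> {0..T}"
  shows "ennreal ((V_seminrm \<Omega> (bochner_integral_in \<nu> (Vsp \<Omega>) (V_nrm \<Omega>) (\<zeta> t)))\<^sup>2)
      \<le> ennreal (measure \<nu> {0..} / \<beta> * exp T * data)" (is ?A)
    and "ennreal ((V_nrm \<Omega> (bochner_integral_in \<nu> (Vsp \<Omega>) (V_nrm \<Omega>) (\<zeta> t)))\<^sup>2)
      \<le> ennreal ((1 + C\<^sub>P\<^sup>2) * (measure \<nu> {0..} / \<beta> * exp T * data))" (is ?B)
proof -
  note z = \<zeta>_mem[OF t]
  have mass: "(LINT l|\<nu>. 1 :: real) = measure \<nu> {0..}" by (simp add: space_\<nu>)
  have fin: "(\<integral>\<^sup>+l. ennreal (1 * a1 (\<zeta> t l) (\<zeta> t l)) \<partial>\<nu>) = Ksq \<Omega> A1 \<nu> (\<zeta> t)" by (simp add: Ksq_def)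
  have "(\<integral>\<^sup>+l. ennreal (1 * a1 (\<zeta> t l) (\<zeta> t l)) \<partial>\<nu>) < \<infinity>" unfolding fin using z by (simp add: Ksp_def)
  from weighted_integral_bound[OF integrable_mass _ K_mem[OF z] K_measurable[OF z] this]
  have "ennreal ((V_seminrm \<Omega> (bochner_integral_in \<nu> (Vsp \<Omega>) (V_nrm \<Omega>) (\<zeta> t)))\<^sup>2)
      \<le> ennreal (measure \<nu> {0..} / \<beta>) * Ksq \<Omega> A1 \<nu> (\<zeta> t)"
    unfolding fin mass by simp
  also have "Ksq \<Omega> A1 \<nu> (\<zeta> t) \<le> ennreal (exp T * data)"
    by (rule order_trans[OF _ energy_bound[OF t]]) simp
  finally show A: ?A using data_nonneg beta
    by (simp add: mult_left_mono ennreal_mult[symmetric] mult.assoc)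
  have K0: "0 \<le> measure \<nu> {0..} / \<beta> * exp T * data"
    using data_nonneg beta by (intro mult_nonneg_nonneg divide_nonneg_nonneg) auto
  show ?B unfolding ennreal_mult[OF one_plus_sq K0] by (rule integral_bound_V_nrm[OF K_integrable[OF z] A])
qed

lemma moment_integral_pointwise:
  assumes t: "t \<in> {0..T}" and fin: "damping (\<zeta> t) < \<infinity>"
  shows "bochner_integrable_in \<nu> (Vsp \<Omega>) (V_nrm \<Omega>) (\<lambda>l. l *\<^sub>R \<zeta> t l)"
    and "ennreal ((V_seminrm \<Omega> (bochner_integral_in \<nu> (Vsp \<Omega>) (V_nrm \<Omega>) (\<lambda>l. l *\<^sub>R \<zeta> t l)))\<^sup>2)
      \<le> ennreal ((LINT l|\<nu>. l) / \<beta>) * damping (\<zeta> t)"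
  using weighted_integral[OF integrable_moment _ K_mem[OF \<zeta>_mem[OF t]] K_measurable[OF \<zeta>_mem[OF t]]] fin
  unfolding damping_def by auto

lemma damping_finite_AE: "AE t in lebesgue_on {0..T}. t \<in> {0..T} \<and> damping (\<zeta> t) < \<infinity>"
proof -
  have "(\<integral>\<^sup>+t. damping (\<zeta> t) \<partial>lebesgue_on {0..T}) \<le> 2 * (\<integral>\<^sup>+t. damping (\<zeta> t) \<partial>lebesgue_on {0..T})"
    by (simp add: mult_2)
  also have "\<dots> < \<infinity>" using damping_bound by (rule order_le_less_trans) simp
  finally have "AE t in lebesgue_on {0..T}. damping (\<zeta> t) \<noteq> \<infinity>"
    by (intro nn_integral_PInf_AE damping_of_solution_measurable) auto
  with AE_space[of "lebesgue_on {0..T}"] show ?thesis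
    by eventually_elim (auto simp: less_top)
qed

theorem moment_integrable_AE:
  "AE t in lebesgue_on {0..T}. bochner_integrable_in \<nu> (Vsp \<Omega>) (V_nrm \<Omega>) (\<lambda>l. l *\<^sub>R \<zeta> t l)"
  using damping_finite_AE by eventually_elim (blast intro: moment_integral_pointwise)

lemma moment_nonneg: "0 \<le> (LINT l|\<nu>. l)"
  by (rule Bochner_Integration.integral_nonneg) (simp add: space_\<nu>)

lemma integral_le_damping_bound:
  assumes c: "0 \<le> c" and le: "AE t in lebesgue_on {0..T}. g t \<le> ennreal c * damping (\<zeta> t)"
  shows "(\<integral>\<^sup>+t. g t \<partial>lebesgue_on {0..T}) \<le> ennreal (c / 2 * ((1 + T * exp T) * data))"
proof -
  have "(\<integral>\<^sup>+t. g t \<partial>lebesgue_on {0..T}) \<le> (\<integral>\<^sup>+t. ennreal c * damping (\<zeta> t) \<partial>lebesgue_on {0..T})"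
    by (rule nn_integral_mono_AE[OF le])
  also have "\<dots> = ennreal c * (\<integral>\<^sup>+t. damping (\<zeta> t) \<partial>lebesgue_on {0..T})"
    by (rule nn_integral_cmult[OF damping_of_solution_measurable])
  also have "ennreal c = ennreal (c / 2) * 2"
    using c ennreal_mult[of "c / 2" 2] by simp
  also have "ennreal (c / 2) * 2 * (\<integral>\<^sup>+t. damping (\<zeta> t) \<partial>lebesgue_on {0..T})
      \<le> ennreal (c / 2) * ennreal ((1 + T * exp T) * data)"
    unfolding mult.assoc by (rule mult_left_mono[OF damping_bound]) simp
  also have "\<dots> = ennreal (c / 2 * ((1 + T * exp T) * data))"
    using c data_nonneg T_pos by (intro ennreal_mult[symmetric]) (auto intro!: mult_nonneg_nonneg add_nonneg_nonneg)
  finally show ?thesis .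
qed

theorem moment_bound:
  shows "(\<integral>\<^sup>+t. ennreal ((V_seminrm \<Omega> (bochner_integral_in \<nu> (Vsp \<Omega>) (V_nrm \<Omega>) (\<lambda>l. l *\<^sub>R \<zeta> t l)))\<^sup>2) \<partial>lebesgue_on {0..T})
      \<le> ennreal ((LINT l|\<nu>. l) / (2 * \<beta>) * (1 + T * exp T) * data)" (is ?A)
    and "(\<integral>\<^sup>+t. ennreal ((V_nrm \<Omega> (bochner_integral_in \<nu> (Vsp \<Omega>) (V_nrm \<Omega>) (\<lambda>l. l *\<^sub>R \<zeta> t l)))\<^sup>2) \<partial>lebesgue_on {0..T})
      \<le> ennreal ((1 + C\<^sub>P\<^sup>2) * ((LINT l|\<nu>. l) / (2 * \<beta>) * (1 + T * exp T) * data))" (is ?B)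
proof -
  let ?c = "(LINT l|\<nu>. l) / \<beta>"
  have c: "0 \<le> ?c" using moment_nonneg beta by simp
  have "AE t in lebesgue_on {0..T}. ennreal ((V_seminrm \<Omega> (bochner_integral_in \<nu> (Vsp \<Omega>) (V_nrm \<Omega>) (\<lambda>l. l *\<^sub>R \<zeta> t l)))\<^sup>2)
      \<le> ennreal ?c * damping (\<zeta> t)"
    using damping_finite_AE by eventually_elim (blast intro: moment_integral_pointwise)
  from integral_le_damping_bound[OF c this] show ?A by (simp add: mult_ac)
  have "AE t in lebesgue_on {0..T}. ennreal ((V_nrm \<Omega> (bochner_integral_in \<nu> (Vsp \<Omega>) (V_nrm \<Omega>) (\<lambda>l. l *\<^sub>R \<zeta> t l)))\<^sup>2)
      \<le> ennreal ((1 + C\<^sub>P\<^sup>2) * ?c) * damping (\<zeta> t)"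
    using damping_finite_AE
  proof eventually_elim
    case (elim t)
    then have t: "t \<in> {0..T}" "damping (\<zeta> t) < \<infinity>" by auto
    show ?case
      unfolding ennreal_mult[OF one_plus_sq c] mult.assoc by (rule integral_bound_V_nrm[OF moment_integral_pointwise[OF t]])
  qed
  from integral_le_damping_bound[OF mult_nonneg_nonneg[OF one_plus_sq c] this] show ?B by (simp add: mult_ac)
qed

end

context history_evolution
begin

lemma bounded_functional_H:
  assumes w: "w \<in> Hsp \<Omega>" shows "V.bounded_functional (\<lambda>x. H_inner \<Omega> x w)"
  unfolding V.bounded_functional_def
proof (intro conjI ballI allI exI[of _ "H_nrm \<Omega> w"])
  fix x assume x: "x \<in> Vsp \<Omega>"
  have "H_nrm \<Omega> x * H_nrm \<Omega> w \<le> V_nrm \<Omega> x * H_nrm \<Omega> w"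
    by (rule mult_right_mono[OF H_nrm_le_V_nrm[OF V_imp_H1[OF x]] H.nrm_nonneg[OF w]])
  then show "\<bar>H_inner \<Omega> x w\<bar> \<le> H_nrm \<Omega> w * V_nrm \<Omega> x"
    using H.Cauchy_Schwarz[OF V_imp_H[OF x] w] by (simp add: mult.commute)
qed (auto intro: H.add_left H.scale_left w V_imp_H H.nrm_nonneg)

lemma bounded_functional_fst:
  assumes w: "w \<in> Hsp \<Omega>" shows "E.bounded_functional (\<lambda>x. H_inner \<Omega> (fst x) w)"
proof -
  have "(w, 0) \<in> Wsp \<Omega> A1 \<nu>" using w K.zero_mem by (simp add: Wsp_def)
  from E.bounded_functional_inner[OF this] have b: "E.bounded_functional (\<lambda>x. W_inner x (w, 0))" .
  have eq: "W_inner x (w, 0) = H_inner \<Omega> (fst x) w" if "x \<in> Wsp \<Omega> A1 \<nu>" for x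
    using that K.sym[of "snd x" 0] K.zero_left[of "snd x"] K.zero_mem by (auto simp: prod_inner_def Wsp_def)
  show ?thesis using b eq E.add_mem E.scale_mem unfolding E.bounded_functional_def by simp
qed

text \<open>
  If \<open>u\<close> is square integrable in \<open>V\<close>, its average can be formed in \<open>V\<close> as well.  It has the same pairings
  in \<open>H\<close> as the velocity component of the average formed in the energy space, so the two agree in \<open>V\<close>.
\<close>

lemma Steklov_average_form:
  assumes uV: "strongly_measurable (lebesgue_on {0..T}) (Vsp \<Omega>) (V_nrm \<Omega>) u"
    and fin: "(\<integral>\<^sup>+t. ennreal ((V_nrm \<Omega> (u t))\<^sup>2) \<partial>lebesgue_on {0..T}) < \<infinity>"
    and h: "0 < h" "0 \<le> t" "t + h < T" and c: "c \<in> Vsp \<Omega>"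
  shows "a0 (fst (E.Y h t)) c = (1 / h) * integral {t..t + h} (\<lambda>s. a0 (u s) c)"
proof -
  have sub: "{t..t + h} \<subseteq> {0..T}" using h by auto
  have meas: "strongly_measurable (lebesgue_on {t..t + h}) (Vsp \<Omega>) (V_nrm \<Omega>) u"
    by (rule strongly_measurable_subset[OF uV sub]) auto
  have "(\<integral>\<^sup>+s. ennreal (V_nrm \<Omega> (u s)) \<partial>lebesgue_on {t..t + h})
      \<le> (\<integral>\<^sup>+s. ennreal (V_nrm \<Omega> (u s)) * indicator {t..t + h} s \<partial>lebesgue_on {0..T})"
  proof -
    have "ennreal (V_nrm \<Omega> (u s)) * indicator {t..t + h} s * indicator {0..T} s
        = ennreal (V_nrm \<Omega> (u s)) * indicator {t..t + h} s" for s
      using sub by (auto simp: indicator_def)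
    then show ?thesis by (simp add: nn_integral_restrict_space)
  qed
  also have "\<dots> \<le> (\<integral>\<^sup>+s. ennreal (1 + (V_nrm \<Omega> (u s))\<^sup>2) \<partial>lebesgue_on {0..T})"
  proof (intro nn_integral_mono)
    fix s :: real
    have "V_nrm \<Omega> (u s) \<le> 1 + (V_nrm \<Omega> (u s))\<^sup>2" by (rule le_one_plus_square)
    from ennreal_leI[OF this]
    show "ennreal (V_nrm \<Omega> (u s)) * indicator {t..t + h} s \<le> ennreal (1 + (V_nrm \<Omega> (u s))\<^sup>2)"
      by (auto simp: indicator_def simp del: ennreal_plus)
  qed
  also have "\<dots> = (\<integral>\<^sup>+s. 1 \<partial>lebesgue_on {0..T}) + (\<integral>\<^sup>+s. ennreal ((V_nrm \<Omega> (u s))\<^sup>2) \<partial>lebesgue_on {0..T})"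
  proof -
    have [measurable]: "(\<lambda>s. V_nrm \<Omega> (u s)) \<in> borel_measurable (lebesgue_on {0..T})"
      using V.measurable_nrm[OF uV] by (simp add: completion_lebesgue_interval)
    have m: "(\<lambda>s. ennreal ((V_nrm \<Omega> (u s))\<^sup>2)) \<in> borel_measurable (lebesgue_on {0..T})" by measurable
    have "(\<integral>\<^sup>+s. ennreal (1 + (V_nrm \<Omega> (u s))\<^sup>2) \<partial>lebesgue_on {0..T}) = (\<integral>\<^sup>+s. 1 + ennreal ((V_nrm \<Omega> (u s))\<^sup>2) \<partial>lebesgue_on {0..T})"
      by (intro nn_integral_cong) simp
    then show ?thesis by (simp add: nn_integral_add[OF _ m])
  qed
  also have "\<dots> < \<infinity>"
    using fin finite_measure.emeasure_finite[OF finite_measure_lebesgue_on_interval[of 0 T], of "{0..T}"]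
    by (simp add: less_top[symmetric])
  finally have fin1: "(\<integral>\<^sup>+s. ennreal (V_nrm \<Omega> (u s)) \<partial>lebesgue_on {t..t + h}) < \<infinity>" .
  obtain I where I: "has_bochner_integral_in (lebesgue_on {t..t + h}) (Vsp \<Omega>) (V_nrm \<Omega>) u I"
    using V.bochner_integral_exists[OF V_complete finite_measure_lebesgue_on_interval meas fin1]
    unfolding bochner_integrable_in_def ..
  have IV: "I \<in> Vsp \<Omega>" by (rule V.bochner_mem[OF I])
  define v where "v = fst (E.Y h t)"
  have v: "v \<in> Vsp \<Omega>" using E.Y_generator(1)[OF h] by (auto simp: v_def gen_dom_def)
  have dV: "I - h *\<^sub>R v \<in> Vsp \<Omega>" by (intro V.diff_mem IV V.scale_mem v)
  have "H_inner \<Omega> (I - h *\<^sub>R v) w = 0" if w: "w \<in> Hsp \<Omega>" for w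
  proof -
    have "H_inner \<Omega> I w = integral {t..t + h} (\<lambda>s. H_inner \<Omega> (u s) w)"
      by (rule V.functional_bochner_interval(2)[OF I bounded_functional_H[OF w]])
    moreover have "H_inner \<Omega> v w = (1 / h) * integral {t..t + h} (\<lambda>s. H_inner \<Omega> (u s) w)"
      using E.functional_Y[OF bounded_functional_fst[OF w], of h t] h by (simp add: v_def)
    ultimately show ?thesis
      using h(1) w V_imp_H[OF IV] V_imp_H[OF v] by (simp add: H.diff_left H.scale_left H.scale_mem)
  qed
  from this[OF V_imp_H[OF dV]] have "H_nrm \<Omega> (I - h *\<^sub>R v) = 0" using H.nrm[OF V_imp_H[OF dV]] by simp
  then have null: "V_nrm \<Omega> (I - h *\<^sub>R v) = 0" by (rule V_nrm_null_if_H_null[OF V_imp_H1[OF dV]])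
  obtain C where C: "C \<ge> 0" "\<And>w v. w \<in> Vsp \<Omega> \<Longrightarrow> v \<in> Vsp \<Omega> \<Longrightarrow> \<bar>a0 w v\<bar> \<le> C * V_nrm \<Omega> w * V_nrm \<Omega> v"
    by (rule bounded_formE[OF a0_bounded]) (rule that; assumption)
  have "a0 (I - h *\<^sub>R v) c = 0" using C(2)[OF dV c] null by simp
  then have "a0 I c = h * a0 v c"
    by (simp add: V0.diff_left[OF IV V.scale_mem[OF v] c] V0.scale_left[OF v c])
  moreover have "a0 I c = integral {t..t + h} (\<lambda>s. a0 (u s) c)"
    by (rule V.functional_bochner_interval(2)[OF I bounded_functional_form[OF A0 a0_bounded c]])
  ultimately show ?thesis using h(1) by (simp add: v_def)
qed

lemma velocity_form_integrable:
  assumes uV: "strongly_measurable (lebesgue_on {0..T}) (Vsp \<Omega>) (V_nrm \<Omega>) u"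
    and fin: "(\<integral>\<^sup>+t. ennreal ((V_nrm \<Omega> (u t))\<^sup>2) \<partial>lebesgue_on {0..T}) < \<infinity>"
    and c: "c \<in> Vsp \<Omega>"
  shows "integrable (lebesgue_on {0..T}) (\<lambda>s. a0 (u s) c)"
proof -
  obtain C where C: "C \<ge> 0" "\<And>w v. w \<in> Vsp \<Omega> \<Longrightarrow> v \<in> Vsp \<Omega> \<Longrightarrow> \<bar>a0 w v\<bar> \<le> C * V_nrm \<Omega> w * V_nrm \<Omega> v"
    by (rule bounded_formE[OF a0_bounded]) (rule that; assumption)
  obtain C' where C': "\<And>x y. x \<in> Vsp \<Omega> \<Longrightarrow> y \<in> Vsp \<Omega> \<Longrightarrow> \<bar>a0 x c - a0 y c\<bar> \<le> C' * V_nrm \<Omega> (x - y)"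
    by (rule V.bounded_functional_lipschitz[OF bounded_functional_form[OF A0 a0_bounded c]]) (rule that; assumption)
  have nm: "(\<lambda>s. V_nrm \<Omega> (u s)) \<in> borel_measurable (lebesgue_on {0..T})"
    using V.measurable_nrm[OF uV] by (simp add: completion_lebesgue_interval)
  have sq: "integrable (lebesgue_on {0..T}) (\<lambda>s. (V_nrm \<Omega> (u s))\<^sup>2)"
    by (rule integrableI_nonneg) (use fin nm in auto)
  interpret finite_measure "lebesgue_on {0..T}" by (rule finite_measure_lebesgue_on_interval)
  show ?thesis
  proof (rule Bochner_Integration.integrable_bound)
    show "integrable (lebesgue_on {0..T}) (\<lambda>s. C * V_nrm \<Omega> c * (1 + (V_nrm \<Omega> (u s))\<^sup>2))"
      by (intro integrable_mult_right Bochner_Integration.integrable_add sq) simp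
    show "(\<lambda>s. a0 (u s) c) \<in> borel_measurable (lebesgue_on {0..T})"
      using V.measurable_lipschitz[OF uV C'] by (simp add: completion_lebesgue_interval)
    have "AE s in lebesgue_on {0..T}. u s \<in> Vsp \<Omega>" using uV unfolding strongly_measurable_def by (rule conjunct1)
    then show "AE s in lebesgue_on {0..T}. norm (a0 (u s) c) \<le> norm (C * V_nrm \<Omega> c * (1 + (V_nrm \<Omega> (u s))\<^sup>2))"
    proof eventually_elim
      case (elim s)
      have "V_nrm \<Omega> (u s) \<le> 1 + (V_nrm \<Omega> (u s))\<^sup>2" by (rule le_one_plus_square)
      then have "C * V_nrm \<Omega> c * V_nrm \<Omega> (u s) \<le> C * V_nrm \<Omega> c * (1 + (V_nrm \<Omega> (u s))\<^sup>2)"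
        by (intro mult_left_mono mult_nonneg_nonneg C(1) V.nrm_nonneg c)
      moreover have "\<bar>a0 (u s) c\<bar> \<le> C * V_nrm \<Omega> c * V_nrm \<Omega> (u s)" using C(2)[OF elim c] by (simp add: mult_ac)
      ultimately show ?case by simp
    qed
  qed
qed

text \<open>
  The tangent of \<open>v \<mapsto> a0 v v\<close> at \<open>c\<close>, with its exact defect.
\<close>

lemma quadratic_tangent: 
  assumes v: "v \<in> Vsp \<Omega>" and c: "c \<in> Vsp \<Omega>"
  shows "2 * a0 v c - a0 c c = a0 v v - a0 (v - c) (v - c)"
  using V0.sym[OF c v] by (simp add: V0.diff_left V0.diff_right v c V.diff_mem)

text \<open>
  Convergence of the averages in \<open>H\<close> does not control \<open>a0\<close>, which may degenerate and is not continuous on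
  \<open>H\<close>.  A tangent at a fixed \<open>c\<close> is affine, so its values along the averages are Steklov averages of a
  scalar function and converge almost everywhere.  Countably many \<open>c\<close> that come arbitrarily close to almost
  every value of \<open>u\<close> recover \<open>a0 (u t) (u t)\<close> as a supremum of tangents, along one common sequence of steps.
\<close>

theorem viscous_damping_bound:
  assumes u: "bochner_L2 (lebesgue_on {0..T}) (Vsp \<Omega>) (V_nrm \<Omega>) u"
  shows "2 * (\<integral>\<^sup>+t. ennreal (a0 (u t) (u t)) \<partial>lebesgue_on {0..T}) + 2 * (\<integral>\<^sup>+t. damping (\<zeta> t) \<partial>lebesgue_on {0..T})
    \<le> ennreal ((1 + T * exp T) * data)"
proof -
  have uV: "strongly_measurable (lebesgue_on {0..T}) (Vsp \<Omega>) (V_nrm \<Omega>) u"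
    and fin: "(\<integral>\<^sup>+t. ennreal ((V_nrm \<Omega> (u t))\<^sup>2) \<partial>lebesgue_on {0..T}) < \<infinity>"
    using u by (auto simp: bochner_L2_def)
  obtain C where C: "C \<ge> 0" "\<And>w v. w \<in> Vsp \<Omega> \<Longrightarrow> v \<in> Vsp \<Omega> \<Longrightarrow> \<bar>a0 w v\<bar> \<le> C * V_nrm \<Omega> w * V_nrm \<Omega> v"
    by (rule bounded_formE[OF a0_bounded]) (rule that; assumption)
  have ae_V: "AE t in lebesgue_on {0..T}. u t \<in> Vsp \<Omega>" using uV unfolding strongly_measurable_def by (rule conjunct1)
  obtain c :: "nat \<Rightarrow> real ^ 'n \<Rightarrow> real" where crange: "range c \<subseteq> Vsp \<Omega>" and "c 0 = 0"
    and dense: "AE t in lebesgue_on {0..T}. \<forall>e>0. \<exists>k. V_nrm \<Omega> (u t - c k) < e"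
    by (rule V.strongly_measurable_dense_sequence[OF uV]) (rule that; assumption)
  have c: "c k \<in> Vsp \<Omega>" for k using crange by auto
  define \<phi> where "\<phi> k t = 2 * a0 (u t) (c k) - a0 (c k) (c k)" for k t
  interpret finite_measure "lebesgue_on {0..T}" by (rule finite_measure_lebesgue_on_interval)
  have ua_int: "integrable (lebesgue_on {0..T}) (\<lambda>t. a0 (u t) (c k))" for k
    by (rule velocity_form_integrable[OF uV fin c])
  have \<phi>_int: "integrable (lebesgue_on {0..T}) (\<phi> k)" for k
    unfolding \<phi>_def by (intro Bochner_Integration.integrable_diff integrable_mult_right ua_int) simp
  obtain h :: "nat \<Rightarrow> real" where h: "\<And>n. 0 < h n" "h \<longlonglongrightarrow> 0"
    and Steklov: "\<And>k. AE t in lebesgue_on {0..T}. t < T \<longrightarrow> (\<lambda>n. (1 / h n) * integral {t..t+h n} (\<phi> k)) \<longlonglongrightarrow> \<phi> k t"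
    by (rule Steklov_average_AE[OF \<phi>_int T_pos]) (rule that; assumption)
  have lower: "(1 / h n) * integral {t..t + h n} (\<phi> k) \<le> a0 (fst (E.Y (h n) t)) (fst (E.Y (h n) t))"
    if t: "0 \<le> t" "t + h n < T" for n t k
  proof -
    let ?v = "fst (E.Y (h n) t)"
    have v: "?v \<in> Vsp \<Omega>" using E.Y_generator(1)[OF h(1) t] by (auto simp: gen_dom_def)
    have io: "(\<lambda>s. a0 (u s) (c k)) integrable_on {t..t + h n}"
      by (rule integrable_on_subinterval[OF integrable_on_lebesgue_on[OF ua_int]]) (use t h(1)[of n] in auto)
    have hn: "0 < h n" by (rule h(1))
    have "integral {t..t + h n} (\<phi> k) = 2 * integral {t..t + h n} (\<lambda>s. a0 (u s) (c k)) - h n * a0 (c k) (c k)"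
      unfolding \<phi>_def using hn
      by (subst Henstock_Kurzweil_Integration.integral_diff[OF integrable_on_mult_right[OF io]]) auto
    then have "(1 / h n) * integral {t..t + h n} (\<phi> k) = 2 * ((1 / h n) * integral {t..t + h n} (\<lambda>s. a0 (u s) (c k))) - a0 (c k) (c k)"
      using hn by (simp add: field_simps)
    also have "\<dots> = 2 * a0 ?v (c k) - a0 (c k) (c k)" by (simp add: Steklov_average_form[OF uV fin hn t c])
    also have "\<dots> \<le> a0 ?v ?v" unfolding quadratic_tangent[OF v c] using a0_nonneg[OF V.diff_mem[OF v c]] by simp
    finally show ?thesis .
  qed
  have "2 * (\<integral>\<^sup>+t. ennreal (a0 (u t) (u t)) + damping (\<zeta> t) \<partial>lebesgue_on {0..T}) \<le> ennreal ((1 + T * exp T) * data)"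
    unfolding data_eq[symmetric]
  proof (rule E.mild_dissipation_bound[OF h])
    have Steklov': "AE t in lebesgue_on {0..T}. \<forall>k. t < T \<longrightarrow> (\<lambda>n. (1 / h n) * integral {t..t+h n} (\<phi> k)) \<longlonglongrightarrow> \<phi> k t"
      unfolding AE_all_countable by (intro allI Steklov)
    show "AE t in lebesgue_on {0..T}. t < T \<longrightarrow> ennreal (a0 (u t) (u t)) + damping (\<zeta> t) \<le> liminf (\<lambda>n. ennreal (E.dissipation (E.Y (h n) t)))"
      using Steklov' dense ae_V AE_space[of "lebesgue_on {0..T}"]
    proof eventually_elim
      case (elim t)
      show ?case
      proof
        assume tT: "t < T"
        have t: "0 \<le> t" using elim(4) by auto
        note uV = elim(3)
        let ?R = "liminf (\<lambda>n. ennreal (E.dissipation (E.Y (h n) t)))"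
        have approx: "ennreal (a0 (u t) (u t) - e) + damping (\<zeta> t) \<le> ?R" if e: "0 < e" for e
        proof -
          obtain d where d: "0 < d" "C * d\<^sup>2 < e"
          proof
            show "0 < sqrt (e / (C + 1))" using e C(1) by simp
            have "C * (sqrt (e / (C + 1)))\<^sup>2 = e * (C / (C + 1))" using e C(1) by simp
            also have "\<dots> < e * 1" using e C(1) by (intro mult_strict_left_mono) auto
            finally show "C * (sqrt (e / (C + 1)))\<^sup>2 < e" by simp
          qed
          obtain k where k: "V_nrm \<Omega> (u t - c k) < d" using elim(2) d(1) by blast
          have m: "u t - c k \<in> Vsp \<Omega>" by (rule V.diff_mem[OF uV c])
          have "a0 (u t - c k) (u t - c k) \<le> C * (V_nrm \<Omega> (u t - c k))\<^sup>2"
            using C(2)[OF m m] by (simp add: power2_eq_square mult_ac)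
          also have "\<dots> \<le> C * d\<^sup>2" using k V.nrm_nonneg[OF m] by (intro mult_left_mono power_mono C(1)) auto
          finally have "a0 (u t) (u t) - e < \<phi> k t" using d(2) unfolding \<phi>_def quadratic_tangent[OF uV c] by linarith
          moreover have "(\<lambda>n. (1 / h n) * integral {t..t+h n} (\<phi> k)) \<longlonglongrightarrow> \<phi> k t" using elim(1) tT by blast
          ultimately have ev: "\<forall>\<^sub>F n in sequentially. a0 (u t) (u t) - e < (1 / h n) * integral {t..t+h n} (\<phi> k)"
            by (rule order_tendstoD(1)[rotated])
          have "ennreal (a0 (u t) (u t) - e) + damping (\<zeta> t)
              \<le> ennreal (a0 (u t) (u t) - e) + liminf (\<lambda>n. damping (snd (E.Y (h n) t)))"
            by (rule add_left_mono[OF damping_liminf[OF t tT h]])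
          also have "\<dots> = liminf (\<lambda>n. ennreal (a0 (u t) (u t) - e) + damping (snd (E.Y (h n) t)))"
            by (rule Liminf_const_add[symmetric]) simp
          also have "\<dots> \<le> ?R"
          proof (rule Liminf_mono)
            show "\<forall>\<^sub>F n in sequentially. ennreal (a0 (u t) (u t) - e) + damping (snd (E.Y (h n) t)) \<le> ennreal (E.dissipation (E.Y (h n) t))"
              using eventually_step[OF tT h(2)] ev
            proof eventually_elim
              case (elim n)
              show ?case unfolding dissipation_Y_eq[OF h(1) t elim(1)]
                by (intro add_right_mono ennreal_leI) (use elim(2) lower[OF t elim(1), of k] in linarith)
            qed
          qed
          finally show ?thesis .
        qed
        have "(\<lambda>n. ennreal (a0 (u t) (u t) - inverse (real (Suc n))) + damping (\<zeta> t)) \<longlonglongrightarrow> ennreal (a0 (u t) (u t) - 0) + damping (\<zeta> t)"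
          by (intro tendsto_add tendsto_ennrealI tendsto_diff tendsto_const LIMSEQ_inverse_real_of_nat)
        then show "ennreal (a0 (u t) (u t)) + damping (\<zeta> t) \<le> ?R"
          by (intro LIMSEQ_le_const2[where X = "\<lambda>n. ennreal (a0 (u t) (u t) - inverse (real (Suc n))) + damping (\<zeta> t)"])
             (auto intro!: approx)
      qed
    qed
  qed
  moreover have "(\<lambda>t. ennreal (a0 (u t) (u t))) \<in> borel_measurable (lebesgue_on {0..T})"
  proof -
    have "strongly_measurable (lebesgue_on {0..T}) (Vsp \<Omega>) (\<lambda>v. sqrt (a0 v v)) u"
    proof (rule V.strongly_measurable_le[OF uV V0.nrm_nonneg])
      show "sqrt (a0 v v) \<le> sqrt C * V_nrm \<Omega> v" if v: "v \<in> Vsp \<Omega>" for v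
        using real_sqrt_le_mono[OF order_trans[OF abs_ge_self C(2)[OF v v]]] V.nrm_nonneg[OF v]
        by (simp add: real_sqrt_mult mult.assoc)
    qed
    from V0.measurable_inner[OF this this] show ?thesis by (simp add: completion_lebesgue_interval)
  qed
  ultimately show ?thesis by (simp add: nn_integral_add damping_of_solution_measurable distrib_left)
qed

end

section \<open>The bounds for the mild solution\<close>

lemma exp_constants:
  fixes T D :: real
  assumes "0 < T" "0 \<le> D" shows "exp T * D + (1 + T * exp T) * D \<le> (2 + T) * exp T * D"
proof -
  have "exp T * D + (1 + T * exp T) * D \<le> (exp T + (exp T + T * exp T)) * D"
    unfolding distrib_right[symmetric] using assms by (intro mult_right_mono add_mono) auto
  then show ?thesis by (simp add: algebra_simps)
qed

theorem corollary5p1: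
  fixes \<Omega> :: "(real ^ 'n::finite) set"
    and A0 A1 :: "real ^ 'n \<Rightarrow> real ^ 'n ^ 'n"
    and a0 a1 :: "(real ^ 'n \<Rightarrow> real) \<Rightarrow> (real ^ 'n \<Rightarrow> real) \<Rightarrow> real"
    and k :: "real \<Rightarrow> real" and \<nu> :: "real measure"
    and T \<beta> C\<^sub>P M\<^sub>0 M\<^sub>1 D\<^sub>0 C\<^sub>T :: real
    and S :: "real \<Rightarrow> (real ^ 'n \<Rightarrow> real) \<times> 'n hist \<Rightarrow> (real ^ 'n \<Rightarrow> real) \<times> 'n hist"
    and u0 :: "real ^ 'n \<Rightarrow> real" and f :: "real \<Rightarrow> real ^ 'n \<Rightarrow> real"
    and X :: "real \<Rightarrow> (real ^ 'n \<Rightarrow> real) \<times> 'n hist"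
    and u :: "real \<Rightarrow> real ^ 'n \<Rightarrow> real" and \<zeta> :: "real \<Rightarrow> 'n hist"
    and \<xi> \<eta> :: "real \<Rightarrow> real ^ 'n \<Rightarrow> real"
  assumes dim: "CARD('n) \<in> {1, 2, 3}"
    and Omega: "bounded_Lipschitz_domain \<Omega>"
    and T: "0 < T"
    and poincare: "\<forall>v\<in>Vsp \<Omega>. H_nrm \<Omega> v \<le> C\<^sub>P * V_seminrm \<Omega> v"
    and A0: "symmetric_Linfty_field \<Omega> A0"
    and A1: "symmetric_Linfty_field \<Omega> A1"
    and A1_psd: "AE x in lebesgue_on \<Omega>. \<forall>y. 0 \<le> (A1 x *v y) \<bullet> y"
    and a0_def: "a0 = form \<Omega> A0" and a1_def: "a1 = form \<Omega> A1"
    and a0_bounded: "bounded_form \<Omega> a0" and a1_bounded: "bounded_form \<Omega> a1"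
    and a0_nonneg: "\<forall>v\<in>Vsp \<Omega>. 0 \<le> a0 v v"
    and beta: "0 < \<beta>" and a1_coercive: "\<forall>v\<in>Vsp \<Omega>. \<beta> * (V_seminrm \<Omega> v)\<^sup>2 \<le> a1 v v"
    and kernel: "completely_monotone k" "\<exists>t>0. k t \<noteq> 0" "represents_kernel \<nu> k"
    and mass: "0 < emeasure \<nu> {0..}" "emeasure \<nu> {0..} < \<infinity>" "M\<^sub>0 = measure \<nu> {0..}"
    and moment: "(\<integral>\<^sup>+l. ennreal l \<partial>\<nu>) < \<infinity>" "M\<^sub>1 = (LINT l|\<nu>. l)"
    and semigroup: "contraction_C0_semigroup (Wsp \<Omega> A1 \<nu>) (W_nrm \<Omega> A1 \<nu>) S"
    and generator: "is_generator (Wsp \<Omega> A1 \<nu>) (W_nrm \<Omega> A1 \<nu>) S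
                      (gen_dom \<Omega> A0 A1 \<nu>) (gen_op \<Omega> A0 A1 \<nu>)"
    and f: "bochner_L2 (lebesgue_on {0..T}) (Hsp \<Omega>) (H_nrm \<Omega>) f"
    and u0: "u0 \<in> Hsp \<Omega>"
    and mild: "mild_solution (Wsp \<Omega> A1 \<nu>) (W_nrm \<Omega> A1 \<nu>) S T (u0, 0) (\<lambda>t. (f t, 0)) X"
    and u_def: "u = (\<lambda>t. fst (X t))" and zeta_def: "\<zeta> = (\<lambda>t. snd (X t))"
    and xi_def: "\<xi> = (\<lambda>t. bochner_integral_in \<nu> (Vsp \<Omega>) (V_nrm \<Omega>) (\<lambda>l. \<zeta> t l))"
    and eta_def: "\<eta> = (\<lambda>t. bochner_integral_in \<nu> (Vsp \<Omega>) (V_nrm \<Omega>) (\<lambda>l. l *\<^sub>R \<zeta> t l))"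
    and D0_def: "D\<^sub>0 = (H_nrm \<Omega> u0)\<^sup>2 + (LINT t|lebesgue_on {0..T}. (H_nrm \<Omega> (f t))\<^sup>2)"
    and CT_def: "C\<^sub>T = (2 + T) * exp T"
  shows
    "(SUP t\<in>{0..T}. ennreal ((H_nrm \<Omega> (u t))\<^sup>2) + (\<integral>\<^sup>+l. ennreal (a1 (\<zeta> t l) (\<zeta> t l)) \<partial>\<nu>))
       + 2 * (\<integral>\<^sup>+t. (\<integral>\<^sup>+l. ennreal (l * a1 (\<zeta> t l) (\<zeta> t l)) \<partial>\<nu>) \<partial>lebesgue_on {0..T})
       \<le> ennreal (C\<^sub>T * D\<^sub>0)
     \<and> (\<forall>t\<in>{0..T}. bochner_integrable_in \<nu> (Vsp \<Omega>) (V_nrm \<Omega>) (\<lambda>l. \<zeta> t l))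
     \<and> (AE t in lebesgue_on {0..T}. bochner_integrable_in \<nu> (Vsp \<Omega>) (V_nrm \<Omega>) (\<lambda>l. l *\<^sub>R \<zeta> t l))
     \<and> (SUP t\<in>{0..T}. ennreal ((V_seminrm \<Omega> (\<xi> t))\<^sup>2)) \<le> ennreal (M\<^sub>0 / \<beta> * exp T * D\<^sub>0)
     \<and> (\<integral>\<^sup>+t. ennreal ((V_seminrm \<Omega> (\<eta> t))\<^sup>2) \<partial>lebesgue_on {0..T})
         \<le> ennreal (M\<^sub>1 / (2 * \<beta>) * (1 + T * exp T) * D\<^sub>0)
     \<and> (SUP t\<in>{0..T}. ennreal ((V_nrm \<Omega> (\<xi> t))\<^sup>2))
         \<le> ennreal ((1 + C\<^sub>P\<^sup>2) * (M\<^sub>0 / \<beta> * exp T * D\<^sub>0))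
     \<and> (\<integral>\<^sup>+t. ennreal ((V_nrm \<Omega> (\<eta> t))\<^sup>2) \<partial>lebesgue_on {0..T})
         \<le> ennreal ((1 + C\<^sub>P\<^sup>2) * (M\<^sub>1 / (2 * \<beta>) * (1 + T * exp T) * D\<^sub>0))
     \<and> (bochner_L2 (lebesgue_on {0..T}) (Vsp \<Omega>) (V_nrm \<Omega>) u \<longrightarrow>
          (SUP t\<in>{0..T}. ennreal ((H_nrm \<Omega> (u t))\<^sup>2) + (\<integral>\<^sup>+l. ennreal (a1 (\<zeta> t l) (\<zeta> t l)) \<partial>\<nu>))
            + 2 * (\<integral>\<^sup>+t. ennreal (a0 (u t) (u t)) \<partial>lebesgue_on {0..T})
            + 2 * (\<integral>\<^sup>+t. (\<integral>\<^sup>+l. ennreal (l * a1 (\<zeta> t l) (\<zeta> t l)) \<partial>\<nu>) \<partial>lebesgue_on {0..T})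
            \<le> ennreal (C\<^sub>T * D\<^sub>0))"
proof -
  have fmeas: "strongly_measurable (lebesgue_on {0..T}) (Hsp \<Omega>) (H_nrm \<Omega>) f" using f by (simp add: bochner_L2_def)
  (* f may leave H on a null set of times; correcting it there changes no integral *)
  define g where "g t = (if f t \<in> Hsp \<Omega> then f t else 0)" for t
  have "AE t in lebesgue_on {0..T}. f t \<in> Hsp \<Omega>" using fmeas unfolding strongly_measurable_def by (rule conjunct1)
  then have fg: "AE t in lebesgue_on {0..T}. f t = g t" by (rule AE_mp) (simp add: g_def)
  have g_L2: "bochner_L2 (lebesgue_on {0..T}) (Hsp \<Omega>) (H_nrm \<Omega>) g"
  proof -
    have "(\<integral>\<^sup>+t. ennreal ((H_nrm \<Omega> (f t))\<^sup>2) \<partial>lebesgue_on {0..T}) = (\<integral>\<^sup>+t. ennreal ((H_nrm \<Omega> (g t))\<^sup>2) \<partial>lebesgue_on {0..T})"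
      by (rule nn_integral_cong_AE) (use fg in \<open>rule AE_mp\<close>, simp)
    with f strongly_measurable_cong_AE[OF fg fmeas] show ?thesis by (simp add: bochner_L2_def)
  qed
  have mild_g: "mild_solution (Wsp \<Omega> A1 \<nu>) (W_nrm \<Omega> A1 \<nu>) S T (u0, 0) (\<lambda>t. (g t, 0)) X"
    unfolding mild_solution_def
  proof (intro conjI ballI)
    show "continuous_path T (Wsp \<Omega> A1 \<nu>) (W_nrm \<Omega> A1 \<nu>) X" using mild by (simp add: mild_solution_def)
    fix t assume t: "t \<in> {0..T}"
    then obtain I where I: "has_bochner_integral_in (lebesgue_on {0..t}) (Wsp \<Omega> A1 \<nu>) (W_nrm \<Omega> A1 \<nu>) (\<lambda>s. S (t - s) (f s, 0)) I"
      "W_nrm \<Omega> A1 \<nu> (X t - (S t (u0, 0) + I)) = 0"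
      using mild unfolding mild_solution_def by blast
    have "AE s in lebesgue_on {0..t}. f s = g s" by (rule AE_lebesgue_on_subset[OF fg]) (use t in auto)
    then have "AE s in lebesgue_on {0..t}. S (t - s) (f s, 0) = S (t - s) (g s, 0)" by (rule AE_mp) simp
    from has_bochner_integral_in_cong_AE[OF this I(1)] I(2)
    show "\<exists>I. has_bochner_integral_in (lebesgue_on {0..t}) (Wsp \<Omega> A1 \<nu>) (W_nrm \<Omega> A1 \<nu>) (\<lambda>s. S (t - s) (g s, 0)) I \<and>
        W_nrm \<Omega> A1 \<nu> (X t - (S t (u0, 0) + I)) = 0" by blast
  qed
  have \<Omega>: "bounded_open \<Omega>" using Omega by (simp add: bounded_open_def bounded_Lipschitz_domain_def)
  have sets_\<nu>: "sets \<nu> = sets (restrict_space borel {0..})" using kernel(3) by (simp add: represents_kernel_def)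
  have system: "history_system \<Omega> A0 A1 \<nu> \<beta> C\<^sub>P"
    by (intro history_system.intro history_system_axioms.intro \<Omega> A0 A1 sets_\<nu> beta mass(2) moment(1))
       (use a0_bounded a1_bounded a0_nonneg a1_coercive poincare in \<open>auto simp: a0_def a1_def\<close>)
  have g_mem: "g t \<in> Hsp \<Omega>" for t
    using semi_inner.zero_mem[OF H_semi_inner[of \<Omega>]] by (simp add: g_def)
  (* the interpretation hides the names mass and moment *)
  note M0_eq = mass(3) and M1_eq = moment(2)
  interpret history_evolution \<Omega> A0 A1 \<nu> \<beta> C\<^sub>P S T u0 g X
    by (intro history_evolution.intro history_evolution_axioms.intro system semigroup generator T g_L2 u0 mild_g g_mem)
  have D0: "D\<^sub>0 = data"
  proof -
    have "(LINT t|lebesgue_on {0..T}. (H_nrm \<Omega> (f t))\<^sup>2) = (LINT t|lebesgue_on {0..T}. (H_nrm \<Omega> (g t))\<^sup>2)"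
    proof (rule integral_cong_AE)
      show "(\<lambda>t. (H_nrm \<Omega> (f t))\<^sup>2) \<in> borel_measurable (lebesgue_on {0..T})"
        using H.measurable_nrm[OF fmeas] by (simp add: completion_lebesgue_interval)
      show "(\<lambda>t. (H_nrm \<Omega> (g t))\<^sup>2) \<in> borel_measurable (lebesgue_on {0..T})"
        using H.measurable_nrm[OF strongly_measurable_cong_AE[OF fg fmeas]] by (simp add: completion_lebesgue_interval)
      show "AE t in lebesgue_on {0..T}. (H_nrm \<Omega> (f t))\<^sup>2 = (H_nrm \<Omega> (g t))\<^sup>2" using fg by (rule AE_mp) simp
    qed
    then show ?thesis by (simp add: D0_def)
  qed
  have D0_nonneg: "0 \<le> D\<^sub>0" unfolding D0 by (rule data_nonneg)
  let ?sup = "SUP t\<in>{0..T}. ennreal ((H_nrm \<Omega> (u t))\<^sup>2) + (\<integral>\<^sup>+l. ennreal (a1 (\<zeta> t l) (\<zeta> t l)) \<partial>\<nu>)"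
  have sup: "?sup \<le> ennreal (exp T * D\<^sub>0)"
    unfolding D0 a1_def u_def zeta_def
    by (rule SUP_least) (rule energy_bound[unfolded Ksq_def])
  have total: "?sup + d \<le> ennreal (C\<^sub>T * D\<^sub>0)" if d: "d \<le> ennreal ((1 + T * exp T) * D\<^sub>0)" for d
  proof -
    have "?sup + d \<le> ennreal (exp T * D\<^sub>0) + ennreal ((1 + T * exp T) * D\<^sub>0)" by (rule add_mono[OF sup d])
    also have "\<dots> = ennreal (exp T * D\<^sub>0 + (1 + T * exp T) * D\<^sub>0)"
      using D0_nonneg T by (intro ennreal_plus[symmetric] mult_nonneg_nonneg add_nonneg_nonneg) auto
    also have "\<dots> \<le> ennreal (C\<^sub>T * D\<^sub>0)" unfolding CT_def by (intro ennreal_leI exp_constants T D0_nonneg)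
    finally show ?thesis .
  qed
  have eq: "damping (snd (X t)) = (\<integral>\<^sup>+l. ennreal (l * a1 (\<zeta> t l) (\<zeta> t l)) \<partial>\<nu>)" for t
    by (simp add: damping_def a1_def zeta_def)
  show ?thesis
  proof (intro conjI impI)
    show "?sup + 2 * (\<integral>\<^sup>+t. (\<integral>\<^sup>+l. ennreal (l * a1 (\<zeta> t l) (\<zeta> t l)) \<partial>\<nu>) \<partial>lebesgue_on {0..T}) \<le> ennreal (C\<^sub>T * D\<^sub>0)"
      using damping_bound unfolding eq D0[symmetric] by (rule total)
    show "\<forall>t\<in>{0..T}. bochner_integrable_in \<nu> (Vsp \<Omega>) (V_nrm \<Omega>) (\<lambda>l. \<zeta> t l)"
      unfolding zeta_def using K_integrable[OF \<zeta>_mem] by simp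
    show "AE t in lebesgue_on {0..T}. bochner_integrable_in \<nu> (Vsp \<Omega>) (V_nrm \<Omega>) (\<lambda>l. l *\<^sub>R \<zeta> t l)"
      unfolding zeta_def by (rule moment_integrable_AE)
    show "(SUP t\<in>{0..T}. ennreal ((V_seminrm \<Omega> (\<xi> t))\<^sup>2)) \<le> ennreal (M\<^sub>0 / \<beta> * exp T * D\<^sub>0)"
      unfolding xi_def zeta_def D0 M0_eq by (rule SUP_least) (rule memory_bound(1))
    show "(SUP t\<in>{0..T}. ennreal ((V_nrm \<Omega> (\<xi> t))\<^sup>2)) \<le> ennreal ((1 + C\<^sub>P\<^sup>2) * (M\<^sub>0 / \<beta> * exp T * D\<^sub>0))"
      unfolding xi_def zeta_def D0 M0_eq by (rule SUP_least) (rule memory_bound(2))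
    show "(\<integral>\<^sup>+t. ennreal ((V_seminrm \<Omega> (\<eta> t))\<^sup>2) \<partial>lebesgue_on {0..T})
        \<le> ennreal (M\<^sub>1 / (2 * \<beta>) * (1 + T * exp T) * D\<^sub>0)"
      unfolding eta_def zeta_def D0 M1_eq by (rule moment_bound(1))
    show "(\<integral>\<^sup>+t. ennreal ((V_nrm \<Omega> (\<eta> t))\<^sup>2) \<partial>lebesgue_on {0..T})
        \<le> ennreal ((1 + C\<^sub>P\<^sup>2) * (M\<^sub>1 / (2 * \<beta>) * (1 + T * exp T) * D\<^sub>0))"
      unfolding eta_def zeta_def D0 M1_eq by (rule moment_bound(2))
    assume "bochner_L2 (lebesgue_on {0..T}) (Vsp \<Omega>) (V_nrm \<Omega>) u"
    from total[OF viscous_damping_bound[folded u_def, OF this, folded D0, unfolded eq]]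
    show "?sup + 2 * (\<integral>\<^sup>+t. ennreal (a0 (u t) (u t)) \<partial>lebesgue_on {0..T})
        + 2 * (\<integral>\<^sup>+t. (\<integral>\<^sup>+l. ennreal (l * a1 (\<zeta> t l) (\<zeta> t l)) \<partial>\<nu>) \<partial>lebesgue_on {0..T}) \<le> ennreal (C\<^sub>T * D\<^sub>0)"
      by (simp add: add.assoc a0_def u_def)
  qed
qed

end
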